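(* Let $p$ be a prime and let $n=3$. Let $\mathcal{L}_{\mathbb Z}=\mathbb{Z}[\mathbf{T}(p),\mathbf{T}_1(p^2),\mathbf{T}_2(p^2),\mathbf{T}_3(p^2)]$ be the (commutative) integral $p$-local Hecke ring of $\mathrm{Sp}_3(\mathbb Z)$, and let $\mathbf{Q}_3(v)=\sum_{j=0}^{8}\mathbf{t}_jv^j\in\mathcal{L}_{\mathbb Z}[v]$ be the polynomial determined by $$\sum_{j=0}^{8}\Omega(\mathbf{t}_j)v^j=(1-x_0v)(1-x_0x_1v)(1-x_0x_2v)(1-x_0x_3v)(1-x_0x_1x_2v)(1-x_0x_1x_3v)(1-x_0x_2x_3v)(1-x_0x_1x_2x_3v),$$ where $\Omega$ is the Satake spherical map. Then $$\begin{aligned}\mathbf{Q}_3(v)=1&-\mathbf{T}(p)\,v+p\big(\mathbf{T}_1(p^2)+(p^2+1)\mathbf{T}_2(p^2)+(1+p^2)^2[\mathbf{p}]_3\big)v^2\\&-p^3\,\mathbf{T}(p)\big(\mathbf{T}_2(p^2)+[\mathbf{p}]_3\big)v^3\\&+p^6\big(-2p\,\mathbf{T}_1(p^2)[\mathbf{p}]_3+\mathbf{T}_2(p^2)^2-2(p-1)\mathbf{T}_2(p^2)[\mathbf{p}]_3\\&\qquad-(p^2+2p-1)(p^2-p+1)(p^2+p+1)[\mathbf{p}]_3^2+[\mathbf{p}]_3\mathbf{T}(p)^2\big)v^4\\&-p^9[\mathbf{p}]_3\,\mathbf{T}(p)\big(\mathbf{T}_2(p^2)+[\mathbf{p}]_3\big)v^5\\&+p^{13}[\mathbf{p}]_3^2\big(\mathbf{T}_1(p^2)+(p^2+1)\mathbf{T}_2(p^2)+(p^2+1)^2[\mathbf{p}]_3\big)v^6\\&-p^{18}[\mathbf{p}]_3^3\,\mathbf{T}(p)\,v^7+p^{24}[\mathbf{p}]_3^4\,v^8\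 \in\mathcal{L}_{\mathbb Z}[v].\end{aligned}$$
   Context: Let $n\ge1$ (here $n=3$), $J_n=\begin{pmatrix}0&E_n\\-E_n&0\end{pmatrix}$, $\mathrm{S}=\mathrm{GSp}_n^+(\mathbb Q)=\{M\in \mathrm{M}_{2n}(\mathbb Q)\mid {}^tMJ_nM=\mu(M)J_n,\ \mu(M)>0\}$ and $\Gamma=\mathrm{Sp}_n(\mathbb Z)\subset \mathrm{GL}_{2n}(\mathbb{Z})$ the Siegel modular group (matrices of size $2n\times 2n$). For $M\in\mathrm S$, $(M)=\Gamma M\Gamma$ denotes the double coset, viewed as an element of the Hecke ring of the pair $(\Gamma,\mathrm S)$ with the usual multiplication (a double coset is identified with the formal sum of the left cosets $\Gamma M_j$ it contains); the unit is $(E_{2n})$. Put $\mathbf{T}(p)=(\mathrm{diag}(1,\dots,1;p,\dots,p))$ ($n$ ones and $n$ $p$'s). For $1\le i\le n$, $$\mathbf{T}_i(p^2)=(\mathrm{diag}(\underbrace{1,\dots,1}_{n-i},\underbrace{p,\dots,p}_{i};\underbrace{p^2,\dots,p^2}_{n-i},\underbrace{p,\dots,p}_{i})),$$ and $[\mathbf{p}]_n=(pE_{2n})=\mathbf{T}_n(p^2)$. The ring $\mathcal{L}_{\mathbb Z}=\mathbb Z[\mathbf{T}(p),\mathbf{T}_1(p^2),\dots,\mathbf{T}_n(p^2)]$ is the commutative subring generated by these elements. The (Satake) spherical map $\Omega:\mathcal{L}_{\mathbb Z}\to\mathbb Q[x_0,x_1,\dots,x_n]$ is the injective ring homomorphism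 defined as follows: write an element as a finite combination $\sum_j a_j\,\Gamma M_j$ of left cosets with representatives $M_j=\begin{pmatrix}p^{\delta_j}\,{}^tD_j^{-1}&B_j\\0&D_j\end{pmatrix}$, with $D_j$ upper triangular with diagonal entries $p^{d_{1j}},\dots,p^{d_{nj}}$; then $\Omega\big(\sum_j a_j\Gamma M_j\big)=\sum_j a_j x_0^{\delta_j}\prod_{i=1}^n(x_ip^{-i})^{d_{ij}}$. For example $\Omega([\mathbf{p}]_n)=p^{-n(n+1)/2}x_0^2x_1\cdots x_n$ and $\Omega(\mathbf{T}(p))=x_0\prod_{i=1}^n(1+x_i)$. It is a known fact that elements $\mathbf{t}_j\in\mathcal{L}_{\mathbb Z}$ with the property required in the definition of $\mathbf{Q}_3$ exist; they are unique since $\Omega$ is injective. *)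

theory Defs
  imports
    "HOL-Algebra.UnivPoly"
    "HOL-Algebra.Coset"
    "HOL-Algebra.Generated_Rings"
    "HOL-Library.Poly_Mapping"
    "HOL-Computational_Algebra.Polynomial"
    "Jordan_Normal_Form.Matrix"
begin

section \<open>The Hecke ring of a pair\<close>

text \<open>
  The cosets \<open>Ha\<close>, called left cosets in the theory of Hecke rings, are written \<open>H #>\<^bsub>G\<^esub> a\<close> in
  HOL-Algebra. An element of the Hecke ring of \<open>(H, G)\<close> is a finite formal integer combination
  of such cosets that is invariant under right translation by \<open>H\<close>; a double coset is the sum of
  the cosets \<open>Ha\<close> it contains.
\<close>

definition hecke_carrier :: "('a, 'b) monoid_scheme \<Rightarrow> 'a set \<Rightarrow> ('a set \<Rightarrow>\<^sub>0 int) set" where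
  "hecke_carrier G H =
     {f. Poly_Mapping.keys f \<subseteq> rcosets\<^bsub>G\<^esub> H \<and>
         (\<forall>C \<in> rcosets\<^bsub>G\<^esub> H. \<forall>h \<in> H.
            Poly_Mapping.lookup f (C #>\<^bsub>G\<^esub> h) = Poly_Mapping.lookup f C)}"

text \<open>
  \<open>(\<Sum>\<^sub>i a\<^sub>i HM\<^sub>i) (\<Sum>\<^sub>j b\<^sub>j HN\<^sub>j) = \<Sum>\<^sub>i\<^sub>j a\<^sub>i b\<^sub>j HM\<^sub>iN\<^sub>j\<close>. On right invariant combinations this does not
  depend on the representatives chosen.
\<close>

definition hecke_mult ::
    "('a, 'b) monoid_scheme \<Rightarrow> 'a set \<Rightarrow> ('a set \<Rightarrow>\<^sub>0 int) \<Rightarrow> ('a set \<Rightarrow>\<^sub>0 int) \<Rightarrow> ('a set \<Rightarrow>\<^sub>0 int)" where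
  "hecke_mult G H f g =
     (\<Sum>A \<in> Poly_Mapping.keys f. \<Sum>B \<in> Poly_Mapping.keys g.
        Poly_Mapping.single (H #>\<^bsub>G\<^esub> ((SOME a. a \<in> A) \<otimes>\<^bsub>G\<^esub> (SOME b. b \<in> B)))
          (Poly_Mapping.lookup f A * Poly_Mapping.lookup g B))"

text \<open>
  The sum is the intended one if \<open>HaH\<close> consists of finitely many cosets \<open>Hb\<close>, as is the case for
  all elements \<open>a\<close> of a Hecke pair, in particular for the pair \<open>(Sp\<^sub>n(\<int>), GSp\<^sub>n\<^sup>+(\<rat>))\<close> below.
\<close>

definition double_coset :: "('a, 'b) monoid_scheme \<Rightarrow> 'a set \<Rightarrow> 'a \<Rightarrow> ('a set \<Rightarrow>\<^sub>0 int)" where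
  "double_coset G H a =
     (\<Sum>C | C \<in> rcosets\<^bsub>G\<^esub> H \<and> C \<subseteq> (H #>\<^bsub>G\<^esub> a) <#>\<^bsub>G\<^esub> H. Poly_Mapping.single C 1)"

definition hecke_ring :: "('a, 'b) monoid_scheme \<Rightarrow> 'a set \<Rightarrow> ('a set \<Rightarrow>\<^sub>0 int) ring" where
  "hecke_ring G H =
     \<lparr>carrier = hecke_carrier G H, monoid.mult = hecke_mult G H, one = double_coset G H \<one>\<^bsub>G\<^esub>,
      zero = 0, add = (+)\<rparr>"


section \<open>The integral \<open>p\<close>-local Hecke ring of \<open>Sp\<^sub>n(\<int>)\<close>\<close>

definition J_mat :: "nat \<Rightarrow> rat mat" where
  "J_mat n = four_block_mat (0\<^sub>m n n) (1\<^sub>m n) (- 1\<^sub>m n) (0\<^sub>m n n)"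

definition GSp_plus :: "nat \<Rightarrow> rat mat monoid" where
  "GSp_plus n =
     \<lparr>carrier = {M \<in> carrier_mat (2*n) (2*n).
                   \<exists>\<mu> > 0. transpose_mat M * J_mat n * M = \<mu> \<cdot>\<^sub>m J_mat n},
      monoid.mult = (*), one = 1\<^sub>m (2*n)\<rparr>"

definition Sp_int :: "nat \<Rightarrow> rat mat set" where
  "Sp_int n = {M \<in> carrier_mat (2*n) (2*n).
                 elements_mat M \<subseteq> \<int> \<and> transpose_mat M * J_mat n * M = J_mat n}"

definition hecke_T :: "nat \<Rightarrow> nat \<Rightarrow> (rat mat set \<Rightarrow>\<^sub>0 int)" where
  "hecke_T n p = double_coset (GSp_plus n) (Sp_int n)
     (mat_diag (2*n) (\<lambda>k. if k < n then 1 else of_nat p))"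

text \<open>\<open>hecke_T2 n p i\<close> is \<open>T\<^sub>i(p\<^sup>2)\<close>, for \<open>1 \<le> i \<le> n\<close>.\<close>

definition hecke_T2 :: "nat \<Rightarrow> nat \<Rightarrow> nat \<Rightarrow> (rat mat set \<Rightarrow>\<^sub>0 int)" where
  "hecke_T2 n p i = double_coset (GSp_plus n) (Sp_int n)
     (mat_diag (2*n) (\<lambda>k. if k < n - i then 1
                          else if k < n then of_nat p
                          else if k < n + (n - i) then (of_nat p)\<^sup>2
                          else of_nat p))"

definition hecke_p :: "nat \<Rightarrow> nat \<Rightarrow> (rat mat set \<Rightarrow>\<^sub>0 int)" where
  "hecke_p n p = double_coset (GSp_plus n) (Sp_int n) (of_nat p \<cdot>\<^sub>m 1\<^sub>m (2*n))"

definition hecke_LZ :: "nat \<Rightarrow> nat \<Rightarrow> (rat mat set \<Rightarrow>\<^sub>0 int) ring" where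
  "hecke_LZ n p =
     (let R = hecke_ring (GSp_plus n) (Sp_int n)
      in R\<lparr>carrier := generate_ring R (insert (hecke_T n p) (hecke_T2 n p ` {1..n}))\<rparr>)"


section \<open>The Satake spherical map\<close>

text \<open>
  Polynomials in \<open>x\<^sub>0, x\<^sub>1, \<dots>\<close> over \<open>\<rat>\<close>: finitely supported coefficient functions on the exponent
  vectors, with the convolution product of \<open>Poly_Mapping\<close>.
\<close>

type_synonym rat_mpoly = "(nat \<Rightarrow>\<^sub>0 nat) \<Rightarrow>\<^sub>0 rat"

definition mvar :: "nat \<Rightarrow> rat_mpoly" where
  "mvar i = Poly_Mapping.single (Poly_Mapping.single i 1) 1"

definition mconst :: "rat \<Rightarrow> rat_mpoly" where
  "mconst c = Poly_Mapping.single 0 c"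

text \<open>
  \<open>M\<close> is block upper triangular with blocks \<open>A = p\<^sup>\<delta> (D\<^sup>T)\<^sup>-\<^sup>1\<close>, \<open>B\<close>, \<open>D\<close>, where \<open>D\<close> is upper triangular
  with diagonal entries \<open>p\<^bsup>d 1\<^esup>, \<dots>, p\<^bsup>d n\<^esup>\<close>. Natural number exponents suffice on \<open>L\<^sub>\<int>\<close>, whose
  elements are supported on cosets of integral matrices.
\<close>

definition satake_rep :: "nat \<Rightarrow> nat \<Rightarrow> rat mat \<Rightarrow> nat \<Rightarrow> (nat \<Rightarrow> nat) \<Rightarrow> bool" where
  "satake_rep n p M \<delta> d \<longleftrightarrow>
     (\<exists>A \<in> carrier_mat n n. \<exists>B \<in> carrier_mat n n. \<exists>D \<in> carrier_mat n n.
        M = four_block_mat A B (0\<^sub>m n n) D \<and>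
        A * transpose_mat D = of_nat p ^ \<delta> \<cdot>\<^sub>m 1\<^sub>m n \<and>
        upper_triangular D \<and>
        (\<forall>i \<in> {1..n}. D $$ (i - 1, i - 1) = of_nat p ^ d i))"

text \<open>The polynomial is the same for all representatives of \<open>C\<close> of the above form.\<close>

definition satake_coset :: "nat \<Rightarrow> nat \<Rightarrow> rat mat set \<Rightarrow> rat_mpoly" where
  "satake_coset n p C =
     (THE q. \<exists>M \<in> C. \<exists>\<delta> d. satake_rep n p M \<delta> d \<and>
        q = mvar 0 ^ \<delta> * (\<Prod>i = 1..n. (mvar i * mconst (1 / of_nat p ^ i)) ^ d i))"

definition satake :: "nat \<Rightarrow> nat \<Rightarrow> (rat mat set \<Rightarrow>\<^sub>0 int) \<Rightarrow> rat_mpoly" where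
  "satake n p f =
     (\<Sum>C \<in> Poly_Mapping.keys f. of_int (Poly_Mapping.lookup f C) * satake_coset n p C)"

end

theory Submission
  imports Defs "Jordan_Normal_Form.Determinant"
begin

text \<open>
  Cosets of integral similitudes have upper triangular representatives, so the Satake image of a double coset
  is given by the numbers of its cosets with prescribed diagonal exponents. Moving the \<open>2 \<times> 2\<close> diagonal block
  that belongs to a simple root by \<open>SL\<^sub>2(\<int>) \<times> SL\<^sub>2(\<int>)\<close> shows that these numbers, suitably weighted, are invariant
  under the Weyl group, so that only few of them have to be counted. The double cosets with multiplier \<open>p\<^sup>2\<close> are
  distinguished by the rank modulo \<open>p\<close> of their elements, and the counting comes down to symmetric matrices of size at
  most \<open>3\<close> of given rank over the field with \<open>p\<close> elements. Among the triangular representatives of the cosets in the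
  support of a Hecke operator, those with lexicographically largest exponents all lie in one double coset; therefore their
  monomial does not cancel, and the Satake map is injective. The theorem is then an identity of polynomials in
  \<open>x\<^sub>0, \<dots>, x\<^sub>3\<close>.
\<close>

section \<open>Hecke rings\<close>

text \<open>Injectivity of the Satake map does more than identify coefficients. Associativity and
  commutativity of the Hecke product are not derived from cosets; they are pulled back from the
  polynomial ring, which is what makes \<open>hecke_LZ 3 p\<close> a commutative ring to which the
  theory of \<open>UP\<close> applies. A reflection of the Weyl group can be treated on one 2 by 2
  block, because a triangular block with diagonal p^a, p^b is determined up to SL2 x SL2 by a + b
  and the gcd of its entries. For multiplier p^2 the reflections leave the exponents (0,0,0),
  (1,0,0), (1,1,0), (1,1,1) of D. The last is the hard case. An off-diagonal entry of D prime to p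
  changes its block into diag(p^2, 1) and so leads back to exponents already counted; for the corner
  of D this takes a root that is not simple. What remains is D = pE with a symmetric block B modulo
  p. The numbers p^3 - 1 and p^5 - p^2 of such B of rank 1 and 2 enter the coefficients of the
  monomial divisible by x_1 x_2 x_3 but by no higher power of the x_i.\<close>

definition lin_ext :: "('a \<Rightarrow> 'r::comm_ring_1) \<Rightarrow> ('a \<Rightarrow>\<^sub>0 int) \<Rightarrow> 'r" where
  "lin_ext \<phi> f = (\<Sum>C \<in> Poly_Mapping.keys f. of_int (Poly_Mapping.lookup f C) * \<phi> C)"

lemma lin_ext_superset:
  assumes "finite S" "Poly_Mapping.keys f \<subseteq> S"
  shows "lin_ext \<phi> f = (\<Sum>C \<in> S. of_int (Poly_Mapping.lookup f C) * \<phi> C)"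
  unfolding lin_ext_def using assms
  by (intro sum.mono_neutral_left) (auto simp: in_keys_iff)

lemma lin_ext_add: "lin_ext \<phi> (f + g) = lin_ext \<phi> f + lin_ext \<phi> g"
proof -
  let ?S = "Poly_Mapping.keys f \<union> Poly_Mapping.keys g"
  have "Poly_Mapping.keys (f + g) \<subseteq> ?S" by (rule keys_add)
  then show ?thesis
    by (simp add: lin_ext_superset[of ?S] lookup_add sum.distrib algebra_simps)
qed

lemma lin_ext_zero [simp]: "lin_ext \<phi> 0 = 0"
  by (simp add: lin_ext_def)

lemma lin_ext_uminus: "lin_ext \<phi> (- f) = - lin_ext \<phi> f"
  using lin_ext_add[of \<phi> f "- f"] by (simp add: add_eq_0_iff)

lemma lin_ext_sum: "lin_ext \<phi> (\<Sum>i\<in>I. F i) = (\<Sum>i\<in>I. lin_ext \<phi> (F i))"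
  by (induction I rule: infinite_finite_induct) (auto simp: lin_ext_add)

lemma lin_ext_single [simp]: "lin_ext \<phi> (Poly_Mapping.single C k) = of_int k * \<phi> C"
  by (cases "k = 0") (auto simp: lin_ext_def)

lemma keys_sum_subset: "Poly_Mapping.keys (\<Sum>i\<in>I. F i) \<subseteq> (\<Union>i\<in>I. Poly_Mapping.keys (F i))"
proof
  fix k assume "k \<in> Poly_Mapping.keys (\<Sum>i\<in>I. F i)"
  then have "(\<Sum>i\<in>I. Poly_Mapping.lookup (F i) k) \<noteq> 0"
    by (simp add: in_keys_iff lookup_sum)
  then obtain i where "i \<in> I" "Poly_Mapping.lookup (F i) k \<noteq> 0"
    by (rule sum.not_neutral_contains_not_neutral)
  then show "k \<in> (\<Union>i\<in>I. Poly_Mapping.keys (F i))"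
    by (auto simp: in_keys_iff)
qed

locale subgroup_pair = group G + H?: subgroup H G for G :: "('a, 'b) monoid_scheme" (structure) and H
begin

abbreviation hecke :: "('a set \<Rightarrow>\<^sub>0 int) set" where "hecke \<equiv> hecke_carrier G H"

lemma is_subgroup_H: "subgroup H G" by (rule H.subgroup_axioms)

lemma rcosets_rep:
  assumes "C \<in> rcosets H" "a \<in> C"
  shows "a \<in> carrier G" "C = H #> a"
proof -
  obtain b where b: "b \<in> carrier G" "C = H #> b"
    using assms(1) by (auto simp: RCOSETS_def)
  show "a \<in> carrier G"
    using assms(2) b elemrcos_carrier[OF is_group] by blast
  show "C = H #> a"
    using assms(2) b repr_independence[OF _ _ is_subgroup_H] by blast
qed

lemma rcosets_translate:
  assumes "C \<in> rcosets H" "x \<in> carrier G"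
  shows "C #> x \<in> rcosets H"
proof -
  obtain b where b: "b \<in> carrier G" "C = H #> b"
    using assms(1) by (auto simp: RCOSETS_def)
  then have "C #> x = H #> (b \<otimes> x)"
    using assms(2) by (simp add: coset_mult_assoc subset)
  then show ?thesis using b assms(2) by (simp add: rcosetsI subset)
qed

lemma rcosets_translate_assoc:
  assumes "C \<in> rcosets H" "x \<in> carrier G" "y \<in> carrier G"
  shows "C #> x #> y = C #> (x \<otimes> y)"
  using assms coset_mult_assoc[of C x y] rcosets_carrier[OF is_group] by blast

lemma rcosets_translate_one [simp]:
  assumes "C \<in> rcosets H" shows "C #> \<one> = C"
  using assms rcosets_carrier[OF is_group] by simp

lemma rcosets_translate_cancel:
  assumes "C \<in> rcosets H" "x \<in> carrier G"
  shows "C #> x #> inv x = C" "C #> inv x #> x = C"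
  using assms by (simp_all add: rcosets_translate_assoc)

section \<open>Right invariant combinations of cosets and their product\<close>

lemma mem_hecke_iff:
  "f \<in> hecke \<longleftrightarrow> Poly_Mapping.keys f \<subseteq> rcosets H \<and>
     (\<forall>C \<in> rcosets H. \<forall>h \<in> H. Poly_Mapping.lookup f (C #> h) = Poly_Mapping.lookup f C)"
  by (simp add: hecke_carrier_def)

lemma keys_translate_bij:
  assumes "f \<in> hecke" "h \<in> H"
  shows "bij_betw (\<lambda>C. C #> h) (Poly_Mapping.keys f) (Poly_Mapping.keys f)"
proof (rule bij_betwI[where g = "\<lambda>C. C #> inv h"])
  have *: "C #> k \<in> Poly_Mapping.keys f" if "C \<in> Poly_Mapping.keys f" "k \<in> H" for C k
    using that assms(1) by (auto simp: mem_hecke_iff in_keys_iff)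
  show "(\<lambda>C. C #> h) \<in> Poly_Mapping.keys f \<rightarrow> Poly_Mapping.keys f"
    "(\<lambda>C. C #> inv h) \<in> Poly_Mapping.keys f \<rightarrow> Poly_Mapping.keys f"
    using * assms(2) by auto
qed (use assms in \<open>auto simp: mem_hecke_iff rcosets_translate_cancel\<close>)

text \<open>Two representatives of one coset differ by a factor h of \<open>H\<close> on the left, b
  = h c, so A b = (A h) c. Translation by h permutes the support of f without changing coefficients,
  hence the sum does not see h. This is the independence of representatives behind the Hecke
  product.\<close>

lemma sum_translate_rep:
  assumes f: "f \<in> hecke" and C: "C \<in> rcosets H" "b \<in> C" "c \<in> C"
  shows "(\<Sum>A \<in> Poly_Mapping.keys f. \<psi> (Poly_Mapping.lookup f A) (A #> b)) =
         (\<Sum>A \<in> Poly_Mapping.keys f. \<psi> (Poly_Mapping.lookup f A) (A #> c))"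
proof -
  have bc: "b \<in> carrier G" "c \<in> carrier G" "C = H #> c" using C rcosets_rep by blast+
  then obtain h where h: "h \<in> H" "b = h \<otimes> c"
    using C(2) by (auto simp: r_coset_def)
  have "(\<Sum>A \<in> Poly_Mapping.keys f. \<psi> (Poly_Mapping.lookup f A) (A #> c)) =
        (\<Sum>A \<in> Poly_Mapping.keys f. \<psi> (Poly_Mapping.lookup f (A #> h)) (A #> h #> c))"
    by (rule sum.reindex_bij_betw[OF keys_translate_bij[OF f h(1)], symmetric])
  also have "\<dots> = (\<Sum>A \<in> Poly_Mapping.keys f. \<psi> (Poly_Mapping.lookup f A) (A #> b))"
    using f h bc by (intro sum.cong refl) (auto simp: mem_hecke_iff rcosets_translate_assoc subset_iff)
  finally show ?thesis by simp
qed

text \<open>\<open>hecke_mult\<close> picks representatives of both factors by \<open>SOME\<close>.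
  The left one is absorbed into its coset and the right one can be exchanged by
  \<open>sum_translate_rep\<close>, so any choice \<rho> for the right factor may be used, in
  particular triangular matrices.\<close>

lemma hecke_mult_reps:
  assumes f: "f \<in> hecke" and g: "g \<in> hecke"
    and \<rho>: "\<And>B. B \<in> Poly_Mapping.keys g \<Longrightarrow> \<rho> B \<in> B"
  shows "hecke_mult G H f g =
    (\<Sum>B \<in> Poly_Mapping.keys g. \<Sum>A \<in> Poly_Mapping.keys f.
       Poly_Mapping.single (A #> \<rho> B) (Poly_Mapping.lookup f A * Poly_Mapping.lookup g B))"
proof -
  have sm: "(SOME a. a \<in> A) \<in> A" if "A \<in> rcosets H" for A
    using rcosets_non_empty[OF that] by (simp add: some_in_eq)
  have fk: "Poly_Mapping.keys f \<subseteq> rcosets H" and gk: "Poly_Mapping.keys g \<subseteq> rcosets H"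
    using f g by (auto simp: mem_hecke_iff)
  have "H #> ((SOME a. a \<in> A) \<otimes> (SOME b. b \<in> B)) = A #> (SOME b. b \<in> B)"
    if "A \<in> Poly_Mapping.keys f" "B \<in> Poly_Mapping.keys g" for A B
  proof -
    have A: "A \<in> rcosets H" and B: "B \<in> rcosets H" using that fk gk by auto
    have a: "A = H #> (SOME a. a \<in> A)" "(SOME a. a \<in> A) \<in> carrier G" "(SOME b. b \<in> B) \<in> carrier G"
      using rcosets_rep[OF A sm[OF A]] rcosets_rep[OF B sm[OF B]] by auto
    show ?thesis
      using coset_mult_assoc[OF subset a(2,3)] unfolding a(1)[symmetric] by simp
  qed
  then have "hecke_mult G H f g = (\<Sum>A \<in> Poly_Mapping.keys f. \<Sum>B \<in> Poly_Mapping.keys g.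
       Poly_Mapping.single (A #> (SOME b. b \<in> B)) (Poly_Mapping.lookup f A * Poly_Mapping.lookup g B))"
    unfolding hecke_mult_def by (intro sum.cong refl) auto
  also have "\<dots> = (\<Sum>B \<in> Poly_Mapping.keys g. \<Sum>A \<in> Poly_Mapping.keys f.
       Poly_Mapping.single (A #> (SOME b. b \<in> B)) (Poly_Mapping.lookup f A * Poly_Mapping.lookup g B))"
    by (rule sum.swap)
  also have "\<dots> = (\<Sum>B \<in> Poly_Mapping.keys g. \<Sum>A \<in> Poly_Mapping.keys f.
       Poly_Mapping.single (A #> \<rho> B) (Poly_Mapping.lookup f A * Poly_Mapping.lookup g B))"
  proof (rule sum.cong[OF refl])
    fix B assume B: "B \<in> Poly_Mapping.keys g"
    then have B': "B \<in> rcosets H" using gk by auto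
    show "(\<Sum>A \<in> Poly_Mapping.keys f.
       Poly_Mapping.single (A #> (SOME b. b \<in> B)) (Poly_Mapping.lookup f A * Poly_Mapping.lookup g B)) =
       (\<Sum>A \<in> Poly_Mapping.keys f.
       Poly_Mapping.single (A #> \<rho> B) (Poly_Mapping.lookup f A * Poly_Mapping.lookup g B))"
      by (rule sum_translate_rep[OF f B' sm[OF B'] \<rho>[OF B], where \<psi> = "\<lambda>k C. Poly_Mapping.single C (k * Poly_Mapping.lookup g B)"])
  qed
  finally show ?thesis .
qed

text \<open>Multiplicativity of \<phi> is demanded only along the chosen representatives \<rho>: the
  Satake monomial of A b is the product of the two monomials when b is triangular, but not for
  arbitrary b.\<close>

lemma lin_ext_hecke_mult:
  assumes "f \<in> hecke" "g \<in> hecke" "\<And>B. B \<in> Poly_Mapping.keys g \<Longrightarrow> \<rho> B \<in> B"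
    and hom: "\<And>A B. A \<in> Poly_Mapping.keys f \<Longrightarrow> B \<in> Poly_Mapping.keys g \<Longrightarrow> \<phi> (A #> \<rho> B) = \<phi> A * \<phi> B"
  shows "lin_ext \<phi> (hecke_mult G H f g) = lin_ext \<phi> f * lin_ext \<phi> g"
proof -
  have "lin_ext \<phi> (hecke_mult G H f g) = (\<Sum>B \<in> Poly_Mapping.keys g. \<Sum>A \<in> Poly_Mapping.keys f.
     of_int (Poly_Mapping.lookup f A * Poly_Mapping.lookup g B) * \<phi> (A #> \<rho> B))"
    by (simp add: hecke_mult_reps[OF assms(1-3)] lin_ext_sum)
  also have "\<dots> = (\<Sum>B \<in> Poly_Mapping.keys g. \<Sum>A \<in> Poly_Mapping.keys f.
     (of_int (Poly_Mapping.lookup f A) * \<phi> A) * (of_int (Poly_Mapping.lookup g B) * \<phi> B))"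
    by (intro sum.cong refl) (simp add: hom)
  also have "\<dots> = lin_ext \<phi> f * lin_ext \<phi> g"
    unfolding lin_ext_def sum_product by (rule sum.swap)
  finally show ?thesis .
qed

lemma keys_hecke_mult:
  assumes "f \<in> hecke" "g \<in> hecke" "C \<in> Poly_Mapping.keys (hecke_mult G H f g)"
  obtains a b where "a \<in> carrier G" "b \<in> carrier G" "H #> a \<in> Poly_Mapping.keys f"
    "H #> b \<in> Poly_Mapping.keys g" "C = H #> (a \<otimes> b)"
proof -
  have rep: "\<exists>a. a \<in> A" if "A \<in> rcosets H" for A
    using rcosets_non_empty[OF that] by blast
  have fk: "Poly_Mapping.keys f \<subseteq> rcosets H" and gk: "Poly_Mapping.keys g \<subseteq> rcosets H"
    using assms(1,2) by (simp_all add: mem_hecke_iff)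
  have *: "hecke_mult G H f g = (\<Sum>B \<in> Poly_Mapping.keys g. \<Sum>A \<in> Poly_Mapping.keys f.
       Poly_Mapping.single (A #> (SOME b. b \<in> B)) (Poly_Mapping.lookup f A * Poly_Mapping.lookup g B))"
  proof (rule hecke_mult_reps[OF assms(1,2), where \<rho> = "\<lambda>B. SOME b. b \<in> B"])
    fix B assume "B \<in> Poly_Mapping.keys g"
    then have "\<exists>b. b \<in> B" using gk by (intro rep) auto
    then show "(SOME b. b \<in> B) \<in> B" by (simp add: some_in_eq ex_in_conv)
  qed
  obtain A B where AB: "A \<in> Poly_Mapping.keys f" "B \<in> Poly_Mapping.keys g"
     "C \<in> Poly_Mapping.keys (Poly_Mapping.single (A #> (SOME b. b \<in> B)) (Poly_Mapping.lookup f A * Poly_Mapping.lookup g B))"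
    using assms(3) unfolding * by (fast dest!: subsetD[OF keys_sum_subset])
  then have C: "C = A #> (SOME b. b \<in> B)" by (auto split: if_splits)
  have A: "A \<in> rcosets H" and B: "B \<in> rcosets H" using AB fk gk by auto
  obtain a where a: "a \<in> A" using rep[OF A] by auto
  have b: "(SOME b. b \<in> B) \<in> B" using rep[OF B] by (rule someI_ex)
  note ra = rcosets_rep[OF A a] and rb = rcosets_rep[OF B b]
  have "C = H #> (a \<otimes> (SOME b. b \<in> B))"
    using coset_mult_assoc[OF subset ra(1) rb(1)] C ra(2) by simp
  then show thesis
    using that[OF ra(1) rb(1)] AB(1,2) ra(2) rb(2) by simp
qed

lemma hecke_mult_closed:
  assumes f: "f \<in> hecke" and g: "g \<in> hecke"
  shows "hecke_mult G H f g \<in> hecke"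
  unfolding mem_hecke_iff
proof (intro conjI ballI subsetI)
  fix C assume "C \<in> Poly_Mapping.keys (hecke_mult G H f g)"
  then show "C \<in> rcosets H"
    by (rule keys_hecke_mult[OF f g]) (simp add: rcosetsI subset)
next
  fix C h assume C: "C \<in> rcosets H" and h: "h \<in> H"
  define \<rho> where "\<rho> B = (SOME b. b \<in> B)" for B :: "'a set"
  \<comment> \<open>Another system of representatives: translate to \<open>B #> h\<close>, choose
    there, translate back. With it the products that equal \<open>C #> h\<close> correspond to
    products that equal \<open>C\<close>.\<close>
  define \<sigma> where "\<sigma> B = \<rho> (B #> h) \<otimes> inv h" for B
  have fk: "Poly_Mapping.keys f \<subseteq> rcosets H" and gk: "Poly_Mapping.keys g \<subseteq> rcosets H"
    using f g by (auto simp: mem_hecke_iff)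
  have \<rho>: "\<rho> B \<in> B" if "B \<in> rcosets H" for B
    unfolding \<rho>_def using rcosets_non_empty[OF that] by (simp add: some_in_eq)
  have Bh: "B #> h \<in> rcosets H" if "B \<in> rcosets H" for B
    using rcosets_translate[OF that] h by simp
  have \<rho>': "\<rho> (B #> h) \<in> carrier G" if "B \<in> rcosets H" for B
    by (rule rcosets_rep(1)[OF Bh[OF that] \<rho>[OF Bh[OF that]]])
  have \<sigma>: "\<sigma> B \<in> B" if "B \<in> rcosets H" for B
  proof -
    have "\<rho> (B #> h) \<in> B #> h" by (rule \<rho>[OF Bh[OF that]])
    then obtain b where b: "b \<in> B" "\<rho> (B #> h) = b \<otimes> h" by (auto simp: r_coset_def)
    have "b \<in> carrier G" by (rule rcosets_rep(1)[OF that b(1)])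
    then show ?thesis using b h by (simp add: \<sigma>_def m_assoc)
  qed
  have eq: "A #> \<rho> (B #> h) = C #> h \<longleftrightarrow> A #> \<sigma> B = C" if "A \<in> rcosets H" "B \<in> rcosets H" for A B
  proof -
    have "A #> \<sigma> B = A #> \<rho> (B #> h) #> inv h"
      using that \<rho>' h unfolding \<sigma>_def by (simp add: rcosets_translate_assoc)
    moreover have "A #> \<rho> (B #> h) \<in> rcosets H"
      by (rule rcosets_translate[OF that(1) \<rho>'[OF that(2)]])
    ultimately show ?thesis
      using rcosets_translate_cancel(1)[OF C mem_carrier[OF h]]
        rcosets_translate_cancel(2)[of "A #> \<rho> (B #> h)", OF _ mem_carrier[OF h]] by auto
  qed
  have lk: "Poly_Mapping.lookup (hecke_mult G H f g) D = (\<Sum>B \<in> Poly_Mapping.keys g. \<Sum>A \<in> Poly_Mapping.keys f.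
      if A #> \<tau> B = D then Poly_Mapping.lookup f A * Poly_Mapping.lookup g B else 0)"
    if "\<And>B. B \<in> rcosets H \<Longrightarrow> \<tau> B \<in> B" for \<tau> D
  proof -
    have "hecke_mult G H f g = (\<Sum>B \<in> Poly_Mapping.keys g. \<Sum>A \<in> Poly_Mapping.keys f.
       Poly_Mapping.single (A #> \<tau> B) (Poly_Mapping.lookup f A * Poly_Mapping.lookup g B))"
      by (rule hecke_mult_reps[OF f g]) (use gk that in auto)
    then show ?thesis by (simp add: lookup_sum lookup_single when_def)
  qed
  have "Poly_Mapping.lookup (hecke_mult G H f g) (C #> h) = (\<Sum>B \<in> Poly_Mapping.keys g. \<Sum>A \<in> Poly_Mapping.keys f.
      if A #> \<rho> B = C #> h then Poly_Mapping.lookup f A * Poly_Mapping.lookup g B else 0)"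
    by (rule lk[OF \<rho>])
  also have "\<dots> = (\<Sum>B \<in> Poly_Mapping.keys g. \<Sum>A \<in> Poly_Mapping.keys f.
      if A #> \<rho> (B #> h) = C #> h then Poly_Mapping.lookup f A * Poly_Mapping.lookup g (B #> h) else 0)"
    by (rule sum.reindex_bij_betw[OF keys_translate_bij[OF g h], symmetric])
  also have "\<dots> = (\<Sum>B \<in> Poly_Mapping.keys g. \<Sum>A \<in> Poly_Mapping.keys f.
      if A #> \<sigma> B = C then Poly_Mapping.lookup f A * Poly_Mapping.lookup g B else 0)"
    using eq fk gk g h by (intro sum.cong refl) (auto simp: mem_hecke_iff subset_iff)
  also have "\<dots> = Poly_Mapping.lookup (hecke_mult G H f g) C" by (rule lk[OF \<sigma>, symmetric])
  finally show "Poly_Mapping.lookup (hecke_mult G H f g) (C #> h) = Poly_Mapping.lookup (hecke_mult G H f g) C" .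
qed

lemma hecke_add_closed: "f \<in> hecke \<Longrightarrow> g \<in> hecke \<Longrightarrow> f + g \<in> hecke"
  using keys_add[of f g] by (auto simp: mem_hecke_iff lookup_add)

lemma hecke_uminus_closed: "f \<in> hecke \<Longrightarrow> - f \<in> hecke"
  by (auto simp: mem_hecke_iff)

text \<open>The orbit of \<open>H #> a\<close> under right translation, which will be the support of
  the double coset. Unlike the inclusion in HaH used by \<open>double_coset\<close>, membership
  supplies a representative.\<close>

definition dcosets :: "'a \<Rightarrow> 'a set set" where
  "dcosets a = {H #> (a \<otimes> h) | h. h \<in> H}"

lemma dcosets_iff:
  assumes "a \<in> carrier G"
  shows "dcosets a = {C \<in> rcosets H. C \<subseteq> (H #> a) <#> H}"
proof (intro equalityI subsetI)
  fix C assume "C \<in> dcosets a"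
  then obtain h where h: "h \<in> H" "C = H #> (a \<otimes> h)" by (auto simp: dcosets_def)
  then have "C \<in> rcosets H" using assms by (simp add: rcosetsI subset)
  moreover have "C \<subseteq> (H #> a) <#> H"
  proof
    fix x assume "x \<in> C"
    then obtain k where k: "k \<in> H" "x = k \<otimes> (a \<otimes> h)" using h by (auto simp: r_coset_def)
    then have "x = (k \<otimes> a) \<otimes> h" using h assms by (simp add: m_assoc)
    then show "x \<in> (H #> a) <#> H" using k h by (auto simp: set_mult_def r_coset_def)
  qed
  ultimately show "C \<in> {C \<in> rcosets H. C \<subseteq> (H #> a) <#> H}" by simp
next
  fix C assume "C \<in> {C \<in> rcosets H. C \<subseteq> (H #> a) <#> H}"
  then have C: "C \<in> rcosets H" "C \<subseteq> (H #> a) <#> H" by auto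
  obtain x where x: "x \<in> C" using rcosets_non_empty[OF C(1)] by auto
  then obtain k h where kh: "k \<in> H" "h \<in> H" "x = (k \<otimes> a) \<otimes> h"
    using C(2) by (force simp: set_mult_def r_coset_def)
  have "x = k \<otimes> (a \<otimes> h)" using kh assms by (simp add: m_assoc)
  then have "x \<in> H #> (a \<otimes> h)" using kh by (auto simp: r_coset_def)
  then have "H #> (a \<otimes> h) = H #> x"
    using repr_independence[OF _ _ is_subgroup_H] assms kh by auto
  moreover have "C = H #> x" using rcosets_rep(2)[OF C(1) x] .
  ultimately show "C \<in> dcosets a" using kh by (auto simp: dcosets_def)
qed

lemma double_coset_eq_sum:
  "a \<in> carrier G \<Longrightarrow> double_coset G H a = (\<Sum>C \<in> dcosets a. Poly_Mapping.single C 1)"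
  by (simp add: double_coset_def dcosets_iff)

lemma lookup_double_coset:
  assumes "a \<in> carrier G" "finite (dcosets a)"
  shows "Poly_Mapping.lookup (double_coset G H a) C = (if C \<in> dcosets a then 1 else 0)"
  using assms by (simp add: double_coset_eq_sum lookup_sum lookup_single when_def)

lemma keys_double_coset:
  assumes "a \<in> carrier G" "finite (dcosets a)"
  shows "Poly_Mapping.keys (double_coset G H a) = dcosets a"
  by (auto simp: in_keys_iff lookup_double_coset[OF assms] split: if_splits)

lemma dcosets_translate:
  assumes "a \<in> carrier G" "C \<in> dcosets a" "h \<in> H"
  shows "C #> h \<in> dcosets a"
proof -
  obtain k where k: "k \<in> H" "C = H #> (a \<otimes> k)" using assms by (auto simp: dcosets_def)
  then have "C #> h = H #> (a \<otimes> (k \<otimes> h))"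
    using assms by (simp add: coset_mult_assoc subset m_assoc)
  then show ?thesis using k assms by (auto simp: dcosets_def)
qed

lemma double_coset_closed:
  assumes "a \<in> carrier G" "finite (dcosets a)"
  shows "double_coset G H a \<in> hecke"
proof -
  have "C #> h \<in> dcosets a \<longleftrightarrow> C \<in> dcosets a" if "C \<in> rcosets H" "h \<in> H" for C h
    using dcosets_translate[OF assms(1), of C h] dcosets_translate[OF assms(1), of "C #> h" "inv h"]
      that rcosets_translate_cancel(1)[of C h] by auto
  moreover have "dcosets a \<subseteq> rcosets H" using dcosets_iff[OF assms(1)] by auto
  ultimately show ?thesis
    by (simp add: mem_hecke_iff keys_double_coset[OF assms] lookup_double_coset[OF assms])
qed

lemma lin_ext_double_coset:
  assumes "a \<in> carrier G"
  shows "lin_ext \<phi> (double_coset G H a) = (\<Sum>C \<in> dcosets a. \<phi> C)"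
  by (simp add: double_coset_eq_sum[OF assms] lin_ext_sum)

end

section \<open>Symplectic similitudes\<close>

lemma J_mat_carrier [simp]: "J_mat n \<in> carrier_mat (2*n) (2*n)"
  by (simp add: J_mat_def mult_2 four_block_carrier_mat)

lemma J_mat_dim [simp]: "dim_row (J_mat n) = 2*n" "dim_col (J_mat n) = 2*n"
  using J_mat_carrier[of n] by blast+

lemma J_mat_index:
  assumes "i < 2*n" "j < 2*n"
  shows "J_mat n $$ (i, j) = (if j = i + n then 1 else if i = j + n then -1 else 0)"
  using assms by (auto simp: J_mat_def)

lemma J_mat_transpose: "transpose_mat (J_mat n) = - J_mat n"
  by (rule eq_matI) (auto simp: J_mat_index)

lemma row_J_mat_scalar:
  assumes "i < 2*n" "v \<in> carrier_vec (2*n)"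
  shows "row (J_mat n) i \<bullet> v = (if i < n then v $ (i + n) else - (v $ (i - n)))"
proof -
  have "row (J_mat n) i \<bullet> v = (\<Sum>k\<in>{0..<2*n}. J_mat n $$ (i, k) * v $ k)"
    using assms by (auto simp: scalar_prod_def intro!: sum.cong)
  also have "\<dots> = (\<Sum>k\<in>{0..<2*n}. if k = (if i < n then i + n else i - n) then
      (if i < n then v $ (i + n) else - (v $ (i - n))) else 0)"
    using assms by (intro sum.cong refl) (auto simp: J_mat_index)
  also have "\<dots> = (if i < n then v $ (i + n) else - (v $ (i - n)))"
    using assms by (subst sum.delta) auto
  finally show ?thesis .
qed

lemma J_mat_mult_index:
  assumes "M \<in> carrier_mat (2*n) m" "i < 2*n" "j < m"
  shows "(J_mat n * M) $$ (i, j) = (if i < n then M $$ (i + n, j) else - (M $$ (i - n, j)))"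
  using assms by (auto simp: row_J_mat_scalar)

lemma J_mat_square: "J_mat n * J_mat n = - 1\<^sub>m (2*n)"
proof (rule eq_matI)
  fix i j assume "i < dim_row (- 1\<^sub>m (2 * n) :: rat mat)" "j < dim_col (- 1\<^sub>m (2 * n) :: rat mat)"
  then have ij: "i < 2*n" "j < 2*n" by auto
  then show "(J_mat n * J_mat n) $$ (i, j) = (- 1\<^sub>m (2*n)) $$ (i, j)"
    by (subst J_mat_mult_index) (auto simp: J_mat_index)
qed auto

lemma sum_double: "(\<Sum>k\<in>{0..<2*n}. f k) = (\<Sum>k<n. f k + f (k + n))" for f :: "nat \<Rightarrow> 'a::comm_monoid_add"
proof -
  have "(\<Sum>k\<in>{0..<2*n}. f k) = (\<Sum>k\<in>{0..<n}. f k) + (\<Sum>k\<in>{n..<n+n}. f k)"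
    by (subst sum.atLeastLessThan_concat) (auto simp: mult_2)
  also have "(\<Sum>k\<in>{n..<n+n}. f k) = (\<Sum>k\<in>{0..<n}. f (k + n))"
    using sum.shift_bounds_nat_ivl[of f 0 n n] by simp
  finally show ?thesis by (simp add: sum.distrib lessThan_atLeast0)
qed

lemma form_index:
  assumes "M \<in> carrier_mat (2*n) m" "N \<in> carrier_mat (2*n) m" "i < m" "j < m"
  shows "(transpose_mat M * J_mat n * N) $$ (i, j) =
    (\<Sum>k<n. M $$ (k, i) * N $$ (k + n, j) - M $$ (k + n, i) * N $$ (k, j))"
proof -
  have "transpose_mat M * J_mat n * N = transpose_mat M * (J_mat n * N)"
    using assms by (intro assoc_mult_mat[of _ m "2*n" _ "2*n" _ m]) auto
  moreover have "(transpose_mat M * (J_mat n * N)) $$ (i, j) =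
     (\<Sum>k\<in>{0..<2*n}. M $$ (k, i) * (J_mat n * N) $$ (k, j))"
    using assms by (auto simp: scalar_prod_def intro!: sum.cong)
  moreover have "\<dots> = (\<Sum>k<n. M $$ (k, i) * N $$ (k + n, j) - M $$ (k + n, i) * N $$ (k, j))"
    unfolding sum_double using assms by (intro sum.cong refl) (auto simp: J_mat_mult_index simp del: index_mult_mat)
  ultimately show ?thesis by simp
qed

section \<open>Rewriting rules for square matrices of one size\<close>

lemma square_mult_carrier: "A \<in> carrier_mat m m \<Longrightarrow> B \<in> carrier_mat m m \<Longrightarrow> A * B \<in> carrier_mat m m"
  by simp

lemma square_mult_assoc:
  "A \<in> carrier_mat m m \<Longrightarrow> B \<in> carrier_mat m m \<Longrightarrow> C \<in> carrier_mat m m \<Longrightarrow> A * B * C = A * (B * C)"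
  by (rule assoc_mult_mat)

lemma square_smult_left:
  "A \<in> carrier_mat m m \<Longrightarrow> B \<in> carrier_mat m m \<Longrightarrow> (k \<cdot>\<^sub>m A) * B = k \<cdot>\<^sub>m (A * (B :: 'a::comm_semiring_0 mat))"
  by (rule mult_smult_assoc_mat)

lemma square_smult_right:
  "A \<in> carrier_mat m m \<Longrightarrow> B \<in> carrier_mat m m \<Longrightarrow> A * (k \<cdot>\<^sub>m B) = k \<cdot>\<^sub>m (A * (B :: 'a::comm_semiring_0 mat))"
  by (rule mult_smult_distrib)

lemma square_smult_smult: "k \<cdot>\<^sub>m (l \<cdot>\<^sub>m (A :: 'a::semigroup_mult mat)) = (k * l) \<cdot>\<^sub>m A"
  by (rule eq_matI) (auto simp: mult.assoc)

lemma square_transpose_carrier: "A \<in> carrier_mat m m \<Longrightarrow> transpose_mat A \<in> carrier_mat m m"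
  by simp

lemma square_transpose_mult:
  "A \<in> carrier_mat m m \<Longrightarrow> B \<in> carrier_mat m m \<Longrightarrow>
     transpose_mat (A * B) = transpose_mat B * transpose_mat (A :: 'a::comm_semiring_0 mat)"
  by (rule transpose_mult)

lemma smult_one_mat: "(1::'a::monoid_mult) \<cdot>\<^sub>m A = A"
  by (rule eq_matI) auto

lemma uminus_eq_smult: "- A = (-1 :: 'a::ring_1) \<cdot>\<^sub>m A"
  by (rule eq_matI) auto

text \<open>With square matrices of one size m all dimension conditions have the form
  \<open>carrier_mat m m\<close>. Once m is instantiated, the rules rewrite products to
  right-associated form with scalars in front and transposes inside.\<close>

lemmas square_ops = square_mult_carrier square_mult_assoc square_smult_left square_smult_right
  square_transpose_carrier square_transpose_mult

lemmas scalar_simps = square_smult_smult smult_one_mat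

definition similitude :: "nat \<Rightarrow> rat \<Rightarrow> rat mat \<Rightarrow> bool" where
  "similitude n \<mu> M \<longleftrightarrow> M \<in> carrier_mat (2*n) (2*n) \<and> transpose_mat M * J_mat n * M = \<mu> \<cdot>\<^sub>m J_mat n"

lemma similitude_carrier: "similitude n \<mu> M \<Longrightarrow> M \<in> carrier_mat (2*n) (2*n)"
  by (simp add: similitude_def)

lemma carrier_GSp_plus_iff: "M \<in> carrier (GSp_plus n) \<longleftrightarrow> (\<exists>\<mu> > 0. similitude n \<mu> M)"
  by (auto simp: GSp_plus_def similitude_def)

lemma mem_Sp_int_iff: "M \<in> Sp_int n \<longleftrightarrow> similitude n 1 M \<and> elements_mat M \<subseteq> \<int>"
  by (auto simp: Sp_int_def similitude_def)

lemma similitude_one: "similitude n 1 (1\<^sub>m (2*n))"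
  by (simp add: similitude_def smult_one_mat)

lemma similitude_eq: "similitude n \<mu> M \<Longrightarrow> transpose_mat M * (J_mat n * M) = \<mu> \<cdot>\<^sub>m J_mat n"
  using square_mult_assoc[of "transpose_mat M" "2*n" "J_mat n" M] by (auto simp: similitude_def)

lemma J_mat_square_mult: "A \<in> carrier_mat (2*n) (2*n) \<Longrightarrow> J_mat n * (J_mat n * A) = (-1) \<cdot>\<^sub>m A"
  using square_mult_assoc[of "J_mat n" "2*n" "J_mat n" A]
  by (simp add: J_mat_square uminus_eq_smult square_ops[where m = "2*n"] scalar_simps)

lemma similitude_mult:
  assumes "similitude n \<mu> M" "similitude n \<nu> N"
  shows "similitude n (\<mu> * \<nu>) (M * N)"
proof -
  note M = similitude_carrier[OF assms(1)] and N = similitude_carrier[OF assms(2)]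
  note sq = square_ops[where m = "2*n"] scalar_simps
  have "transpose_mat M * (J_mat n * (M * N)) = \<mu> \<cdot>\<^sub>m (J_mat n * N)"
    using M N similitude_eq[OF assms(1)] square_mult_assoc[of "transpose_mat M" "2*n" "J_mat n * M" N]
    by (simp add: sq)
  then show ?thesis
    using M N similitude_eq[OF assms(2)] by (simp add: similitude_def sq)
qed

text \<open>Solving M^T J M = \<mu> J for the inverse with J^2 = -1 gives M^-1 = -\<mu>^-1 J M^T J.
  In this form \<mu> M^-1 is visibly integral when M is.\<close>

definition similitude_inv :: "nat \<Rightarrow> rat \<Rightarrow> rat mat \<Rightarrow> rat mat" where
  "similitude_inv n \<mu> M = (- inverse \<mu>) \<cdot>\<^sub>m (J_mat n * (transpose_mat M * J_mat n))"

lemma similitude_inv_carrier: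
  "M \<in> carrier_mat (2*n) (2*n) \<Longrightarrow> similitude_inv n \<mu> M \<in> carrier_mat (2*n) (2*n)"
  by (simp add: similitude_inv_def square_ops[where m = "2*n"] scalar_simps)

lemma similitude_inv_mult_left:
  assumes "similitude n \<mu> M" "\<mu> \<noteq> 0"
  shows "similitude_inv n \<mu> M * M = 1\<^sub>m (2*n)"
  using assms similitude_carrier[OF assms(1)] similitude_eq[OF assms(1)]
  by (simp add: similitude_inv_def square_ops[where m = "2*n"] scalar_simps J_mat_square uminus_eq_smult)

lemma similitude_inv_mult_right:
  assumes "similitude n \<mu> M" "\<mu> \<noteq> 0"
  shows "M * similitude_inv n \<mu> M = 1\<^sub>m (2*n)"
  by (rule mat_mult_left_right_inverse[OF similitude_inv_carrier similitude_carrier similitude_inv_mult_left])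
    (use assms similitude_carrier in blast)+

text \<open>A left inverse of a square matrix is a right inverse. Inserting M M^-1 = 1 with the
  explicit inverse into \<mu> J turns the relation between columns into M J M^T = \<mu> J, the
  relation between rows.\<close>

lemma similitude_transpose:
  assumes "similitude n \<mu> M" "\<mu> \<noteq> 0"
  shows "similitude n \<mu> (transpose_mat M)"
proof -
  note M = similitude_carrier[OF assms(1)]
  note sq = square_ops[where m = "2*n"] scalar_simps
  have "\<mu> \<cdot>\<^sub>m J_mat n = \<mu> \<cdot>\<^sub>m (M * similitude_inv n \<mu> M * J_mat n)"
    using similitude_inv_mult_right[OF assms] by simp
  also have "\<dots> = M * (J_mat n * transpose_mat M)"
    using M assms(2) by (simp add: sq similitude_inv_def J_mat_square uminus_eq_smult)
  finally show ?thesis using M by (simp add: similitude_def sq)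
qed

text \<open>Up to the scalar -\<mu>^-1 the inverse is J M^T J, a product of similitudes with
  multipliers 1, \<mu>, 1. The scalar enters squared, so the multiplier is \<mu> \<mu>^-2.\<close>

lemma similitude_similitude_inv:
  assumes "similitude n \<mu> M" "\<mu> \<noteq> 0"
  shows "similitude n (inverse \<mu>) (similitude_inv n \<mu> M)"
proof -
  note M = similitude_carrier[OF assms(1)]
  note sq = square_ops[where m = "2*n"] scalar_simps
  have "similitude n \<mu> (J_mat n * (transpose_mat M * J_mat n))"
    using similitude_mult[OF _ similitude_mult[OF similitude_transpose[OF assms]], of 1 "J_mat n" 1 "J_mat n"]
    by (simp add: similitude_def J_mat_transpose uminus_eq_smult sq J_mat_square_mult)
  moreover have "transpose_mat (c \<cdot>\<^sub>m A) = c \<cdot>\<^sub>m transpose_mat A" for c :: rat and A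
    by (rule eq_matI) auto
  ultimately show ?thesis
    using M assms(2) by (simp add: similitude_def similitude_inv_def sq)
qed

lemma GSp_plus_simps [simp]:
  "monoid.mult (GSp_plus n) M N = M * N" "\<one>\<^bsub>GSp_plus n\<^esub> = 1\<^sub>m (2*n)"
  by (simp_all add: GSp_plus_def)

lemma group_GSp_plus: "group (GSp_plus n)"
proof (rule groupI)
  fix x y assume "x \<in> carrier (GSp_plus n)" "y \<in> carrier (GSp_plus n)"
  then show "x \<otimes>\<^bsub>GSp_plus n\<^esub> y \<in> carrier (GSp_plus n)"
    by (auto simp: carrier_GSp_plus_iff) (metis similitude_mult mult_pos_pos)
next
  show "\<one>\<^bsub>GSp_plus n\<^esub> \<in> carrier (GSp_plus n)"
    using similitude_one by (auto simp: carrier_GSp_plus_iff intro!: exI[of _ 1])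
next
  fix x y z assume "x \<in> carrier (GSp_plus n)" "y \<in> carrier (GSp_plus n)" "z \<in> carrier (GSp_plus n)"
  then show "x \<otimes>\<^bsub>GSp_plus n\<^esub> y \<otimes>\<^bsub>GSp_plus n\<^esub> z = x \<otimes>\<^bsub>GSp_plus n\<^esub> (y \<otimes>\<^bsub>GSp_plus n\<^esub> z)"
    by (auto simp: carrier_GSp_plus_iff dest!: similitude_carrier intro!: assoc_mult_mat)
next
  fix x assume "x \<in> carrier (GSp_plus n)"
  then show "\<one>\<^bsub>GSp_plus n\<^esub> \<otimes>\<^bsub>GSp_plus n\<^esub> x = x"
    by (auto simp: carrier_GSp_plus_iff dest!: similitude_carrier)
next
  fix x assume "x \<in> carrier (GSp_plus n)"
  then obtain \<mu> where \<mu>: "\<mu> > 0" "similitude n \<mu> x" by (auto simp: carrier_GSp_plus_iff)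
  then have "similitude_inv n \<mu> x \<in> carrier (GSp_plus n)"
    using similitude_similitude_inv[OF \<mu>(2)] by (auto simp: carrier_GSp_plus_iff intro!: exI[of _ "inverse \<mu>"])
  then show "\<exists>y\<in>carrier (GSp_plus n). y \<otimes>\<^bsub>GSp_plus n\<^esub> x = \<one>\<^bsub>GSp_plus n\<^esub>"
    using similitude_inv_mult_left[OF \<mu>(2)] \<mu> by auto
qed

lemma inv_GSp_plus:
  assumes "similitude n \<mu> M" "\<mu> > 0"
  shows "inv\<^bsub>GSp_plus n\<^esub> M = similitude_inv n \<mu> M"
proof (rule group.inv_equality[OF group_GSp_plus])
  show "similitude_inv n \<mu> M \<otimes>\<^bsub>GSp_plus n\<^esub> M = \<one>\<^bsub>GSp_plus n\<^esub>"
    using similitude_inv_mult_left assms by simp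
  show "M \<in> carrier (GSp_plus n)" using assms by (auto simp: carrier_GSp_plus_iff)
  show "similitude_inv n \<mu> M \<in> carrier (GSp_plus n)"
    using similitude_similitude_inv[OF assms(1)] assms(2)
    by (auto simp: carrier_GSp_plus_iff intro!: exI[of _ "inverse \<mu>"])
qed

section \<open>Integral matrices and the integral symplectic group\<close>

definition integral_mat :: "rat mat \<Rightarrow> bool" where
  "integral_mat M \<longleftrightarrow> (\<forall>i < dim_row M. \<forall>j < dim_col M. M $$ (i, j) \<in> \<int>)"

lemma integral_mat_elements: "elements_mat M \<subseteq> \<int> \<longleftrightarrow> integral_mat M"
  by (force simp: integral_mat_def elements_mat_def)

lemma integral_matI: "(\<And>i j. i < dim_row M \<Longrightarrow> j < dim_col M \<Longrightarrow> M $$ (i, j) \<in> \<int>) \<Longrightarrow> integral_mat M"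
  by (simp add: integral_mat_def)

lemma integral_mat_mult: "integral_mat M \<Longrightarrow> integral_mat N \<Longrightarrow> dim_col M = dim_row N \<Longrightarrow> integral_mat (M * N)"
  by (auto simp: integral_mat_def scalar_prod_def intro!: Ints_sum Ints_mult)

lemma integral_mat_transpose: "integral_mat M \<Longrightarrow> integral_mat (transpose_mat M)"
  by (auto simp: integral_mat_def)

lemma integral_mat_one: "integral_mat (1\<^sub>m n)"
  by (auto simp: integral_mat_def)

lemma integral_mat_J: "integral_mat (J_mat n)"
  by (auto simp: integral_mat_def J_mat_index)

lemma integral_mat_smult: "c \<in> \<int> \<Longrightarrow> integral_mat M \<Longrightarrow> integral_mat (c \<cdot>\<^sub>m M)"
  by (auto simp: integral_mat_def)

lemma mem_Sp_int: "M \<in> Sp_int n \<longleftrightarrow> similitude n 1 M \<and> integral_mat M"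
  by (simp add: mem_Sp_int_iff integral_mat_elements)

lemma Sp_int_transpose: "M \<in> Sp_int n \<Longrightarrow> transpose_mat M \<in> Sp_int n"
  by (auto simp: mem_Sp_int similitude_transpose integral_mat_transpose)

lemma subgroup_Sp_int: "subgroup (Sp_int n) (GSp_plus n)"
proof (rule group.subgroupI[OF group_GSp_plus])
  show "Sp_int n \<subseteq> carrier (GSp_plus n)"
    by (auto simp: mem_Sp_int carrier_GSp_plus_iff intro!: exI[of _ 1])
  show "Sp_int n \<noteq> {}" using similitude_one[of n] integral_mat_one[of "2*n"] mem_Sp_int by blast
next
  fix a assume "a \<in> Sp_int n"
  then have a: "similitude n 1 a" "integral_mat a" by (auto simp: mem_Sp_int)
  have "integral_mat (similitude_inv n 1 a)"
    unfolding similitude_inv_def using similitude_carrier[OF a(1)]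
    by (intro integral_mat_smult integral_mat_mult integral_mat_J integral_mat_transpose a) auto
  then show "inv\<^bsub>GSp_plus n\<^esub> a \<in> Sp_int n"
    using similitude_similitude_inv[OF a(1)] inv_GSp_plus[OF a(1)] by (simp add: mem_Sp_int)
next
  fix a b assume "a \<in> Sp_int n" "b \<in> Sp_int n"
  then show "a \<otimes>\<^bsub>GSp_plus n\<^esub> b \<in> Sp_int n"
    using similitude_mult[of n 1 a 1 b] by (auto simp: mem_Sp_int similitude_def intro!: integral_mat_mult)
qed

interpretation Sp: subgroup_pair "GSp_plus n" "Sp_int n" for n
  by (simp add: subgroup_pair_def group_GSp_plus subgroup_Sp_int)

section \<open>Explicit computation with matrices of size six\<close>

lemma sum6: "(\<Sum>k\<in>{0..<6::nat}. f k) = f 0 + f 1 + f 2 + f 3 + f 4 + (f 5 :: 'a::comm_monoid_add)"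
  by (simp add: numeral_eq_Suc add.assoc)

lemma sum_lt3: "(\<Sum>k<3::nat. f k) = f 0 + f 1 + (f 2 :: 'a::comm_monoid_add)"
  by (simp add: numeral_eq_Suc add.assoc)

lemma all6: "(\<forall>i<6::nat. P i) \<longleftrightarrow> P 0 \<and> P 1 \<and> P 2 \<and> P 3 \<and> P 4 \<and> P 5"
  by (simp add: numeral_eq_Suc All_less_Suc) blast

lemma mult6:
  assumes "A \<in> carrier_mat 6 6" "B \<in> carrier_mat 6 6" "i < 6" "j < 6"
  shows "(A * B) $$ (i, j) = A $$ (i,0) * B $$ (0,j) + A $$ (i,1) * B $$ (1,j) + A $$ (i,2) * B $$ (2,j)
    + A $$ (i,3) * B $$ (3,j) + A $$ (i,4) * B $$ (4,j) + A $$ (i,5) * B $$ (5,j)"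
  using assms by (simp add: scalar_prod_def sum6)

definition mat6 :: "'a list list \<Rightarrow> 'a mat" where
  "mat6 rs = mat 6 6 (\<lambda>(i, j). rs ! i ! j)"

lemma mat6_carrier [simp]: "mat6 rs \<in> carrier_mat 6 6"
  by (simp add: mat6_def)

lemma mat6_index [simp]: "i < 6 \<Longrightarrow> j < 6 \<Longrightarrow> mat6 rs $$ (i, j) = rs ! i ! j"
  by (simp add: mat6_def)

text \<open>The alternating form with matrix \<open>J_mat 3\<close>, evaluated on columns i and j.
  Written out, it turns the similitude condition into polynomial equations between entries.\<close>

definition cpair :: "rat mat \<Rightarrow> nat \<Rightarrow> nat \<Rightarrow> rat" where
  "cpair M i j = M $$ (0,i) * M $$ (3,j) - M $$ (3,i) * M $$ (0,j) + (M $$ (1,i) * M $$ (4,j) - M $$ (4,i) * M $$ (1,j))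
     + (M $$ (2,i) * M $$ (5,j) - M $$ (5,i) * M $$ (2,j))"

lemma cpair_swap: "cpair M i j = - cpair M j i"
  by (simp add: cpair_def)

lemma form_index6:
  assumes "M \<in> carrier_mat 6 6" "i < 6" "j < 6"
  shows "(transpose_mat M * J_mat 3 * M) $$ (i, j) = cpair M i j"
  using form_index[of M 3 6 M i j] assms by (simp add: sum_lt3 cpair_def)

lemma similitude3_iff:
  "similitude 3 \<mu> M \<longleftrightarrow> M \<in> carrier_mat 6 6 \<and> (\<forall>i<6. \<forall>j<6. cpair M i j = \<mu> * J_mat 3 $$ (i, j))"
proof -
  have "transpose_mat M * J_mat 3 * M = \<mu> \<cdot>\<^sub>m J_mat 3 \<longleftrightarrow> (\<forall>i<6. \<forall>j<6. cpair M i j = \<mu> * J_mat 3 $$ (i, j))"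
    if M: "M \<in> carrier_mat 6 6"
  proof
    assume "transpose_mat M * J_mat 3 * M = \<mu> \<cdot>\<^sub>m J_mat 3"
    then show "\<forall>i<6. \<forall>j<6. cpair M i j = \<mu> * J_mat 3 $$ (i, j)"
      using form_index6[OF M] by auto
  next
    assume *: "\<forall>i<6. \<forall>j<6. cpair M i j = \<mu> * J_mat 3 $$ (i, j)"
    show "transpose_mat M * J_mat 3 * M = \<mu> \<cdot>\<^sub>m J_mat 3"
    proof (rule eq_matI)
      fix i j assume "i < dim_row (\<mu> \<cdot>\<^sub>m J_mat 3)" "j < dim_col (\<mu> \<cdot>\<^sub>m J_mat 3)"
      then have "i < 6" "j < 6" by auto
      then show "(transpose_mat M * J_mat 3 * M) $$ (i, j) = (\<mu> \<cdot>\<^sub>m J_mat 3) $$ (i, j)"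
        using * form_index6[OF M, of i j] by auto
    qed (use M in auto)
  qed
  then show ?thesis by (auto simp: similitude_def)
qed

text \<open>The form is alternating, so the fifteen pairs of columns i < j suffice.\<close>

lemma similitude3I:
  assumes "M \<in> carrier_mat 6 6"
    and "cpair M 0 1 = 0" "cpair M 0 2 = 0" "cpair M 0 3 = \<mu>" "cpair M 0 4 = 0" "cpair M 0 5 = 0"
    and "cpair M 1 2 = 0" "cpair M 1 3 = 0" "cpair M 1 4 = \<mu>" "cpair M 1 5 = 0"
    and "cpair M 2 3 = 0" "cpair M 2 4 = 0" "cpair M 2 5 = \<mu>"
    and "cpair M 3 4 = 0" "cpair M 3 5 = 0" "cpair M 4 5 = 0"
  shows "similitude 3 \<mu> M"
proof -
  have d: "cpair M i i = 0" for i by (simp add: cpair_def)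
  show ?thesis
    unfolding similitude3_iff using assms
    by (simp add: all6 d J_mat_index cpair_swap[of M "Suc 0" 0]
      cpair_swap[of M 2 0] cpair_swap[of M 2 "Suc 0"]
      cpair_swap[of M 3 0] cpair_swap[of M 3 "Suc 0"] cpair_swap[of M 3 2]
      cpair_swap[of M 4 0] cpair_swap[of M 4 "Suc 0"] cpair_swap[of M 4 2] cpair_swap[of M 4 3]
      cpair_swap[of M 5 0] cpair_swap[of M 5 "Suc 0"] cpair_swap[of M 5 2] cpair_swap[of M 5 3] cpair_swap[of M 5 4])
qed

lemma similitude3D:
  assumes "similitude 3 \<mu> M"
  shows "cpair M 0 1 = 0" "cpair M 0 2 = 0" "cpair M 0 3 = \<mu>" "cpair M 0 4 = 0" "cpair M 0 5 = 0"
    "cpair M 1 2 = 0" "cpair M 1 3 = 0" "cpair M 1 4 = \<mu>" "cpair M 1 5 = 0"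
    "cpair M 2 3 = 0" "cpair M 2 4 = 0" "cpair M 2 5 = \<mu>"
    "cpair M 3 4 = 0" "cpair M 3 5 = 0" "cpair M 4 5 = 0"
  using assms by (simp_all add: similitude3_iff J_mat_index)

text \<open>Elements of the local Hecke ring are supported on cosets of such matrices; \<delta> = 0
  gives the group itself, \<delta> = 1 and 2 the generators.\<close>

definition int_sim :: "nat \<Rightarrow> nat \<Rightarrow> rat mat set" where
  "int_sim p \<delta> = {M. similitude 3 (of_nat p ^ \<delta>) M \<and> integral_mat M}"

lemma int_sim_0: "int_sim p 0 = Sp_int 3"
  by (auto simp: int_sim_def mem_Sp_int)

lemma int_sim_carrier: "M \<in> int_sim p \<delta> \<Longrightarrow> M \<in> carrier_mat 6 6"
  by (auto simp: int_sim_def similitude_def)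

lemma int_sim_Ints: "M \<in> int_sim p \<delta> \<Longrightarrow> i < 6 \<Longrightarrow> j < 6 \<Longrightarrow> M $$ (i, j) \<in> \<int>"
  by (auto simp: int_sim_def similitude_def integral_mat_def)

lemma int_sim_similitude: "M \<in> int_sim p \<delta> \<Longrightarrow> similitude 3 (of_nat p ^ \<delta>) M"
  by (simp add: int_sim_def)

lemma int_sim_mult: "M \<in> int_sim p \<delta> \<Longrightarrow> N \<in> int_sim p \<epsilon> \<Longrightarrow> M * N \<in> int_sim p (\<delta> + \<epsilon>)"
  using similitude_mult[of 3 "of_nat p ^ \<delta>" M "of_nat p ^ \<epsilon>" N]
  by (auto simp: int_sim_def power_add similitude_def intro!: integral_mat_mult)

lemma Sp_int_carrier: "g \<in> Sp_int 3 \<Longrightarrow> g \<in> carrier_mat 6 6"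
  using int_sim_carrier[of g _ 0] by (simp add: int_sim_0)

lemma Sp_int_Ints: "M \<in> Sp_int 3 \<Longrightarrow> i < 6 \<Longrightarrow> j < 6 \<Longrightarrow> M $$ (i, j) \<in> \<int>"
  using int_sim_Ints[of M _ 0] by (simp add: int_sim_0)

lemma int_sim_mult_left: "g \<in> Sp_int 3 \<Longrightarrow> M \<in> int_sim p \<delta> \<Longrightarrow> g * M \<in> int_sim p \<delta>"
  using int_sim_mult[of g p 0 M \<delta>] by (simp add: int_sim_0)

lemma int_sim_mult_right: "M \<in> int_sim p \<delta> \<Longrightarrow> g \<in> Sp_int 3 \<Longrightarrow> M * g \<in> int_sim p \<delta>"
  using int_sim_mult[of M p \<delta> g 0] by (simp add: int_sim_0)

lemma Sp_int_mult: "g \<in> Sp_int 3 \<Longrightarrow> h \<in> Sp_int 3 \<Longrightarrow> g * h \<in> Sp_int 3"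
  using subgroup.m_closed[OF subgroup_Sp_int] by fastforce

lemma Sp_int_one: "1\<^sub>m 6 \<in> Sp_int 3"
  using subgroup.one_closed[OF subgroup_Sp_int, of 3] by simp

lemma Sp_int_mat6I:
  assumes "similitude 3 1 (mat6 rs)" "\<And>i j. i < 6 \<Longrightarrow> j < 6 \<Longrightarrow> rs ! i ! j \<in> \<int>"
  shows "mat6 rs \<in> Sp_int 3"
  using assms by (auto simp: mem_Sp_int integral_mat_def mat6_def)

definition Sp_inv :: "rat mat \<Rightarrow> rat mat" where "Sp_inv g = similitude_inv 3 1 g"

lemma Sp_inv:
  assumes "g \<in> Sp_int 3"
  shows "Sp_inv g \<in> Sp_int 3" "g * Sp_inv g = 1\<^sub>m 6" "Sp_inv g * g = 1\<^sub>m 6"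
proof -
  have g: "similitude 3 1 g" using assms by (simp add: mem_Sp_int)
  show "Sp_inv g \<in> Sp_int 3"
    using subgroup.m_inv_closed[OF subgroup_Sp_int assms] inv_GSp_plus[OF g] by (simp add: Sp_inv_def)
  show "g * Sp_inv g = 1\<^sub>m 6" "Sp_inv g * g = 1\<^sub>m 6"
    using similitude_inv_mult_right[OF g] similitude_inv_mult_left[OF g] by (simp_all add: Sp_inv_def)
qed

section \<open>Root subgroups and unipotent elements\<close>

definition root0 :: "rat \<Rightarrow> rat \<Rightarrow> rat \<Rightarrow> rat \<Rightarrow> rat mat" where
  "root0 a b c d = mat6 [[a,0,0,b,0,0],[0,1,0,0,0,0],[0,0,1,0,0,0],[c,0,0,d,0,0],[0,0,0,0,1,0],[0,0,0,0,0,1]]"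

text \<open>\<open>root1\<close>, \<open>root2\<close> and \<open>root3\<close> embed SL2 into the
  Levi subgroup: the matrix acts on two rows of the D block, its inverse transpose on the
  corresponding rows of the A block. \<open>root0\<close> belongs to the long simple root,
  \<open>root1\<close> and \<open>root2\<close> to the short simple ones, \<open>root3\<close> to
  the sum of these two, which is not simple.\<close>

definition root1 :: "rat \<Rightarrow> rat \<Rightarrow> rat \<Rightarrow> rat \<Rightarrow> rat mat" where
  "root1 a b c d = mat6 [[d,-c,0,0,0,0],[-b,a,0,0,0,0],[0,0,1,0,0,0],[0,0,0,a,b,0],[0,0,0,c,d,0],[0,0,0,0,0,1]]"

definition root2 :: "rat \<Rightarrow> rat \<Rightarrow> rat \<Rightarrow> rat \<Rightarrow> rat mat" where
  "root2 a b c d = mat6 [[1,0,0,0,0,0],[0,d,-c,0,0,0],[0,-b,a,0,0,0],[0,0,0,1,0,0],[0,0,0,0,a,b],[0,0,0,0,c,d]]"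

definition root3 :: "rat \<Rightarrow> rat \<Rightarrow> rat \<Rightarrow> rat \<Rightarrow> rat mat" where
  "root3 a b c d = mat6 [[d,0,-c,0,0,0],[0,1,0,0,0,0],[-b,0,a,0,0,0],[0,0,0,a,0,b],[0,0,0,0,1,0],[0,0,0,c,0,d]]"

definition upper_unip :: "rat \<Rightarrow> rat \<Rightarrow> rat \<Rightarrow> rat \<Rightarrow> rat \<Rightarrow> rat \<Rightarrow> rat mat" where
  "upper_unip s00 s01 s02 s11 s12 s22 = mat6 [[1,0,0,s00,s01,s02],[0,1,0,s01,s11,s12],[0,0,1,s02,s12,s22],
     [0,0,0,1,0,0],[0,0,0,0,1,0],[0,0,0,0,0,1]]"

text \<open>The unipotent radical of the stabiliser of a line, a Heisenberg group;
  \<open>heis1\<close> is its analogue in the coordinates 0, 1, 3, 4. One row is free apart from its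
  diagonal entry: right multiplication clears a row with the pivot on the diagonal, and right
  multiplication by the transpose adds arbitrary multiples of the other columns to one
  column.\<close>

definition heis0 :: "rat \<Rightarrow> rat \<Rightarrow> rat \<Rightarrow> rat \<Rightarrow> rat \<Rightarrow> rat mat" where
  "heis0 y1 y2 y3 y4 y5 = mat6 [[1,0,0,0,0,y3],[0,1,0,0,0,y4],[y2,y1,1,y3,y4,y5],[0,0,0,1,0,-y2],[0,0,0,0,1,-y1],[0,0,0,0,0,1]]"

definition heis1 :: "rat \<Rightarrow> rat \<Rightarrow> rat \<Rightarrow> rat mat" where
  "heis1 y2 y3 y4 = mat6 [[1,0,0,0,y3,0],[y2,1,0,y3,y4,0],[0,0,1,0,0,0],[0,0,0,1,-y2,0],[0,0,0,0,1,0],[0,0,0,0,0,1]]"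

definition diag_unit :: "rat \<Rightarrow> rat \<Rightarrow> rat \<Rightarrow> rat mat" where
  "diag_unit a b c = mat6 [[a,0,0,0,0,0],[0,b,0,0,0,0],[0,0,c,0,0,0],[0,0,0,a,0,0],[0,0,0,0,b,0],[0,0,0,0,0,c]]"

lemma root0_index [simp]: "root0 a b c d \<in> carrier_mat 6 6" "dim_row (root0 a b c d) = 6" "dim_col (root0 a b c d) = 6"
  "i < 6 \<Longrightarrow> j < 6 \<Longrightarrow> root0 a b c d $$ (i,j) = [[a,0,0,b,0,0],[0,1,0,0,0,0],[0,0,1,0,0,0],[c,0,0,d,0,0],[0,0,0,0,1,0],[0,0,0,0,0,1]] ! i ! j"
  by (simp_all add: root0_def mat6_def)

lemma root1_index [simp]: "root1 a b c d \<in> carrier_mat 6 6" "dim_row (root1 a b c d) = 6" "dim_col (root1 a b c d) = 6"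
  "i < 6 \<Longrightarrow> j < 6 \<Longrightarrow> root1 a b c d $$ (i,j) = [[d,-c,0,0,0,0],[-b,a,0,0,0,0],[0,0,1,0,0,0],[0,0,0,a,b,0],[0,0,0,c,d,0],[0,0,0,0,0,1]] ! i ! j"
  by (simp_all add: root1_def mat6_def)

lemma root2_index [simp]: "root2 a b c d \<in> carrier_mat 6 6" "dim_row (root2 a b c d) = 6" "dim_col (root2 a b c d) = 6"
  "i < 6 \<Longrightarrow> j < 6 \<Longrightarrow> root2 a b c d $$ (i,j) = [[1,0,0,0,0,0],[0,d,-c,0,0,0],[0,-b,a,0,0,0],[0,0,0,1,0,0],[0,0,0,0,a,b],[0,0,0,0,c,d]] ! i ! j"
  by (simp_all add: root2_def mat6_def)

lemma root3_index [simp]: "root3 a b c d \<in> carrier_mat 6 6" "dim_row (root3 a b c d) = 6" "dim_col (root3 a b c d) = 6"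
  "i < 6 \<Longrightarrow> j < 6 \<Longrightarrow> root3 a b c d $$ (i,j) = [[d,0,-c,0,0,0],[0,1,0,0,0,0],[-b,0,a,0,0,0],[0,0,0,a,0,b],[0,0,0,0,1,0],[0,0,0,c,0,d]] ! i ! j"
  by (simp_all add: root3_def mat6_def)

lemma upper_unip_index [simp]: "upper_unip s00 s01 s02 s11 s12 s22 \<in> carrier_mat 6 6" "dim_row (upper_unip s00 s01 s02 s11 s12 s22) = 6" "dim_col (upper_unip s00 s01 s02 s11 s12 s22) = 6"
  "i < 6 \<Longrightarrow> j < 6 \<Longrightarrow> upper_unip s00 s01 s02 s11 s12 s22 $$ (i,j) = [[1,0,0,s00,s01,s02],[0,1,0,s01,s11,s12],[0,0,1,s02,s12,s22], [0,0,0,1,0,0],[0,0,0,0,1,0],[0,0,0,0,0,1]] ! i ! j"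
  by (simp_all add: upper_unip_def mat6_def)

lemma heis0_index [simp]: "heis0 y1 y2 y3 y4 y5 \<in> carrier_mat 6 6" "dim_row (heis0 y1 y2 y3 y4 y5) = 6" "dim_col (heis0 y1 y2 y3 y4 y5) = 6"
  "i < 6 \<Longrightarrow> j < 6 \<Longrightarrow> heis0 y1 y2 y3 y4 y5 $$ (i,j) = [[1,0,0,0,0,y3],[0,1,0,0,0,y4],[y2,y1,1,y3,y4,y5],[0,0,0,1,0,-y2],[0,0,0,0,1,-y1],[0,0,0,0,0,1]] ! i ! j"
  by (simp_all add: heis0_def mat6_def)

lemma heis1_index [simp]: "heis1 y2 y3 y4 \<in> carrier_mat 6 6" "dim_row (heis1 y2 y3 y4) = 6" "dim_col (heis1 y2 y3 y4) = 6"
  "i < 6 \<Longrightarrow> j < 6 \<Longrightarrow> heis1 y2 y3 y4 $$ (i,j) = [[1,0,0,0,y3,0],[y2,1,0,y3,y4,0],[0,0,1,0,0,0],[0,0,0,1,-y2,0],[0,0,0,0,1,0],[0,0,0,0,0,1]] ! i ! j"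
  by (simp_all add: heis1_def mat6_def)

lemma diag_unit_index [simp]: "diag_unit a b c \<in> carrier_mat 6 6" "dim_row (diag_unit a b c) = 6" "dim_col (diag_unit a b c) = 6"
  "i < 6 \<Longrightarrow> j < 6 \<Longrightarrow> diag_unit a b c $$ (i,j) = [[a,0,0,0,0,0],[0,b,0,0,0,0],[0,0,c,0,0,0],[0,0,0,a,0,0],[0,0,0,0,b,0],[0,0,0,0,0,c]] ! i ! j"
  by (simp_all add: diag_unit_def mat6_def)

lemma less6_cases:
  assumes "i < 6"
  obtains "i = 0" | "i = Suc 0" | "i = 2" | "i = 3" | "i = 4" | "i = (5::nat)"
  using assms by fastforce

lemma Sp_int_generators:
  assumes "a \<in> \<int>" "b \<in> \<int>" "c \<in> \<int>" "d \<in> \<int>" "a * d - b * c = 1"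
  shows "root0 a b c d \<in> Sp_int 3" "root1 a b c d \<in> Sp_int 3"
    "root2 a b c d \<in> Sp_int 3" "root3 a b c d \<in> Sp_int 3"
  unfolding root0_def root1_def root2_def root3_def using assms
  by (intro Sp_int_mat6I similitude3I; (simp add: cpair_def algebra_simps; fail)?;
      elim less6_cases; simp)+

lemma upper_unip_Sp_int:
  assumes "s00 \<in> \<int>" "s01 \<in> \<int>" "s02 \<in> \<int>" "s11 \<in> \<int>" "s12 \<in> \<int>" "s22 \<in> \<int>"
  shows "upper_unip s00 s01 s02 s11 s12 s22 \<in> Sp_int 3"
  unfolding upper_unip_def using assms
  by (intro Sp_int_mat6I similitude3I; (simp add: cpair_def algebra_simps; fail)?;
      elim less6_cases; simp)

lemma heis_Sp_int:
  assumes "y1 \<in> \<int>" "y2 \<in> \<int>" "y3 \<in> \<int>" "y4 \<in> \<int>" "y5 \<in> \<int>"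
  shows "heis0 y1 y2 y3 y4 y5 \<in> Sp_int 3" "heis1 y2 y3 y4 \<in> Sp_int 3"
  unfolding heis0_def heis1_def using assms
  by (intro Sp_int_mat6I similitude3I; (simp add: cpair_def algebra_simps; fail)?;
      elim less6_cases; simp)+

lemma diag_unit_Sp_int:
  assumes "a \<in> \<int>" "b \<in> \<int>" "c \<in> \<int>" "a * a = 1" "b * b = 1" "c * c = 1"
  shows "diag_unit a b c \<in> Sp_int 3"
  unfolding diag_unit_def using assms
  by (intro Sp_int_mat6I similitude3I; (simp add: cpair_def; fail)?;
      elim less6_cases; simp)

section \<open>Upper triangular representatives\<close>

abbreviation cs :: "rat mat \<Rightarrow> rat mat set" where
  "cs M \<equiv> Sp_int 3 #>\<^bsub>GSp_plus 3\<^esub> M"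

lemma mem_cs_iff: "N \<in> cs M \<longleftrightarrow> (\<exists>g \<in> Sp_int 3. N = g * M)"
  by (auto simp: r_coset_def)

lemma cs_eq: "M \<in> carrier (GSp_plus 3) \<Longrightarrow> N \<in> cs M \<Longrightarrow> cs N = cs M"
  using group.repr_independence[OF group_GSp_plus _ _ subgroup_Sp_int] by metis

lemma cs_self: "M \<in> carrier (GSp_plus 3) \<Longrightarrow> M \<in> cs M"
  using group.rcos_self[OF group_GSp_plus _ subgroup_Sp_int] by metis

lemma cs_eqD: "M \<in> carrier (GSp_plus 3) \<Longrightarrow> cs M = cs N \<Longrightarrow> \<exists>g \<in> Sp_int 3. M = g * N"
  using cs_self mem_cs_iff by blast

lemma Sp_int_subset: "Sp_int 3 \<subseteq> carrier (GSp_plus 3)"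
  by (rule subgroup.subset[OF subgroup_Sp_int])

lemma cs_translate:
  "M \<in> carrier (GSp_plus 3) \<Longrightarrow> N \<in> carrier (GSp_plus 3) \<Longrightarrow> cs M #>\<^bsub>GSp_plus 3\<^esub> N = cs (M * N)"
  using group.coset_mult_assoc[OF group_GSp_plus Sp_int_subset, of M N] by simp

lemma mult6_assoc:
  "A \<in> carrier_mat 6 6 \<Longrightarrow> B \<in> carrier_mat 6 6 \<Longrightarrow> C \<in> carrier_mat 6 6 \<Longrightarrow> A * B * C = A * (B * (C :: rat mat))"
  by (rule assoc_mult_mat)

text \<open>(c, d) is (-y, x) divided by the gcd, a primitive vector orthogonal to (x, y), and a
  Bezout relation completes it to determinant 1. For x = y = 0 the identity matrix does.\<close>

lemma bezout_kill:
  assumes "x \<in> \<int>" "y \<in> \<int>"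
  obtains a b c d :: rat where "a \<in> \<int>" "b \<in> \<int>" "c \<in> \<int>" "d \<in> \<int>" "a * d - b * c = 1" "c * x + d * y = 0"
proof -
  obtain X Y where XY: "x = of_int X" "y = of_int Y" using assms by (auto elim!: Ints_cases)
  show thesis
  proof (cases "X = 0 \<and> Y = 0")
    case True
    then show thesis using that[of 1 0 0 1] XY by simp
  next
    case False
    let ?g = "gcd X Y"
    obtain u v where uv: "u * X + v * Y = ?g" using bezout_int by blast
    have g: "?g \<noteq> 0" using False by auto
    obtain X' Y' where X': "X = ?g * X'" "Y = ?g * Y'" by (meson gcd_dvd1 gcd_dvd2 dvdE)
    have "?g * (u * X' + v * Y') = u * (?g * X') + v * (?g * Y')" by (simp add: algebra_simps)
    also have "\<dots> = ?g" using X'[symmetric] uv by simp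
    finally have 1: "u * X' + v * Y' = 1" using False by auto
    have "?g * (- Y' * X + X' * Y) = - (?g * Y') * X + (?g * X') * Y" by (simp add: algebra_simps)
    also have "\<dots> = 0" using X'[symmetric] by simp
    finally have 2: "- Y' * X + X' * Y = 0" using False by auto
    have 3: "rat_of_int u * of_int X' - of_int v * of_int (- Y') = 1"
      using arg_cong[OF 1, of rat_of_int] by simp
    have 4: "rat_of_int (- Y') * x + of_int X' * y = 0"
      using arg_cong[OF 2, of rat_of_int] by (simp add: XY)
    show thesis
      by (rule that[OF _ _ _ _ 3 4]) auto
  qed
qed

definition lrel :: "rat mat \<Rightarrow> rat mat \<Rightarrow> bool" where
  "lrel M N \<longleftrightarrow> (\<exists>g \<in> Sp_int 3. N = g * M)"

lemma lrelI: "g \<in> Sp_int 3 \<Longrightarrow> lrel M (g * M)"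
  by (auto simp: lrel_def)

lemma lrel_trans: "lrel M N \<Longrightarrow> lrel N L \<Longrightarrow> M \<in> carrier_mat 6 6 \<Longrightarrow> lrel M L"
  unfolding lrel_def using Sp_int_mult mult6_assoc Sp_int_carrier by metis

lemma lrel_sym: "lrel M N \<Longrightarrow> M \<in> carrier_mat 6 6 \<Longrightarrow> lrel N M"
proof -
  assume "lrel M N" and M: "M \<in> carrier_mat 6 6"
  then obtain g where g: "g \<in> Sp_int 3" "N = g * M" by (auto simp: lrel_def)
  have "Sp_inv g * N = M"
    using mult6_assoc[OF Sp_int_carrier[OF Sp_inv(1)[OF g(1)]] Sp_int_carrier[OF g(1)] M] g Sp_inv(3)[OF g(1)] M by simp
  then show "lrel N M" using lrelI[OF Sp_inv(1)[OF g(1)], of N] by simp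
qed

section \<open>Elimination with root elements\<close>

lemma kill0:
  assumes M: "M \<in> int_sim p \<delta>" and j: "j < 6"
  obtains N where "N \<in> int_sim p \<delta>" "lrel M N" "N $$ (3,j) = 0"
    "\<And>c. c < 6 \<Longrightarrow> M $$ (0,c) = 0 \<Longrightarrow> M $$ (3,c) = 0 \<Longrightarrow> N $$ (0,c) = 0 \<and> N $$ (3,c) = 0"
    "\<And>r c. r \<in> {1,2,4,5} \<Longrightarrow> c < 6 \<Longrightarrow> N $$ (r,c) = M $$ (r,c)"
proof -
  have x: "M $$ (0, j) \<in> \<int>" "M $$ (3, j) \<in> \<int>" using int_sim_Ints[OF M] j by auto
  obtain a b c d where *: "a \<in> \<int>" "b \<in> \<int>" "c \<in> \<int>" "d \<in> \<int>" "a * d - b * c = 1" "c * M $$ (0,j) + d * M $$ (3,j) = 0"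
    using bezout_kill[OF x] by blast
  have g: "root0 a b c d \<in> Sp_int 3" by (rule Sp_int_generators) fact+
  note m6 = mult6[OF mat6_carrier int_sim_carrier[OF M]]
  show thesis
    by (rule that[of "root0 a b c d * M"])
      (use g M j * in \<open>auto simp: int_sim_mult_left lrelI m6 root0_def simp del: index_mult_mat\<close>)
qed

text \<open>The last conclusions of this and the other \<open>kill\<close> lemmas record what
  elimination preserves: a column that vanishes in both combined rows still does, and the other rows
  are untouched. An element of the Levi subgroup combines rows of D and of A simultaneously, so each
  short root serves twice, here for row 4 and in \<open>kill1'\<close> for row 0.\<close>

lemma kill1:
  assumes M: "M \<in> int_sim p \<delta>" and j: "j < 6"
  obtains N where "N \<in> int_sim p \<delta>" "lrel M N" "N $$ (4,j) = 0"
    "\<And>c. c < 6 \<Longrightarrow> M $$ (0,c) = 0 \<Longrightarrow> M $$ (1,c) = 0 \<Longrightarrow> N $$ (0,c) = 0 \<and> N $$ (1,c) = 0"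
    "\<And>c. c < 6 \<Longrightarrow> M $$ (3,c) = 0 \<Longrightarrow> M $$ (4,c) = 0 \<Longrightarrow> N $$ (3,c) = 0 \<and> N $$ (4,c) = 0"
    "\<And>r c. r \<in> {2,5} \<Longrightarrow> c < 6 \<Longrightarrow> N $$ (r,c) = M $$ (r,c)"
proof -
  have x: "M $$ (3, j) \<in> \<int>" "M $$ (4, j) \<in> \<int>" using int_sim_Ints[OF M] j by auto
  obtain a b c d where *: "a \<in> \<int>" "b \<in> \<int>" "c \<in> \<int>" "d \<in> \<int>" "a * d - b * c = 1" "c * M $$ (3,j) + d * M $$ (4,j) = 0"
    using bezout_kill[OF x] by blast
  have g: "root1 a b c d \<in> Sp_int 3" by (rule Sp_int_generators) fact+
  note m6 = mult6[OF mat6_carrier int_sim_carrier[OF M]]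
  show thesis
    by (rule that[of "root1 a b c d * M"])
      (use g M j * in \<open>auto simp: int_sim_mult_left lrelI m6 root1_def simp del: index_mult_mat\<close>)
qed

lemma kill1':
  assumes M: "M \<in> int_sim p \<delta>" and j: "j < 6"
  obtains N where "N \<in> int_sim p \<delta>" "lrel M N" "N $$ (0,j) = 0"
    "\<And>c. c < 6 \<Longrightarrow> M $$ (0,c) = 0 \<Longrightarrow> M $$ (1,c) = 0 \<Longrightarrow> N $$ (0,c) = 0 \<and> N $$ (1,c) = 0"
    "\<And>c. c < 6 \<Longrightarrow> M $$ (3,c) = 0 \<Longrightarrow> M $$ (4,c) = 0 \<Longrightarrow> N $$ (3,c) = 0 \<and> N $$ (4,c) = 0"
    "\<And>r c. r \<in> {2,5} \<Longrightarrow> c < 6 \<Longrightarrow> N $$ (r,c) = M $$ (r,c)"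
proof -
  have x: "M $$ (1, j) \<in> \<int>" "M $$ (0, j) \<in> \<int>" using int_sim_Ints[OF M] j by auto
  obtain a b c d where *: "a \<in> \<int>" "b \<in> \<int>" "c \<in> \<int>" "d \<in> \<int>" "a * d - b * c = 1" "c * M $$ (1,j) + d * M $$ (0,j) = 0"
    using bezout_kill[OF x] by blast
  \<comment> \<open>\<open>root1\<close> acts on rows 0 and 1 by the inverse transpose; these signs
    make the new row 0 equal to d times row 0 plus c times row 1.\<close>
  have g: "root1 a (-b) (-c) d \<in> Sp_int 3" by (rule Sp_int_generators) (use * in auto)
  note m6 = mult6[OF mat6_carrier int_sim_carrier[OF M]]
  show thesis
    by (rule that[of "root1 a (-b) (-c) d * M"])
      (use g M j * in \<open>auto simp: int_sim_mult_left lrelI m6 root1_def algebra_simps simp del: index_mult_mat\<close>)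
qed

lemma kill2:
  assumes M: "M \<in> int_sim p \<delta>" and j: "j < 6"
  obtains N where "N \<in> int_sim p \<delta>" "lrel M N" "N $$ (5,j) = 0"
    "\<And>c. c < 6 \<Longrightarrow> M $$ (1,c) = 0 \<Longrightarrow> M $$ (2,c) = 0 \<Longrightarrow> N $$ (1,c) = 0 \<and> N $$ (2,c) = 0"
    "\<And>c. c < 6 \<Longrightarrow> M $$ (4,c) = 0 \<Longrightarrow> M $$ (5,c) = 0 \<Longrightarrow> N $$ (4,c) = 0 \<and> N $$ (5,c) = 0"
    "\<And>r c. r \<in> {0,3} \<Longrightarrow> c < 6 \<Longrightarrow> N $$ (r,c) = M $$ (r,c)"
proof -
  have x: "M $$ (4, j) \<in> \<int>" "M $$ (5, j) \<in> \<int>" using int_sim_Ints[OF M] j by auto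
  obtain a b c d where *: "a \<in> \<int>" "b \<in> \<int>" "c \<in> \<int>" "d \<in> \<int>" "a * d - b * c = 1" "c * M $$ (4,j) + d * M $$ (5,j) = 0"
    using bezout_kill[OF x] by blast
  have g: "root2 a b c d \<in> Sp_int 3" by (rule Sp_int_generators) fact+
  note m6 = mult6[OF mat6_carrier int_sim_carrier[OF M]]
  show thesis
    by (rule that[of "root2 a b c d * M"])
      (use g M j * in \<open>auto simp: int_sim_mult_left lrelI m6 root2_def simp del: index_mult_mat\<close>)
qed

lemma kill2':
  assumes M: "M \<in> int_sim p \<delta>" and j: "j < 6"
  obtains N where "N \<in> int_sim p \<delta>" "lrel M N" "N $$ (1,j) = 0"
    "\<And>c. c < 6 \<Longrightarrow> M $$ (1,c) = 0 \<Longrightarrow> M $$ (2,c) = 0 \<Longrightarrow> N $$ (1,c) = 0 \<and> N $$ (2,c) = 0"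
    "\<And>c. c < 6 \<Longrightarrow> M $$ (4,c) = 0 \<Longrightarrow> M $$ (5,c) = 0 \<Longrightarrow> N $$ (4,c) = 0 \<and> N $$ (5,c) = 0"
    "\<And>r c. r \<in> {0,3} \<Longrightarrow> c < 6 \<Longrightarrow> N $$ (r,c) = M $$ (r,c)"
proof -
  have x: "M $$ (2, j) \<in> \<int>" "M $$ (1, j) \<in> \<int>" using int_sim_Ints[OF M] j by auto
  obtain a b c d where *: "a \<in> \<int>" "b \<in> \<int>" "c \<in> \<int>" "d \<in> \<int>" "a * d - b * c = 1" "c * M $$ (2,j) + d * M $$ (1,j) = 0"
    using bezout_kill[OF x] by blast
  have g: "root2 a (-b) (-c) d \<in> Sp_int 3" by (rule Sp_int_generators) (use * in auto)
  note m6 = mult6[OF mat6_carrier int_sim_carrier[OF M]]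
  show thesis
    by (rule that[of "root2 a (-b) (-c) d * M"])
      (use g M j * in \<open>auto simp: int_sim_mult_left lrelI m6 root2_def algebra_simps simp del: index_mult_mat\<close>)
qed

text \<open>Columns are treated in the order 2, 1, 0 because upper triangular D means lower
  triangular A. Each is swept through its D rows from below and then through its A rows down to the
  pivot; the roots used for later columns avoid the pivot rows of earlier ones. The remaining zeros
  of a triangular matrix follow from the symplectic relations.\<close>

lemma kill_columns:
  assumes M: "M \<in> int_sim p \<delta>"
  obtains N where "N \<in> int_sim p \<delta>" "lrel M N"
    "N $$ (0,2) = 0" "N $$ (1,2) = 0" "N $$ (3,2) = 0" "N $$ (4,2) = 0" "N $$ (5,2) = 0"
    "N $$ (0,1) = 0" "N $$ (3,1) = 0" "N $$ (4,1) = 0" "N $$ (3,0) = 0"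
proof -
  note C = int_sim_carrier
  obtain M1 where M1: "M1 \<in> int_sim p \<delta>" "lrel M M1" and z1: "M1 $$ (5,2) = 0"
    by (rule kill2[OF M, of 2]) auto
  obtain M2 where M2: "M2 \<in> int_sim p \<delta>" "lrel M1 M2" and z2: "M2 $$ (4,2) = 0" "M2 $$ (5,2) = 0"
    by (rule kill1[OF M1(1), of 2]) (use z1 in auto)
  obtain M3 where M3: "M3 \<in> int_sim p \<delta>" "lrel M2 M3" and z3: "M3 $$ (3,2) = 0" "M3 $$ (4,2) = 0" "M3 $$ (5,2) = 0"
    by (rule kill0[OF M2(1), of 2]) (use z2 in auto)
  obtain M4 where M4: "M4 \<in> int_sim p \<delta>" "lrel M3 M4"
    and z4: "M4 $$ (0,2) = 0" "M4 $$ (3,2) = 0" "M4 $$ (4,2) = 0" "M4 $$ (5,2) = 0"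
    by (rule kill1'[OF M3(1), of 2]) (use z3 in auto)
  obtain M5 where M5: "M5 \<in> int_sim p \<delta>" "lrel M4 M5"
    and z5: "M5 $$ (0,2) = 0" "M5 $$ (1,2) = 0" "M5 $$ (3,2) = 0" "M5 $$ (4,2) = 0" "M5 $$ (5,2) = 0"
    by (rule kill2'[OF M4(1), of 2]) (use z4 in auto)
  obtain M6 where M6: "M6 \<in> int_sim p \<delta>" "lrel M5 M6"
    and z6: "M6 $$ (0,2) = 0" "M6 $$ (1,2) = 0" "M6 $$ (3,2) = 0" "M6 $$ (4,2) = 0" "M6 $$ (5,2) = 0" "M6 $$ (4,1) = 0"
    by (rule kill1[OF M5(1), of 1]) (use z5 in auto)
  obtain M7 where M7: "M7 \<in> int_sim p \<delta>" "lrel M6 M7"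
    and z7: "M7 $$ (0,2) = 0" "M7 $$ (1,2) = 0" "M7 $$ (3,2) = 0" "M7 $$ (4,2) = 0" "M7 $$ (5,2) = 0"
      "M7 $$ (4,1) = 0" "M7 $$ (3,1) = 0"
    by (rule kill0[OF M6(1), of 1]) (use z6 in auto)
  obtain M8 where M8: "M8 \<in> int_sim p \<delta>" "lrel M7 M8"
    and z8: "M8 $$ (0,2) = 0" "M8 $$ (1,2) = 0" "M8 $$ (3,2) = 0" "M8 $$ (4,2) = 0" "M8 $$ (5,2) = 0"
      "M8 $$ (4,1) = 0" "M8 $$ (3,1) = 0" "M8 $$ (0,1) = 0"
    by (rule kill1'[OF M7(1), of 1]) (use z7 in auto)
  obtain M9 where M9: "M9 \<in> int_sim p \<delta>" "lrel M8 M9"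
    and z9: "M9 $$ (0,2) = 0" "M9 $$ (1,2) = 0" "M9 $$ (3,2) = 0" "M9 $$ (4,2) = 0" "M9 $$ (5,2) = 0"
      "M9 $$ (4,1) = 0" "M9 $$ (3,1) = 0" "M9 $$ (0,1) = 0" "M9 $$ (3,0) = 0"
    by (rule kill0[OF M8(1), of 0]) (use z8 in auto)
  have "lrel M M9"
  proof -
    note tr = lrel_trans[OF _ _ int_sim_carrier[OF M]]
    show ?thesis
      by (rule tr[OF tr[OF tr[OF tr[OF tr[OF tr[OF tr[OF tr[OF M1(2) M2(2)] M3(2)] M4(2)] M5(2)] M6(2)] M7(2)] M8(2)] M9(2)])
  qed
  then show thesis using that M9(1) z9 by blast
qed

text \<open>Only the zeros of the lower left block and those below the diagonal of D are imposed.
  That A is lower triangular with diagonal p^(\<delta> - d i) is a consequence,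
  \<open>tri_diag\<close>. Exponents are functions on 1, 2, 3 as in
  \<open>satake_rep\<close>.\<close>

definition tri :: "nat \<Rightarrow> nat \<Rightarrow> (nat \<Rightarrow> nat) \<Rightarrow> rat mat \<Rightarrow> bool" where
  "tri p \<delta> d M \<longleftrightarrow> M \<in> int_sim p \<delta> \<and>
     M $$ (3,0) = 0 \<and> M $$ (3,1) = 0 \<and> M $$ (3,2) = 0 \<and>
     M $$ (4,0) = 0 \<and> M $$ (4,1) = 0 \<and> M $$ (4,2) = 0 \<and> M $$ (4,3) = 0 \<and>
     M $$ (5,0) = 0 \<and> M $$ (5,1) = 0 \<and> M $$ (5,2) = 0 \<and> M $$ (5,3) = 0 \<and> M $$ (5,4) = 0 \<and>
     M $$ (3,3) = of_nat p ^ d 1 \<and> M $$ (4,4) = of_nat p ^ d 2 \<and> M $$ (5,5) = of_nat p ^ d 3"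

lemma triD:
  assumes "tri p \<delta> d M"
  shows "M \<in> int_sim p \<delta>"
     "M $$ (3,0) = 0" "M $$ (3,1) = 0" "M $$ (3,2) = 0"
     "M $$ (4,0) = 0" "M $$ (4,1) = 0" "M $$ (4,2) = 0" "M $$ (4,3) = 0"
     "M $$ (5,0) = 0" "M $$ (5,1) = 0" "M $$ (5,2) = 0" "M $$ (5,3) = 0" "M $$ (5,4) = 0"
     "M $$ (3,3) = of_nat p ^ d 1" "M $$ (4,4) = of_nat p ^ d 2" "M $$ (5,5) = of_nat p ^ d 3"
     "M $$ (3,Suc 0) = 0" "M $$ (4,Suc 0) = 0" "M $$ (5,Suc 0) = 0"
  using assms by (auto simp: tri_def)

lemma tri_carrier: "tri p \<delta> d M \<Longrightarrow> M \<in> carrier_mat 6 6"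
  using int_sim_carrier triD(1) by blast

definition dvec :: "nat \<Rightarrow> nat \<Rightarrow> nat \<Rightarrow> nat \<Rightarrow> nat" where
  "dvec a b c = (\<lambda>i. if i = 1 then a else if i = 2 then b else c)"

lemma dvec_simps [simp]: "dvec a b c 1 = a" "dvec a b c (Suc 0) = a" "dvec a b c 2 = b" "dvec a b c 3 = c"
  by (simp_all add: dvec_def)

lemma tri_cong: "d 1 = e 1 \<Longrightarrow> d 2 = e 2 \<Longrightarrow> d 3 = e 3 \<Longrightarrow> tri p \<delta> d M \<longleftrightarrow> tri p \<delta> e M"
  by (simp add: tri_def)

section \<open>Existence of triangular representatives and uniqueness of their exponents\<close>

locale fixed_prime =
  fixes p :: nat
  assumes prime_p: "prime p"
begin

lemma p_pos [simp]: "p > 0" "(of_nat p :: rat) > 0" "p \<noteq> 0"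
  using prime_gt_0_nat[OF prime_p] by auto

lemma p_gt_1: "p > 1" "(of_nat p :: rat) > 1"
  using prime_gt_1_nat[OF prime_p] by auto

lemma int_sim_GSp: "M \<in> int_sim p \<delta> \<Longrightarrow> M \<in> carrier (GSp_plus 3)"
  using int_sim_similitude p_pos(2) by (auto simp: carrier_GSp_plus_iff intro!: exI[of _ "of_nat p ^ \<delta>"])

lemma power_p_eq_iff: "(of_nat p :: rat) ^ a = of_nat p ^ b \<longleftrightarrow> a = b"
  using p_gt_1 by (simp add: power_inject_exp)

lemma int_mult_power_eq:
  assumes "x \<in> \<int>" "x * of_nat p ^ a = (of_nat p :: rat) ^ b"
  shows "a \<le> b" "x = of_nat p ^ (b - a)"
proof -
  obtain k where k: "x = of_int k" using assms by (auto elim: Ints_cases)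
  have "x > 0"
    by (rule zero_less_mult_pos2[of x "of_nat p ^ a"]) (simp_all add: assms(2))
  then have "k > 0" using k by simp
  then have "of_int k \<ge> (1::rat)" by simp
  then have "1 * (of_nat p :: rat) ^ a \<le> x * of_nat p ^ a" unfolding k by (rule mult_right_mono) simp
  then have "(of_nat p :: rat) ^ a \<le> of_nat p ^ b" using assms(2) by simp
  then show ab: "a \<le> b" by (rule power_le_imp_le_exp[OF p_gt_1(2)])
  have "(of_nat p :: rat) ^ (b - a) * of_nat p ^ a = of_nat p ^ (b - a + a)" by (simp only: power_add)
  then have "x * of_nat p ^ a = of_nat p ^ (b - a) * (of_nat p :: rat) ^ a" using assms(2) ab by simp
  then show "x = of_nat p ^ (b - a)" by (subst (asm) mult_right_cancel) simp_all
qed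

lemma int_factor_power:
  assumes "x \<in> \<int>" "y \<in> \<int>" "x * y = (of_nat p :: rat) ^ b"
  obtains s a where "s \<in> {1, -1}" "s * y = of_nat p ^ a" "a \<le> b"
proof -
  obtain k l where kl: "x = of_int k" "y = of_int l" using assms by (auto elim!: Ints_cases)
  have "(of_int (k * l) :: rat) = of_int (int p ^ b)" using assms kl by simp
  then have "k * l = int p ^ b" by (simp only: of_int_eq_iff)
  then have "nat \<bar>k\<bar> * nat \<bar>l\<bar> = p ^ b"
    by (simp add: nat_power_eq flip: nat_abs_mult_distrib)
  then have "nat \<bar>l\<bar> dvd p ^ b" using dvd_triv_right[of "nat \<bar>l\<bar>" "nat \<bar>k\<bar>"] by simp
  then obtain a where a: "a \<le> b" "nat \<bar>l\<bar> = p ^ a"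
    using divides_primepow_nat[OF prime_p] by blast
  have "\<bar>l\<bar> = int p ^ a" using arg_cong[OF a(2), of int] by simp
  then have "rat_of_int \<bar>l\<bar> = of_nat p ^ a" by simp
  then have "(if l < 0 then -1 else 1) * y = (of_nat p :: rat) ^ a"
    using kl(2) by (auto simp: abs_if split: if_splits)
  then show thesis using that[of "if l < 0 then -1 else 1" a] a(1) by auto
qed

lemma tri_diag:
  assumes "tri p \<delta> d M"
  shows "M $$ (0,1) = 0" "M $$ (0,2) = 0" "M $$ (1,2) = 0"
    "d 1 \<le> \<delta>" "d 2 \<le> \<delta>" "d 3 \<le> \<delta>"
    "M $$ (0,0) = of_nat p ^ (\<delta> - d 1)" "M $$ (1,1) = of_nat p ^ (\<delta> - d 2)" "M $$ (2,2) = of_nat p ^ (\<delta> - d 3)"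
proof -
  note t = triD[OF assms]
  note s = similitude3D[OF int_sim_similitude[OF t(1)]]
  have nz: "of_nat p ^ k \<noteq> (0::rat)" for k using p_pos by simp
  show 01: "M $$ (0,1) = 0" using s(7) t nz by (simp add: cpair_def)
  show 02: "M $$ (0,2) = 0" using s(10) t nz by (simp add: cpair_def)
  have 0: "M $$ (0,0) * of_nat p ^ d 1 = of_nat p ^ \<delta>" using s(3) t nz by (simp add: cpair_def)
  show 12: "M $$ (1,2) = 0" using s(11) t nz 02 by (simp add: cpair_def)
  have 1: "M $$ (1,1) * of_nat p ^ d 2 = of_nat p ^ \<delta>" using s(8) t nz 01 by (simp add: cpair_def)
  have 2: "M $$ (2,2) * of_nat p ^ d 3 = of_nat p ^ \<delta>" using s(12) t nz 02 12 by (simp add: cpair_def)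
  show "d 1 \<le> \<delta>" "M $$ (0,0) = of_nat p ^ (\<delta> - d 1)"
    using int_mult_power_eq[OF int_sim_Ints[OF t(1)] 0] by auto
  show "d 2 \<le> \<delta>" "M $$ (1,1) = of_nat p ^ (\<delta> - d 2)"
    using int_mult_power_eq[OF int_sim_Ints[OF t(1)] 1] by auto
  show "d 3 \<le> \<delta>" "M $$ (2,2) = of_nat p ^ (\<delta> - d 3)"
    using int_mult_power_eq[OF int_sim_Ints[OF t(1)] 2] by auto
qed

lemma triangularize:
  assumes M: "M \<in> int_sim p \<delta>"
  obtains N d where "tri p \<delta> d N" "lrel M N"
proof -
  obtain N where N: "N \<in> int_sim p \<delta>" "lrel M N" and
    z: "N $$ (0,2) = 0" "N $$ (1,2) = 0" "N $$ (3,2) = 0" "N $$ (4,2) = 0" "N $$ (5,2) = 0"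
    "N $$ (0,1) = 0" "N $$ (3,1) = 0" "N $$ (4,1) = 0" "N $$ (3,0) = 0"
    by (rule kill_columns[OF M])
  note s = similitude3D[OF int_sim_similitude[OF N(1)]]
  have nz: "of_nat p ^ \<delta> \<noteq> (0::rat)" using p_pos by simp
  have 2: "N $$ (2,2) * N $$ (5,5) = of_nat p ^ \<delta>" using s(12) z by (simp add: cpair_def)
  then have n2: "N $$ (2,2) \<noteq> 0" "N $$ (5,5) \<noteq> 0" using nz by auto
  \<comment> \<open>Column 2 is now a multiple of the unit vector in row 2, so up to sign its
    symplectic product with column j is N(2,2) N(5,j).\<close>
  have z5: "N $$ (5,0) = 0" "N $$ (5,1) = 0" "N $$ (5,3) = 0" "N $$ (5,4) = 0"
    using s(2,6,10,11) z n2 by (auto simp: cpair_def)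
  have 1: "N $$ (1,1) * N $$ (4,4) = of_nat p ^ \<delta>" using s(8) z z5 by (simp add: cpair_def)
  then have n1: "N $$ (Suc 0,Suc 0) \<noteq> 0" using nz by auto
  have z4: "N $$ (4,0) = 0" "N $$ (4,3) = 0"
    using s(1,7) z z5 n1 by (auto simp: cpair_def)
  have 0: "N $$ (0,0) * N $$ (3,3) = of_nat p ^ \<delta>" using s(3) z z4 z5 by (simp add: cpair_def)
  obtain s0 a0 where s0: "s0 \<in> {1, -1}" "s0 * N $$ (3,3) = of_nat p ^ a0"
    by (rule int_factor_power[OF int_sim_Ints[OF N(1), of 0 0] int_sim_Ints[OF N(1), of 3 3] 0]) auto
  obtain s1 a1 where s1: "s1 \<in> {1, -1}" "s1 * N $$ (4,4) = of_nat p ^ a1"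
    by (rule int_factor_power[OF int_sim_Ints[OF N(1), of 1 1] int_sim_Ints[OF N(1), of 4 4] 1]) auto
  obtain s2 a2 where s2: "s2 \<in> {1, -1}" "s2 * N $$ (5,5) = of_nat p ^ a2"
    by (rule int_factor_power[OF int_sim_Ints[OF N(1), of 2 2] int_sim_Ints[OF N(1), of 5 5] 2]) auto
  \<comment> \<open>The diagonal entries of D divide a power of p, hence are powers of p up to
    signs, which are removed here.\<close>
  have g: "diag_unit s0 s1 s2 \<in> Sp_int 3"
    by (rule diag_unit_Sp_int) (use s0 s1 s2 in auto)
  note m6 = mult6[OF mat6_carrier int_sim_carrier[OF N(1)]]
  have "tri p \<delta> (dvec a0 a1 a2) (diag_unit s0 s1 s2 * N)"
    using int_sim_mult_left[OF g N(1)] z z4 z5 s0(2) s1(2) s2(2)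
    by (simp add: tri_def diag_unit_def m6 del: index_mult_mat)
  moreover have "lrel M (diag_unit s0 s1 s2 * N)"
    using lrel_trans[OF N(2) lrelI[OF g] int_sim_carrier[OF M]] .
  ultimately show thesis by (rule that)
qed

text \<open>In M' = g M, comparing columns 2, 1, 0 in turn shows that the upper left block of g is
  lower triangular. Its integral diagonal entries multiply p^(\<delta> - d i) to p^(\<epsilon> - e
  i), which bounds the exponents in one direction; the inverse of g gives the other.\<close>

lemma tri_exponents_le:
  assumes M: "tri p \<delta> d M" and M': "tri p \<epsilon> e M'" and rel: "lrel M M'"
  shows "\<delta> = \<epsilon>" "e 1 \<le> d 1" "e 2 \<le> d 2" "e 3 \<le> d 3"
proof -
  obtain g where g: "g \<in> Sp_int 3" "M' = g * M" using rel by (auto simp: lrel_def)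
  have "M' \<in> int_sim p \<delta>" using g int_sim_mult_left triD(1)[OF M] by auto
  then have "cpair M' 0 3 = of_nat p ^ \<delta>" "cpair M' 0 3 = of_nat p ^ \<epsilon>"
    using similitude3D(3)[OF int_sim_similitude] triD(1)[OF M'] by blast+
  then show \<delta>: "\<delta> = \<epsilon>" by (simp add: power_p_eq_iff)
  have nz: "of_nat p ^ k \<noteq> (0::rat)" for k using p_pos by simp
  note m6 = mult6[OF Sp_int_carrier[OF g(1)] tri_carrier[OF M], folded g(2)]
  have q2: "M' $$ (i,2) = g $$ (i,2) * of_nat p ^ (\<delta> - d 3)" if "i < 6" for i
    using m6[of i 2] that tri_diag(2,3,9)[OF M] triD(4,7,11)[OF M] by simp
  have g2: "g $$ (0,2) = 0" "g $$ (1,2) = 0"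
    using q2[of 0] q2[of 1] tri_diag(2,3)[OF M'] nz by simp_all
  have 2: "g $$ (2,2) * of_nat p ^ (\<delta> - d 3) = of_nat p ^ (\<epsilon> - e 3)"
    using q2[of 2] tri_diag(9)[OF M'] by simp
  have q1: "M' $$ (i,1) = g $$ (i,1) * of_nat p ^ (\<delta> - d 2)" if "i < 6" "g $$ (i,2) = 0" for i
    using m6[of i 1] that tri_diag(1,8)[OF M] triD(3,6,10)[OF M] by simp
  have g1: "g $$ (0,1) = 0" using q1[of 0] g2 tri_diag(1)[OF M'] nz by simp
  have 1: "g $$ (1,1) * of_nat p ^ (\<delta> - d 2) = of_nat p ^ (\<epsilon> - e 2)"
    using q1[of 1] g2 tri_diag(8)[OF M'] by simp
  have 0: "g $$ (0,0) * of_nat p ^ (\<delta> - d 1) = of_nat p ^ (\<epsilon> - e 1)"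
    using m6[of 0 0] g1 g2 tri_diag(7)[OF M] tri_diag(7)[OF M'] triD(2,5,9)[OF M] by simp
  note i = int_mult_power_eq(1)[OF Sp_int_Ints[OF g(1)]]
  show "e 1 \<le> d 1" "e 2 \<le> d 2" "e 3 \<le> d 3"
    using i[OF _ _ 0] i[OF _ _ 1] i[OF _ _ 2] tri_diag(4-6)[OF M] tri_diag(4-6)[OF M'] \<delta> by simp_all
qed

lemma tri_exponents_eq:
  assumes M: "tri p \<delta> d M" and M': "tri p \<epsilon> e M'" and rel: "lrel M M'"
  shows "\<delta> = \<epsilon>" "d 1 = e 1" "d 2 = e 2" "d 3 = e 3"
  using tri_exponents_le[OF M M' rel] tri_exponents_le[OF M' M lrel_sym[OF rel tri_carrier[OF M]]] by auto

end

section \<open>The Satake map on cosets of integral similitudes\<close>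

lemma cpair_transpose:
  assumes "M \<in> carrier_mat 6 6" "i < 6" "j < 6"
  shows "cpair (transpose_mat M) i j =
    M $$ (i,0) * M $$ (j,3) - M $$ (i,3) * M $$ (j,0) + (M $$ (i,1) * M $$ (j,4) - M $$ (i,4) * M $$ (j,1))
     + (M $$ (i,2) * M $$ (j,5) - M $$ (i,5) * M $$ (j,2))"
  using assms by (simp add: cpair_def)

lemma mult3:
  assumes "A \<in> carrier_mat 3 3" "B \<in> carrier_mat 3 3" "i < 3" "j < 3"
  shows "(A * B) $$ (i, j) = A $$ (i,0) * B $$ (0,j) + A $$ (i,1) * B $$ (1,j) + A $$ (i,2) * (B $$ (2,j) :: rat)"
  using assms by (simp add: scalar_prod_def numeral_3_eq_3 numeral_2_eq_2)

lemma less3_cases: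
  assumes "i < 3"
  obtains "i = 0" | "i = Suc 0" | "i = (2::nat)"
  using assms by fastforce

lemma atLeastAtMost_1_3: "{Suc 0..3} = {Suc 0, 2, 3}"
  by auto

abbreviation dc :: "rat mat \<Rightarrow> rat mat set set" where
  "dc \<equiv> subgroup_pair.dcosets (GSp_plus 3) (Sp_int 3)"

lemma satake_lin_ext: "satake n p = lin_ext (satake_coset n p)"
  by (rule ext) (simp add: satake_def lin_ext_def)

context fixed_prime
begin

lemma power_p_diff: "a \<le> b \<Longrightarrow> (of_nat p :: rat) ^ (b - a) * of_nat p ^ a = of_nat p ^ b"
  by (simp flip: power_add)

lemma similitude3_transposeD:
  assumes "M \<in> int_sim p \<delta>"
  shows "similitude 3 (of_nat p ^ \<delta>) (transpose_mat M)"
  by (rule similitude_transpose[OF int_sim_similitude[OF assms]]) simp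

text \<open>As the lower left block vanishes, A D^T consists of the symplectic products of rows i
  and j + 3 of M, and these are known because the transpose is a similitude as well.\<close>

lemma tri_satake_rep:
  assumes M: "tri p \<delta> d M"
  shows "satake_rep 3 p M \<delta> d"
proof -
  note t = triD[OF M] and c = tri_carrier[OF M] and td = tri_diag[OF M]
  note r = similitude3D[OF similitude3_transposeD[OF t(1)]]
  define A where "A = mat 3 3 (\<lambda>(i,j). M $$ (i,j))"
  define B where "B = mat 3 3 (\<lambda>(i,j). M $$ (i,j+3))"
  define D where "D = mat 3 3 (\<lambda>(i,j). M $$ (i+3,j+3))"
  have car: "A \<in> carrier_mat 3 3" "B \<in> carrier_mat 3 3" "D \<in> carrier_mat 3 3"
    by (auto simp: A_def B_def D_def)
  have "M = four_block_mat A B (0\<^sub>m 3 3) D"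
  proof (rule eq_matI)
    fix i j assume "i < dim_row (four_block_mat A B (0\<^sub>m 3 3) D)" "j < dim_col (four_block_mat A B (0\<^sub>m 3 3) D)"
    then have ij: "i < 6" "j < 6" using car by auto
    then show "M $$ (i,j) = four_block_mat A B (0\<^sub>m 3 3) D $$ (i,j)"
      using t(2-13) by (elim less6_cases) (simp_all add: A_def B_def D_def)
  qed (use c car in auto)
  moreover have "A * transpose_mat D = of_nat p ^ \<delta> \<cdot>\<^sub>m 1\<^sub>m 3"
  proof (rule eq_matI)
    fix i j assume "i < dim_row (of_nat p ^ \<delta> \<cdot>\<^sub>m 1\<^sub>m 3 :: rat mat)" "j < dim_col (of_nat p ^ \<delta> \<cdot>\<^sub>m 1\<^sub>m 3 :: rat mat)"
    then have ij: "i < 3" "j < 3" by auto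
    have "(A * transpose_mat D) $$ (i,j) = cpair (transpose_mat M) i (j + 3)"
      using ij car t(2-13)
      by (subst mult3) (auto simp: cpair_transpose[OF c] A_def D_def elim!: less3_cases)
    also have "\<dots> = (of_nat p ^ \<delta> \<cdot>\<^sub>m 1\<^sub>m 3) $$ (i,j)"
      using ij r similitude3_transposeD[OF t(1)] by (simp add: similitude3_iff J_mat_index)
    finally show "(A * transpose_mat D) $$ (i,j) = (of_nat p ^ \<delta> \<cdot>\<^sub>m 1\<^sub>m 3) $$ (i,j)" .
  qed (use car in auto)
  moreover have "upper_triangular D"
  proof (rule upper_triangularI)
    fix i j assume "j < i" "i < dim_row D"
    then have "i = 1 \<and> j = 0 \<or> i = 2 \<and> j = 0 \<or> i = 2 \<and> j = 1" using car by auto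
    then show "D $$ (i,j) = 0" using t(8,12,13) by (auto simp: D_def)
  qed
  moreover have "\<forall>i \<in> {1..3}. D $$ (i - 1, i - 1) = of_nat p ^ d i"
    using t(14-16) by (simp add: atLeastAtMost_1_3 D_def)
  ultimately show ?thesis using car unfolding satake_rep_def by blast
qed

text \<open>\<open>satake_rep\<close> does not itself tie \<epsilon> to the multiplier; \<epsilon>
  is recovered from the entry (2,2) of A D^T, a symplectic product of rows.\<close>

lemma satake_rep_tri:
  assumes rep: "satake_rep 3 p M \<epsilon> d" and M: "M \<in> int_sim p \<delta>"
  shows "tri p \<epsilon> d M"
proof -
  obtain A B D where car: "A \<in> carrier_mat 3 3" "B \<in> carrier_mat 3 3" "D \<in> carrier_mat 3 3"
    and eq: "M = four_block_mat A B (0\<^sub>m 3 3) D" and AD: "A * transpose_mat D = of_nat p ^ \<epsilon> \<cdot>\<^sub>m 1\<^sub>m 3"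
    and up: "upper_triangular D" and dg: "\<forall>i \<in> {1..3}. D $$ (i - 1, i - 1) = of_nat p ^ d i"
    using rep unfolding satake_rep_def by blast
  note c = int_sim_carrier[OF M]
  have up: "D $$ (1,0) = 0" "D $$ (2,0) = 0" "D $$ (2,1) = 0"
    using up car by (auto simp: upper_triangular_def)
  have "of_nat p ^ \<epsilon> = (A * transpose_mat D) $$ (2,2)" by (simp add: AD)
  also have "\<dots> = A $$ (2,0) * D $$ (2,0) + A $$ (2,1) * D $$ (2,1) + A $$ (2,2) * D $$ (2,2)"
    using car mult3[of A "transpose_mat D" 2 2] by simp
  also have "\<dots> = M $$ (2,0) * M $$ (5,3) - M $$ (2,3) * M $$ (5,0) + (M $$ (2,1) * M $$ (5,4) - M $$ (2,4) * M $$ (5,1))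
     + (M $$ (2,2) * M $$ (5,5) - M $$ (2,5) * M $$ (5,2))"
    using car by (simp add: eq)
  also have "\<dots> = cpair (transpose_mat M) 2 5"
    by (rule cpair_transpose[OF c, symmetric]) simp_all
  also have "\<dots> = of_nat p ^ \<delta>" using similitude3D(12)[OF similitude3_transposeD[OF M]] .
  finally have "\<epsilon> = \<delta>" by (simp add: power_p_eq_iff)
  then show ?thesis using M up dg car by (simp add: tri_def eq atLeastAtMost_1_3)
qed

definition wmono :: "nat \<Rightarrow> (nat \<Rightarrow> nat) \<Rightarrow> rat_mpoly" where
  "wmono \<delta> d = mvar 0 ^ \<delta> * (\<Prod>i = 1..3. (mvar i * mconst (1 / of_nat p ^ i)) ^ d i)"

lemma wmono_cong: "d 1 = e 1 \<Longrightarrow> d 2 = e 2 \<Longrightarrow> d 3 = e 3 \<Longrightarrow> wmono \<delta> d = wmono \<delta> e"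
  by (simp add: wmono_def atLeastAtMost_1_3)

lemma wmono_mult: "wmono (\<delta> + \<epsilon>) (\<lambda>i. d i + e i) = wmono \<delta> d * wmono \<epsilon> e"
  by (simp add: wmono_def power_add prod.distrib mult_ac)

lemma lrel_int_sim: "lrel M N \<Longrightarrow> M \<in> int_sim p \<delta> \<Longrightarrow> N \<in> int_sim p \<delta>"
  using int_sim_mult_left by (auto simp: lrel_def)

lemma cs_lrel_iff:
  assumes "M \<in> int_sim p \<delta>" "N \<in> int_sim p \<epsilon>"
  shows "cs M = cs N \<longleftrightarrow> lrel M N"
proof
  assume "cs M = cs N"
  then have "N \<in> cs M" using cs_self[OF int_sim_GSp[OF assms(2)]] by simp
  then show "lrel M N" by (simp add: lrel_def mem_cs_iff)
next
  assume "lrel M N"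
  then have "N \<in> cs M" by (simp add: lrel_def mem_cs_iff)
  then show "cs M = cs N" using cs_eq[OF int_sim_GSp[OF assms(1)]] by simp
qed

text \<open>The \<open>THE\<close> is well defined because a representative in the sense of
  \<open>satake_rep\<close> is triangular here, and all triangular matrices of one coset have the
  same exponents.\<close>

lemma satake_coset_tri:
  assumes M: "tri p \<delta> d M"
  shows "satake_coset 3 p (cs M) = wmono \<delta> d"
  unfolding satake_coset_def
proof (rule the_equality)
  note M' = triD(1)[OF M]
  show "\<exists>Ma\<in>cs M. \<exists>\<delta>' d'. satake_rep 3 p Ma \<delta>' d' \<and>
       wmono \<delta> d = mvar 0 ^ \<delta>' * (\<Prod>i = 1..3. (mvar i * mconst (1 / of_nat p ^ i)) ^ d' i)"
    using tri_satake_rep[OF M] cs_self[OF int_sim_GSp[OF M']] wmono_def by blast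
  fix q assume "\<exists>Ma\<in>cs M. \<exists>\<delta> d. satake_rep 3 p Ma \<delta> d \<and>
       q = mvar 0 ^ \<delta> * (\<Prod>i = 1..3. (mvar i * mconst (1 / of_nat p ^ i)) ^ d i)"
  then obtain N \<epsilon> e where N: "N \<in> cs M" "satake_rep 3 p N \<epsilon> e" "q = wmono \<epsilon> e"
    unfolding wmono_def by blast
  have rel: "lrel M N" using N(1) by (simp add: lrel_def mem_cs_iff)
  have "tri p \<epsilon> e N" by (rule satake_rep_tri[OF N(2) lrel_int_sim[OF rel M']])
  note e = tri_exponents_eq[OF M this rel]
  show "q = wmono \<delta> d"
    unfolding N(3) e(1) using e(2-4) by (intro wmono_cong) auto
qed

lemma tri_mult:
  assumes M: "tri p \<delta> d M" and N: "tri p \<epsilon> e N"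
  shows "tri p (\<delta> + \<epsilon>) (\<lambda>i. d i + e i) (M * N)"
proof -
  note t = triD[OF M] and u = triD[OF N]
  note m6 = mult6[OF tri_carrier[OF M] tri_carrier[OF N]]
  show ?thesis
    unfolding tri_def using int_sim_mult[OF t(1) u(1)]
    by (simp add: m6 t(2-13,17-) u(2-13,17-) t(14-16)[simplified] u(14-16)[simplified] power_add
        del: index_mult_mat)
qed

text \<open>The part of the Hecke ring where every coset of the support has a triangular
  representative. There the Satake map is a homomorphism and injective; \<open>hecke_LZ\<close> is
  contained in it, and membership can be checked on the support.\<close>

definition hecke_int :: "(rat mat set \<Rightarrow>\<^sub>0 int) set" where
  "hecke_int = {f \<in> hecke_carrier (GSp_plus 3) (Sp_int 3).
     \<forall>C \<in> Poly_Mapping.keys f. \<exists>\<delta>. \<exists>M \<in> int_sim p \<delta>. C = cs M}"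

lemma hecke_intD: "f \<in> hecke_int \<Longrightarrow> f \<in> hecke_carrier (GSp_plus 3) (Sp_int 3)"
  by (simp add: hecke_int_def)

lemma hecke_int_rep:
  assumes "f \<in> hecke_int" "C \<in> Poly_Mapping.keys f"
  obtains \<delta> d M where "tri p \<delta> d M" "C = cs M"
proof -
  obtain \<delta> M where M: "M \<in> int_sim p \<delta>" "C = cs M" using assms by (auto simp: hecke_int_def)
  obtain N d where N: "tri p \<delta> d N" "lrel M N" by (rule triangularize[OF M(1)])
  then have "C = cs N" using M cs_lrel_iff[OF M(1) triD(1)[OF N(1)]] by simp
  then show thesis using N(1) that by blast
qed

text \<open>With triangular representatives for the right factor, products of representatives are
  again triangular and their exponents add, so the monomials multiply.\<close>

lemma satake_mult:
  assumes f: "f \<in> hecke_int" and g: "g \<in> hecke_int"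
  shows "satake 3 p (hecke_mult (GSp_plus 3) (Sp_int 3) f g) = satake 3 p f * satake 3 p g"
proof -
  define \<rho> where "\<rho> B = (SOME b. (\<exists>\<delta> d. tri p \<delta> d b) \<and> B = cs b)" for B
  have \<rho>: "(\<exists>\<delta> d. tri p \<delta> d (\<rho> B)) \<and> B = cs (\<rho> B)" if B: "B \<in> Poly_Mapping.keys g" for B
    unfolding \<rho>_def
  proof (rule someI_ex)
    obtain \<delta> d M where "tri p \<delta> d M" "B = cs M" by (rule hecke_int_rep[OF g B])
    then show "\<exists>b. (\<exists>\<delta> d. tri p \<delta> d b) \<and> B = cs b" by blast
  qed
  show ?thesis
    unfolding satake_lin_ext
  proof (rule Sp.lin_ext_hecke_mult[OF hecke_intD[OF f] hecke_intD[OF g], where \<rho> = \<rho>])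
    fix B assume "B \<in> Poly_Mapping.keys g"
    then obtain \<delta> d where "tri p \<delta> d (\<rho> B)" "B = cs (\<rho> B)" using \<rho> by blast
    then show "\<rho> B \<in> B" using cs_self[OF int_sim_GSp[OF triD(1)]] by blast
  next
    fix A B assume A: "A \<in> Poly_Mapping.keys f" and B: "B \<in> Poly_Mapping.keys g"
    obtain \<delta> d M where M: "tri p \<delta> d M" "A = cs M" by (rule hecke_int_rep[OF f A])
    obtain \<epsilon> e where N: "tri p \<epsilon> e (\<rho> B)" "B = cs (\<rho> B)" using \<rho>[OF B] by blast
    have "A #>\<^bsub>GSp_plus 3\<^esub> \<rho> B = cs (M * \<rho> B)"
      unfolding M(2) by (rule cs_translate[OF int_sim_GSp[OF triD(1)[OF M(1)]] int_sim_GSp[OF triD(1)[OF N(1)]]])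
    then show "satake_coset 3 p (A #>\<^bsub>GSp_plus 3\<^esub> \<rho> B) = satake_coset 3 p A * satake_coset 3 p B"
      using satake_coset_tri[OF M(1)] satake_coset_tri[OF N(1)] satake_coset_tri[OF tri_mult[OF M(1) N(1)]]
        M(2) N(2) wmono_mult by simp
  qed
qed

lemma satake_add: "satake 3 p (f + g) = satake 3 p f + satake 3 p g"
  by (simp add: satake_lin_ext lin_ext_add)

lemma satake_uminus: "satake 3 p (- f) = - satake 3 p f"
  by (simp add: satake_lin_ext lin_ext_uminus)

lemma hecke_int_add: "f \<in> hecke_int \<Longrightarrow> g \<in> hecke_int \<Longrightarrow> f + g \<in> hecke_int"
  using keys_add[of f g] Sp.hecke_add_closed[of f 3 g] by (auto simp: hecke_int_def)

lemma hecke_int_uminus: "f \<in> hecke_int \<Longrightarrow> - f \<in> hecke_int"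
  using Sp.hecke_uminus_closed[of f 3] by (auto simp: hecke_int_def)

lemma hecke_int_mult:
  assumes f: "f \<in> hecke_int" and g: "g \<in> hecke_int"
  shows "hecke_mult (GSp_plus 3) (Sp_int 3) f g \<in> hecke_int"
proof -
  have int: "\<exists>\<delta>. a \<in> int_sim p \<delta>" if h: "h \<in> hecke_int" and a: "a \<in> carrier (GSp_plus 3)" and ha: "cs a \<in> Poly_Mapping.keys h" for h a
  proof -
    obtain \<delta> M where M: "M \<in> int_sim p \<delta>" "cs a = cs M" using h ha unfolding hecke_int_def by blast
    then obtain k where "k \<in> Sp_int 3" "a = k * M" using cs_eqD[OF a] by blast
    then show ?thesis using int_sim_mult_left[OF _ M(1)] by auto
  qed
  have "\<exists>\<delta>. \<exists>M \<in> int_sim p \<delta>. C = cs M" if "C \<in> Poly_Mapping.keys (hecke_mult (GSp_plus 3) (Sp_int 3) f g)" for C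
  proof (rule Sp.keys_hecke_mult[OF hecke_intD[OF f] hecke_intD[OF g] that])
    fix a b assume *: "a \<in> carrier (GSp_plus 3)" "b \<in> carrier (GSp_plus 3)" "cs a \<in> Poly_Mapping.keys f"
      "cs b \<in> Poly_Mapping.keys g" "C = cs (a \<otimes>\<^bsub>GSp_plus 3\<^esub> b)"
    obtain \<delta> \<epsilon> where "a \<in> int_sim p \<delta>" "b \<in> int_sim p \<epsilon>" using int[OF f *(1,3)] int[OF g *(2,4)] by blast
    then show ?thesis using int_sim_mult[of a p \<delta> b \<epsilon>] *(5) by auto
  qed
  then show ?thesis using Sp.hecke_mult_closed[OF hecke_intD[OF f] hecke_intD[OF g]] by (simp add: hecke_int_def)
qed

section \<open>Finiteness of the coset sets\<close>

definition residues6 :: "nat \<Rightarrow> rat mat \<Rightarrow> (nat \<times> nat) \<Rightarrow> int" where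
  "residues6 m N = restrict (\<lambda>(i,j). \<lfloor>N $$ (i,j)\<rfloor> mod int m) ({..<6} \<times> {..<6})"

text \<open>If N = M + \<mu> E with E integral, then N M^-1 = 1 + E (\<mu> M^-1) is integral because
  \<mu> M^-1 is, and it has multiplier 1. A coset with multiplier p^\<delta> is thus determined by a
  representative modulo p^\<delta>, which leaves finitely many.\<close>

lemma lrel_if_residues6_eq:
  assumes M: "M \<in> int_sim p \<delta>" and N: "N \<in> int_sim p \<delta>" and eq: "residues6 (p ^ \<delta>) M = residues6 (p ^ \<delta>) N"
  shows "lrel M N"
proof -
  let ?\<mu> = "of_nat p ^ \<delta> :: rat"
  have \<mu>: "?\<mu> \<noteq> 0" "?\<mu> > 0" by simp_all
  note cM = int_sim_carrier[OF M] and cN = int_sim_carrier[OF N]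
  note sM = int_sim_similitude[OF M]
  define I where "I = similitude_inv 3 ?\<mu> M"
  define K where "K = J_mat 3 * (transpose_mat M * J_mat 3)"
  have cI: "I \<in> carrier_mat 6 6" using similitude_inv_carrier[of M 3] cM by (simp add: I_def)
  have cK: "K \<in> carrier_mat 6 6" using J_mat_carrier[of 3] cM by (auto simp: K_def)
  have intM: "integral_mat M" using M by (simp add: int_sim_def)
  have intK: "integral_mat K" unfolding K_def
    using cM by (intro integral_mat_mult integral_mat_J integral_mat_transpose intM) auto
  have "\<exists>k::int. N $$ (i,j) - M $$ (i,j) = ?\<mu> * of_int k" if ij: "i < 6" "j < 6" for i j
  proof -
    obtain a b where ab: "M $$ (i,j) = of_int a" "N $$ (i,j) = of_int b"
      using int_sim_Ints[OF M ij] int_sim_Ints[OF N ij] by (auto elim!: Ints_cases)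
    have "a mod int (p ^ \<delta>) = b mod int (p ^ \<delta>)"
      using fun_cong[OF eq, of "(i,j)"] ij ab by (simp add: residues6_def)
    then have "int (p ^ \<delta>) dvd b - a" by (simp add: mod_eq_dvd_iff dvd_diff_commute)
    then obtain k where "b - a = int (p ^ \<delta>) * k" by (auto elim: dvdE)
    then have "rat_of_int (b - a) = of_int (int (p ^ \<delta>) * k)" by simp
    then show ?thesis using ab by auto
  qed
  then obtain k where k: "\<And>i j. i < 6 \<Longrightarrow> j < 6 \<Longrightarrow> N $$ (i,j) - M $$ (i,j) = ?\<mu> * of_int (k i j)" by metis
  define E where "E = mat 6 6 (\<lambda>(i,j). rat_of_int (k i j))"
  have cE: "E \<in> carrier_mat 6 6" by (simp add: E_def)
  have intE: "integral_mat E" by (simp add: E_def integral_mat_def)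
  have N_eq: "N = M + ?\<mu> \<cdot>\<^sub>m E"
    using k cM cN by (intro eq_matI) (auto simp: E_def algebra_simps)
  have I_eq: "I = (- inverse ?\<mu>) \<cdot>\<^sub>m K" by (simp add: I_def K_def similitude_inv_def)
  have "N * I = M * I + (?\<mu> \<cdot>\<^sub>m E) * I"
    unfolding N_eq using cM cE cI by (intro add_mult_distrib_mat) auto
  also have "M * I = 1\<^sub>m 6" using similitude_inv_mult_right[OF sM \<mu>(1)] by (simp add: I_def)
  also have "(?\<mu> \<cdot>\<^sub>m E) * I = (-1) \<cdot>\<^sub>m (E * K)"
    unfolding I_eq using cE cK by (simp add: square_smult_left[of _ 6] square_smult_right[of _ 6] square_smult_smult)
  finally have NI: "N * I = 1\<^sub>m 6 + (-1) \<cdot>\<^sub>m (E * K)" .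
  have EK: "integral_mat (E * K)" using cE cK by (intro integral_mat_mult intE intK) auto
  have "integral_mat (N * I)"
    unfolding NI using EK cE cK by (auto simp: integral_mat_def)
  moreover have "similitude 3 1 (N * I)"
    using similitude_mult[OF int_sim_similitude[OF N] similitude_similitude_inv[OF sM \<mu>(1)]] \<mu> by (simp add: I_def)
  ultimately have "N * I \<in> Sp_int 3" by (simp add: mem_Sp_int)
  moreover have "N * I * M = N"
    using mult6_assoc[OF cN cI cM] similitude_inv_mult_left[OF sM \<mu>(1)] cN by (simp add: I_def)
  ultimately show ?thesis using lrelI[of "N * I" M] by simp
qed

lemma finite_cosets_int_sim: "finite (cs ` int_sim p \<delta>)"
proof -
  let ?r = "residues6 (p ^ \<delta>)"
  have "?r ` int_sim p \<delta> \<subseteq> PiE ({..<6} \<times> {..<6}) (\<lambda>_. {0..<int (p ^ \<delta>)})"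
    unfolding residues6_def by (intro image_subsetI restrict_PiE_iff[THEN iffD2]) auto
  then have fin: "finite (?r ` int_sim p \<delta>)"
    by (rule finite_subset) (intro finite_PiE finite_cartesian_product; simp)
  define F where "F r = cs (SOME N. N \<in> int_sim p \<delta> \<and> ?r N = r)" for r
  have "cs M = F (?r M)" if "M \<in> int_sim p \<delta>" for M
  proof -
    let ?N = "SOME N. N \<in> int_sim p \<delta> \<and> ?r N = ?r M"
    have "?N \<in> int_sim p \<delta> \<and> ?r ?N = ?r M" by (rule someI[where x = M]) (use that in auto)
    then show ?thesis
      unfolding F_def using lrel_if_residues6_eq[OF that, of ?N] cs_lrel_iff[OF that, of ?N \<delta>] by auto
  qed
  then have "cs ` int_sim p \<delta> \<subseteq> F ` (?r ` int_sim p \<delta>)" by auto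
  then show ?thesis using fin finite_surj by blast
qed

lemma dc_eq: "dc a = {cs (a * h) | h. h \<in> Sp_int 3}"
  using Sp.dcosets_def[of 3 a] by simp

lemma dc_subset: "a \<in> int_sim p \<delta> \<Longrightarrow> dc a \<subseteq> cs ` int_sim p \<delta>"
  using int_sim_mult_right by (auto simp: dc_eq)

lemma finite_dc: "a \<in> int_sim p \<delta> \<Longrightarrow> finite (dc a)"
  by (rule finite_subset[OF dc_subset finite_cosets_int_sim])

lemma double_coset_hecke_int:
  assumes "a \<in> int_sim p \<delta>"
  shows "double_coset (GSp_plus 3) (Sp_int 3) a \<in> hecke_int"
proof -
  note a = int_sim_GSp[OF assms] finite_dc[OF assms]
  have "\<exists>\<delta>. \<exists>M \<in> int_sim p \<delta>. C = cs M" if "C \<in> dc a" for C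
    using that dc_subset[OF assms] by blast
  then show ?thesis
    using Sp.double_coset_closed[OF a] Sp.keys_double_coset[OF a]
    unfolding hecke_int_def by simp
qed

lemma satake_double_coset:
  assumes "a \<in> int_sim p \<delta>"
  shows "satake 3 p (double_coset (GSp_plus 3) (Sp_int 3) a) = (\<Sum>C \<in> dc a. satake_coset 3 p C)"
  by (simp add: satake_lin_ext Sp.lin_ext_double_coset[OF int_sim_GSp[OF assms]])

end

section \<open>Double cosets and injectivity of the Satake map\<close>

definition drel :: "rat mat \<Rightarrow> rat mat \<Rightarrow> bool" where
  "drel M N \<longleftrightarrow> (\<exists>g \<in> Sp_int 3. \<exists>h \<in> Sp_int 3. N = g * M * h)"

lemma drel_lrel: "lrel M N \<Longrightarrow> M \<in> carrier_mat 6 6 \<Longrightarrow> drel M N"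
proof -
  assume "lrel M N" and M: "M \<in> carrier_mat 6 6"
  then obtain g where g: "g \<in> Sp_int 3" "N = g * M" by (auto simp: lrel_def)
  then have "N = g * M * 1\<^sub>m 6" using M Sp_int_carrier[OF g(1)] by simp
  then show ?thesis unfolding drel_def using g(1) Sp_int_one by blast
qed

lemma drel_right: "h \<in> Sp_int 3 \<Longrightarrow> M \<in> carrier_mat 6 6 \<Longrightarrow> drel M (M * h)"
proof -
  assume h: "h \<in> Sp_int 3" and M: "M \<in> carrier_mat 6 6"
  have "M * h = 1\<^sub>m 6 * M * h" using M by simp
  then show ?thesis unfolding drel_def using h Sp_int_one by blast
qed

lemma drel_carrier: "drel M N \<Longrightarrow> M \<in> carrier_mat 6 6 \<Longrightarrow> N \<in> carrier_mat 6 6"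
  unfolding drel_def by (auto intro!: mult_carrier_mat[of _ 6 6] dest!: Sp_int_carrier)

lemma drel_trans:
  assumes "drel M N" "drel N L" "M \<in> carrier_mat 6 6"
  shows "drel M L"
proof -
  obtain g h where g: "g \<in> Sp_int 3" "h \<in> Sp_int 3" "N = g * M * h" using assms by (auto simp: drel_def)
  obtain g' h' where g': "g' \<in> Sp_int 3" "h' \<in> Sp_int 3" "L = g' * N * h'" using assms by (auto simp: drel_def)
  note c = Sp_int_carrier[OF g(1)] Sp_int_carrier[OF g(2)] Sp_int_carrier[OF g'(1)] Sp_int_carrier[OF g'(2)] assms(3)
  have "L = (g' * g) * M * (h * h')"
    using c by (simp add: g g' square_ops[where m = 6])
  then show ?thesis unfolding drel_def using Sp_int_mult[OF g'(1) g(1)] Sp_int_mult[OF g(2) g'(2)] by blast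
qed

lemma drel_sym:
  assumes "drel M N" "M \<in> carrier_mat 6 6"
  shows "drel N M"
proof -
  obtain g h where g: "g \<in> Sp_int 3" "h \<in> Sp_int 3" "N = g * M * h" using assms by (auto simp: drel_def)
  note i = Sp_inv[OF g(1)] and j = Sp_inv[OF g(2)]
  note c = Sp_int_carrier[OF g(1)] Sp_int_carrier[OF g(2)] Sp_int_carrier[OF i(1)] Sp_int_carrier[OF j(1)] assms(2)
  have "Sp_inv g * N * Sp_inv h = (Sp_inv g * g) * M * (h * Sp_inv h)"
    using c unfolding g(3) by (simp only: square_ops[where m = 6])
  also have "\<dots> = M" using c unfolding i(3) j(2) by simp
  finally show ?thesis unfolding drel_def using i(1) j(1) by (intro bexI[of _ "Sp_inv g"] bexI[of _ "Sp_inv h"]) auto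
qed

definition diag6 :: "rat \<Rightarrow> rat \<Rightarrow> rat \<Rightarrow> rat \<Rightarrow> rat \<Rightarrow> rat \<Rightarrow> rat mat" where
  "diag6 a b c d e f = mat6 [[a,0,0,0,0,0],[0,b,0,0,0,0],[0,0,c,0,0,0],[0,0,0,d,0,0],[0,0,0,0,e,0],[0,0,0,0,0,f]]"

lemma diag6_int_sim:
  assumes "a \<in> \<int>" "b \<in> \<int>" "c \<in> \<int>" "d \<in> \<int>" "e \<in> \<int>" "f \<in> \<int>"
    "a * d = of_nat p ^ \<delta>" "b * e = of_nat p ^ \<delta>" "c * f = of_nat p ^ \<delta>"
  shows "diag6 a b c d e f \<in> int_sim p \<delta>"
proof -
  have "similitude 3 (of_nat p ^ \<delta>) (diag6 a b c d e f)"
    unfolding diag6_def using assms(7-) by (intro similitude3I; simp add: cpair_def)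
  moreover have "integral_mat (diag6 a b c d e f)"
    unfolding integral_mat_def diag6_def mat6_def using assms(1-6) by (auto elim!: less6_cases)
  ultimately show ?thesis by (simp add: int_sim_def)
qed

lemma diag6_index [simp]: "diag6 a b c d e f \<in> carrier_mat 6 6" "dim_row (diag6 a b c d e f) = 6" "dim_col (diag6 a b c d e f) = 6"
  "i < 6 \<Longrightarrow> j < 6 \<Longrightarrow> diag6 a b c d e f $$ (i,j) =
     [[a,0,0,0,0,0],[0,b,0,0,0,0],[0,0,c,0,0,0],[0,0,0,d,0,0],[0,0,0,0,e,0],[0,0,0,0,0,f]] ! i ! j"
  by (simp_all add: diag6_def mat6_def)

context fixed_prime
begin

section \<open>Divisibility by powers of p, and extremal matrices\<close>

definition pmult :: "nat \<Rightarrow> rat \<Rightarrow> bool" where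
  "pmult m x \<longleftrightarrow> (\<exists>k \<in> \<int>. x = of_nat p ^ m * k)"

lemma pmultI: "k \<in> \<int> \<Longrightarrow> pmult m (of_nat p ^ m * k)"
  by (auto simp: pmult_def)

lemma pmult_zero [simp]: "pmult m 0"
  by (auto simp: pmult_def intro!: bexI[of _ 0])

lemma pmult_diff: "pmult m x \<Longrightarrow> pmult m y \<Longrightarrow> pmult m (x - y)"
  unfolding pmult_def by (metis Ints_diff right_diff_distrib)

lemma pmult_add: "pmult m x \<Longrightarrow> pmult m y \<Longrightarrow> pmult m (x + y)"
  unfolding pmult_def by (metis Ints_add distrib_left)

lemma pmult_mult: "pmult m x \<Longrightarrow> y \<in> \<int> \<Longrightarrow> pmult m (x * y)"
  unfolding pmult_def by (metis Ints_mult mult.assoc)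

lemma pmult_diff_cancel: "pmult m (x + y) \<Longrightarrow> pmult m x \<Longrightarrow> pmult m y"
  using pmult_diff[of m "x + y" x] by simp

lemma pmult_le: "pmult m x \<Longrightarrow> l \<le> m \<Longrightarrow> pmult l x"
proof -
  assume "pmult m x" "l \<le> m"
  then obtain k where k: "k \<in> \<int>" "x = of_nat p ^ m * k" by (auto simp: pmult_def)
  have "x = of_nat p ^ l * (of_nat p ^ (m - l) * k)"
    using k \<open>l \<le> m\<close> power_p_diff[of l m] by (simp add: ac_simps)
  then show ?thesis using k(1) by (auto simp: pmult_def)
qed

lemma pmult_power_iff: "pmult m (of_nat p ^ k) \<longleftrightarrow> m \<le> k"
proof
  assume "pmult m (of_nat p ^ k)"
  then obtain l where l: "l \<in> \<int>" "(of_nat p :: rat) ^ k = of_nat p ^ m * l" by (auto simp: pmult_def)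
  show "m \<le> k" by (rule int_mult_power_eq(1)[OF l(1)]) (simp add: l(2) mult.commute)
next
  assume "m \<le> k"
  then show "pmult m (of_nat p ^ k)"
    using power_p_diff[of m k] by (auto simp: pmult_def mult.commute intro!: bexI[of _ "of_nat p ^ (k - m)"])
qed

text \<open>The lexicographic order with d 3 most significant, encoded by digits in base \<delta> +
  1; this is faithful because exponents of triangular matrices are at most \<delta>. As a number it
  can be maximised by \<open>Max\<close>.\<close>

definition lexkey :: "nat \<Rightarrow> (nat \<Rightarrow> nat) \<Rightarrow> nat" where
  "lexkey \<delta> d = d 3 * (\<delta> + 1)\<^sup>2 + d 2 * (\<delta> + 1) + d 1"

lemma lexkey_le:
  assumes le: "lexkey \<delta> e \<le> lexkey \<delta> d" and d: "d 1 \<le> \<delta>" "d 2 \<le> \<delta>"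
  shows "e 3 \<le> d 3" "e 3 = d 3 \<Longrightarrow> e 2 \<le> d 2" "e 3 = d 3 \<Longrightarrow> e 2 = d 2 \<Longrightarrow> e 1 \<le> d 1"
proof -
  let ?K = "\<delta> + 1"
  have lt: "d 2 * ?K + d 1 < ?K\<^sup>2"
  proof -
    have "d 2 * ?K \<le> \<delta> * ?K" using d(2) by (rule mult_right_mono) simp
    then have "d 2 * ?K + d 1 < \<delta> * ?K + ?K" using d(1) by linarith
    then show ?thesis by (simp add: power2_eq_square)
  qed
  show "e 3 \<le> d 3"
  proof (rule ccontr)
    assume "\<not> e 3 \<le> d 3"
    then have "d 3 + 1 \<le> e 3" by simp
    then have "(d 3 + 1) * ?K\<^sup>2 \<le> e 3 * ?K\<^sup>2" by (rule mult_right_mono) simp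
    then show False using le lt unfolding lexkey_def by simp
  qed
  show "e 2 \<le> d 2" if "e 3 = d 3"
  proof (rule ccontr)
    assume "\<not> e 2 \<le> d 2"
    then have "d 2 + 1 \<le> e 2" by simp
    then have "(d 2 + 1) * ?K \<le> e 2 * ?K" by (rule mult_right_mono) simp
    then show False using le that d(1) unfolding lexkey_def by simp
  qed
  show "e 1 \<le> d 1" if "e 3 = d 3" "e 2 = d 2"
    using le that unfolding lexkey_def by simp
qed

text \<open>A large d 3 makes the pivot p^(\<delta> - d 3) at (2,2) small. Extremality asks the
  pivots of A to be as little divisible by p as possible, in the order 2, 1, 0; it replaces the
  choice of a minimal pivot in the elementary divisor algorithm.\<close>

definition extremal :: "nat \<Rightarrow> (nat \<Rightarrow> nat) \<Rightarrow> rat mat \<Rightarrow> bool" where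
  "extremal \<delta> d M \<longleftrightarrow> tri p \<delta> d M \<and> (\<forall>N e. drel M N \<and> tri p \<delta> e N \<longrightarrow> lexkey \<delta> e \<le> lexkey \<delta> d)"

lemma extremal_drel:
  assumes "extremal \<delta> d M" "drel M N" "tri p \<delta> d N"
  shows "extremal \<delta> d N"
  using assms drel_trans tri_carrier unfolding extremal_def by blast

lemma extremal_exists:
  assumes M: "M \<in> int_sim p \<delta>"
  obtains N d where "extremal \<delta> d N" "drel M N"
proof -
  define K where "K = {lexkey \<delta> e | N e. drel M N \<and> tri p \<delta> e N}"
  obtain N0 d0 where 0: "tri p \<delta> d0 N0" "lrel M N0" by (rule triangularize[OF M])
  then have "lexkey \<delta> d0 \<in> K" using drel_lrel int_sim_carrier[OF M] unfolding K_def by blast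
  moreover have "K \<subseteq> {..\<delta> * (\<delta> + 1)\<^sup>2 + \<delta> * (\<delta> + 1) + \<delta>}"
  proof
    fix x assume "x \<in> K"
    then obtain N e where N: "x = lexkey \<delta> e" "tri p \<delta> e N" by (auto simp: K_def)
    show "x \<in> {..\<delta> * (\<delta> + 1)\<^sup>2 + \<delta> * (\<delta> + 1) + \<delta>}"
      using tri_diag(4-6)[OF N(2)] unfolding N(1) lexkey_def atMost_iff
      by (intro add_mono mult_right_mono) auto
  qed
  then have fin: "finite K" by (rule finite_subset) simp
  ultimately have "Max K \<in> K" by (intro Max_in) auto
  then obtain N d where N: "drel M N" "tri p \<delta> d N" "lexkey \<delta> d = Max K" by (auto simp: K_def)
  have "extremal \<delta> d N"
    unfolding extremal_def
  proof (intro conjI allI impI)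
    fix N' e assume "drel N N' \<and> tri p \<delta> e N'"
    then have "lexkey \<delta> e \<in> K" using drel_trans[OF N(1)] int_sim_carrier[OF M] unfolding K_def by blast
    then show "lexkey \<delta> e \<le> lexkey \<delta> d" using fin N(3) by simp
  qed (rule N(2))
  then show thesis using that N(1) by blast
qed

text \<open>In a lexicographically extremal triangular matrix the first diagonal entry divides every entry,
  because it is the content of the first column of \<open>M * h\<close> up to \<open>Sp_int 3\<close>, for all \<open>h\<close>.\<close>

lemma extremal_step:
  assumes ext: "extremal \<delta> d M" and h: "h \<in> Sp_int 3"
  obtains g N e where "g \<in> Sp_int 3" "M * h = g * N" "tri p \<delta> e N" "lexkey \<delta> e \<le> lexkey \<delta> d"
proof -
  have M: "tri p \<delta> d M" using ext by (simp add: extremal_def)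
  note c = tri_carrier[OF M]
  have Mh: "M * h \<in> int_sim p \<delta>" by (rule int_sim_mult_right[OF triD(1)[OF M] h])
  obtain N e where N: "tri p \<delta> e N" "lrel (M * h) N" by (rule triangularize[OF Mh])
  have "drel M N" using drel_trans[OF drel_right[OF h c] drel_lrel[OF N(2) int_sim_carrier[OF Mh]] c] .
  then have "lexkey \<delta> e \<le> lexkey \<delta> d" using ext N(1) by (auto simp: extremal_def)
  moreover obtain g where "g \<in> Sp_int 3" "M * h = g * N"
    using lrel_sym[OF N(2) int_sim_carrier[OF Mh]] by (auto simp: lrel_def)
  ultimately show thesis using that N(1) by blast
qed

text \<open>In M h = g N with N triangular, column 2 is p^(\<delta> - e 3) times a column of g, and
  e 3 cannot exceed d 3.\<close>

lemma extremal_col2: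
  assumes ext: "extremal \<delta> d M" and h: "h \<in> Sp_int 3" and i: "i < 6"
  shows "pmult (\<delta> - d 3) ((M * h) $$ (i,2))"
proof -
  have M: "tri p \<delta> d M" using ext by (simp add: extremal_def)
  obtain g N e where g: "g \<in> Sp_int 3" "M * h = g * N" "tri p \<delta> e N" "lexkey \<delta> e \<le> lexkey \<delta> d"
    by (rule extremal_step[OF ext h])
  have "e 3 \<le> d 3" using lexkey_le(1)[OF g(4)] tri_diag[OF M] by simp
  have "(M * h) $$ (i,2) = g $$ (i,2) * of_nat p ^ (\<delta> - e 3)"
    unfolding g(2) using mult6[OF Sp_int_carrier[OF g(1)] tri_carrier[OF g(3)] i, of 2]
      triD[OF g(3)] tri_diag(2,3,9)[OF g(3)] by simp
  moreover have "pmult (\<delta> - e 3) (g $$ (i,2) * of_nat p ^ (\<delta> - e 3))"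
    using pmultI[OF Sp_int_Ints[OF g(1) i, of 2], of "\<delta> - e 3"] by (simp add: mult.commute)
  ultimately show ?thesis using pmult_le[OF _ diff_le_mono2[OF \<open>e 3 \<le> d 3\<close>]] by simp
qed

text \<open>Transposes of \<open>heis0\<close> add arbitrary integral multiples of the other columns
  to column 2, so differences of the divisibilities in \<open>extremal_col2\<close> isolate every
  single column.\<close>

lemma extremal_level0:
  assumes ext: "extremal \<delta> d M" and i: "i < 6" and j: "j < 6"
  shows "pmult (\<delta> - d 3) (M $$ (i,j))"
proof -
  have M: "tri p \<delta> d M" using ext by (simp add: extremal_def)
  define H where "H y1 y2 y3 y4 y5 = transpose_mat (heis0 y1 y2 y3 y4 y5)" for y1 y2 y3 y4 y5
  have H: "H y1 y2 y3 y4 y5 \<in> Sp_int 3"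
    if "y1 \<in> \<int>" "y2 \<in> \<int>" "y3 \<in> \<int>" "y4 \<in> \<int>" "y5 \<in> \<int>" for y1 y2 y3 y4 y5
    unfolding H_def using that by (intro Sp_int_transpose heis_Sp_int)
  have c: "H y1 y2 y3 y4 y5 \<in> carrier_mat 6 6" for y1 y2 y3 y4 y5
    by (simp add: H_def)
  have e: "(M * H y1 y2 y3 y4 y5) $$ (i,2) =
      M $$ (i,0) * y2 + M $$ (i,1) * y1 + M $$ (i,2) + M $$ (i,3) * y3 + M $$ (i,4) * y4 + M $$ (i,5) * y5"
    for y1 y2 y3 y4 y5
    using mult6[OF tri_carrier[OF M] c i, of 2] by (simp add: H_def)
  have q: "pmult (\<delta> - d 3) (M $$ (i,0) * y2 + M $$ (i,1) * y1 + M $$ (i,2) + M $$ (i,3) * y3 + M $$ (i,4) * y4 + M $$ (i,5) * y5)"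
    if "y1 \<in> \<int>" "y2 \<in> \<int>" "y3 \<in> \<int>" "y4 \<in> \<int>" "y5 \<in> \<int>" for y1 y2 y3 y4 y5
    using extremal_col2[OF ext H[OF that] i] by (simp only: e)
  have q2: "pmult (\<delta> - d 3) (M $$ (i,2))" using q[of 0 0 0 0 0] by simp
  note cancel = pmult_diff_cancel[OF _ q2]
  have "pmult (\<delta> - d 3) (M $$ (i,0))" "pmult (\<delta> - d 3) (M $$ (i,1))" "pmult (\<delta> - d 3) (M $$ (i,3))"
    "pmult (\<delta> - d 3) (M $$ (i,4))" "pmult (\<delta> - d 3) (M $$ (i,5))"
    by (rule cancel, use q[of 0 1 0 0 0] q[of 1 0 0 0 0] q[of 0 0 1 0 0] q[of 0 0 0 1 0] q[of 0 0 0 0 1]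
        in \<open>simp add: add.commute\<close>)+
  then show ?thesis using j q2 by (elim less6_cases) simp_all
qed

text \<open>Together with triangularity this says that the coordinate plane 2, 5 splits off as an
  orthogonal summand; \<open>split1\<close> adds the plane 1, 4.\<close>

definition split2 :: "rat mat \<Rightarrow> bool" where
  "split2 M \<longleftrightarrow> (\<forall>j<6. j \<noteq> 2 \<longrightarrow> M $$ (2,j) = 0) \<and> (\<forall>i<6. i \<noteq> 5 \<longrightarrow> M $$ (i,5) = 0)"

definition split1 :: "rat mat \<Rightarrow> bool" where
  "split1 M \<longleftrightarrow> split2 M \<and> (\<forall>j<6. j \<noteq> 1 \<longrightarrow> M $$ (1,j) = 0) \<and> (\<forall>i<6. i \<noteq> 4 \<longrightarrow> M $$ (i,4) = 0)"

lemma split2D: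
  assumes "split2 M"
  shows "M $$ (2,0) = 0" "M $$ (2,1) = 0" "M $$ (2,Suc 0) = 0" "M $$ (2,3) = 0" "M $$ (2,4) = 0" "M $$ (2,5) = 0"
    "M $$ (0,5) = 0" "M $$ (1,5) = 0" "M $$ (Suc 0,5) = 0" "M $$ (3,5) = 0" "M $$ (4,5) = 0"
  using assms by (auto simp: split2_def)

lemma split1D:
  assumes "split1 M"
  shows "split2 M" "M $$ (1,0) = 0" "M $$ (1,2) = 0" "M $$ (1,3) = 0" "M $$ (1,4) = 0"
    "M $$ (Suc 0,0) = 0" "M $$ (Suc 0,2) = 0" "M $$ (Suc 0,3) = 0" "M $$ (Suc 0,4) = 0"
    "M $$ (0,4) = 0" "M $$ (3,4) = 0" "M $$ (2,4) = 0" "M $$ (5,4) = 0"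
  using assms by (auto simp: split1_def)

lemma transpose_cpairD:
  assumes "M \<in> int_sim p \<delta>" "i < 6" "j < 6"
  shows "cpair (transpose_mat M) i j = of_nat p ^ \<delta> * J_mat 3 $$ (i,j)"
  using similitude3_transposeD[OF assms(1)] assms by (simp add: similitude3_iff)

text \<open>The pivot at (2,2) divides all of row 2, so \<open>heis0\<close> clears this row and
  keeps the matrix triangular with the same exponents. The inequality expresses that the pivot also
  divides the diagonal entry at (1,1).\<close>

lemma extremal_split2:
  assumes ext: "extremal \<delta> d M"
  obtains N where "extremal \<delta> d N" "drel M N" "split2 N" "d 2 \<le> d 3"
proof -
  have M: "tri p \<delta> d M" using ext by (simp add: extremal_def)
  note t = triD[OF M] and td = tri_diag[OF M] and c = tri_carrier[OF M]
  let ?q = "of_nat p ^ (\<delta> - d 3) :: rat"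
  have q: "?q \<noteq> 0" by simp
  have "\<exists>y \<in> \<int>. M $$ (2,j) = ?q * y" if "j < 6" for j
    using extremal_level0[OF ext, of 2 j] that by (auto simp: pmult_def)
  then obtain y where y: "\<And>j. j < 6 \<Longrightarrow> y j \<in> \<int> \<and> M $$ (2,j) = ?q * y j" by metis
  have yI: "y 0 \<in> \<int>" "y 1 \<in> \<int>" "y 3 \<in> \<int>" "y 4 \<in> \<int>" "y 5 \<in> \<int>" using y by simp_all
  define H where "H = heis0 (- y 1) (- y 0) (- y 3) (- y 4) (- y 5)"
  have H: "H \<in> Sp_int 3" unfolding H_def using yI by (intro heis_Sp_int) auto
  define N where "N = M * H"
  have m6: "N $$ (i,j) = M $$ (i,0) * H $$ (0,j) + M $$ (i,1) * H $$ (1,j) + M $$ (i,2) * H $$ (2,j)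
    + M $$ (i,3) * H $$ (3,j) + M $$ (i,4) * H $$ (4,j) + M $$ (i,5) * H $$ (5,j)" if "i < 6" "j < 6" for i j
    unfolding N_def using mult6[OF c Sp_int_carrier[OF H] that] .
  have NI: "N \<in> int_sim p \<delta>" unfolding N_def by (rule int_sim_mult_right[OF t(1) H])
  have tN: "tri p \<delta> d N"
    unfolding tri_def using NI
    by (simp add: m6 H_def t(2-13,17-) t(14-16)[simplified])
  have dr: "drel M N" unfolding N_def by (rule drel_right[OF H c])
  note eN = extremal_drel[OF ext dr tN]
  have y2: "M $$ (2,2) = ?q" by (rule td(9))
  have z: "N $$ (2,0) = 0" "N $$ (2,1) = 0" "N $$ (2,3) = 0" "N $$ (2,4) = 0" "N $$ (2,5) = 0"
    using y[of 0] y[of 1] y[of 3] y[of 4] y[of 5] y2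
    by (simp_all add: m6 H_def algebra_simps)
  have N22: "N $$ (2,2) = ?q" using tri_diag(9)[OF tN] .
  have "N $$ (i,5) = 0" if "i < 6" "i \<noteq> 5" for i
  proof -
    \<comment> \<open>Row 2 of \<open>N\<close> is supported at column 2, so its symplectic product
      with row i is the pivot times the entry (i,5).\<close>
    have "cpair (transpose_mat N) 2 i = 0" using transpose_cpairD[OF NI, of 2 i] that by (simp add: J_mat_index)
    then have "?q * N $$ (i,5) = 0" using cpair_transpose[OF tri_carrier[OF tN], of 2 i] that z N22 by simp
    then show ?thesis using q by simp
  qed
  moreover have "N $$ (2,j) = 0" if "j < 6" "j \<noteq> 2" for j
    using that z by (elim less6_cases) auto
  ultimately have s: "split2 N" by (simp add: split2_def)
  have "pmult (\<delta> - d 3) (of_nat p ^ (\<delta> - d 2))"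
    using extremal_level0[OF ext, of 1 1] td(8) by simp
  then have "d 2 \<le> d 3" using td by (simp add: pmult_power_iff)
  then show thesis using that eN dr s by blast
qed

text \<open>The argument of the previous level with \<open>heis1\<close>, whose transposes leave
  column 2 alone. That column then yields e 3 = d 3, and only after this does lexicographic
  maximality bound e 2.\<close>

lemma extremal_level1:
  assumes ext: "extremal \<delta> d M" and s: "split2 M" and ij: "i \<in> {0,1,3,4}" "j \<in> {0,1,3,4}"
  shows "pmult (\<delta> - d 2) (M $$ (i,j))"
proof -
  have M: "tri p \<delta> d M" using ext by (simp add: extremal_def)
  note td = tri_diag[OF M] and t = triD[OF M]
  have i: "i < 6" "i \<noteq> 2" using ij by auto
  have q: "pmult (\<delta> - d 2) (M $$ (i,0) * y2 + M $$ (i,1) + M $$ (i,3) * y3 + M $$ (i,4) * y4)"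
    if y: "y2 \<in> \<int>" "y3 \<in> \<int>" "y4 \<in> \<int>" for y2 y3 y4
  proof -
    define H where "H = transpose_mat (heis1 y2 y3 y4)"
    have H: "H \<in> Sp_int 3" unfolding H_def using y heis_Sp_int(2)[OF Ints_0 y Ints_0] by (intro Sp_int_transpose)
    have m6: "(M * H) $$ (k,j) = M $$ (k,0) * H $$ (0,j) + M $$ (k,1) * H $$ (1,j) + M $$ (k,2) * H $$ (2,j)
      + M $$ (k,3) * H $$ (3,j) + M $$ (k,4) * H $$ (4,j) + M $$ (k,5) * H $$ (5,j)" if "k < 6" "j < 6" for k j
      using mult6[OF tri_carrier[OF M] Sp_int_carrier[OF H] that] .
    obtain g N e where g: "g \<in> Sp_int 3" "M * H = g * N" "tri p \<delta> e N" "lexkey \<delta> e \<le> lexkey \<delta> d"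
      by (rule extremal_step[OF ext H])
    note n6 = mult6[OF Sp_int_carrier[OF g(1)] tri_carrier[OF g(3)]]
    note u = triD[OF g(3)] and ud = tri_diag[OF g(3)]
    have col2: "g $$ (k,2) * of_nat p ^ (\<delta> - e 3) = M $$ (k,2)" if "k < 6" for k
      using m6[OF that, of 2] n6[OF that, of 2] u ud(2,3,9) unfolding g(2)
      by (simp add: H_def)
    have "g $$ (i,2) * of_nat p ^ (\<delta> - e 3) = 0"
      using col2[OF i(1)] ij t(4,7) td(2,3) by auto
    then have gi2: "g $$ (i,2) = 0" by simp
    \<comment> \<open>Reading column 2 at the pivot gives d 3 \<le> e 3, the inequality opposite to
      the one from maximality.\<close>
    have "g $$ (2,2) * of_nat p ^ (\<delta> - e 3) = of_nat p ^ (\<delta> - d 3)" using col2[of 2] td(9) by simp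
    then have "\<delta> - e 3 \<le> \<delta> - d 3" by (rule int_mult_power_eq(1)[OF Sp_int_Ints[OF g(1)], rotated 2]) auto
    then have e3: "e 3 = d 3" using lexkey_le(1)[OF g(4)] td(4-6) ud(4-6) by simp
    then have e2: "e 2 \<le> d 2" using lexkey_le(2)[OF g(4)] td by simp
    have "(M * H) $$ (i,1) = g $$ (i,1) * of_nat p ^ (\<delta> - e 2)"
      unfolding g(2) using n6[OF i(1), of 1] u ud(1,8) gi2 by simp
    moreover have "pmult (\<delta> - e 2) (g $$ (i,1) * of_nat p ^ (\<delta> - e 2))"
      using pmultI[OF Sp_int_Ints[OF g(1) i(1), of 1], of "\<delta> - e 2"] by (simp add: mult.commute)
    ultimately have "pmult (\<delta> - d 2) ((M * H) $$ (i,1))" using pmult_le[OF _ diff_le_mono2[OF e2]] by simp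
    then show ?thesis using m6[OF i(1), of 1] by (simp add: H_def)
  qed
  have q1: "pmult (\<delta> - d 2) (M $$ (i,1))" using q[of 0 0 0] by simp
  show ?thesis
    using ij(2) q1 pmult_diff_cancel[OF _ q1, of "M $$ (i,0)"] pmult_diff_cancel[OF _ q1, of "M $$ (i,3)"]
      pmult_diff_cancel[OF _ q1, of "M $$ (i,4)"] q[of 1 0 0] q[of 0 1 0] q[of 0 0 1]
    by (auto simp: add.commute)
qed

lemma extremal_split1:
  assumes ext: "extremal \<delta> d M" and s: "split2 M"
  obtains N where "extremal \<delta> d N" "drel M N" "split1 N" "d 1 \<le> d 2"
proof -
  have M: "tri p \<delta> d M" using ext by (simp add: extremal_def)
  note t = triD[OF M] and td = tri_diag[OF M] and c = tri_carrier[OF M] and sd = split2D[OF s]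
  let ?q = "of_nat p ^ (\<delta> - d 2) :: rat"
  have q: "?q \<noteq> 0" by simp
  have "\<exists>y \<in> \<int>. M $$ (1,j) = ?q * y" if "j \<in> {0,1,3,4}" for j
    using extremal_level1[OF ext s, of 1 j] that unfolding pmult_def by blast
  then obtain y where y: "\<And>j. j \<in> {0,1,3,4} \<Longrightarrow> y j \<in> \<int> \<and> M $$ (1,j) = ?q * y j" by metis
  have yI: "y 0 \<in> \<int>" "y 3 \<in> \<int>" "y 4 \<in> \<int>" using y by simp_all
  define H where "H = heis1 (- y 0) (- y 3) (- y 4)"
  have H: "H \<in> Sp_int 3" unfolding H_def using yI by (intro heis_Sp_int(2)[of 0 _ _ _ 0]) auto
  define N where "N = M * H"
  have m6: "N $$ (i,j) = M $$ (i,0) * H $$ (0,j) + M $$ (i,1) * H $$ (1,j) + M $$ (i,2) * H $$ (2,j)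
    + M $$ (i,3) * H $$ (3,j) + M $$ (i,4) * H $$ (4,j) + M $$ (i,5) * H $$ (5,j)" if "i < 6" "j < 6" for i j
    unfolding N_def using mult6[OF c Sp_int_carrier[OF H] that] .
  have NI: "N \<in> int_sim p \<delta>" unfolding N_def by (rule int_sim_mult_right[OF t(1) H])
  have tN: "tri p \<delta> d N"
    unfolding tri_def using NI
    by (simp add: m6 H_def t(2-13,17-) t(14-16)[simplified])
  have dr: "drel M N" unfolding N_def by (rule drel_right[OF H c])
  note eN = extremal_drel[OF ext dr tN]
  have y1: "M $$ (1,1) = ?q" by (rule td(8))
  have z: "N $$ (1,0) = 0" "N $$ (1,3) = 0" "N $$ (1,4) = 0"
    using y[of 0] y[of 3] y[of 4] y1
    by (simp_all add: m6 H_def algebra_simps)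
  have z': "N $$ (1,2) = 0" "N $$ (1,5) = 0" "N $$ (2,0) = 0" "N $$ (2,1) = 0" "N $$ (2,3) = 0" "N $$ (2,4) = 0" "N $$ (2,5) = 0"
    "N $$ (0,5) = 0" "N $$ (3,5) = 0" "N $$ (4,5) = 0"
    using sd tri_diag[OF tN] by (simp_all add: m6 H_def)
  have N11: "N $$ (1,1) = ?q" using tri_diag(8)[OF tN] .
  have "N $$ (i,4) = 0" if "i < 6" "i \<noteq> 4" for i
  proof -
    have "cpair (transpose_mat N) 1 i = 0" using transpose_cpairD[OF NI, of 1 i] that by (simp add: J_mat_index)
    then have "?q * N $$ (i,4) = 0" using cpair_transpose[OF tri_carrier[OF tN], of 1 i] that z z' N11 by simp
    then show ?thesis using q by simp
  qed
  moreover have "N $$ (1,j) = 0" if "j < 6" "j \<noteq> 1" for j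
    using that z z' by (elim less6_cases) auto
  moreover have "split2 N"
    unfolding split2_def all6 using z' by simp
  ultimately have s: "split1 N" by (simp add: split1_def)
  have "pmult (\<delta> - d 2) (of_nat p ^ (\<delta> - d 1))"
    using extremal_level1[OF ext \<open>split2 M\<close>, of 0 0] td(7) by simp
  then have "d 1 \<le> d 2" using td by (simp add: pmult_power_iff)
  then show thesis using that eN dr s by blast
qed

text \<open>The last level is SL2 in the coordinates 0, 3, where \<open>root0\<close> adds multiples
  of column 3 to column 0. The unchanged columns 2 and 1 fix e 3 and e 2, so that maximality bounds
  e 1.\<close>

lemma extremal_level2:
  assumes ext: "extremal \<delta> d M" and s: "split1 M" and i: "i \<in> {0,3}"
  shows "pmult (\<delta> - d 1) (M $$ (i,3))"
proof -
  have M: "tri p \<delta> d M" using ext by (simp add: extremal_def)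
  note td = tri_diag[OF M] and t = triD[OF M] and s1 = split1D[OF s] and s2 = split2D[OF split1D(1)[OF s]]
  have i6: "i < 6" using i by auto
  have q: "pmult (\<delta> - d 1) (M $$ (i,0) + M $$ (i,3) * y)" if y: "y \<in> \<int>" for y
  proof -
    define H where "H = root0 1 0 y 1"
    have H: "H \<in> Sp_int 3" unfolding H_def using y by (intro Sp_int_generators) auto
    have m6: "(M * H) $$ (k,j) = M $$ (k,0) * H $$ (0,j) + M $$ (k,1) * H $$ (1,j) + M $$ (k,2) * H $$ (2,j)
      + M $$ (k,3) * H $$ (3,j) + M $$ (k,4) * H $$ (4,j) + M $$ (k,5) * H $$ (5,j)" if "k < 6" "j < 6" for k j
      using mult6[OF tri_carrier[OF M] Sp_int_carrier[OF H] that] .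
    obtain g N e where g: "g \<in> Sp_int 3" "M * H = g * N" "tri p \<delta> e N" "lexkey \<delta> e \<le> lexkey \<delta> d"
      by (rule extremal_step[OF ext H])
    note n6 = mult6[OF Sp_int_carrier[OF g(1)] tri_carrier[OF g(3)]]
    note u = triD[OF g(3)] and ud = tri_diag[OF g(3)]
    have col2: "g $$ (k,2) * of_nat p ^ (\<delta> - e 3) = M $$ (k,2)" if "k < 6" for k
      using m6[OF that, of 2] n6[OF that, of 2] u ud(2,3,9) unfolding g(2)
      by (simp add: H_def)
    have "g $$ (0,2) * of_nat p ^ (\<delta> - e 3) = 0" "g $$ (1,2) * of_nat p ^ (\<delta> - e 3) = 0" "g $$ (3,2) * of_nat p ^ (\<delta> - e 3) = 0"
      using col2[of 0] col2[of 1] col2[of 3] t(4) td(2,3) by simp_all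
    then have g2: "g $$ (0,2) = 0" "g $$ (1,2) = 0" "g $$ (3,2) = 0" by simp_all
    have "g $$ (2,2) * of_nat p ^ (\<delta> - e 3) = of_nat p ^ (\<delta> - d 3)" using col2[of 2] td(9) by simp
    then have "\<delta> - e 3 \<le> \<delta> - d 3" by (rule int_mult_power_eq(1)[OF Sp_int_Ints[OF g(1)], rotated 2]) auto
    then have e3: "e 3 = d 3" using lexkey_le(1)[OF g(4)] td(4-6) ud(4-6) by simp
    have col1: "g $$ (k,1) * of_nat p ^ (\<delta> - e 2) = M $$ (k,1)" if "k < 6" "g $$ (k,2) = 0" for k
      using m6[OF that(1), of 1] n6[OF that(1), of 1] that u ud(1,8) unfolding g(2)
      by (simp add: H_def)
    have "g $$ (0,1) * of_nat p ^ (\<delta> - e 2) = 0" "g $$ (3,1) * of_nat p ^ (\<delta> - e 2) = 0"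
      using col1[of 0] col1[of 3] g2 t(3) td(1) by simp_all
    then have g1: "g $$ (0,1) = 0" "g $$ (3,1) = 0" by simp_all
    have "g $$ (1,1) * of_nat p ^ (\<delta> - e 2) = of_nat p ^ (\<delta> - d 2)" using col1[of 1] g2 td(8) by simp
    then have "\<delta> - e 2 \<le> \<delta> - d 2" by (rule int_mult_power_eq(1)[OF Sp_int_Ints[OF g(1)], rotated 2]) auto
    then have e2: "e 2 = d 2" using lexkey_le(2)[OF g(4)] e3 td(4-6) ud(4-6) by simp
    then have e1: "e 1 \<le> d 1" using lexkey_le(3)[OF g(4)] e3 td(4-6) by simp
    have gi: "g $$ (i,1) = 0" "g $$ (i,2) = 0" using i g1 g2 by auto
    have "(M * H) $$ (i,0) = g $$ (i,0) * of_nat p ^ (\<delta> - e 1)"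
      unfolding g(2) using n6[OF i6, of 0] u ud(7) gi by simp
    moreover have "pmult (\<delta> - e 1) (g $$ (i,0) * of_nat p ^ (\<delta> - e 1))"
      using pmultI[OF Sp_int_Ints[OF g(1) i6, of 0], of "\<delta> - e 1"] by (simp add: mult.commute)
    ultimately have "pmult (\<delta> - d 1) ((M * H) $$ (i,0))" using pmult_le[OF _ diff_le_mono2[OF e1]] by simp
    then show ?thesis using m6[OF i6, of 0] by (simp add: H_def)
  qed
  show ?thesis using q[of 0] q[of 1] pmult_diff_cancel[of _ "M $$ (i,0)"] by simp
qed

definition dmat :: "nat \<Rightarrow> (nat \<Rightarrow> nat) \<Rightarrow> rat mat" where
  "dmat \<delta> d = diag6 (of_nat p ^ (\<delta> - d 1)) (of_nat p ^ (\<delta> - d 2)) (of_nat p ^ (\<delta> - d 3))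
     (of_nat p ^ d 1) (of_nat p ^ d 2) (of_nat p ^ d 3)"

text \<open>After both splittings only the entry (0,3) is left beside the diagonal, and it is a
  multiple of the pivot at (0,0). The result is the symplectic elementary divisor form. It serves
  injectivity, since extremal matrices with equal exponents share a double coset, and through the
  inequalities the classification of double cosets.\<close>

theorem extremal_diag:
  assumes ext: "extremal \<delta> d M"
  shows "drel M (dmat \<delta> d)" "d 1 \<le> d 2" "d 2 \<le> d 3" "\<delta> - d 1 \<le> d 1"
proof -
  have cM: "M \<in> carrier_mat 6 6" using ext tri_carrier by (auto simp: extremal_def)
  obtain M1 where M1: "extremal \<delta> d M1" "drel M M1" "split2 M1" "d 2 \<le> d 3" by (rule extremal_split2[OF ext])
  obtain M2 where M2: "extremal \<delta> d M2" "drel M1 M2" "split1 M2" "d 1 \<le> d 2" by (rule extremal_split1[OF M1(1,3)])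
  show "d 1 \<le> d 2" "d 2 \<le> d 3" by fact+
  have M: "tri p \<delta> d M2" using M2(1) by (simp add: extremal_def)
  note td = tri_diag[OF M] and t = triD[OF M] and s1 = split1D[OF M2(3)] and s2 = split2D[OF split1D(1)[OF M2(3)]]
  obtain k where k: "k \<in> \<int>" "M2 $$ (0,3) = of_nat p ^ (\<delta> - d 1) * k"
    using extremal_level2[OF M2(1,3), of 0] unfolding pmult_def by blast
  have "pmult (\<delta> - d 1) (of_nat p ^ d 1)" using extremal_level2[OF M2(1,3), of 3] t(14) by simp
  then show "\<delta> - d 1 \<le> d 1" by (simp add: pmult_power_iff)
  have H: "root0 1 (-k) 0 1 \<in> Sp_int 3" using k(1) by (intro Sp_int_generators) auto
  have "M2 * root0 1 (-k) 0 1 = dmat \<delta> d"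
  proof (rule eq_matI)
    fix i j assume "i < dim_row (dmat \<delta> d)" "j < dim_col (dmat \<delta> d)"
    then have ij: "i < 6" "j < 6" by (simp_all add: dmat_def)
    note m6 = mult6[OF tri_carrier[OF M] Sp_int_carrier[OF H]]
    from ij show "(M2 * root0 1 (-k) 0 1) $$ (i,j) = dmat \<delta> d $$ (i,j)"
      by (elim less6_cases)
        (simp_all add: m6 k(2) t(2-13,17-) t(14-16)[simplified] td(1-3)[simplified] td(7-9)[simplified]
          s1(2-)[simplified] s2[simplified] dmat_def del: index_mult_mat)
  qed (use tri_carrier[OF M] Sp_int_carrier[OF H] in \<open>auto simp: dmat_def \<close>)
  then have "drel M2 (dmat \<delta> d)" using drel_right[OF H tri_carrier[OF M]] by simp
  then show "drel M (dmat \<delta> d)"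
    using drel_trans[OF M1(2) drel_trans[OF M2(2)] cM] drel_carrier[OF M1(2) cM] by blast
qed

end

section \<open>Injectivity of the Satake map\<close>

lemma mvar_power: "mvar i ^ k = Poly_Mapping.single (Poly_Mapping.single i k) 1"
proof (induction k)
  case 0
  then show ?case by simp
next
  case (Suc k)
  have "mvar i ^ Suc k = Poly_Mapping.single (Poly_Mapping.single i 1 + Poly_Mapping.single i k) 1"
    unfolding power_Suc Suc by (simp add: mvar_def mult_single)
  then show ?case by (simp flip: single_add)
qed

lemma mconst_power: "mconst c ^ k = mconst (c ^ k)"
  by (induction k) (simp_all add: mconst_def mult_single)

lemma mvar_mconst_power:
  "(mvar i * mconst c) ^ k = Poly_Mapping.single (Poly_Mapping.single i k) (c ^ k)"
  by (simp add: power_mult_distrib mvar_power mconst_power) (simp add: mconst_def mult_single)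

definition expv :: "nat \<Rightarrow> (nat \<Rightarrow> nat) \<Rightarrow> (nat \<Rightarrow>\<^sub>0 nat)" where
  "expv \<delta> d = Poly_Mapping.single 0 \<delta> + (Poly_Mapping.single 1 (d 1) + (Poly_Mapping.single 2 (d 2) + Poly_Mapping.single 3 (d 3)))"

lemma expv_inject:
  assumes "expv \<delta> d = expv \<epsilon> e"
  shows "\<delta> = \<epsilon>" "d 1 = e 1" "d 2 = e 2" "d 3 = e 3"
proof -
  have "Poly_Mapping.lookup (expv \<delta> d) i = Poly_Mapping.lookup (expv \<epsilon> e) i" for i
    by (simp add: assms)
  from this[of 0] this[of 1] this[of 2] this[of 3]
  show "\<delta> = \<epsilon>" "d 1 = e 1" "d 2 = e 2" "d 3 = e 3"
    by (simp_all add: expv_def lookup_add lookup_single when_def)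
qed

context fixed_prime
begin

definition wcoef :: "(nat \<Rightarrow> nat) \<Rightarrow> rat" where
  "wcoef d = (1 / of_nat p) ^ d 1 * ((1 / of_nat p ^ 2) ^ d 2 * (1 / of_nat p ^ 3) ^ d 3)"

lemma wcoef_pos: "wcoef d > 0"
  by (simp add: wcoef_def)

lemma wmono_single: "wmono \<delta> d = Poly_Mapping.single (expv \<delta> d) (wcoef d)"
  unfolding wmono_def
  by (simp add: atLeastAtMost_1_3 mvar_power mvar_mconst_power mult_single expv_def wcoef_def)

lemma of_int_mult_wmono:
  "of_int k * wmono \<delta> d = Poly_Mapping.single (expv \<delta> d) (of_int k * wcoef d)"
  by (simp add: wmono_single mult_single flip: single_of_int)

text \<open>Right translation by h preserves coefficients by the definition of the Hecke ring, and
  left multiplication by g does not change the coset.\<close>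

lemma lookup_hecke_drel:
  assumes f: "f \<in> hecke_carrier (GSp_plus 3) (Sp_int 3)" and M: "M \<in> int_sim p \<delta>" and rel: "drel M N"
  shows "Poly_Mapping.lookup f (cs N) = Poly_Mapping.lookup f (cs M)"
proof -
  obtain g h where g: "g \<in> Sp_int 3" "h \<in> Sp_int 3" "N = g * M * h" using rel by (auto simp: drel_def)
  have h: "h \<in> carrier (GSp_plus 3)" using g(2) Sp_int_subset by blast
  have Mh: "M * h \<in> int_sim p \<delta>" by (rule int_sim_mult_right[OF M g(2)])
  have N: "N = g * (M * h)"
    unfolding g(3) by (rule mult6_assoc[OF Sp_int_carrier[OF g(1)] int_sim_carrier[OF M] Sp_int_carrier[OF g(2)]])
  have "lrel (M * h) N" unfolding N by (rule lrelI[OF g(1)])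
  then have "cs N = cs (M * h)"
    using cs_lrel_iff[OF Mh lrel_int_sim[OF _ Mh]] by simp
  also have "\<dots> = cs M #>\<^bsub>GSp_plus 3\<^esub> h" by (rule cs_translate[OF int_sim_GSp[OF M] h, symmetric])
  also have "Poly_Mapping.lookup f \<dots> = Poly_Mapping.lookup f (cs M)"
    using f g(2) int_sim_GSp[OF M] group.rcosetsI[OF group_GSp_plus Sp_int_subset] by (auto simp: hecke_carrier_def)
  finally show ?thesis .
qed

text \<open>Cancellation can occur only between cosets with equal exponents. Fix the multiplier of
  one coset of the support and take the largest exponents occurring with it: the cosets with these
  exponents carry one common coefficient a by \<open>extremal_diag\<close>, and their monomial
  appears with a times a positive weight times their number.\<close>

lemma satake_kernel:
  assumes f: "f \<in> hecke_int" and zero: "satake 3 p f = 0"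
  shows "f = 0"
proof (rule ccontr)
  assume "f \<noteq> 0"
  then have "Poly_Mapping.keys f \<noteq> {}" by simp
  then obtain C0 where C0: "C0 \<in> Poly_Mapping.keys f" by blast
  obtain \<delta> d0 N0 where N0: "tri p \<delta> d0 N0" "C0 = cs N0" by (rule hecke_int_rep[OF f C0])
  define K where "K = {lexkey \<delta> e | N e. cs N \<in> Poly_Mapping.keys f \<and> tri p \<delta> e N}"
  have "lexkey \<delta> d0 \<in> K" using C0 N0 unfolding K_def by blast
  moreover have "K \<subseteq> {..\<delta> * (\<delta> + 1)\<^sup>2 + \<delta> * (\<delta> + 1) + \<delta>}"
  proof
    fix x assume "x \<in> K"
    then obtain N e where N: "x = lexkey \<delta> e" "tri p \<delta> e N" by (auto simp: K_def)
    show "x \<in> {..\<delta> * (\<delta> + 1)\<^sup>2 + \<delta> * (\<delta> + 1) + \<delta>}"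
      using tri_diag(4-6)[OF N(2)] unfolding N(1) lexkey_def atMost_iff
      by (intro add_mono mult_right_mono) auto
  qed
  then have fin: "finite K" by (rule finite_subset) simp
  ultimately have "Max K \<in> K" by (intro Max_in) auto
  then obtain N d where N: "cs N \<in> Poly_Mapping.keys f" "tri p \<delta> d N" "lexkey \<delta> d = Max K" by (auto simp: K_def)
  \<comment> \<open>The support is a union of double cosets, so the maximum over the support bounds
    all triangular matrices in the double coset of \<open>N'\<close>.\<close>
  have ext: "extremal \<delta> d N'" if N': "cs N' \<in> Poly_Mapping.keys f" "tri p \<delta> d N'" for N'
    unfolding extremal_def
  proof (intro conjI allI impI)
    fix N'' e assume *: "drel N' N'' \<and> tri p \<delta> e N''"
    then have "cs N'' \<in> Poly_Mapping.keys f"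
      using lookup_hecke_drel[OF hecke_intD[OF f] triD(1)[OF N'(2)], of N''] N'(1) by (simp add: in_keys_iff)
    then have "lexkey \<delta> e \<in> K" using * unfolding K_def by blast
    then show "lexkey \<delta> e \<le> lexkey \<delta> d" using fin N(3) by simp
  qed (rule N'(2))
  define a where "a = Poly_Mapping.lookup f (cs N)"
  have a: "a \<noteq> 0" using N(1) by (simp add: a_def in_keys_iff)
  have same: "Poly_Mapping.lookup f (cs N') = a" if N': "cs N' \<in> Poly_Mapping.keys f" "tri p \<delta> d N'" for N'
  proof -
    have "drel N' N"
      using drel_trans[OF extremal_diag(1)[OF ext[OF N']] drel_sym[OF extremal_diag(1)[OF ext[OF N(1,2)]] tri_carrier[OF N(2)]]
          tri_carrier[OF N'(2)]] .
    then show ?thesis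
      using lookup_hecke_drel[OF hecke_intD[OF f] triD(1)[OF N'(2)], of N] by (simp add: a_def)
  qed
  let ?v = "expv \<delta> d"
  define S where "S = {C \<in> Poly_Mapping.keys f. \<exists>N'. C = cs N' \<and> tri p \<delta> d N'}"
  have summand: "Poly_Mapping.lookup (of_int (Poly_Mapping.lookup f C) * satake_coset 3 p C) ?v =
      (if C \<in> S then of_int a * wcoef d else 0)" if C: "C \<in> Poly_Mapping.keys f" for C
  proof -
    obtain \<epsilon> e N' where N': "tri p \<epsilon> e N'" "C = cs N'" by (rule hecke_int_rep[OF f C])
    have *: "Poly_Mapping.lookup (of_int (Poly_Mapping.lookup f C) * satake_coset 3 p C) ?v =
      (if expv \<epsilon> e = ?v then of_int (Poly_Mapping.lookup f C) * wcoef e else 0)"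
      unfolding N'(2) satake_coset_tri[OF N'(1)] of_int_mult_wmono by (simp add: lookup_single when_def)
    show ?thesis
    proof (cases "expv \<epsilon> e = ?v")
      case True
      note ee = expv_inject[OF True]
      have t: "tri p \<delta> d N'" using N'(1) tri_cong[of e d] ee by simp
      have "wcoef e = wcoef d" using ee unfolding wcoef_def by simp
      moreover have "Poly_Mapping.lookup f C = a" unfolding N'(2) by (rule same[OF _ t]) (use C N'(2) in simp)
      moreover have "C \<in> S" unfolding S_def using C N'(2) t by blast
      ultimately show ?thesis unfolding * using True by simp
    next
      case False
      have "C \<notin> S"
      proof
        assume "C \<in> S"
        then obtain N'' where N'': "C = cs N''" "tri p \<delta> d N''" by (auto simp: S_def)
        have "lrel N' N''" using cs_lrel_iff[OF triD(1)[OF N'(1)] triD(1)[OF N''(2)]] N'(2) N''(1) by simp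
        from tri_exponents_eq[OF N'(1) N''(2) this] False show False by (simp add: expv_def)
      qed
      then show ?thesis unfolding * using False by simp
    qed
  qed
  have "0 = Poly_Mapping.lookup (satake 3 p f) ?v" by (simp add: zero)
  also have "\<dots> = (\<Sum>C \<in> Poly_Mapping.keys f. if C \<in> S then of_int a * wcoef d else 0)"
    unfolding satake_def lookup_sum by (rule sum.cong[OF refl summand])
  \<comment> \<open>All contributions are equal and nonzero, so the sum vanishes only if
    \<open>S\<close> is empty.\<close>
  also have "\<dots> = of_nat (card S) * (of_int a * wcoef d)"
    by (simp add: sum.If_cases S_def Int_def)
  finally have "card S = 0" using a wcoef_pos[of d] by simp
  moreover have "cs N \<in> S" "finite S" unfolding S_def using N by auto
  ultimately show False by auto
qed

lemma satake_inj:
  assumes "f \<in> hecke_int" "g \<in> hecke_int" "satake 3 p f = satake 3 p g"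
  shows "f = g"
proof -
  have "satake 3 p (f + (- g)) = 0" unfolding satake_add satake_uminus using assms(3) by simp
  then have "f + (- g) = 0" by (rule satake_kernel[OF hecke_int_add[OF assms(1) hecke_int_uminus[OF assms(2)]]])
  then show ?thesis by simp
qed

lemma mem_dc_iff:
  assumes a: "a \<in> int_sim p \<delta>" and M: "M \<in> int_sim p \<epsilon>"
  shows "cs M \<in> dc a \<longleftrightarrow> drel a M"
proof
  assume "cs M \<in> dc a"
  then obtain h where h: "h \<in> Sp_int 3" "cs M = cs (a * h)" by (auto simp: dc_eq)
  have "lrel (a * h) M" using cs_lrel_iff[OF int_sim_mult_right[OF a h(1)] M] h(2) by simp
  then show "drel a M" using drel_trans[OF drel_right[OF h(1)] drel_lrel] a h int_sim_carrier int_sim_mult_right by blast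
next
  assume "drel a M"
  then obtain g h where g: "g \<in> Sp_int 3" "h \<in> Sp_int 3" "M = g * a * h" by (auto simp: drel_def)
  have "M = g * (a * h)"
    unfolding g(3) by (rule mult6_assoc[OF Sp_int_carrier[OF g(1)] int_sim_carrier[OF a] Sp_int_carrier[OF g(2)]])
  then have "lrel (a * h) M" using lrelI[OF g(1)] by simp
  then have "cs M = cs (a * h)" using cs_lrel_iff[OF int_sim_mult_right[OF a g(2)] M] by simp
  then show "cs M \<in> dc a" using g(2) by (auto simp: dc_eq)
qed

section \<open>Double cosets with multiplier p and p^2, and rank modulo p\<close>

definition T_rep :: "rat mat" where "T_rep = diag6 1 1 1 (of_nat p) (of_nat p) (of_nat p)"

text \<open>Index 0 is not among the generators; it represents the fourth double coset with
  multiplier p^2 and completes the list. For i \<le> 3 the diagonal has 3 - i entries 1, which is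
  the rank modulo p.\<close>

definition T2_rep :: "nat \<Rightarrow> rat mat" where
  "T2_rep i = (if i = 0 then diag6 1 1 1 (of_nat p ^ 2) (of_nat p ^ 2) (of_nat p ^ 2)
    else if i = 1 then diag6 1 1 (of_nat p) (of_nat p ^ 2) (of_nat p ^ 2) (of_nat p)
    else if i = 2 then diag6 1 (of_nat p) (of_nat p) (of_nat p ^ 2) (of_nat p) (of_nat p)
    else diag6 (of_nat p) (of_nat p) (of_nat p) (of_nat p) (of_nat p) (of_nat p))"

lemma T_rep_int_sim: "T_rep \<in> int_sim p 1"
  unfolding T_rep_def by (rule diag6_int_sim) auto

lemma T2_rep_int_sim: "T2_rep i \<in> int_sim p 2"
  unfolding T2_rep_def by (auto intro!: diag6_int_sim simp: power2_eq_square)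

lemma hecke_T_eq: "hecke_T 3 p = double_coset (GSp_plus 3) (Sp_int 3) T_rep"
proof -
  have "mat_diag (2*3) (\<lambda>k. if k < 3 then 1 else of_nat p) = T_rep"
  proof (rule eq_matI)
    fix i j assume "i < dim_row T_rep" "j < dim_col T_rep"
    then have "i < 6" "j < 6" by (auto simp: T_rep_def)
    then show "mat_diag (2*3) (\<lambda>k. if k < 3 then 1 else of_nat p) $$ (i,j) = T_rep $$ (i,j)"
      by (elim less6_cases) (simp_all add: T_rep_def mat_diag_def)
  qed (auto simp: T_rep_def mat_diag_def)
  then show ?thesis by (simp add: hecke_T_def)
qed

lemma hecke_T2_eq:
  assumes i: "i \<in> {1,2,3}"
  shows "hecke_T2 3 p i = double_coset (GSp_plus 3) (Sp_int 3) (T2_rep i)"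
proof -
  let ?D = "mat_diag (2*3) (\<lambda>k. if k < 3 - i then 1 else if k < 3 then of_nat p
                          else if k < 3 + (3 - i) then (of_nat p)\<^sup>2 else of_nat p) :: rat mat"
  have "?D = T2_rep i"
  proof (rule eq_matI)
    fix k j assume "k < dim_row (T2_rep i)" "j < dim_col (T2_rep i)"
    then have "k < 6" "j < 6" by (auto simp: T2_rep_def split: if_splits)
    then show "?D $$ (k,j) = T2_rep i $$ (k,j)"
      using i by (elim less6_cases) (auto simp add: T2_rep_def mat_diag_def)
  qed (auto simp: T2_rep_def mat_diag_def)
  then show ?thesis by (simp add: hecke_T2_def)
qed

lemma hecke_p_eq: "hecke_p 3 p = double_coset (GSp_plus 3) (Sp_int 3) (T2_rep 3)"
proof -
  have "of_nat p \<cdot>\<^sub>m 1\<^sub>m (2*3) = T2_rep 3"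
  proof (rule eq_matI)
    fix i j assume "i < dim_row (T2_rep 3)" "j < dim_col (T2_rep 3)"
    then have "i < 6" "j < 6" by (auto simp: T2_rep_def)
    then show "(of_nat p \<cdot>\<^sub>m 1\<^sub>m (2*3)) $$ (i,j) = T2_rep 3 $$ (i,j)"
      by (elim less6_cases) (simp_all add: T2_rep_def)
  qed (auto simp: T2_rep_def)
  then show ?thesis by (simp add: hecke_p_def)
qed

text \<open>The extremal form has increasing exponents d 1, d 2, d 3, while in \<open>T2_rep\<close>
  they decrease; a Weyl element exchanging the coordinates 0 and 2 reverses them.\<close>

lemma drel_diag6_flip: "drel (diag6 a b c d e f) (diag6 c b a f e d)"
proof -
  have w: "root3 0 1 (-1) 0 \<in> Sp_int 3" "root3 0 (-1) 1 0 \<in> Sp_int 3"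
    by (rule Sp_int_generators; simp)+
  note m1 = mult6[OF root3_index(1) diag6_index(1)]
  note m2 = mult6[OF mult_carrier_mat[OF root3_index(1) diag6_index(1)] root3_index(1)]
  have "root3 0 1 (-1) 0 * diag6 a b c d e f * root3 0 (-1) 1 0 = diag6 c b a f e d"
  proof (rule eq_matI)
    fix i j assume "i < dim_row (diag6 c b a f e d)" "j < dim_col (diag6 c b a f e d)"
    then have "i < 6" "j < 6" by auto
    then show "(root3 0 1 (-1) 0 * diag6 a b c d e f * root3 0 (-1) 1 0) $$ (i,j) = diag6 c b a f e d $$ (i,j)"
      by (elim less6_cases) (simp_all add: m1 m2 del: index_mult_mat)
  qed auto
  then show ?thesis
    unfolding drel_def by (intro bexI[OF _ w(1)] bexI[OF _ w(2)]) (rule sym)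
qed

text \<open>The inequality 1 - d 1 \<le> d 1 of the extremal form forces the exponents (1,1,1), so
  there is a single double coset.\<close>

lemma int_sim_1_class:
  assumes M: "M \<in> int_sim p 1"
  shows "cs M \<in> dc T_rep"
proof -
  obtain N d where N: "extremal 1 d N" "drel M N" by (rule extremal_exists[OF M])
  note ed = extremal_diag[OF N(1)]
  have "d 3 \<le> 1" using tri_diag(6) N(1) by (auto simp: extremal_def)
  then have "d 1 = 1" "d 2 = 1" "d 3 = 1" using ed by auto
  then have "dmat 1 d = T_rep" by (simp add: dmat_def T_rep_def)
  then have "drel M T_rep" using drel_trans[OF N(2)] ed(1) int_sim_carrier[OF M] by simp
  then show ?thesis using mem_dc_iff[OF T_rep_int_sim M] drel_sym int_sim_carrier[OF M] by blast
qed

text \<open>For multiplier p^2 the chain 1 \<le> d 1 \<le> d 2 \<le> d 3 \<le> 2 has four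
  solutions.\<close>

lemma int_sim_2_class:
  assumes M: "M \<in> int_sim p 2"
  obtains i where "i \<in> {0,1,2,3}" "drel (T2_rep i) M"
proof -
  obtain N d where N: "extremal 2 d N" "drel M N" by (rule extremal_exists[OF M])
  note ed = extremal_diag[OF N(1)]
  have "d 3 \<le> 2" using tri_diag(6) N(1) by (auto simp: extremal_def)
  then have "d 1 = 2 \<and> d 2 = 2 \<and> d 3 = 2 \<or> d 1 = 1 \<and> d 2 = 2 \<and> d 3 = 2 \<or>
    d 1 = 1 \<and> d 2 = 1 \<and> d 3 = 2 \<or> d 1 = 1 \<and> d 2 = 1 \<and> d 3 = 1" using ed(2-4) by auto
  then have "\<exists>i\<in>{0,1,2,3}. diag6 (of_nat p ^ (2 - d 3)) (of_nat p ^ (2 - d 2)) (of_nat p ^ (2 - d 1))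
      (of_nat p ^ d 3) (of_nat p ^ d 2) (of_nat p ^ d 1) = T2_rep i"
    by (elim disjE) (auto simp: T2_rep_def)
  then obtain i where i: "i \<in> {0,1,2,3}" "drel (dmat 2 d) (T2_rep i)"
    using drel_diag6_flip unfolding dmat_def by metis
  have "drel M (T2_rep i)"
    using drel_trans[OF drel_trans[OF N(2) ed(1)] i(2)] int_sim_carrier[OF M] by blast
  then show thesis using that[OF i(1)] drel_sym int_sim_carrier[OF M] by blast
qed

text \<open>Rank modulo p at most r, expressed as congruence to a sum of r outer products. In this
  form upper bounds are proved by exhibiting vectors and invariance under integral multiplication is
  direct; lower bounds come from minors.\<close>

definition rank_le :: "nat \<Rightarrow> rat mat \<Rightarrow> bool" where
  "rank_le r M \<longleftrightarrow> (\<exists>x y. (\<forall>k i. x k i \<in> \<int> \<and> y k i \<in> \<int>) \<and>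
     (\<forall>i<6. \<forall>j<6. pmult 1 (M $$ (i,j) - (\<Sum>k<r. x k i * y k j))))"

lemma rank_leE:
  assumes "rank_le r M"
  obtains x y where "\<forall>k i. x k i \<in> \<int> \<and> y k i \<in> \<int>"
    "\<forall>i<6. \<forall>j<6. pmult 1 (M $$ (i,j) - (\<Sum>k<r. x k i * y k j))"
  using assms unfolding rank_le_def by (elim exE conjE)

lemma pmult_sum: "(\<And>i. i \<in> A \<Longrightarrow> pmult m (f i)) \<Longrightarrow> pmult m (\<Sum>i\<in>A. f i)"
  by (induction A rule: infinite_finite_induct) (auto intro: pmult_add)

lemma rank_le_mult_left:
  assumes "rank_le r M" and g: "g \<in> Sp_int 3" and M: "M \<in> carrier_mat 6 6"
  shows "rank_le r (g * M)"
proof -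
  obtain x y where xy: "\<forall>k i. x k i \<in> \<int> \<and> y k i \<in> \<int>"
    "\<forall>i<6. \<forall>j<6. pmult 1 (M $$ (i,j) - (\<Sum>k<r. x k i * y k j))"
    by (rule rank_leE[OF assms(1)])
  \<comment> \<open>The value 0 outside the range keeps \<open>x'\<close> integral at every index,
    as \<open>rank_le\<close> demands.\<close>
  define x' where "x' k i = (if i < 6 then \<Sum>l\<in>{0..<6}. g $$ (i,l) * x k l else 0)" for k i
  have "x' k i \<in> \<int>" for k i
    using xy(1) Sp_int_Ints[OF g] by (auto simp: x'_def intro!: Ints_sum Ints_mult)
  moreover have "pmult 1 ((g * M) $$ (i,j) - (\<Sum>k<r. x' k i * y k j))" if ij: "i < 6" "j < 6" for i j
  proof -
    have "(\<Sum>k<r. x' k i * y k j) = (\<Sum>k<r. \<Sum>l\<in>{0..<6}. g $$ (i,l) * x k l * y k j)"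
      using ij by (simp add: x'_def sum_distrib_right)
    also have "\<dots> = (\<Sum>l\<in>{0..<6}. \<Sum>k<r. g $$ (i,l) * x k l * y k j)" by (rule sum.swap)
    also have "\<dots> = (\<Sum>l\<in>{0..<6}. g $$ (i,l) * (\<Sum>k<r. x k l * y k j))"
      by (simp add: sum_distrib_left mult.assoc)
    finally have "(\<Sum>k<r. x' k i * y k j) = (\<Sum>l\<in>{0..<6}. g $$ (i,l) * (\<Sum>k<r. x k l * y k j))" .
    moreover have "(g * M) $$ (i,j) = (\<Sum>l\<in>{0..<6}. g $$ (i,l) * M $$ (l,j))"
      using ij M Sp_int_carrier[OF g] by (simp add: scalar_prod_def)
    ultimately have "(g * M) $$ (i,j) - (\<Sum>k<r. x' k i * y k j) =
        (\<Sum>l\<in>{0..<6}. (M $$ (l,j) - (\<Sum>k<r. x k l * y k j)) * g $$ (i,l))"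
      by (simp add: sum_subtractf algebra_simps)
    also have "pmult 1 \<dots>"
      using xy(2) ij Sp_int_Ints[OF g] by (intro pmult_sum pmult_mult) auto
    finally show ?thesis .
  qed
  ultimately show ?thesis unfolding rank_le_def using xy(1) by blast
qed

lemma rank_le_transpose:
  assumes "rank_le r M" "M \<in> carrier_mat 6 6"
  shows "rank_le r (transpose_mat M)"
proof -
  obtain x y where "\<forall>k i. x k i \<in> \<int> \<and> y k i \<in> \<int>"
    "\<forall>i<6. \<forall>j<6. pmult 1 (M $$ (i,j) - (\<Sum>k<r. x k i * y k j))"
    by (rule rank_leE[OF assms(1)])
  then show ?thesis
    unfolding rank_le_def using assms(2) by (intro exI[of _ y] exI[of _ x]) (auto simp: mult.commute)
qed

text \<open>Right multiplication is left multiplication after transposition, and transposition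
  merely exchanges the two families of vectors.\<close>

lemma rank_le_drel:
  assumes "rank_le r M" and rel: "drel M N" and M: "M \<in> carrier_mat 6 6"
  shows "rank_le r N"
proof -
  obtain g h where g: "g \<in> Sp_int 3" "h \<in> Sp_int 3" "N = g * M * h" using rel by (auto simp: drel_def)
  note c = Sp_int_carrier[OF g(1)] Sp_int_carrier[OF g(2)] M
  have gM: "g * M \<in> carrier_mat 6 6" using c by simp
  have "rank_le r (transpose_mat h * transpose_mat (g * M))"
    using c by (intro rank_le_mult_left rank_le_transpose assms Sp_int_transpose g) auto
  then have "rank_le r (transpose_mat (transpose_mat h * transpose_mat (g * M)))"
    using c by (intro rank_le_transpose) auto
  moreover have "transpose_mat (transpose_mat h * transpose_mat (g * M)) = N"
    using transpose_mult[OF gM c(2)] g(3) by (metis transpose_transpose)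
  ultimately show ?thesis by simp
qed

lemma pcong_mult:
  assumes "pmult 1 (a - a')" "pmult 1 (b - b')" "a \<in> \<int>" "b' \<in> \<int>"
  shows "pmult 1 (a * b - a' * b')"
proof -
  have "a * b - a' * b' = (b - b') * a + (a - a') * b'" by (simp add: algebra_simps)
  then show ?thesis using pmult_add[OF pmult_mult[OF assms(2,3)] pmult_mult[OF assms(1,4)]] by simp
qed

lemma pcong_diff: "pmult 1 (a - a') \<Longrightarrow> pmult 1 (b - b') \<Longrightarrow> pmult 1 (a - b - (a' - b'))"
  using pmult_diff[of 1 "a - a'" "b - b'"] by (simp add: algebra_simps)

lemma pcong_add: "pmult 1 (a - a') \<Longrightarrow> pmult 1 (b - b') \<Longrightarrow> pmult 1 (a + b - (a' + b'))"
  using pmult_add[of 1 "a - a'" "b - b'"] by (simp add: algebra_simps)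

definition minor2 :: "rat mat \<Rightarrow> nat \<Rightarrow> nat \<Rightarrow> nat \<Rightarrow> nat \<Rightarrow> rat" where
  "minor2 M i k j l = M $$ (i,j) * M $$ (k,l) - M $$ (i,l) * M $$ (k,j)"

lemma rank_le_0D:
  assumes "rank_le 0 M" "i < 6" "j < 6"
  shows "pmult 1 (M $$ (i,j))"
  using assms by (auto simp: rank_le_def)

text \<open>Minors are polynomials in the entries, hence compatible with congruence, and the 2 by 2
  minors of one outer product vanish identically. \<open>rank_le_2D\<close> is the same for two
  outer products and 3 by 3 minors.\<close>

lemma rank_le_1D:
  assumes "rank_le 1 M" and M: "integral_mat M" "M \<in> carrier_mat 6 6" and lt: "i < 6" "k < 6" "j < 6" "l < 6"
  shows "pmult 1 (minor2 M i k j l)"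
proof -
  obtain x y where xy: "\<forall>k i. x k i \<in> \<int> \<and> y k i \<in> \<int>"
    "\<forall>i<6. \<forall>j<6. pmult 1 (M $$ (i,j) - (\<Sum>k<(1::nat). x k i * y k j))"
    by (rule rank_leE[OF assms(1)])
  define u where "u i j = x 0 i * y 0 j" for i j :: nat
  have uI: "u i j \<in> \<int>" for i j unfolding u_def using xy(1) by (intro Ints_add Ints_mult) auto
  have MI: "M $$ (i,j) \<in> \<int>" if "i < 6" "j < 6" for i j using M that by (auto simp: integral_mat_def)
  have cg: "pmult 1 (M $$ (i,j) - u i j)" if "i < 6" "j < 6" for i j
    using xy(2)[rule_format, OF that] by (simp add: u_def)
  have "pmult 1 (minor2 M i k j l - (u i j * u k l - u i l * u k j))"
    unfolding minor2_def using lt by (intro pcong_diff pcong_mult cg uI MI)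
  then show ?thesis by (simp add: u_def)
qed

definition minor3 :: "rat mat \<Rightarrow> nat \<Rightarrow> nat \<Rightarrow> nat \<Rightarrow> nat \<Rightarrow> nat \<Rightarrow> nat \<Rightarrow> rat" where
  "minor3 M i k m j l n = M $$ (i,j) * (M $$ (k,l) * M $$ (m,n) - M $$ (k,n) * M $$ (m,l))
     - M $$ (i,l) * (M $$ (k,j) * M $$ (m,n) - M $$ (k,n) * M $$ (m,j))
     + M $$ (i,n) * (M $$ (k,j) * M $$ (m,l) - M $$ (k,l) * M $$ (m,j))"

lemma rank_le_2D:
  assumes "rank_le 2 M" and M: "integral_mat M" "M \<in> carrier_mat 6 6"
    and lt: "i < 6" "k < 6" "m < 6" "j < 6" "l < 6" "n < 6"
  shows "pmult 1 (minor3 M i k m j l n)"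
proof -
  obtain x y where xy: "\<forall>k i. x k i \<in> \<int> \<and> y k i \<in> \<int>"
    "\<forall>i<6. \<forall>j<6. pmult 1 (M $$ (i,j) - (\<Sum>k<(2::nat). x k i * y k j))"
    by (rule rank_leE[OF assms(1)])
  define u where "u i j = x 0 i * y 0 j + x 1 i * y 1 j" for i j :: nat
  have uI: "u i j \<in> \<int>" for i j unfolding u_def using xy(1) by (intro Ints_add Ints_mult) auto
  have MI: "M $$ (i,j) \<in> \<int>" if "i < 6" "j < 6" for i j using M that by (auto simp: integral_mat_def)
  have cg: "pmult 1 (M $$ (i,j) - u i j)" if "i < 6" "j < 6" for i j
    using xy(2)[rule_format, OF that] by (simp add: u_def numeral_2_eq_2)
  have "pmult 1 (minor3 M i k m j l n - (u i j * (u k l * u m n - u k n * u m l)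
     - u i l * (u k j * u m n - u k n * u m j) + u i n * (u k j * u m l - u k l * u m j)))"
    unfolding minor3_def using lt by (intro pcong_add pcong_diff pcong_mult cg uI MI Ints_diff Ints_mult)
  moreover have "u i j * (u k l * u m n - u k n * u m l)
     - u i l * (u k j * u m n - u k n * u m j) + u i n * (u k j * u m l - u k l * u m j) = 0"
    unfolding u_def by (simp add: algebra_simps)
  ultimately show ?thesis by simp
qed

lemma rank_le_I1:
  assumes "\<And>i. x i \<in> \<int>" "\<And>i. y i \<in> \<int>" "\<And>i j. i < 6 \<Longrightarrow> j < 6 \<Longrightarrow> pmult 1 (M $$ (i,j) - x i * y j)"
  shows "rank_le 1 M"
  unfolding rank_le_def using assms by (intro exI[of _ "\<lambda>_. x"] exI[of _ "\<lambda>_. y"]) auto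

lemma rank_le_I2:
  assumes "\<And>i. x i \<in> \<int>" "\<And>i. y i \<in> \<int>" "\<And>i. x' i \<in> \<int>" "\<And>i. y' i \<in> \<int>"
    "\<And>i j. i < 6 \<Longrightarrow> j < 6 \<Longrightarrow> pmult 1 (M $$ (i,j) - (x i * y j + x' i * y' j))"
  shows "rank_le 2 M"
  unfolding rank_le_def using assms
  by (intro exI[of _ "\<lambda>k. if k = 0 then x else x'"] exI[of _ "\<lambda>k. if k = 0 then y else y'"])
    (auto simp: numeral_2_eq_2)

lemma not_pmult_1_one: "\<not> pmult 1 1"
  using pmult_power_iff[of 1 0] by simp

lemma pmult_1_p: "pmult 1 (of_nat p)" "pmult 1 (of_nat p ^ 2)"
  using pmult_power_iff[of 1 1] pmult_power_iff[of 1 2] by simp_all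

lemma pmult_1_p': "pmult (Suc 0) (of_nat p)" "pmult (Suc 0) (of_nat p ^ 2)"
  using pmult_1_p by simp_all

lemma T2_rep_rank:
  "rank_le 2 (T2_rep 1)" "\<not> rank_le 1 (T2_rep 1)"
  "rank_le 1 (T2_rep 2)" "\<not> rank_le 0 (T2_rep 2)" "rank_le 0 (T2_rep 3)"
  "\<not> rank_le 2 (T2_rep 0)" "\<not> rank_le 1 (T2_rep 0)"
proof -
  note D = T2_rep_int_sim int_sim_carrier[OF T2_rep_int_sim]
  have I: "integral_mat (T2_rep i)" for i using D(1) by (simp add: int_sim_def)
  let ?x = "\<lambda>a i::nat. if i = a then 1 else (0::rat)"
  show "rank_le 2 (T2_rep 1)"
  proof (rule rank_le_I2[of "?x 0" "?x 0" "?x 1" "?x 1"])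
    fix i j :: nat assume "i < 6" "j < 6"
    then show "pmult 1 (T2_rep 1 $$ (i,j) - (?x 0 i * ?x 0 j + ?x 1 i * ?x 1 j))"
      by (elim less6_cases) (simp_all add: T2_rep_def pmult_1_p')
  qed auto
  show "rank_le 1 (T2_rep 2)"
  proof (rule rank_le_I1[of "?x 0" "?x 0"])
    fix i j :: nat assume "i < 6" "j < 6"
    then show "pmult 1 (T2_rep 2 $$ (i,j) - ?x 0 i * ?x 0 j)"
      by (elim less6_cases) (simp_all add: T2_rep_def pmult_1_p')
  qed auto
  show "rank_le 0 (T2_rep 3)"
  proof -
    have "pmult 1 (T2_rep 3 $$ (i,j))" if "i < 6" "j < 6" for i j
      using that by (elim less6_cases) (simp_all add: T2_rep_def pmult_1_p')
    then show ?thesis unfolding rank_le_def by (intro exI[of _ "\<lambda>_ _. 0"]) auto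
  qed
  have m: "minor2 (T2_rep 1) 0 1 0 1 = 1" "minor2 (T2_rep 0) 0 1 0 1 = 1" "minor3 (T2_rep 0) 0 1 2 0 1 2 = 1"
      "T2_rep 2 $$ (0,0) = 1"
    by (simp_all add: minor2_def minor3_def T2_rep_def)
  show "\<not> rank_le 1 (T2_rep 1)"
    using rank_le_1D[where M = "T2_rep 1" and i = 0 and k = 1 and j = 0 and l = 1, OF _ I D(2)]
    unfolding m using not_pmult_1_one by auto
  show "\<not> rank_le 1 (T2_rep 0)"
    using rank_le_1D[where M = "T2_rep 0" and i = 0 and k = 1 and j = 0 and l = 1, OF _ I D(2)]
    unfolding m using not_pmult_1_one by auto
  show "\<not> rank_le 0 (T2_rep 2)"
    using rank_le_0D[of "T2_rep 2" 0 0] unfolding m using not_pmult_1_one by auto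
  show "\<not> rank_le 2 (T2_rep 0)"
    using rank_le_2D[where M = "T2_rep 0" and i = 0 and k = 1 and m = 2 and j = 0 and l = 1 and n = 2, OF _ I D(2)]
    unfolding m using not_pmult_1_one by auto
qed

lemma rank_le_mono_0: "rank_le 0 M \<Longrightarrow> rank_le r M"
  unfolding rank_le_def by (elim exE, intro exI[of _ "\<lambda>_ _. 0"]) auto

text \<open>Every matrix with multiplier p^2 lies in one of four double cosets, of ranks 3, 2, 1, 0
  modulo p; being invariant, the rank decides which one.\<close>

lemma mem_dc_T2_rep_iff:
  assumes M: "M \<in> int_sim p 2"
  shows "cs M \<in> dc (T2_rep 2) \<longleftrightarrow> rank_le 1 M \<and> \<not> rank_le 0 M"
    "cs M \<in> dc (T2_rep 1) \<longleftrightarrow> rank_le 2 M \<and> \<not> rank_le 1 M"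
proof -
  note c = int_sim_carrier[OF M] int_sim_carrier[OF T2_rep_int_sim]
  obtain i where i: "i \<in> {0,1,2,3}" "drel (T2_rep i) M" by (rule int_sim_2_class[OF M])
  have eq: "rank_le r M \<longleftrightarrow> rank_le r (T2_rep j)" if "drel (T2_rep j) M" for r j
    using rank_le_drel[OF _ that c(2)] rank_le_drel[OF _ drel_sym[OF that c(2)] c(1)] by blast
  have r: "rank_le 2 (T2_rep 3)" "rank_le 1 (T2_rep 3)"
    using T2_rep_rank(5) rank_le_mono_0 by blast+
  note T = T2_rep_rank r
  show "cs M \<in> dc (T2_rep 2) \<longleftrightarrow> rank_le 1 M \<and> \<not> rank_le 0 M"
    unfolding mem_dc_iff[OF T2_rep_int_sim M]
  proof
    assume "drel (T2_rep 2) M"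
    then show "rank_le 1 M \<and> \<not> rank_le 0 M" using eq T by blast
  next
    assume "rank_le 1 M \<and> \<not> rank_le 0 M"
    then have "rank_le 1 (T2_rep i) \<and> \<not> rank_le 0 (T2_rep i)" using eq[OF i(2)] by blast
    then have "i = 2" using i(1) T by auto
    then show "drel (T2_rep 2) M" using i(2) by simp
  qed
  show "cs M \<in> dc (T2_rep 1) \<longleftrightarrow> rank_le 2 M \<and> \<not> rank_le 1 M"
    unfolding mem_dc_iff[OF T2_rep_int_sim M]
  proof
    assume "drel (T2_rep 1) M"
    then show "rank_le 2 M \<and> \<not> rank_le 1 M" using eq T by blast
  next
    assume "rank_le 2 M \<and> \<not> rank_le 1 M"
    then have "rank_le 2 (T2_rep i) \<and> \<not> rank_le 1 (T2_rep i)" using eq[OF i(2)] by blast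
    then have "i = 1" using i(1) T by auto
    then show "drel (T2_rep 1) M" using i(2) by simp
  qed
qed

end

section \<open>Weyl group invariance of the coset numbers\<close>

text \<open>A triple \<open>(A, x, B)\<close> stands for the upper triangular matrix with diagonal \<open>A, B\<close> and corner \<open>x\<close>; equivalence
  under \<open>SL\<^sub>2(\<int>) \<times> SL\<^sub>2(\<int>)\<close> is written as \<open>g L = L' g'\<close>.\<close>

definition sl2_equiv_by :: "rat \<times> rat \<times> rat \<times> rat \<Rightarrow> rat \<times> rat \<times> rat \<times> rat \<Rightarrow>
    rat \<times> rat \<times> rat \<Rightarrow> rat \<times> rat \<times> rat \<Rightarrow> bool" where
  "sl2_equiv_by = (\<lambda>(\<alpha>,\<beta>,\<gamma>,\<epsilon>) (\<alpha>',\<beta>',\<gamma>',\<epsilon>') (A,x,B) (A',x',B').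
     {\<alpha>,\<beta>,\<gamma>,\<epsilon>,\<alpha>',\<beta>',\<gamma>',\<epsilon>'} \<subseteq> \<int> \<and> \<alpha> * \<epsilon> - \<beta> * \<gamma> = 1 \<and> \<alpha>' * \<epsilon>' - \<beta>' * \<gamma>' = 1 \<and>
     \<alpha> * A = A' * \<alpha>' + x' * \<gamma>' \<and> \<alpha> * x + \<beta> * B = A' * \<beta>' + x' * \<epsilon>' \<and>
     \<gamma> * A = B' * \<gamma>' \<and> \<gamma> * x + \<epsilon> * B = B' * \<epsilon>')"

definition sl2_equiv :: "rat \<times> rat \<times> rat \<Rightarrow> rat \<times> rat \<times> rat \<Rightarrow> bool" where
  "sl2_equiv L L' \<longleftrightarrow> (\<exists>g g'. sl2_equiv_by g g' L L')"

lemma sl2_equivE: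
  assumes "sl2_equiv L L'"
  obtains \<alpha> \<beta> \<gamma> \<epsilon> \<alpha>' \<beta>' \<gamma>' \<epsilon>' where "sl2_equiv_by (\<alpha>,\<beta>,\<gamma>,\<epsilon>) (\<alpha>',\<beta>',\<gamma>',\<epsilon>') L L'"
proof -
  obtain g g' where *: "sl2_equiv_by g g' L L'" using assms unfolding sl2_equiv_def by (elim exE)
  show thesis
    by (cases g rule: prod_cases4; cases g' rule: prod_cases4) (use * that in blast)
qed

text \<open>Since g' has determinant 1, L' = g L g'^-1 can be written with the adjugate of g'. This
  is the form in which the block appears in a product of three matrices.\<close>

lemma sl2_equiv_by_conj:
  assumes "sl2_equiv_by (\<alpha>,\<beta>,\<gamma>,\<epsilon>) (\<alpha>',\<beta>',\<gamma>',\<epsilon>') (A,x,B) (A',x',B')"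
  shows "\<alpha> * A * \<epsilon>' - (\<alpha> * x + \<beta> * B) * \<gamma>' = A'"
    "(\<alpha> * x + \<beta> * B) * \<alpha>' - \<alpha> * A * \<beta>' = x'"
    "\<gamma> * A * \<epsilon>' - (\<gamma> * x + \<epsilon> * B) * \<gamma>' = 0"
    "(\<gamma> * x + \<epsilon> * B) * \<alpha>' - \<gamma> * A * \<beta>' = B'"
proof -
  have e: "\<alpha>' * \<epsilon>' = 1 + \<beta>' * \<gamma>'" "\<alpha> * A = A' * \<alpha>' + x' * \<gamma>'" "\<alpha> * x + \<beta> * B = A' * \<beta>' + x' * \<epsilon>'" "\<gamma> * A = B' * \<gamma>'"
     "\<gamma> * x + \<epsilon> * B = B' * \<epsilon>'"
    using assms by (simp_all add: sl2_equiv_by_def algebra_simps)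
  have m: "z * \<alpha>' * \<epsilon>' = z + z * (\<beta>' * \<gamma>')" for z
    using arg_cong[OF e(1), of "\<lambda>w. z * w"] by (simp add: algebra_simps)
  show "\<alpha> * A * \<epsilon>' - (\<alpha> * x + \<beta> * B) * \<gamma>' = A'"
    "(\<alpha> * x + \<beta> * B) * \<alpha>' - \<alpha> * A * \<beta>' = x'"
    "\<gamma> * A * \<epsilon>' - (\<gamma> * x + \<epsilon> * B) * \<gamma>' = 0"
    "(\<gamma> * x + \<epsilon> * B) * \<alpha>' - \<gamma> * A * \<beta>' = B'"
    unfolding e(2-5) using m[of A'] m[of x'] m[of B'] by (simp_all add: algebra_simps)
qed

lemma sl2_equiv_sym: "sl2_equiv L L' \<Longrightarrow> sl2_equiv L' L"
proof -
  obtain A x B A' x' B' where L: "L = (A,x,B)" "L' = (A',x',B')" by (cases L, cases L') auto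
  assume "sl2_equiv L L'"
  then obtain \<alpha> \<beta> \<gamma> \<epsilon> \<alpha>' \<beta>' \<gamma>' \<epsilon>' where
    *: "sl2_equiv_by (\<alpha>,\<beta>,\<gamma>,\<epsilon>) (\<alpha>',\<beta>',\<gamma>',\<epsilon>') (A,x,B) (A',x',B')"
    unfolding L by (rule sl2_equivE)
  then have e: "\<alpha> * \<epsilon> - \<beta> * \<gamma> = 1" "\<alpha>' * \<epsilon>' - \<beta>' * \<gamma>' = 1" "\<alpha> * A = A' * \<alpha>' + x' * \<gamma>'"
     "\<alpha> * x + \<beta> * B = A' * \<beta>' + x' * \<epsilon>'" "\<gamma> * A = B' * \<gamma>'" "\<gamma> * x + \<epsilon> * B = B' * \<epsilon>'"
    by (simp_all add: sl2_equiv_by_def)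
  have "sl2_equiv_by (\<epsilon>,-\<beta>,-\<gamma>,\<alpha>) (\<epsilon>',-\<beta>',-\<gamma>',\<alpha>') (A',x',B') (A,x,B)"
  proof -
    have "\<epsilon> * A' = A * \<epsilon>' + x * (-\<gamma>')" "\<epsilon> * x' + (-\<beta>) * B' = A * (-\<beta>') + x * \<alpha>'"
      "(-\<gamma>) * A' = B * (-\<gamma>')" "(-\<gamma>) * x' + \<alpha> * B' = B * \<alpha>'"
    proof -
      have x: "\<alpha> * x = A' * \<beta>' + x' * \<epsilon>' - \<beta> * B" "\<gamma> * x = B' * \<epsilon>' - \<epsilon> * B"
        using e(4,6) by (simp_all add: algebra_simps)
      \<comment> \<open>u and v form the first row of L g'^-1. As \<alpha> or \<gamma> may vanish,
        each is recovered from its multiples by \<alpha> and by \<gamma>, by Cramer's rule with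
        determinant 1.\<close>
      define u where "u = A * \<epsilon>' - x * \<gamma>'"
      define v where "v = x * \<alpha>' - A * \<beta>'"
      have "\<alpha> * u = (\<alpha> * A) * \<epsilon>' - (\<alpha> * x) * \<gamma>'" by (simp add: u_def algebra_simps)
      also have "\<dots> = A' * (\<alpha>' * \<epsilon>' - \<beta>' * \<gamma>') + \<beta> * B * \<gamma>'" unfolding e(3) x by (simp add: algebra_simps)
      finally have u1: "\<alpha> * u = A' + \<beta> * B * \<gamma>'" unfolding e(2) by simp
      have "\<gamma> * u = (\<gamma> * A) * \<epsilon>' - (\<gamma> * x) * \<gamma>'" by (simp add: u_def algebra_simps)
      then have u2: "\<gamma> * u = \<epsilon> * B * \<gamma>'" unfolding e(5) x by (simp add: algebra_simps)
      have "\<alpha> * v = (\<alpha> * x) * \<alpha>' - (\<alpha> * A) * \<beta>'" by (simp add: v_def algebra_simps)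
      also have "\<dots> = x' * (\<alpha>' * \<epsilon>' - \<beta>' * \<gamma>') - \<beta> * B * \<alpha>'" unfolding e(3) x by (simp add: algebra_simps)
      finally have v1: "\<alpha> * v = x' - \<beta> * B * \<alpha>'" unfolding e(2) by simp
      have "\<gamma> * v = (\<gamma> * x) * \<alpha>' - (\<gamma> * A) * \<beta>'" by (simp add: v_def algebra_simps)
      also have "\<dots> = B' * (\<alpha>' * \<epsilon>' - \<beta>' * \<gamma>') - \<epsilon> * B * \<alpha>'" unfolding e(5) x by (simp add: algebra_simps)
      finally have v2: "\<gamma> * v = B' - \<epsilon> * B * \<alpha>'" unfolding e(2) by simp
      have cramer: "w = \<epsilon> * P - \<beta> * Q" if "\<alpha> * w = P" "\<gamma> * w = Q" for w P Q
      proof -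
        have "\<epsilon> * P - \<beta> * Q = (\<alpha> * \<epsilon> - \<beta> * \<gamma>) * w" unfolding that[symmetric] by (simp add: algebra_simps)
        then show ?thesis unfolding e(1) by simp
      qed
      have cross: "\<alpha> * Q = \<gamma> * P" if "\<alpha> * w = P" "\<gamma> * w = Q" for w P Q
        unfolding that[symmetric] by simp
      have B: "B * c = \<alpha> * (\<epsilon> * B * c) - \<gamma> * (\<beta> * B * c)" for c
      proof -
        have "\<alpha> * (\<epsilon> * B * c) - \<gamma> * (\<beta> * B * c) = (\<alpha> * \<epsilon> - \<beta> * \<gamma>) * (B * c)" by (simp add: algebra_simps)
        then show ?thesis unfolding e(1) by simp
      qed
      show "\<epsilon> * A' = A * \<epsilon>' + x * (-\<gamma>')"
        using cramer[OF u1 u2] by (simp add: u_def algebra_simps)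
      show "\<epsilon> * x' + (-\<beta>) * B' = A * (-\<beta>') + x * \<alpha>'"
        using cramer[OF v1 v2] by (simp add: v_def algebra_simps)
      show "(-\<gamma>) * A' = B * (-\<gamma>')"
        using cross[OF u1 u2] B[of "\<gamma>'"] by (simp add: algebra_simps)
      show "(-\<gamma>) * x' + \<alpha> * B' = B * \<alpha>'"
        using cross[OF v1 v2] B[of "\<alpha>'"] by (simp add: algebra_simps)
    qed
    then show ?thesis using * by (simp add: sl2_equiv_by_def algebra_simps)
  qed
  then show ?thesis unfolding sl2_equiv_def L by blast
qed

lemma sl2_equivI:
  assumes "{\<alpha>,\<beta>,\<gamma>,\<epsilon>,\<alpha>',\<beta>',\<gamma>',\<epsilon>'} \<subseteq> \<int>" "\<alpha> * \<epsilon> - \<beta> * \<gamma> = 1" "\<alpha>' * \<epsilon>' - \<beta>' * \<gamma>' = 1"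
    "\<alpha> * A = A' * \<alpha>' + x' * \<gamma>'" "\<alpha> * x + \<beta> * B = A' * \<beta>' + x' * \<epsilon>'" "\<gamma> * A = B' * \<gamma>'" "\<gamma> * x + \<epsilon> * B = B' * \<epsilon>'"
  shows "sl2_equiv (A,x,B) (A',x',B')"
  unfolding sl2_equiv_def sl2_equiv_by_def using assms
  by (intro exI[of _ "(\<alpha>,\<beta>,\<gamma>,\<epsilon>)"] exI[of _ "(\<alpha>',\<beta>',\<gamma>',\<epsilon>')"]) simp

lemma sl2_equiv_shift_left: "t \<in> \<int> \<Longrightarrow> sl2_equiv (A,x,B) (A,x + t * B,B)"
  by (rule sl2_equivI[of 1 t 0 1 1 0 0 1]) simp_all

lemma sl2_equiv_shift_right: "t \<in> \<int> \<Longrightarrow> sl2_equiv (A,x,B) (A,x + t * A,B)"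
  by (rule sl2_equivI[of 1 0 0 1 1 "-t" 0 1]) simp_all

lemma sl2_equiv_swap: "sl2_equiv (A,0,B) (B,0,A)"
  by (rule sl2_equivI[of 0 "-1" 1 0 0 "-1" 1 0]) simp_all

text \<open>As u and a are coprime, the block has content q, and its determinant is q^2 a b; so its
  elementary divisors are q and q a b.\<close>

lemma sl2_equiv_coprime:
  assumes "{q,a,b,u,y,z} \<subseteq> \<int>" "u * y + a * z = 1"
  shows "sl2_equiv (q * a, q * u, q * b) (q, 0, q * (a * b))"
proof (rule sl2_equivI[of 1 0 "- (b * y)" 1 a u "-y" z])
  have az: "a * z = 1 - u * y" using assms(2) by (simp add: algebra_simps)
  have "- (b * y) * (q * u) + 1 * (q * b) = q * b * (1 - u * y)" by (simp add: algebra_simps)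
  also have "\<dots> = q * (a * b) * z" unfolding az[symmetric] by (simp add: ac_simps)
  finally show "- (b * y) * (q * u) + 1 * (q * b) = q * (a * b) * z" .
qed (use assms in \<open>auto simp: algebra_simps\<close>)

section \<open>Symmetry of sums over the corner of a 2 by 2 block\<close>

lemma sum_periodic:
  fixes f :: "nat \<Rightarrow> nat"
  assumes "\<And>x. f (x + m) = f x"
  shows "(\<Sum>x<k * m. f x) = k * (\<Sum>x<m. f x)"
proof -
  have *: "f (x + i * m) = f x" for x i
    by (induction i) (use assms[of "x + _ * m"] in \<open>simp_all add: ac_simps\<close>)
  have "(\<Sum>x<k * m. f x) = (\<Sum>i<k. sum f {i * m..<i * m + m})" by (rule sum.nat_group[symmetric])
  also have "\<dots> = (\<Sum>i<k. \<Sum>x<m. f x)"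
  proof (rule sum.cong[OF refl])
    fix i
    have "sum f {i * m..<i * m + m} = (\<Sum>x\<in>{0..<m}. f (x + i * m))"
      using sum.shift_bounds_nat_ivl[of f 0 "i * m" m] by (simp add: add.commute)
    then show "sum f {i * m..<i * m + m} = (\<Sum>x<m. f x)" by (simp add: * lessThan_atLeast0)
  qed
  finally show ?thesis by simp
qed

context fixed_prime
begin

text \<open>Up to SL2 x SL2 the block with diagonal p^a, p^b and corner x depends only on a + b and
  the gcd of its entries, so F is unchanged when a and b are exchanged and x is kept. If a \<le> b,
  F has period p^a in x, and the sum over p^b values is p^(b - a) times the sum over p^a values; the
  factors p^a and p^b balance this.\<close>

lemma block_sum_symmetric:
  fixes F :: "nat \<Rightarrow> int \<Rightarrow> nat \<Rightarrow> nat"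
  assumes F: "\<And>a x b a' x' b'. a + b = s \<Longrightarrow> a' + b' = s \<Longrightarrow>
      sl2_equiv (of_nat p ^ a, of_int x, of_nat p ^ b) (of_nat p ^ a', of_int x', of_nat p ^ b') \<Longrightarrow> F a x b = F a' x' b'"
    and s: "a + b = s"
  shows "(\<Sum>x<p ^ b. F a (int x) b) * p ^ a = (\<Sum>x<p ^ a. F b (int x) a) * p ^ b"
proof -
  have left: "F a (x + t * int p ^ b) b = F a x b" if "a + b = s" for a b x t
    using F[OF that that, of x "x + t * int p ^ b"] sl2_equiv_shift_left[of "of_int t" "of_nat p ^ a" "of_int x" "of_nat p ^ b"]
    by simp
  have right: "F a (x + t * int p ^ a) b = F a x b" if "a + b = s" for a b x t
    using F[OF that that, of x "x + t * int p ^ a"] sl2_equiv_shift_right[of "of_int t" "of_nat p ^ a" "of_int x" "of_nat p ^ b"]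
    by simp
  have swap0: "F a 0 b = F b 0 a" if "a + b = s" for a b
    using F[of a b b a 0 0] that sl2_equiv_swap[of "of_nat p ^ a" "of_nat p ^ b"] by simp
  have swap: "F a x b = F b x a" if ab: "a + b = s" for a b x
  proof -
    have ba: "b + a = s" using ab by simp
    \<comment> \<open>If p^a or p^b divides x, the corner can be shifted to 0. Otherwise x has
      valuation g below a and b, and both blocks are equivalent to diag(p^g, p^(a + b - g)).\<close>
    consider "int p ^ a dvd x" | "int p ^ b dvd x" | "\<not> int p ^ a dvd x" "\<not> int p ^ b dvd x" by blast
    then show ?thesis
    proof cases
      case 1
      then obtain t where "x = t * int p ^ a" by (auto elim: dvdE simp: mult.commute)
      then have "F a x b = F a 0 b" "F b x a = F b 0 a"
        using right[OF ab, of 0 t] left[OF ba, of 0 t] by simp_all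
      then show ?thesis using swap0[OF ab] by simp
    next
      case 2
      then obtain t where "x = t * int p ^ b" by (auto elim: dvdE simp: mult.commute)
      then have "F a x b = F a 0 b" "F b x a = F b 0 a"
        using left[OF ab, of 0 t] right[OF ba, of 0 t] by simp_all
      then show ?thesis using swap0[OF ab] by simp
    next
      case 3
      have x0: "x \<noteq> 0" using 3 by auto
      have pp: "prime (int p)" using prime_p by simp
      define g where "g = multiplicity (int p) x"
      obtain u where u: "x = int p ^ g * u" "\<not> int p dvd u"
        using multiplicity_decompose'[of x "int p"] x0 pp unfolding g_def by (metis not_prime_unit)
      have ga: "g < a" "g < b"
        using 3 multiplicity_dvd'[of _ "int p" x] unfolding g_def by (meson not_less)+
      have cop: "coprime u (int p ^ k)" for k
        using prime_imp_coprime[OF pp u(2)] by (simp add: coprime_commute)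
      have F0: "F a x b = F g 0 (a + b - g)" if ab: "a + b = s" "g < a" "g < b" for a b
      proof -
        obtain y z where yz: "y * u + z * int p ^ (a - g) = 1"
          using cop[of "a - g"] by (metis coprime_iff_gcd_eq_1 bezout_int)
        have "of_int (y * u + z * int p ^ (a - g)) = (1::rat)" unfolding yz by simp
        then have "(of_int u :: rat) * of_int y + of_nat p ^ (a - g) * of_int z = 1" by (simp add: mult.commute)
        then have "sl2_equiv (of_nat p ^ g * of_nat p ^ (a - g), of_nat p ^ g * of_int u, of_nat p ^ g * of_nat p ^ (b - g))
           (of_nat p ^ g, 0, of_nat p ^ g * (of_nat p ^ (a - g) * of_nat p ^ (b - g)))"
          by (intro sl2_equiv_coprime) auto
        moreover have "of_nat p ^ g * of_nat p ^ (a - g) = (of_nat p ^ a :: rat)"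
          "of_nat p ^ g * of_nat p ^ (b - g) = (of_nat p ^ b :: rat)"
          "of_nat p ^ g * (of_nat p ^ (a - g) * of_nat p ^ (b - g)) = (of_nat p ^ (a + b - g) :: rat)"
          using that by (simp_all flip: power_add)
        ultimately show ?thesis using F[of a b g "a + b - g" x 0] that u(1) by simp
      qed
      show ?thesis using F0[OF ab ga] F0[OF ba ga(2,1)] by (simp add: add.commute)
    qed
  qed
  have main: "(\<Sum>x<p ^ b. F a (int x) b) * p ^ a = (\<Sum>x<p ^ a. F b (int x) a) * p ^ b" if ab: "a + b = s" "a \<le> b" for a b
  proof -
    have "F a (int (x + p ^ a)) b = F a (int x) b" for x
      using right[OF ab(1), of "int x" 1] by simp
    then have "(\<Sum>x<p ^ (b - a) * p ^ a. F a (int x) b) = p ^ (b - a) * (\<Sum>x<p ^ a. F a (int x) b)"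
      by (rule sum_periodic)
    moreover have pw: "p ^ (b - a) * p ^ a = p ^ b" using ab(2) by (simp flip: power_add)
    ultimately have "(\<Sum>x<p ^ b. F a (int x) b) * p ^ a = (p ^ (b - a) * p ^ a) * (\<Sum>x<p ^ a. F a (int x) b)" by simp
    also have "\<dots> = (\<Sum>x<p ^ a. F b (int x) a) * p ^ b"
      unfolding pw using swap[OF ab(1)] by simp
    finally show ?thesis .
  qed
  show ?thesis
    using main[OF s] main[of b a] s by (cases "a \<le> b") (simp_all add: add.commute)
qed

section \<open>Moving a diagonal block by a simple root\<close>

definition root_elt :: "nat \<Rightarrow> rat \<Rightarrow> rat \<Rightarrow> rat \<Rightarrow> rat \<Rightarrow> rat mat" where
  "root_elt k = (if k = 0 then root0 else if k = 1 then root1 else root2)"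

definition root_pos :: "nat \<Rightarrow> nat \<times> nat" where
  "root_pos k = (if k = 0 then (0,3) else if k = 1 then (3,4) else (4,5))"

text \<open>The exponents obtained from \<open>d\<close> by giving the \<open>2 \<times> 2\<close> diagonal block at the \<open>k\<close>-th simple root the
  diagonal \<open>p\<^sup>a, p\<^sup>b\<close>; for \<open>k = 0\<close> this makes sense only for \<open>a + b = \<delta>\<close>.\<close>

definition set_exps :: "nat \<Rightarrow> (nat \<Rightarrow> nat) \<Rightarrow> nat \<Rightarrow> nat \<Rightarrow> (nat \<Rightarrow> nat)" where
  "set_exps k d a b = (if k = 0 then d(1 := b) else if k = 1 then d(1 := a, 2 := b) else d(2 := a, 3 := b))"

lemma root_elt_Sp_int:
  "a \<in> \<int> \<Longrightarrow> b \<in> \<int> \<Longrightarrow> c \<in> \<int> \<Longrightarrow> d \<in> \<int> \<Longrightarrow> a * d - b * c = 1 \<Longrightarrow> root_elt k a b c d \<in> Sp_int 3"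
  using Sp_int_generators[of a b c d] by (simp add: root_elt_def)

text \<open>For a simple root the two factors mix only the rows and columns of one 2 by 2 diagonal
  block and, for k > 0, of its dual block in A. The matrix stays triangular outside, and the block
  becomes g L g'^-1. For k = 0 the block has diagonal p^(\<delta> - d 1), p^(d 1), whence a + b =
  \<delta>.\<close>

lemma tri_block_move:
  assumes M: "tri p \<delta> (set_exps k d a b) M" and x: "M $$ root_pos k = x" and k: "k < 3"
    and s: "k = 0 \<Longrightarrow> a + b = \<delta>" "k = 0 \<Longrightarrow> a' + b' = \<delta>"
    and eq: "sl2_equiv_by (\<alpha>,\<beta>,\<gamma>,\<epsilon>) (\<alpha>',\<beta>',\<gamma>',\<epsilon>') (of_nat p ^ a, x, of_nat p ^ b) (of_nat p ^ a', x', of_nat p ^ b')"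
  shows "tri p \<delta> (set_exps k d a' b') (root_elt k \<alpha> \<beta> \<gamma> \<epsilon> * M * root_elt k \<epsilon>' (-\<beta>') (-\<gamma>') \<alpha>')"
    "(root_elt k \<alpha> \<beta> \<gamma> \<epsilon> * M * root_elt k \<epsilon>' (-\<beta>') (-\<gamma>') \<alpha>') $$ root_pos k = x'"
proof -
  have I: "\<alpha> \<in> \<int>" "\<beta> \<in> \<int>" "\<gamma> \<in> \<int>" "\<epsilon> \<in> \<int>" "\<alpha>' \<in> \<int>" "\<beta>' \<in> \<int>" "\<gamma>' \<in> \<int>" "\<epsilon>' \<in> \<int>"
    and e: "\<alpha> * \<epsilon> - \<beta> * \<gamma> = 1" "\<alpha>' * \<epsilon>' - \<beta>' * \<gamma>' = 1" "\<alpha> * of_nat p ^ a = of_nat p ^ a' * \<alpha>' + x' * \<gamma>'"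
     "\<alpha> * x + \<beta> * of_nat p ^ b = of_nat p ^ a' * \<beta>' + x' * \<epsilon>'" "\<gamma> * of_nat p ^ a = of_nat p ^ b' * \<gamma>'"
     "\<gamma> * x + \<epsilon> * of_nat p ^ b = of_nat p ^ b' * \<epsilon>'"
    using eq by (simp_all add: sl2_equiv_by_def)
  let ?N = "root_elt k \<alpha> \<beta> \<gamma> \<epsilon> * M * root_elt k \<epsilon>' (-\<beta>') (-\<gamma>') \<alpha>'"
  have g: "root_elt k \<alpha> \<beta> \<gamma> \<epsilon> \<in> Sp_int 3" by (rule root_elt_Sp_int) fact+
  have "\<epsilon>' * \<alpha>' - (-\<beta>') * (-\<gamma>') = 1" using e(2) by (simp add: algebra_simps)
  then have h: "root_elt k \<epsilon>' (-\<beta>') (-\<gamma>') \<alpha>' \<in> Sp_int 3" using I by (intro root_elt_Sp_int) auto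
  have NI: "?N \<in> int_sim p \<delta>" by (rule int_sim_mult_right[OF int_sim_mult_left[OF g triD(1)[OF M]] h])
  note c = Sp_int_carrier[OF g] tri_carrier[OF M] Sp_int_carrier[OF h]
  note t = triD[OF M] and td = tri_diag[OF M]
  note r = sl2_equiv_by_conj[OF eq]
  note ts = t(2-13,17-) td(1-3)[simplified]
  consider "k = 0" | "k = 1" | "k = 2" using k by linarith
  then have "tri p \<delta> (set_exps k d a' b') ?N \<and> ?N $$ root_pos k = x'"
  proof cases
    case 1
    have dd: "M $$ (0,0) = of_nat p ^ a" "M $$ (3,3) = of_nat p ^ b" "M $$ (0,3) = x"
      "M $$ (4,4) = of_nat p ^ d 2" "M $$ (5,5) = of_nat p ^ d 3"
      using td(7) t(14-16) x s(1) 1 by (auto simp: set_exps_def root_pos_def)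
    have N: "?N = root0 \<alpha> \<beta> \<gamma> \<epsilon> * M * root0 \<epsilon>' (-\<beta>') (-\<gamma>') \<alpha>'"
      using 1 by (simp add: root_elt_def)
    note m = mult6[OF root0_index(1) tri_carrier[OF M]] mult6[OF mult_carrier_mat[OF root0_index(1) tri_carrier[OF M]] root0_index(1)]
    have n: "?N $$ (0,0) = \<alpha> * of_nat p ^ a * \<epsilon>' - (\<alpha> * x + \<beta> * of_nat p ^ b) * \<gamma>'"
      "?N $$ (0,3) = (\<alpha> * x + \<beta> * of_nat p ^ b) * \<alpha>' - \<alpha> * of_nat p ^ a * \<beta>'"
      "?N $$ (3,0) = \<gamma> * of_nat p ^ a * \<epsilon>' - (\<gamma> * x + \<epsilon> * of_nat p ^ b) * \<gamma>'"
      "?N $$ (3,3) = (\<gamma> * x + \<epsilon> * of_nat p ^ b) * \<alpha>' - \<gamma> * of_nat p ^ a * \<beta>'"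
      unfolding N by (simp_all add: m ts dd algebra_simps del: index_mult_mat)
    have z: "?N $$ (3,1) = 0" "?N $$ (3,2) = 0" "?N $$ (4,0) = 0" "?N $$ (4,1) = 0" "?N $$ (4,2) = 0" "?N $$ (4,3) = 0" "?N $$ (5,0) = 0" "?N $$ (5,1) = 0" "?N $$ (5,2) = 0" "?N $$ (5,3) = 0" "?N $$ (5,4) = 0"
      and z': "?N $$ (4,4) = of_nat p ^ d 2" "?N $$ (5,5) = of_nat p ^ d 3"
      unfolding N by (simp_all add: m ts dd del: index_mult_mat)
    show ?thesis
      unfolding tri_def using NI n[unfolded r] z z' 1
      by (simp add: root_pos_def set_exps_def del: index_mult_mat)
  next
    case 2
    have dd: "M $$ (3,3) = of_nat p ^ a" "M $$ (4,4) = of_nat p ^ b" "M $$ (3,4) = x" "M $$ (5,5) = of_nat p ^ d 3"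
      using t(14-16) x 2 by (auto simp: set_exps_def root_pos_def)
    have N: "?N = root1 \<alpha> \<beta> \<gamma> \<epsilon> * M * root1 \<epsilon>' (-\<beta>') (-\<gamma>') \<alpha>'"
      using 2 by (simp add: root_elt_def)
    note m = mult6[OF root1_index(1) tri_carrier[OF M]] mult6[OF mult_carrier_mat[OF root1_index(1) tri_carrier[OF M]] root1_index(1)]
    have n: "?N $$ (3,3) = \<alpha> * of_nat p ^ a * \<epsilon>' - (\<alpha> * x + \<beta> * of_nat p ^ b) * \<gamma>'"
      "?N $$ (3,4) = (\<alpha> * x + \<beta> * of_nat p ^ b) * \<alpha>' - \<alpha> * of_nat p ^ a * \<beta>'"
      "?N $$ (4,3) = \<gamma> * of_nat p ^ a * \<epsilon>' - (\<gamma> * x + \<epsilon> * of_nat p ^ b) * \<gamma>'"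
      "?N $$ (4,4) = (\<gamma> * x + \<epsilon> * of_nat p ^ b) * \<alpha>' - \<gamma> * of_nat p ^ a * \<beta>'"
      unfolding N by (simp_all add: m ts dd algebra_simps del: index_mult_mat)
    have z: "?N $$ (3,0) = 0" "?N $$ (3,1) = 0" "?N $$ (3,2) = 0" "?N $$ (4,0) = 0" "?N $$ (4,1) = 0" "?N $$ (4,2) = 0" "?N $$ (5,0) = 0" "?N $$ (5,1) = 0" "?N $$ (5,2) = 0" "?N $$ (5,3) = 0" "?N $$ (5,4) = 0"
      and z': "?N $$ (5,5) = of_nat p ^ d 3"
      unfolding N by (simp_all add: m ts dd del: index_mult_mat)
    show ?thesis
      unfolding tri_def using NI n[unfolded r] z z' 2
      by (simp add: root_pos_def set_exps_def del: index_mult_mat)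
  next
    case 3
    have dd: "M $$ (4,4) = of_nat p ^ a" "M $$ (5,5) = of_nat p ^ b" "M $$ (4,5) = x" "M $$ (3,3) = of_nat p ^ d 1"
      using t(14-16) x 3 by (auto simp: set_exps_def root_pos_def)
    have N: "?N = root2 \<alpha> \<beta> \<gamma> \<epsilon> * M * root2 \<epsilon>' (-\<beta>') (-\<gamma>') \<alpha>'"
      using 3 by (simp add: root_elt_def)
    note m = mult6[OF root2_index(1) tri_carrier[OF M]] mult6[OF mult_carrier_mat[OF root2_index(1) tri_carrier[OF M]] root2_index(1)]
    have n: "?N $$ (4,4) = \<alpha> * of_nat p ^ a * \<epsilon>' - (\<alpha> * x + \<beta> * of_nat p ^ b) * \<gamma>'"
      "?N $$ (4,5) = (\<alpha> * x + \<beta> * of_nat p ^ b) * \<alpha>' - \<alpha> * of_nat p ^ a * \<beta>'"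
      "?N $$ (5,4) = \<gamma> * of_nat p ^ a * \<epsilon>' - (\<gamma> * x + \<epsilon> * of_nat p ^ b) * \<gamma>'"
      "?N $$ (5,5) = (\<gamma> * x + \<epsilon> * of_nat p ^ b) * \<alpha>' - \<gamma> * of_nat p ^ a * \<beta>'"
      unfolding N by (simp_all add: m ts dd algebra_simps del: index_mult_mat)
    have z: "?N $$ (3,0) = 0" "?N $$ (3,1) = 0" "?N $$ (3,2) = 0" "?N $$ (4,0) = 0" "?N $$ (4,1) = 0" "?N $$ (4,2) = 0" "?N $$ (4,3) = 0" "?N $$ (5,0) = 0" "?N $$ (5,1) = 0" "?N $$ (5,2) = 0" "?N $$ (5,3) = 0"
      and z': "?N $$ (3,3) = of_nat p ^ d 1"
      unfolding N by (simp_all add: m ts dd del: index_mult_mat)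
    show ?thesis
      unfolding tri_def using NI n[unfolded r] z z' 3
      by (simp add: root_pos_def set_exps_def del: index_mult_mat)
  qed
  then show "tri p \<delta> (set_exps k d a' b') ?N" "?N $$ root_pos k = x'" by blast+
qed

definition translation_closed :: "nat \<Rightarrow> rat mat set set \<Rightarrow> bool" where
  "translation_closed \<delta> S \<longleftrightarrow> finite S \<and> (\<forall>M \<in> int_sim p \<delta>. \<forall>h \<in> Sp_int 3. cs M \<in> S \<longrightarrow> cs (M * h) \<in> S)"

lemma translation_closedD:
  "translation_closed \<delta> S \<Longrightarrow> M \<in> int_sim p \<delta> \<Longrightarrow> h \<in> Sp_int 3 \<Longrightarrow> cs M \<in> S \<Longrightarrow> cs (M * h) \<in> S"
  unfolding translation_closed_def by blast

definition block_cosets :: "nat \<Rightarrow> rat mat set set \<Rightarrow> nat \<Rightarrow> (nat \<Rightarrow> nat) \<Rightarrow> rat \<Rightarrow> rat mat set set" where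
  "block_cosets \<delta> S k d x = {C \<in> S. \<exists>M. tri p \<delta> d M \<and> M $$ root_pos k = x \<and> C = cs M}"

definition tri_cosets :: "nat \<Rightarrow> rat mat set set \<Rightarrow> (nat \<Rightarrow> nat) \<Rightarrow> rat mat set set" where
  "tri_cosets \<delta> S d = {C \<in> S. \<exists>M. tri p \<delta> d M \<and> C = cs M}"

lemma cs_mult_left:
  assumes "M \<in> int_sim p \<delta>" "g \<in> Sp_int 3"
  shows "cs (g * M) = cs M"
  using cs_lrel_iff[OF assms(1) int_sim_mult_left[OF assms(2,1)]] lrelI[OF assms(2), of M] by simp

lemma card_translate_le:
  assumes fin: "finite Y" and h: "h \<in> Sp_int 3"
    and X: "\<And>C. C \<in> X \<Longrightarrow> \<exists>M \<in> int_sim p \<delta>. C = cs M \<and> cs (M * h) \<in> Y"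
  shows "card X \<le> card Y"
proof (rule card_inj_on_le[OF _ _ fin])
  let ?f = "\<lambda>C. C #>\<^bsub>GSp_plus 3\<^esub> h"
  have hG: "h \<in> carrier (GSp_plus 3)" using h Sp_int_subset by blast
  show "inj_on ?f X"
  proof (rule inj_onI)
    fix C D assume CD: "C \<in> X" "D \<in> X" "?f C = ?f D"
    have rc: "E \<in> rcosets\<^bsub>GSp_plus 3\<^esub> (Sp_int 3)" if E: "E \<in> X" for E
    proof -
      obtain M where M: "M \<in> int_sim p \<delta>" "E = cs M" using X[OF E] by blast
      show ?thesis unfolding M(2) by (rule group.rcosetsI[OF group_GSp_plus Sp_int_subset int_sim_GSp[OF M(1)]])
    qed
    show "C = D"
      by (rule trans[OF Sp.rcosets_translate_cancel(1)[OF rc[OF CD(1)] hG, symmetric]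
            trans[OF arg_cong[where f = "\<lambda>X. X #>\<^bsub>GSp_plus 3\<^esub> inv\<^bsub>GSp_plus 3\<^esub> h", OF CD(3)]
              Sp.rcosets_translate_cancel(1)[OF rc[OF CD(2)] hG]]])
  qed
  show "?f ` X \<subseteq> Y"
  proof (rule image_subsetI)
    fix C assume "C \<in> X"
    then obtain M where M: "M \<in> int_sim p \<delta>" "C = cs M" "cs (M * h) \<in> Y" using X by blast
    show "?f C \<in> Y" unfolding M(2) cs_translate[OF int_sim_GSp[OF M(1)] hG] by (rule M(3))
  qed
qed

text \<open>Right translation by h is injective on cosets and carries the block L to L'; the left
  factor g that restores triangular form does not change the coset. The opposite inequality will
  come from symmetry of \<open>sl2_equiv\<close>.\<close>

lemma card_block_cosets_le:
  assumes S: "translation_closed \<delta> S" and k: "k < 3"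
    and s: "k = 0 \<Longrightarrow> a + b = \<delta>" "k = 0 \<Longrightarrow> a' + b' = \<delta>"
    and eq: "sl2_equiv (of_nat p ^ a, x, of_nat p ^ b) (of_nat p ^ a', x', of_nat p ^ b')"
  shows "card (block_cosets \<delta> S k (set_exps k d a b) x) \<le> card (block_cosets \<delta> S k (set_exps k d a' b') x')"
proof -
  obtain \<alpha> \<beta> \<gamma> \<epsilon> \<alpha>' \<beta>' \<gamma>' \<epsilon>' where
    eq: "sl2_equiv_by (\<alpha>,\<beta>,\<gamma>,\<epsilon>) (\<alpha>',\<beta>',\<gamma>',\<epsilon>') (of_nat p ^ a, x, of_nat p ^ b) (of_nat p ^ a', x', of_nat p ^ b')"
    using eq by (rule sl2_equivE)
  define h where "h = root_elt k \<epsilon>' (-\<beta>') (-\<gamma>') \<alpha>'"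
  define g where "g = root_elt k \<alpha> \<beta> \<gamma> \<epsilon>"
  have g: "g \<in> Sp_int 3" unfolding g_def using eq by (intro root_elt_Sp_int) (auto simp: sl2_equiv_by_def)
  have h: "h \<in> Sp_int 3" unfolding h_def using eq by (intro root_elt_Sp_int) (auto simp: sl2_equiv_by_def algebra_simps)
  show ?thesis
  proof (rule card_translate_le[OF _ h])
    show "finite (block_cosets \<delta> S k (set_exps k d a' b') x')"
      using S by (simp add: translation_closed_def block_cosets_def)
    fix C assume "C \<in> block_cosets \<delta> S k (set_exps k d a b) x"
    then obtain M where M: "C \<in> S" "tri p \<delta> (set_exps k d a b) M" "M $$ root_pos k = x" "C = cs M"
      by (auto simp: block_cosets_def)
    note MI = triD(1)[OF M(2)]
    have N: "tri p \<delta> (set_exps k d a' b') (g * M * h)" "(g * M * h) $$ root_pos k = x'"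
      unfolding g_def h_def by (rule tri_block_move[OF M(2,3) k _ _ eq]; use s in blast)+
    have as: "g * M * h = g * (M * h)"
      by (rule mult6_assoc[OF Sp_int_carrier[OF g] int_sim_carrier[OF MI] Sp_int_carrier[OF h]])
    have e: "cs (g * M * h) = cs (M * h)" unfolding as by (rule cs_mult_left[OF int_sim_mult_right[OF MI h] g])
    have "cs (M * h) \<in> S"
      by (rule translation_closedD[OF S MI h M(1)[unfolded M(4)]])
    then have "cs (M * h) \<in> block_cosets \<delta> S k (set_exps k d a' b') x'"
      unfolding block_cosets_def by (intro CollectI conjI exI[of _ "g * M * h"] N e[symmetric])
    then show "\<exists>M \<in> int_sim p \<delta>. C = cs M \<and> cs (M * h) \<in> block_cosets \<delta> S k (set_exps k d a' b') x'"
      using MI M(4) by (intro bexI[of _ M] conjI)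
  qed
qed

lemma card_block_cosets_eq:
  assumes "translation_closed \<delta> S" "k < 3" "k = 0 \<Longrightarrow> a + b = \<delta>" "k = 0 \<Longrightarrow> a' + b' = \<delta>"
    "sl2_equiv (of_nat p ^ a, x, of_nat p ^ b) (of_nat p ^ a', x', of_nat p ^ b')"
  shows "card (block_cosets \<delta> S k (set_exps k d a b) x) = card (block_cosets \<delta> S k (set_exps k d a' b') x')"
proof (rule le_antisym)
  show "card (block_cosets \<delta> S k (set_exps k d a b) x) \<le> card (block_cosets \<delta> S k (set_exps k d a' b') x')"
    by (rule card_block_cosets_le[OF assms(1,2) _ _ assms(5)]) (fact assms(3,4))+
  show "card (block_cosets \<delta> S k (set_exps k d a' b') x') \<le> card (block_cosets \<delta> S k (set_exps k d a b) x)"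
    by (rule card_block_cosets_le[OF assms(1,2) _ _ sl2_equiv_sym[OF assms(5)]]) (fact assms(3,4))+
qed

text \<open>Comparing columns in the order 2, 1, 0, 3, 4, 5 determines g step by step: with equal
  exponents on both sides its diagonal entries are 1 and the entries that would destroy
  triangularity vanish.\<close>

lemma tri_lrel_unipotent:
  assumes M: "tri p \<delta> d M" and M': "tri p \<delta> d (g * M)" and g: "g \<in> Sp_int 3"
  shows "g $$ (0,0) = 1" "g $$ (0,1) = 0" "g $$ (0,2) = 0" "g $$ (1,2) = 0"
    "g $$ (3,0) = 0" "g $$ (3,1) = 0" "g $$ (3,2) = 0" "g $$ (4,0) = 0" "g $$ (4,1) = 0" "g $$ (4,2) = 0"
    "g $$ (4,3) = 0" "g $$ (3,3) = 1" "g $$ (4,4) = 1" "g $$ (1,1) = 1" "g $$ (2,2) = 1"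
    "g $$ (5,0) = 0" "g $$ (5,1) = 0" "g $$ (5,2) = 0" "g $$ (5,3) = 0" "g $$ (5,4) = 0" "g $$ (5,5) = 1"
proof -
  note m6 = mult6[OF Sp_int_carrier[OF g] tri_carrier[OF M]]
  have nz: "of_nat p ^ k \<noteq> (0::rat)" for k by simp
  note td = tri_diag[OF M] and td' = tri_diag[OF M'] and t = triD[OF M] and t' = triD[OF M']
  have q2: "(g * M) $$ (i,2) = g $$ (i,2) * of_nat p ^ (\<delta> - d 3)" if "i < 6" for i
    using m6[OF that, of 2] td(2,3,9) t(4,7,11) by simp
  show c2: "g $$ (0,2) = 0" "g $$ (1,2) = 0" "g $$ (3,2) = 0" "g $$ (4,2) = 0" "g $$ (5,2) = 0" "g $$ (2,2) = 1"
    using q2[of 0] q2[of 1] q2[of 2] q2[of 3] q2[of 4] q2[of 5] td'(2,3,9) t'(4,7,11) nz by simp_all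
  have q1: "(g * M) $$ (i,1) = g $$ (i,1) * of_nat p ^ (\<delta> - d 2)" if "i < 6" "g $$ (i,2) = 0" for i
    using m6[OF that(1), of 1] that td(1,8) t(3,6,10) by simp
  show c1: "g $$ (0,1) = 0" "g $$ (3,1) = 0" "g $$ (4,1) = 0" "g $$ (5,1) = 0" "g $$ (1,1) = 1"
    using q1[of 0] q1[of 1] q1[of 3] q1[of 4] q1[of 5] td'(1,8) t'(3,6,10) c2 nz by simp_all
  have q0: "(g * M) $$ (i,0) = g $$ (i,0) * of_nat p ^ (\<delta> - d 1)" if "i < 6" "g $$ (i,1) = 0" "g $$ (i,2) = 0" for i
    using m6[OF that(1), of 0] that td(7) t(2,5,9) by simp
  show c0: "g $$ (0,0) = 1" "g $$ (3,0) = 0" "g $$ (4,0) = 0" "g $$ (5,0) = 0"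
    using q0[of 0] q0[of 3] q0[of 4] q0[of 5] td'(7) t'(2,5,9) c1 c2 nz by simp_all
  have q3: "(g * M) $$ (i,3) = g $$ (i,3) * of_nat p ^ d 1" if "i < 6" "g $$ (i,0) = 0" "g $$ (i,1) = 0" "g $$ (i,2) = 0" for i
    using m6[OF that(1), of 3] that t(8,12,14) by simp
  show c3: "g $$ (3,3) = 1" "g $$ (4,3) = 0" "g $$ (5,3) = 0"
    using q3[of 3] q3[of 4] q3[of 5] t'(8,12,14) c0 c1 c2 nz by simp_all
  have q4: "(g * M) $$ (i,4) = g $$ (i,4) * of_nat p ^ d 2" if "i < 6" "g $$ (i,0) = 0" "g $$ (i,1) = 0" "g $$ (i,2) = 0" "g $$ (i,3) = 0" for i
    using m6[OF that(1), of 4] that t(13,15) by simp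
  show c4: "g $$ (4,4) = 1" "g $$ (5,4) = 0"
    using q4[of 4] q4[of 5] t'(13,15) c0 c1 c2 c3 nz by simp_all
  show "g $$ (5,5) = 1"
    using m6[of 5 5] t(16) t'(16) c0 c1 c2 c3 c4 nz by simp
qed

lemma block_cosets_shift:
  assumes k: "k < 3" and s: "k = 0 \<Longrightarrow> a + b = \<delta>" and t: "t \<in> \<int>"
    and C: "C \<in> block_cosets \<delta> S k (set_exps k d a b) x"
  shows "C \<in> block_cosets \<delta> S k (set_exps k d a b) (x + t * of_nat p ^ b)"
proof -
  obtain M where M: "C \<in> S" "tri p \<delta> (set_exps k d a b) M" "M $$ root_pos k = x" "C = cs M"
    using C by (auto simp: block_cosets_def)
  have eq: "sl2_equiv_by (1,t,0,1) (1,0,0,1) (of_nat p ^ a, x, of_nat p ^ b) (of_nat p ^ a, x + t * of_nat p ^ b, of_nat p ^ b)"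
    using t by (simp add: sl2_equiv_by_def)
  have N: "tri p \<delta> (set_exps k d a b) (root_elt k 1 t 0 1 * M * root_elt k 1 (-0) (-0) 1)"
    "(root_elt k 1 t 0 1 * M * root_elt k 1 (-0) (-0) 1) $$ root_pos k = x + t * of_nat p ^ b"
    by (rule tri_block_move[OF M(2,3) k _ _ eq]; use s in blast)+
  have g: "root_elt k 1 t 0 1 \<in> Sp_int 3" using t by (intro root_elt_Sp_int) auto
  \<comment> \<open>The shift has a trivial right factor, so the product is a left multiple of
    \<open>M\<close> and represents the same coset.\<close>
  have one: "root_elt k 1 0 0 1 = 1\<^sub>m 6"
  proof (rule eq_matI)
    fix i j :: nat assume "i < dim_row (1\<^sub>m 6 :: rat mat)" "j < dim_col (1\<^sub>m 6 :: rat mat)"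
    then have "i < 6" "j < 6" by auto
    then show "root_elt k 1 0 0 1 $$ (i,j) = 1\<^sub>m 6 $$ (i,j)"
      by (elim less6_cases) (simp_all add: root_elt_def)
  qed (simp_all add: root_elt_def)
  have "root_elt k 1 t 0 1 * M \<in> carrier_mat 6 6"
    using Sp_int_carrier[OF g] tri_carrier[OF M(2)] by (rule mult_carrier_mat)
  then have eqn: "root_elt k 1 t 0 1 * M * root_elt k 1 (-0) (-0) 1 = root_elt k 1 t 0 1 * M"
    unfolding minus_zero one by (rule right_mult_one_mat)
  note N' = N[unfolded eqn]
  have e: "C = cs (root_elt k 1 t 0 1 * M)" unfolding M(4) by (rule cs_mult_left[OF triD(1)[OF M(2)] g, symmetric])
  show ?thesis unfolding block_cosets_def
    by (intro CollectI conjI exI[of _ "root_elt k 1 t 0 1 * M"] N' M(1) e)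
qed

text \<open>The matrix relating two triangular representatives is unipotent, so the corner changes
  by an integer times the diagonal entry p^b below it. Together with
  \<open>block_cosets_shift\<close>: the corners belonging to one coset form exactly one residue
  class modulo p^b.\<close>

lemma block_cosets_overlap:
  assumes k: "k < 3" and s: "k = 0 \<Longrightarrow> a + b = \<delta>"
    and C: "C \<in> block_cosets \<delta> S k (set_exps k d a b) x" "C \<in> block_cosets \<delta> S k (set_exps k d a b) y"
  shows "\<exists>t \<in> \<int>. y = x + t * of_nat p ^ b"
proof -
  obtain M where M: "tri p \<delta> (set_exps k d a b) M" "M $$ root_pos k = x" "C = cs M"
    using C by (auto simp: block_cosets_def)
  obtain N where N: "tri p \<delta> (set_exps k d a b) N" "N $$ root_pos k = y" "C = cs N"
    using C by (auto simp: block_cosets_def)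
  obtain g where g: "g \<in> Sp_int 3" "N = g * M"
    using cs_lrel_iff[OF triD(1)[OF M(1)] triD(1)[OF N(1)]] M(3) N(3) by (auto simp: lrel_def)
  note u = tri_lrel_unipotent[OF M(1) N(1)[unfolded g(2)] g(1)]
  note m6 = mult6[OF Sp_int_carrier[OF g(1)] tri_carrier[OF M(1)], folded g(2)]
  note t = triD[OF M(1)] and td = tri_diag[OF M(1)]
  consider "k = 0" | "k = 1" | "k = 2" using k by linarith
  then show ?thesis
  proof cases
    case 1
    have "M $$ (3,3) = of_nat p ^ b" using t(14) 1 by (simp add: set_exps_def)
    then have "y = x + g $$ (0,3) * of_nat p ^ b"
      using m6[of 0 3] M(2) N(2) 1 t(8,12) u(1-3) by (simp add: root_pos_def)
    then show ?thesis using Sp_int_Ints[OF g(1), of 0 3] by auto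
  next
    case 2
    have "M $$ (4,4) = of_nat p ^ b" using t(15) 2 by (simp add: set_exps_def)
    then have "y = x + g $$ (3,4) * of_nat p ^ b"
      using m6[of 3 4] M(2) N(2) 2 t(13) u(5-7,12) by (simp add: root_pos_def)
    then show ?thesis using Sp_int_Ints[OF g(1), of 3 4] by auto
  next
    case 3
    have "M $$ (5,5) = of_nat p ^ b" using t(16) 3 by (simp add: set_exps_def)
    then have "y = x + g $$ (4,5) * of_nat p ^ b"
      using m6[of 4 5] M(2) N(2) 3 u(8-11,13) by (simp add: root_pos_def)
    then show ?thesis using Sp_int_Ints[OF g(1), of 4 5] by auto
  qed
qed

lemma block_cosets_disjoint:
  assumes k: "k < 3" and s: "k = 0 \<Longrightarrow> a + b = \<delta>" and xy: "x < p ^ b" "y < p ^ b" "x \<noteq> y"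
  shows "block_cosets \<delta> S k (set_exps k d a b) (of_nat x) \<inter> block_cosets \<delta> S k (set_exps k d a b) (of_nat y) = {}"
proof (rule ccontr)
  assume "\<not> ?thesis"
  then obtain C where "C \<in> block_cosets \<delta> S k (set_exps k d a b) (of_nat x)" "C \<in> block_cosets \<delta> S k (set_exps k d a b) (of_nat y)" by blast
  from block_cosets_overlap[OF k s this] obtain t where "t \<in> \<int>" "(of_nat y :: rat) = of_nat x + t * of_nat p ^ b" by auto
  then obtain l where l: "(of_nat y :: rat) = of_nat x + of_int l * of_nat p ^ b" by (auto elim: Ints_cases)
  then have "rat_of_int (int y) = of_int (int x + l * int (p ^ b))" by simp
  then have "int y = int x + l * int (p ^ b)" by (simp only: of_int_eq_iff)
  then have "int y mod int (p ^ b) = int x mod int (p ^ b)" by simp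
  then show False using xy by (simp flip: of_nat_mod add: of_nat_power[symmetric] del: of_nat_power)
qed

lemma tri_cosets_eq_blocks:
  assumes k: "k < 3" and s: "k = 0 \<Longrightarrow> a + b = \<delta>"
  shows "tri_cosets \<delta> S (set_exps k d a b) = (\<Union>x\<in>{..<p ^ b}. block_cosets \<delta> S k (set_exps k d a b) (of_nat x))"
proof
  show "(\<Union>x\<in>{..<p ^ b}. block_cosets \<delta> S k (set_exps k d a b) (of_nat x)) \<subseteq> tri_cosets \<delta> S (set_exps k d a b)"
    by (auto simp: block_cosets_def tri_cosets_def)
  show "tri_cosets \<delta> S (set_exps k d a b) \<subseteq> (\<Union>x\<in>{..<p ^ b}. block_cosets \<delta> S k (set_exps k d a b) (of_nat x))"
  proof
    fix C assume "C \<in> tri_cosets \<delta> S (set_exps k d a b)"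
    then obtain M where M: "C \<in> S" "tri p \<delta> (set_exps k d a b) M" "C = cs M" by (auto simp: tri_cosets_def)
    have "M $$ root_pos k \<in> \<int>" using int_sim_Ints[OF triD(1)[OF M(2)]] by (simp add: root_pos_def)
    then obtain x where x: "M $$ root_pos k = of_int x" by (auto elim: Ints_cases)
    have C: "C \<in> block_cosets \<delta> S k (set_exps k d a b) (of_int x)" using M x by (auto simp: block_cosets_def)
    let ?y = "nat (x mod int (p ^ b))"
    have pb: "int (p ^ b) > 0" by simp
    have "of_int x + of_int (- (x div int (p ^ b))) * of_nat p ^ b = (of_int (x - x div int (p ^ b) * int (p ^ b)) :: rat)" by simp
    also have "x - x div int (p ^ b) * int (p ^ b) = int ?y" using pb by (simp add: minus_div_mult_eq_mod)
    finally have "C \<in> block_cosets \<delta> S k (set_exps k d a b) (of_nat ?y)"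
      using block_cosets_shift[OF k s _ C, of "of_int (- (x div int (p ^ b)))"] by simp
    moreover have "?y < p ^ b" using pb pos_mod_bound[OF pb, of x] by (simp add: nat_less_iff)
    ultimately show "C \<in> (\<Union>x\<in>{..<p ^ b}. block_cosets \<delta> S k (set_exps k d a b) (of_nat x))" by blast
  qed
qed

lemma card_tri_cosets_blocks:
  assumes S: "translation_closed \<delta> S" and k: "k < 3" and s: "k = 0 \<Longrightarrow> a + b = \<delta>"
  shows "card (tri_cosets \<delta> S (set_exps k d a b)) = (\<Sum>x<p ^ b. card (block_cosets \<delta> S k (set_exps k d a b) (of_nat x)))"
proof -
  have "tri_cosets \<delta> S (set_exps k d a b) = (\<Union>x\<in>{..<p ^ b}. block_cosets \<delta> S k (set_exps k d a b) (of_nat x))"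
    by (rule tri_cosets_eq_blocks[OF k]) (rule s)
  moreover have "card \<dots> = (\<Sum>x<p ^ b. card (block_cosets \<delta> S k (set_exps k d a b) (of_nat x)))"
  proof (rule card_UN_disjoint)
    show "\<forall>x\<in>{..<p ^ b}. finite (block_cosets \<delta> S k (set_exps k d a b) (of_nat x))"
      using S by (simp add: translation_closed_def block_cosets_def)
    show "\<forall>x\<in>{..<p ^ b}. \<forall>y\<in>{..<p ^ b}. x \<noteq> y \<longrightarrow>
      block_cosets \<delta> S k (set_exps k d a b) (of_nat x) \<inter> block_cosets \<delta> S k (set_exps k d a b) (of_nat y) = {}"
      by (intro ballI impI block_cosets_disjoint[OF k]) (use s in auto)
  qed simp
  ultimately show ?thesis by simp
qed

text \<open>Cosets are sorted by the residue of the corner. The number in each class depends only on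
  the block up to equivalence, and \<open>block_sum_symmetric\<close> compares the two sums.\<close>

theorem card_tri_cosets_reflect:
  assumes S: "translation_closed \<delta> S" and k: "k < 3" and s: "k = 0 \<Longrightarrow> a + b = \<delta>"
  shows "card (tri_cosets \<delta> S (set_exps k d a b)) * p ^ a = card (tri_cosets \<delta> S (set_exps k d b a)) * p ^ b"
proof -
  have s': "k = 0 \<Longrightarrow> b + a = \<delta>" using s by simp
  let ?F = "\<lambda>a x b. card (block_cosets \<delta> S k (set_exps k d a b) (of_int x))"
  have "(\<Sum>x<p ^ b. ?F a (int x) b) * p ^ a = (\<Sum>x<p ^ a. ?F b (int x) a) * p ^ b"
    by (rule block_sum_symmetric[where s = "a + b"]) (auto intro!: card_block_cosets_eq[OF S k] simp: s)
  then show ?thesis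
    using card_tri_cosets_blocks[OF S k, of a b d] card_tri_cosets_blocks[OF S k, of b a d] s s' by simp
qed

end

section \<open>Coset numbers of the generators\<close>

lemma sum_le2: "(\<Sum>a\<le>2. f a) = f 0 + f 1 + (f (2::nat) :: 'a::comm_monoid_add)"
  by (simp add: numeral_2_eq_2)

context fixed_prime
begin

lemma tri_cosets_cong: "d 1 = e 1 \<Longrightarrow> d 2 = e 2 \<Longrightarrow> d 3 = e 3 \<Longrightarrow> tri_cosets \<delta> S d = tri_cosets \<delta> S e"
  using tri_cong[of d e] by (simp add: tri_cosets_def)

definition tcount :: "nat \<Rightarrow> rat mat set set \<Rightarrow> nat \<Rightarrow> nat \<Rightarrow> nat \<Rightarrow> nat" where
  "tcount \<delta> S a b c = card (tri_cosets \<delta> S (dvec a b c))"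

text \<open>The weight makes the number of cosets invariant under the Weyl group.\<close>

definition tcoef :: "nat \<Rightarrow> rat mat set set \<Rightarrow> nat \<Rightarrow> nat \<Rightarrow> nat \<Rightarrow> rat" where
  "tcoef \<delta> S a b c = of_nat (tcount \<delta> S a b c) / of_nat p ^ (a + 2 * b + 3 * c)"

lemma tcount_eq_tcoef: "of_nat (tcount \<delta> S a b c) = tcoef \<delta> S a b c * of_nat p ^ (a + 2 * b + 3 * c)"
  by (simp add: tcoef_def)

lemma tri_cosets_set_exps:
  "tri_cosets \<delta> S (set_exps 0 (dvec a b c) s t) = tri_cosets \<delta> S (dvec t b c)"
  "tri_cosets \<delta> S (set_exps 1 (dvec a b c) s t) = tri_cosets \<delta> S (dvec s t c)"
  "tri_cosets \<delta> S (set_exps 2 (dvec a b c) s t) = tri_cosets \<delta> S (dvec a s t)"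
  by (rule tri_cosets_cong; simp add: set_exps_def)+

lemma frac_eq_of_weighted_eq:
  assumes "m * p ^ s = n * p ^ t" "u + s = v + t"
  shows "of_nat m / (of_nat p :: rat) ^ u = of_nat n / of_nat p ^ v"
proof -
  have nz: "(of_nat p :: rat) ^ k \<noteq> 0" for k by simp
  have 1: "(of_nat m :: rat) * of_nat p ^ s = of_nat n * of_nat p ^ t"
    using arg_cong[OF assms(1), of "of_nat :: nat \<Rightarrow> rat"] by simp
  have "(of_nat m * (of_nat p :: rat) ^ v) * of_nat p ^ s = of_nat m * of_nat p ^ s * of_nat p ^ v" by (simp only: mult_ac)
  also have "\<dots> = of_nat n * of_nat p ^ (v + t)" unfolding 1 by (simp only: power_add mult_ac)
  also have "\<dots> = (of_nat n * of_nat p ^ u) * of_nat p ^ s" unfolding assms(2)[symmetric] by (simp only: power_add mult_ac)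
  finally have "of_nat m * (of_nat p :: rat) ^ v = of_nat n * of_nat p ^ u" using nz[of s] by simp
  then show ?thesis using nz[of u] nz[of v] by (simp add: frac_eq_eq)
qed

text \<open>A simple reflection changes a + 2 b + 3 c by exactly the power of p in
  \<open>card_tri_cosets_reflect\<close>; this is the effect of the weights p^-i in the Satake
  map.\<close>

lemma tcoef_weyl:
  assumes S: "translation_closed \<delta> S"
  shows "tcoef \<delta> S a b c = tcoef \<delta> S b a c" "tcoef \<delta> S a b c = tcoef \<delta> S a c b"
    "a + a' = \<delta> \<Longrightarrow> tcoef \<delta> S a b c = tcoef \<delta> S a' b c"
proof -
  have reflect: "card (tri_cosets \<delta> S (set_exps k d a b)) * p ^ a = card (tri_cosets \<delta> S (set_exps k d b a)) * p ^ b"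
    if "k < 3" "k = 0 \<longrightarrow> a + b = \<delta>" for k a b d
    by (rule card_tri_cosets_reflect[OF S that(1)]) (use that(2) in blast)
  have "tcount \<delta> S a b c * p ^ a = tcount \<delta> S b a c * p ^ b"
    using reflect[of 1 a b "dvec 0 0 c"] by (simp add: tri_cosets_set_exps[simplified] tcount_def)
  then show "tcoef \<delta> S a b c = tcoef \<delta> S b a c"
    unfolding tcoef_def by (rule frac_eq_of_weighted_eq) simp
  have "tcount \<delta> S a b c * p ^ b = tcount \<delta> S a c b * p ^ c"
    using reflect[of 2 b c "dvec a 0 0"] by (simp add: tri_cosets_set_exps tcount_def)
  then show "tcoef \<delta> S a b c = tcoef \<delta> S a c b"
    unfolding tcoef_def by (rule frac_eq_of_weighted_eq) simp
  assume "a + a' = \<delta>"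
  then have "tcount \<delta> S a b c * p ^ a' = tcount \<delta> S a' b c * p ^ a"
    using reflect[of 0 a' a "dvec 0 b c"] by (simp add: tri_cosets_set_exps tcount_def)
  then show "tcoef \<delta> S a b c = tcoef \<delta> S a' b c"
    unfolding tcoef_def by (rule frac_eq_of_weighted_eq) simp
qed

text \<open>The Weyl group permutes the exponents and replaces single ones by 2 minus themselves, so
  an orbit in {0,1,2}^3 is determined by its number of ones.\<close>

lemma tcoef_2:
  assumes S: "translation_closed 2 S"
  shows "tcoef 2 S 2 b c = tcoef 2 S 0 b c" "tcoef 2 S a 2 c = tcoef 2 S a 0 c" "tcoef 2 S a b 2 = tcoef 2 S a b 0"
    "tcoef 2 S 0 0 1 = tcoef 2 S 1 0 0" "tcoef 2 S 0 1 0 = tcoef 2 S 1 0 0"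
    "tcoef 2 S 0 1 1 = tcoef 2 S 1 1 0" "tcoef 2 S 1 0 1 = tcoef 2 S 1 1 0"
proof -
  note w = tcoef_weyl[OF S]
  have 1: "tcoef 2 S 2 b c = tcoef 2 S 0 b c" for b c by (rule w(3)) simp
  have 2: "tcoef 2 S a 2 c = tcoef 2 S a 0 c" for a c using w(1)[of a 2 c] w(1)[of 0 a c] 1[of a c] by simp
  show "tcoef 2 S 2 b c = tcoef 2 S 0 b c" "tcoef 2 S a 2 c = tcoef 2 S a 0 c" by (fact 1 2)+
  show "tcoef 2 S a b 2 = tcoef 2 S a b 0" using w(2)[of a b 2] w(2)[of a 0 b] 2[of a b] by simp
  show 3: "tcoef 2 S 0 1 0 = tcoef 2 S 1 0 0" by (rule w(1))
  show "tcoef 2 S 0 0 1 = tcoef 2 S 1 0 0" using w(2)[of 0 0 1] 3 by simp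
  show 4: "tcoef 2 S 1 0 1 = tcoef 2 S 1 1 0" by (rule w(2))
  show "tcoef 2 S 0 1 1 = tcoef 2 S 1 1 0" using w(1)[of 0 1 1] 4 by simp
qed

lemma of_nat_mult_wmono:
  "of_nat n * wmono \<delta> (dvec a b c) =
     mconst (of_nat n / of_nat p ^ (a + 2 * b + 3 * c)) * (mvar 0 ^ \<delta> * (mvar 1 ^ a * (mvar 2 ^ b * mvar 3 ^ c)))"
proof -
  have "of_nat n * wmono \<delta> (dvec a b c) = of_int (int n) * wmono \<delta> (dvec a b c)" by simp
  also have "\<dots> = Poly_Mapping.single (expv \<delta> (dvec a b c)) (of_int (int n) * wcoef (dvec a b c))"
    by (rule of_int_mult_wmono)
  also have "of_int (int n) * wcoef (dvec a b c) = of_nat n / of_nat p ^ (a + 2 * b + 3 * c)"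
    by (simp add: wcoef_def power_divide power_add flip: power_mult)
  finally show ?thesis by (simp add: mvar_power mconst_def mult_single expv_def)
qed

lemma satake_double_coset_tcoef:
  assumes r: "r \<in> int_sim p \<delta>"
  shows "satake 3 p (double_coset (GSp_plus 3) (Sp_int 3) r) = (\<Sum>a\<le>\<delta>. \<Sum>b\<le>\<delta>. \<Sum>c\<le>\<delta>.
     mconst (tcoef \<delta> (dc r) a b c) * (mvar 0 ^ \<delta> * (mvar 1 ^ a * (mvar 2 ^ b * mvar 3 ^ c))))"
proof -
  let ?I = "{..\<delta>} \<times> {..\<delta>} \<times> {..\<delta>}"
  let ?A = "\<lambda>(a,b,c). tri_cosets \<delta> (dc r) (dvec a b c)"
  have un: "dc r = (\<Union>t\<in>?I. ?A t)"
  proof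
    show "(\<Union>t\<in>?I. ?A t) \<subseteq> dc r" by (auto simp: tri_cosets_def)
    show "dc r \<subseteq> (\<Union>t\<in>?I. ?A t)"
    proof
      fix C assume C: "C \<in> dc r"
      then obtain M where M: "M \<in> int_sim p \<delta>" "C = cs M" using dc_subset[OF r] by blast
      obtain N d where N: "tri p \<delta> d N" "lrel M N" by (rule triangularize[OF M(1)])
      have CN: "C = cs N" using M(2) cs_lrel_iff[OF M(1) triD(1)[OF N(1)]] N(2) by simp
      have "tri p \<delta> (dvec (d 1) (d 2) (d 3)) N" using N(1) tri_cong[of d "dvec (d 1) (d 2) (d 3)"] by simp
      then have "C \<in> ?A (d 1, d 2, d 3)" using C CN by (auto simp: tri_cosets_def)
      moreover have "(d 1, d 2, d 3) \<in> ?I" using tri_diag(4-6)[OF N(1)] by simp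
      ultimately show "C \<in> (\<Union>t\<in>?I. ?A t)" by blast
    qed
  qed
  have disj: "?A s \<inter> ?A t = {}" if "s \<noteq> t" for s t
  proof (rule ccontr)
    assume "?A s \<inter> ?A t \<noteq> {}"
    then obtain C where C: "C \<in> ?A s" "C \<in> ?A t" by blast
    obtain a b c a' b' c' where st: "s = (a,b,c)" "t = (a',b',c')" by (cases s, cases t) auto
    obtain M where M: "tri p \<delta> (dvec a b c) M" "C = cs M" using C(1) st by (auto simp: tri_cosets_def)
    obtain N where N: "tri p \<delta> (dvec a' b' c') N" "C = cs N" using C(2) st by (auto simp: tri_cosets_def)
    have "lrel M N" using cs_lrel_iff[OF triD(1)[OF M(1)] triD(1)[OF N(1)]] M(2) N(2) by simp
    from tri_exponents_eq[OF M(1) N(1) this] have "s = t" unfolding st by simp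
    then show False using that by simp
  qed
  have fin: "finite (?A t)" for t
    using finite_dc[OF r] by (auto simp: tri_cosets_def split: prod.split)
  have "satake 3 p (double_coset (GSp_plus 3) (Sp_int 3) r) = (\<Sum>C\<in>(\<Union>t\<in>?I. ?A t). satake_coset 3 p C)"
    unfolding satake_double_coset[OF r] using un by simp
  also have "\<dots> = (\<Sum>t\<in>?I. \<Sum>C\<in>?A t. satake_coset 3 p C)"
    by (rule sum.UNION_disjoint) (use fin disj in auto)
  also have "\<dots> = (\<Sum>t\<in>?I. case t of (a,b,c) \<Rightarrow>
     mconst (tcoef \<delta> (dc r) a b c) * (mvar 0 ^ \<delta> * (mvar 1 ^ a * (mvar 2 ^ b * mvar 3 ^ c))))"
  proof (rule sum.cong[OF refl])
    fix t :: "nat \<times> nat \<times> nat"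
    obtain a b c where t: "t = (a,b,c)" by (cases t)
    have "(\<Sum>C\<in>?A t. satake_coset 3 p C) = (\<Sum>C\<in>?A t. wmono \<delta> (dvec a b c))"
      unfolding t by (rule sum.cong[OF refl]) (auto simp: tri_cosets_def satake_coset_tri)
    also have "\<dots> = of_nat (tcount \<delta> (dc r) a b c) * wmono \<delta> (dvec a b c)"
      by (simp add: t tcount_def)
    finally show "(\<Sum>C\<in>?A t. satake_coset 3 p C) = (case t of (a,b,c) \<Rightarrow>
       mconst (tcoef \<delta> (dc r) a b c) * (mvar 0 ^ \<delta> * (mvar 1 ^ a * (mvar 2 ^ b * mvar 3 ^ c))))"
      unfolding of_nat_mult_wmono t by (simp add: tcoef_def)
  qed
  finally show ?thesis by (simp add: sum.cartesian_product)
qed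

lemma translation_closed_dc: "r \<in> int_sim p \<delta> \<Longrightarrow> translation_closed \<delta> (dc r)"
proof -
  assume r: "r \<in> int_sim p \<delta>"
  have "cs (M * h) \<in> dc r" if M: "M \<in> int_sim p \<delta>" "h \<in> Sp_int 3" "cs M \<in> dc r" for M h
  proof -
    have "drel r M" using mem_dc_iff[OF r M(1)] M(3) by simp
    then have "drel r (M * h)"
      by (rule drel_trans[OF _ drel_right[OF M(2) int_sim_carrier[OF M(1)]] int_sim_carrier[OF r]])
    then show ?thesis using mem_dc_iff[OF r int_sim_mult_right[OF M(1,2)]] by simp
  qed
  then show ?thesis unfolding translation_closed_def using finite_dc[OF r] by blast
qed

lemma satake_double_coset_2:
  assumes r: "r \<in> int_sim p 2"
  shows "satake 3 p (double_coset (GSp_plus 3) (Sp_int 3) r) = mvar 0 ^ 2 *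
     (mconst (tcoef 2 (dc r) 0 0 0) * ((1 + mvar 1 ^ 2) * (1 + mvar 2 ^ 2) * (1 + mvar 3 ^ 2)) +
      mconst (tcoef 2 (dc r) 1 0 0) * (mvar 1 * (1 + mvar 2 ^ 2) * (1 + mvar 3 ^ 2) + mvar 2 * (1 + mvar 1 ^ 2) * (1 + mvar 3 ^ 2)
         + mvar 3 * (1 + mvar 1 ^ 2) * (1 + mvar 2 ^ 2)) +
      mconst (tcoef 2 (dc r) 1 1 0) * (mvar 1 * mvar 2 * (1 + mvar 3 ^ 2) + mvar 1 * mvar 3 * (1 + mvar 2 ^ 2)
         + mvar 2 * mvar 3 * (1 + mvar 1 ^ 2)) +
      mconst (tcoef 2 (dc r) 1 1 1) * (mvar 1 * mvar 2 * mvar 3))"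
  unfolding satake_double_coset_tcoef[OF r] sum_le2 tcoef_2[OF translation_closed_dc[OF r]] power_0 power_one_right
  by (simp only: mult_1 mult_1_right) (simp only: distrib_left distrib_right mult_1 mult_1_right mult_ac add_ac)

text \<open>The quotient g = M F^-1 has multiplier 1, so its integrality puts it into the
  group.\<close>

lemma cs_eq_left_factor:
  assumes M: "M \<in> int_sim p \<delta>" and F: "F \<in> int_sim p \<delta>"
    and g: "g \<in> carrier_mat 6 6" "integral_mat g" "M = g * F"
  shows "cs M = cs F"
proof -
  let ?\<mu> = "of_nat p ^ \<delta> :: rat"
  have \<mu>: "?\<mu> \<noteq> 0" by simp
  define I where "I = similitude_inv 3 ?\<mu> F"
  have cI: "I \<in> carrier_mat 6 6" using similitude_inv_carrier[of F 3] int_sim_carrier[OF F] by (simp add: I_def)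
  have FI: "F * I = 1\<^sub>m 6" using similitude_inv_mult_right[OF int_sim_similitude[OF F] \<mu>] by (simp add: I_def)
  have "M * I = g * (F * I)" unfolding g(3) by (rule mult6_assoc[OF g(1) int_sim_carrier[OF F] cI])
  then have "g = M * I" unfolding FI using g(1) by simp
  moreover have "similitude 3 1 (M * I)"
    using similitude_mult[OF int_sim_similitude[OF M] similitude_similitude_inv[OF int_sim_similitude[OF F] \<mu>]]
    by (simp add: I_def)
  ultimately have "g \<in> Sp_int 3" using g(2) by (simp add: mem_Sp_int)
  then show ?thesis unfolding g(3) by (rule cs_mult_left[OF F])
qed

lemma cs_eq_diag6:
  assumes M: "M \<in> int_sim p \<delta>" and F: "diag6 a b c d e f \<in> int_sim p \<delta>"
    and nz: "a \<noteq> 0" "b \<noteq> 0" "c \<noteq> 0" "d \<noteq> 0" "e \<noteq> 0" "f \<noteq> 0"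
    and dv: "\<And>i. i < 6 \<Longrightarrow> M $$ (i,0) / a \<in> \<int>" "\<And>i. i < 6 \<Longrightarrow> M $$ (i,1) / b \<in> \<int>" "\<And>i. i < 6 \<Longrightarrow> M $$ (i,2) / c \<in> \<int>"
      "\<And>i. i < 6 \<Longrightarrow> M $$ (i,3) / d \<in> \<int>" "\<And>i. i < 6 \<Longrightarrow> M $$ (i,4) / e \<in> \<int>" "\<And>i. i < 6 \<Longrightarrow> M $$ (i,5) / f \<in> \<int>"
  shows "cs M = cs (diag6 a b c d e f)"
proof (rule cs_eq_left_factor[OF M F])
  let ?g = "mat 6 6 (\<lambda>(i,j). M $$ (i,j) / [a,b,c,d,e,f] ! j)"
  show "?g \<in> carrier_mat 6 6" by simp
  show "integral_mat ?g"
  proof (rule integral_matI)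
    fix i j assume "i < dim_row ?g" "j < dim_col ?g"
    then have i: "i < 6" and j: "j < 6" by auto
    from j show "?g $$ (i,j) \<in> \<int>" by (elim less6_cases) (use i dv[OF i] in simp_all)
  qed
  note m = mult6[OF mat_carrier[of 6 6] diag6_index(1)]
  show "M = ?g * diag6 a b c d e f"
  proof (rule eq_matI)
    fix i j assume "i < dim_row (?g * diag6 a b c d e f)" "j < dim_col (?g * diag6 a b c d e f)"
    then have i: "i < 6" and j: "j < 6" by auto
    from j show "M $$ (i,j) = (?g * diag6 a b c d e f) $$ (i,j)"
      by (elim less6_cases) (use i nz in \<open>simp_all add: m del: index_mult_mat\<close>)
  qed (use int_sim_carrier[OF M] in auto)
qed

lemma cs_eq_diag6_tri:
  assumes M: "tri p \<delta> k M" and F: "diag6 a b c d e f \<in> int_sim p \<delta>"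
    and nz: "a \<noteq> 0" "b \<noteq> 0" "c \<noteq> 0" "d \<noteq> 0" "e \<noteq> 0" "f \<noteq> 0"
    and c0: "M $$ (0,0) / a \<in> \<int>" "M $$ (1,0) / a \<in> \<int>" "M $$ (2,0) / a \<in> \<int>"
    and c1: "M $$ (1,1) / b \<in> \<int>" "M $$ (2,1) / b \<in> \<int>" and c2: "M $$ (2,2) / c \<in> \<int>"
    and c3: "\<And>i. i < 4 \<Longrightarrow> M $$ (i,3) / d \<in> \<int>" and c4: "\<And>i. i < 5 \<Longrightarrow> M $$ (i,4) / e \<in> \<int>"
    and c5: "\<And>i. i < 6 \<Longrightarrow> M $$ (i,5) / f \<in> \<int>"
  shows "cs M = cs (diag6 a b c d e f)"
proof (rule cs_eq_diag6[OF triD(1)[OF M] F nz])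
  note t = triD(2-13)[OF M] tri_diag(1-3)[OF M]
  fix i :: nat assume i: "i < 6"
  consider "i = 0" | "i = 1" | "i = 2" | "i = 3" | "i = 4" | "i = 5" using i by linarith
  note cases = this
  have z: "0 / x \<in> \<int>" for x :: rat by simp
  show "M $$ (i,0) / a \<in> \<int>"
    by (rule cases; hypsubst; (rule c0)?; (unfold t)?; (rule z)?)
  show "M $$ (i,1) / b \<in> \<int>"
    by (rule cases; hypsubst; (rule c1)?; (unfold t)?; (rule z)?)
  show "M $$ (i,2) / c \<in> \<int>"
    by (rule cases; hypsubst; (rule c2)?; (unfold t)?; (rule z)?)
  show "M $$ (i,3) / d \<in> \<int>"
    by (cases "i < 4", rule c3, assumption, rule cases; (hypsubst, unfold t)?; (rule z)?; simp)
  show "M $$ (i,4) / e \<in> \<int>"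
    by (cases "i < 5", rule c4, assumption, rule cases; (hypsubst, unfold t)?; (rule z)?; simp)
  show "M $$ (i,5) / f \<in> \<int>" by (rule c5[OF i])
qed

section \<open>Exponents with one coset or none\<close>

lemma pmult_div: "pmult 1 x \<Longrightarrow> x / of_nat p \<in> \<int>"
  by (auto simp: pmult_def)

lemma pmult1I: "k \<in> \<int> \<Longrightarrow> x = of_nat p * k \<Longrightarrow> pmult 1 x"
  using pmultI[of k 1] by simp

text \<open>The column relations that triangularity leaves over: the first three state that A^T D is
  diagonal, the other three that B^T D is symmetric.\<close>

lemma tri_relations:
  assumes M: "tri p \<delta> d M"
  shows "M $$ (0,0) * M $$ (3,4) + M $$ (1,0) * M $$ (4,4) = 0"
    "M $$ (0,0) * M $$ (3,5) + M $$ (1,0) * M $$ (4,5) + M $$ (2,0) * M $$ (5,5) = 0"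
    "M $$ (1,1) * M $$ (4,5) + M $$ (2,1) * M $$ (5,5) = 0"
    "M $$ (0,3) * M $$ (3,4) - M $$ (3,3) * M $$ (0,4) + M $$ (1,3) * M $$ (4,4) = 0"
    "M $$ (0,3) * M $$ (3,5) - M $$ (3,3) * M $$ (0,5) + M $$ (1,3) * M $$ (4,5) + M $$ (2,3) * M $$ (5,5) = 0"
    "M $$ (0,4) * M $$ (3,5) - M $$ (3,4) * M $$ (0,5) + M $$ (1,4) * M $$ (4,5) - M $$ (4,4) * M $$ (1,5) + M $$ (2,4) * M $$ (5,5) = 0"
proof -
  note t = triD(2-13)[OF M] tri_diag(1-3)[OF M]
  note s = similitude3D[OF int_sim_similitude[OF triD(1)[OF M]]]
  show "M $$ (0,0) * M $$ (3,4) + M $$ (1,0) * M $$ (4,4) = 0"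
    using s(4) t by (simp add: cpair_def)
  show "M $$ (0,0) * M $$ (3,5) + M $$ (1,0) * M $$ (4,5) + M $$ (2,0) * M $$ (5,5) = 0"
    using s(5) t by (simp add: cpair_def)
  show "M $$ (1,1) * M $$ (4,5) + M $$ (2,1) * M $$ (5,5) = 0"
    using s(9) t by (simp add: cpair_def)
  show "M $$ (0,3) * M $$ (3,4) - M $$ (3,3) * M $$ (0,4) + M $$ (1,3) * M $$ (4,4) = 0"
    using s(13) t by (simp add: cpair_def)
  show "M $$ (0,3) * M $$ (3,5) - M $$ (3,3) * M $$ (0,5) + M $$ (1,3) * M $$ (4,5) + M $$ (2,3) * M $$ (5,5) = 0"
    using s(14) t by (simp add: cpair_def)
  show "M $$ (0,4) * M $$ (3,5) - M $$ (3,4) * M $$ (0,5) + M $$ (1,4) * M $$ (4,5) - M $$ (4,4) * M $$ (1,5) + M $$ (2,4) * M $$ (5,5) = 0"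
    using s(15) t by (simp add: cpair_def)
qed

lemma int_sim_integral: "M \<in> int_sim p \<delta> \<Longrightarrow> integral_mat M"
  by (simp add: int_sim_def)

lemma tri_dc_T2_repD:
  assumes "C \<in> tri_cosets 2 (dc (T2_rep i)) d"
  obtains M where "C = cs M" "tri p 2 d M" "cs M \<in> dc (T2_rep i)"
  using assms by (auto simp: tri_cosets_def)

text \<open>With all exponents 0 the matrix D is unipotent and A = p D^-T is divisible by p, so M is
  a left multiple of one fixed diagonal matrix: there is exactly one coset, of weight 1.\<close>

lemma tcoef_T: "tcoef 1 (dc T_rep) 0 0 0 = 1"
proof -
  let ?p = "of_nat p :: rat"
  let ?D = "diag6 ?p ?p ?p 1 1 1"
  have D: "?D \<in> int_sim p 1" by (rule diag6_int_sim) auto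
  have "tri_cosets 1 (dc T_rep) (dvec 0 0 0) = {cs ?D}"
  proof (intro equalityI subsetI)
    fix C assume "C \<in> tri_cosets 1 (dc T_rep) (dvec 0 0 0)"
    then obtain M where M: "tri p 1 (dvec 0 0 0) M" "C = cs M" by (auto simp: tri_cosets_def)
    note t = triD[OF M(1)] and td = tri_diag[OF M(1)] and r = tri_relations[OF M(1)]
    have I: "M $$ (i,j) \<in> \<int>" if "i < 6" "j < 6" for i j using int_sim_Ints[OF t(1) that] .
    have e: "M $$ (0,0) = ?p" "M $$ (1,1) = ?p" "M $$ (2,2) = ?p" "M $$ (3,3) = 1" "M $$ (4,4) = 1" "M $$ (5,5) = 1"
      using t(14-16) td(7-9) by simp_all
    have 10: "M $$ (1,0) = ?p * (- M $$ (3,4))" using r(1) e by (simp add: algebra_simps)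
    have 20: "M $$ (2,0) = ?p * (M $$ (3,4) * M $$ (4,5) - M $$ (3,5))" using r(2) 10 e by (simp add: algebra_simps)
    have 21: "M $$ (2,1) = ?p * (- M $$ (4,5))" using r(3) e by (simp add: algebra_simps)
    have d: "M $$ (1,0) / ?p \<in> \<int>" "M $$ (2,0) / ?p \<in> \<int>" "M $$ (2,1) / ?p \<in> \<int>"
      unfolding 10 20 21 using I[of 3 4] I[of 3 5] I[of 4 5] by simp_all
    have "cs M = cs ?D"
    proof (rule cs_eq_diag6_tri[OF M(1) D])
      show "M $$ (i,3) / 1 \<in> \<int>" if "i < 4" for i using I[of i 3] that by simp
      show "M $$ (i,4) / 1 \<in> \<int>" if "i < 5" for i using I[of i 4] that by simp
      show "M $$ (i,5) / 1 \<in> \<int>" if "i < 6" for i using I[of i 5] that by simp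
    qed (use d e in simp_all)
    then show "C \<in> {cs ?D}" using M(2) by simp
  next
    fix C assume "C \<in> {cs ?D}"
    then have C: "C = cs ?D" by simp
    have "tri p 1 (dvec 0 0 0) ?D" unfolding tri_def using D by simp
    then show "C \<in> tri_cosets 1 (dc T_rep) (dvec 0 0 0)"
      unfolding tri_cosets_def C using int_sim_1_class[OF D] by blast
  qed
  then show ?thesis unfolding tcoef_def tcount_def by (simp only:) simp
qed

text \<open>All exponents 0 make D unipotent, so rows and columns 3, 4, 5 give a minor equal to 1.
  \<open>rank_gt_1_unit\<close> uses the lower right 2 by 2 part of D in the same way.\<close>

lemma rank_gt_2_unit:
  assumes M: "tri p 2 (dvec 0 0 0) M"
  shows "\<not> rank_le 2 M"
proof
  assume "rank_le 2 M"
  then have "pmult 1 (minor3 M 3 4 5 3 4 5)"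
    by (rule rank_le_2D) (use int_sim_integral[OF triD(1)[OF M]] tri_carrier[OF M] in simp_all)
  moreover have "minor3 M 3 4 5 3 4 5 = 1" using triD[OF M] by (simp add: minor3_def)
  ultimately show False using not_pmult_1_one by simp
qed

lemma rank_gt_1_unit:
  assumes M: "tri p 2 (dvec a 0 0) M"
  shows "\<not> rank_le 1 M"
proof
  assume "rank_le 1 M"
  then have "pmult 1 (minor2 M 4 5 4 5)"
    by (rule rank_le_1D) (use int_sim_integral[OF triD(1)[OF M]] tri_carrier[OF M] in simp_all)
  moreover have "minor2 M 4 5 4 5 = 1" using triD[OF M] by (simp add: minor2_def)
  ultimately show False using not_pmult_1_one by simp
qed

lemma rank_le_1_2: "rank_le 1 M \<Longrightarrow> rank_le 2 M"
proof -
  assume "rank_le 1 M"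
  then obtain x y where xy: "\<forall>k i. x k i \<in> \<int> \<and> y k i \<in> \<int>"
    "\<forall>i<6. \<forall>j<6. pmult 1 (M $$ (i,j) - (\<Sum>k<(1::nat). x k i * y k j))" by (rule rank_leE)
  show ?thesis
    by (rule rank_le_I2[of "x 0" "y 0" "\<lambda>_. 0" "\<lambda>_. 0"]) (use xy in auto)
qed

lemma tcoef_zero:
  "tcoef 2 (dc (T2_rep 1)) 0 0 0 = 0" "tcoef 2 (dc (T2_rep 2)) 0 0 0 = 0" "tcoef 2 (dc (T2_rep 2)) 1 0 0 = 0"
proof -
  have empty: "tri_cosets 2 (dc (T2_rep i)) d = {}" if "\<And>M. tri p 2 d M \<Longrightarrow> cs M \<notin> dc (T2_rep i)" for i d
    using that by (auto simp: tri_cosets_def)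
  have "tri_cosets 2 (dc (T2_rep 1)) (dvec 0 0 0) = {}"
    by (rule empty) (use mem_dc_T2_rep_iff triD(1) rank_gt_2_unit in blast)
  then show "tcoef 2 (dc (T2_rep 1)) 0 0 0 = 0" by (simp add: tcoef_def tcount_def)
  have "tri_cosets 2 (dc (T2_rep 2)) (dvec a 0 0) = {}" for a
    by (rule empty) (use mem_dc_T2_rep_iff triD(1) rank_gt_1_unit in blast)
  then show "tcoef 2 (dc (T2_rep 2)) 0 0 0 = 0" "tcoef 2 (dc (T2_rep 2)) 1 0 0 = 0"
    by (simp_all add: tcoef_def tcount_def)
qed

definition unit_vec :: "nat \<Rightarrow> nat \<Rightarrow> rat" where "unit_vec a i = (if i = a then 1 else 0)"

text \<open>Exactly one coset, and the exponent of the weight is 1 + 2. Row 5 has only the entry 1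
  at (5,5), so the 2 by 2 minors with this pivot are the entries outside row and column 5; rank 1
  makes them divisible by p.\<close>

lemma tcoef_T2_110: "tcoef 2 (dc (T2_rep 2)) 1 1 0 = 1 / of_nat p ^ 3"
proof -
  let ?p = "of_nat p :: rat"
  let ?D = "diag6 ?p ?p (?p ^ 2) ?p ?p 1"
  have D: "?D \<in> int_sim p 2" by (rule diag6_int_sim) (auto simp: power2_eq_square)
  have r1: "rank_le 1 ?D"
  proof (rule rank_le_I1[of "unit_vec 5" "unit_vec 5"])
    fix i j :: nat assume "i < 6" "j < 6"
    then show "pmult 1 (?D $$ (i,j) - unit_vec 5 i * unit_vec 5 j)"
      by (elim less6_cases) (simp_all add: unit_vec_def pmult_1_p')
  qed (auto simp: unit_vec_def)
  have r0: "\<not> rank_le 0 ?D" using rank_le_0D[of ?D 5 5] not_pmult_1_one by auto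
  have "tri_cosets 2 (dc (T2_rep 2)) (dvec 1 1 0) = {cs ?D}"
  proof (intro equalityI subsetI)
    fix C assume "C \<in> tri_cosets 2 (dc (T2_rep 2)) (dvec 1 1 0)"
    then obtain M where M: "C = cs M" "tri p 2 (dvec 1 1 0) M" "cs M \<in> dc (T2_rep 2)" by (rule tri_dc_T2_repD)
    note t = triD[OF M(2)] and td = tri_diag[OF M(2)] and r = tri_relations[OF M(2)]
    have I: "M $$ (i,j) \<in> \<int>" if "i < 6" "j < 6" for i j using int_sim_Ints[OF t(1) that] .
    have e: "M $$ (0,0) = ?p" "M $$ (1,1) = ?p" "M $$ (2,2) = ?p ^ 2" "M $$ (3,3) = ?p" "M $$ (4,4) = ?p" "M $$ (5,5) = 1"
      using t(14-16) td(7-9) by simp_all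
    have rk: "rank_le 1 M" using mem_dc_T2_rep_iff(1)[OF t(1)] M(3) by simp
    have u: "pmult 1 (M $$ (i,j))" if "i < 5" "j < 5" for i j
    proof -
      have "pmult 1 (minor2 M i 5 j 5)"
        by (rule rank_le_1D[OF rk]) (use int_sim_integral[OF t(1)] tri_carrier[OF M(2)] that in simp_all)
      moreover have "M $$ (5,j) = 0" using that(2) t(9-13) by (auto simp: less_Suc_eq numeral_eq_Suc)
      ultimately show ?thesis using e by (simp add: minor2_def)
    qed
    have u5: "pmult 1 (M $$ (5,j))" if "j < 5" for j
      using that t(9-13) by (auto simp: less_Suc_eq numeral_eq_Suc)
    have dv: "M $$ (i,j) / ?p \<in> \<int>" if "i < 6" "j < 5" for i j
    proof (cases "i = 5")
      case True
      then show ?thesis using pmult_div[OF u5[OF that(2)]] by simp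
    next
      case False
      then show ?thesis using pmult_div[OF u[of i j]] that by simp
    qed
    have c2: "M $$ (i,2) / ?p ^ 2 \<in> \<int>" if "i < 6" for i
      using that by (elim less6_cases) (use t(4,7,11) td(2,3) e in simp_all)
    have "cs M = cs ?D"
      by (rule cs_eq_diag6[OF t(1) D]) (use dv c2 I in simp_all)
    then show "C \<in> {cs ?D}" using M(1) by simp
  next
    fix C assume "C \<in> {cs ?D}"
    then have C: "C = cs ?D" by simp
    have "tri p 2 (dvec 1 1 0) ?D" unfolding tri_def using D by simp
    moreover have "cs ?D \<in> dc (T2_rep 2)" using mem_dc_T2_rep_iff(1)[OF D] r0 r1 by simp
    ultimately show "C \<in> tri_cosets 2 (dc (T2_rep 2)) (dvec 1 1 0)"
      unfolding tri_cosets_def C by blast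
  qed
  then show ?thesis unfolding tcoef_def tcount_def by (simp only:) (simp add: power3_eq_cube)
qed

text \<open>Again exactly one coset, of weight 1 / p. The unit block of D in rows 4, 5 and rank 2
  make the entry (0,3) divisible by p. Symmetry of B^T D passes this on to the rest of column 3, and
  all columns can be divided by the pivots of the diagonal representative.\<close>

lemma tcoef_T1_100: "tcoef 2 (dc (T2_rep 1)) 1 0 0 = 1 / of_nat p"
proof -
  let ?p = "of_nat p :: rat"
  let ?D = "diag6 ?p (?p ^ 2) (?p ^ 2) ?p 1 1"
  have D: "?D \<in> int_sim p 2" by (rule diag6_int_sim) (auto simp: power2_eq_square)
  have tD: "tri p 2 (dvec 1 0 0) ?D" unfolding tri_def using D by simp
  have r2: "rank_le 2 ?D"
  proof (rule rank_le_I2[of "unit_vec 4" "unit_vec 4" "unit_vec 5" "unit_vec 5"])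
    fix i j :: nat assume "i < 6" "j < 6"
    then show "pmult 1 (?D $$ (i,j) - (unit_vec 4 i * unit_vec 4 j + unit_vec 5 i * unit_vec 5 j))"
      by (elim less6_cases) (simp_all add: unit_vec_def pmult_1_p')
  qed (auto simp: unit_vec_def)
  have "tri_cosets 2 (dc (T2_rep 1)) (dvec 1 0 0) = {cs ?D}"
  proof (intro equalityI subsetI)
    fix C assume "C \<in> tri_cosets 2 (dc (T2_rep 1)) (dvec 1 0 0)"
    then obtain M where M: "C = cs M" "tri p 2 (dvec 1 0 0) M" "cs M \<in> dc (T2_rep 1)" by (rule tri_dc_T2_repD)
    note t = triD[OF M(2)] and td = tri_diag[OF M(2)] and r = tri_relations[OF M(2)]
    have I: "M $$ (i,j) \<in> \<int>" if "i < 6" "j < 6" for i j using int_sim_Ints[OF t(1) that] .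
    have e: "M $$ (0,0) = ?p" "M $$ (1,1) = ?p ^ 2" "M $$ (2,2) = ?p ^ 2" "M $$ (3,3) = ?p" "M $$ (4,4) = 1" "M $$ (5,5) = 1"
      using t(14-16) td(7-9) by simp_all
    have rk: "rank_le 2 M" using mem_dc_T2_rep_iff(2)[OF t(1)] M(3) by simp
    have "pmult 1 (minor3 M 0 4 5 3 4 5)"
      by (rule rank_le_2D[OF rk]) (use int_sim_integral[OF t(1)] tri_carrier[OF M(2)] in simp_all)
    then have 03: "pmult 1 (M $$ (0,3))" using e t(8,12,13) by (simp add: minor3_def)
    have 10: "M $$ (1,0) = ?p * (- M $$ (3,4))" using r(1) e by (simp add: algebra_simps)
    have 20: "M $$ (2,0) = ?p * (M $$ (3,4) * M $$ (4,5) - M $$ (3,5))" using r(2) 10 e by (simp add: algebra_simps)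
    have 21: "M $$ (2,1) = ?p ^ 2 * (- M $$ (4,5))" using r(3) e by (simp add: algebra_simps)
    have 13: "M $$ (1,3) = ?p * M $$ (0,4) - M $$ (0,3) * M $$ (3,4)" using r(4) e by (simp add: algebra_simps)
    have p13: "pmult 1 (M $$ (1,3))"
      unfolding 13 using I by (intro pmult_diff pmult1I[of "M $$ (0,4)"] pmult_mult 03) simp_all
    have 23: "M $$ (2,3) = ?p * M $$ (0,5) - M $$ (0,3) * M $$ (3,5) - M $$ (1,3) * M $$ (4,5)" using r(5) e by (simp add: algebra_simps)
    have p23: "pmult 1 (M $$ (2,3))"
      unfolding 23 using I by (intro pmult_diff pmult1I[of "M $$ (0,5)"] pmult_mult 03 p13) simp_all
    have d: "M $$ (1,0) / ?p \<in> \<int>" "M $$ (2,0) / ?p \<in> \<int>" "M $$ (2,1) / ?p ^ 2 \<in> \<int>"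
      unfolding 10 20 21 using I[of 3 4] I[of 3 5] I[of 4 5] by simp_all
    note d3 = pmult_div[OF 03] pmult_div[OF p13] pmult_div[OF p23]
    have "cs M = cs ?D"
    proof (rule cs_eq_diag6_tri[OF M(2) D])
      fix i :: nat assume "i < 4"
      then consider "i = 0" | "i = 1" | "i = 2" | "i = 3" by linarith
      then show "M $$ (i,3) / ?p \<in> \<int>" by cases (use d3 e in simp_all)
    next
      show "M $$ (i,4) / 1 \<in> \<int>" if "i < 5" for i using I[of i 4] that by simp
      show "M $$ (i,5) / 1 \<in> \<int>" if "i < 6" for i using I[of i 5] that by simp
    qed (use d e in simp_all)
    then show "C \<in> {cs ?D}" using M(1) by simp
  next
    fix C assume "C \<in> {cs ?D}"
    then have C: "C = cs ?D" by simp
    have "cs ?D \<in> dc (T2_rep 1)" using mem_dc_T2_rep_iff(2)[OF D] r2 rank_gt_1_unit[OF tD] by simp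
    then show "C \<in> tri_cosets 2 (dc (T2_rep 1)) (dvec 1 0 0)"
      unfolding tri_cosets_def C using tD by blast
  qed
  then show ?thesis unfolding tcoef_def tcount_def by (simp only:) simp
qed

text \<open>The block has an entry prime to p and determinant p^2, so its elementary divisors are 1
  and p^2.\<close>

lemma sl2_equiv_unit:
  assumes x: "\<not> int p dvd x"
  shows "sl2_equiv (of_nat p ^ 1, of_int x, of_nat p ^ 1) (of_nat p ^ 2, 0, of_nat p ^ 0)"
proof -
  have "coprime (int p) x" using x prime_p by (intro prime_imp_coprime) auto
  then obtain y z where yz: "y * x + z * int p = 1"
    by (metis coprime_iff_gcd_eq_1 bezout_int coprime_commute)
  define \<alpha> \<beta> where "\<alpha> = (of_int y :: rat)" and "\<beta> = (of_int z :: rat)"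
  have "rat_of_int (y * x + z * int p) = 1" unfolding yz by simp
  then have *: "\<alpha> * of_int x + \<beta> * of_nat p = 1" by (simp add: \<alpha>_def \<beta>_def)
  have "of_nat p * \<alpha> * of_int x + of_nat p * \<beta> * of_nat p = of_nat p * (\<alpha> * of_int x + \<beta> * of_nat p)"
    by (simp add: algebra_simps)
  then have **: "of_nat p * \<alpha> * of_int x + of_nat p * \<beta> * of_nat p = of_nat p" unfolding * by simp
  show ?thesis
    by (rule sl2_equivI[of "of_nat p" "- of_int x" \<alpha> \<beta> 1 0 "of_nat p * \<alpha>" 1])
      (use * ** in \<open>simp_all add: \<alpha>_def \<beta>_def power2_eq_square algebra_simps\<close>)
qed

text \<open>With b = 0 there is a single residue class of corners, so corner 0 accounts for all
  cosets with the exponents 2, 0.\<close>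

lemma card_block_cosets_unit:
  assumes S: "translation_closed 2 S" and k: "k < 3" and x: "\<not> int p dvd x"
  shows "card (block_cosets 2 S k (set_exps k d 1 1) (of_int x)) = card (tri_cosets 2 S (set_exps k d 2 0))"
proof -
  have "card (block_cosets 2 S k (set_exps k d 1 1) (of_int x)) = card (block_cosets 2 S k (set_exps k d 2 0) 0)"
    by (rule card_block_cosets_eq[OF S k _ _ sl2_equiv_unit[OF x]]) simp_all
  also have "\<dots> = card (tri_cosets 2 S (set_exps k d 2 0))"
    using card_tri_cosets_blocks[OF S k, of 2 0 d] by simp
  finally show ?thesis .
qed

text \<open>Sorted by the corner modulo p, each of the p - 1 nonzero residues contributes as many
  cosets as the block diag(p^2, 1).\<close>

lemma card_tri_cosets_split:
  assumes S: "translation_closed 2 S" and k: "k < 3"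
  shows "card (tri_cosets 2 S (set_exps k d 1 1)) =
    card (block_cosets 2 S k (set_exps k d 1 1) 0) + (p - 1) * card (tri_cosets 2 S (set_exps k d 2 0))"
proof -
  have nd: "\<not> int p dvd int x" if "x \<in> {..<p} - {0}" for x
    using that by (auto dest: nat_dvd_not_less)
  have "card (tri_cosets 2 S (set_exps k d 1 1)) = (\<Sum>x<p ^ 1. card (block_cosets 2 S k (set_exps k d 1 1) (of_nat x)))"
    by (rule card_tri_cosets_blocks[OF S k]) simp
  also have "\<dots> = card (block_cosets 2 S k (set_exps k d 1 1) (of_nat 0)) +
      (\<Sum>x\<in>{..<p} - {0}. card (block_cosets 2 S k (set_exps k d 1 1) (of_nat x)))"
    by (subst sum.remove[of _ 0]) simp_all
  also have "(\<Sum>x\<in>{..<p} - {0}. card (block_cosets 2 S k (set_exps k d 1 1) (of_nat x))) =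
      (\<Sum>x\<in>{..<p} - {0}. card (tri_cosets 2 S (set_exps k d 2 0)))"
  proof (rule sum.cong[OF refl])
    fix x assume "x \<in> {..<p} - {0}"
    from card_block_cosets_unit[OF S k nd[OF this], of d]
    show "card (block_cosets 2 S k (set_exps k d 1 1) (of_nat x)) = card (tri_cosets 2 S (set_exps k d 2 0))" by simp
  qed
  finally show ?thesis by simp
qed

end

section \<open>Symmetric matrices over residue fields\<close>

lemma card_Times_filter:
  assumes "finite A" "finite B"
  shows "card {z \<in> A \<times> B. P z} = (\<Sum>a\<in>A. card {b \<in> B. P (a, b)})"
proof -
  have "{z \<in> A \<times> B. P z} = Sigma A (\<lambda>a. {b \<in> B. P (a, b)})" by auto
  then show ?thesis using assms by simp
qed

context fixed_prime
begin

definition res :: "int set" where "res = {0..<int p}"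

lemma res_simps [simp]: "finite res" "card res = p" "0 \<in> res"
  by (simp_all add: res_def)

lemma prime_int_p: "prime (int p)"
  using prime_p by simp

lemma dvd_res: "x \<in> res \<Longrightarrow> int p dvd x \<longleftrightarrow> x = 0"
  using zdvd_imp_le[of "int p" x] by (cases "x = 0") (auto simp: res_def)

lemma dvd_mult_p: "int p dvd x * y \<longleftrightarrow> int p dvd x \<or> int p dvd y"
  by (rule prime_dvd_mult_iff[OF prime_int_p])

lemma unit_mod_p:
  assumes "\<not> int p dvd u"
  obtains v where "int p dvd u * v - 1"
proof -
  have "coprime u (int p)" using prime_imp_coprime[OF prime_int_p assms] by (simp add: coprime_commute)
  then obtain y z where "y * u + z * int p = 1" by (metis coprime_iff_gcd_eq_1 bezout_int)
  then have "u * y - 1 = int p * (- z)" by (simp add: algebra_simps)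
  then show thesis using that[of y] by simp
qed

lemma card_linear_congruence:
  assumes u: "\<not> int p dvd u" and P: "\<And>x. x \<in> res \<Longrightarrow> P x \<longleftrightarrow> int p dvd u * x - v"
  shows "card {x \<in> res. P x} = 1"
proof -
  obtain w where w: "int p dvd u * w - 1" using unit_mod_p[OF u] by blast
  have "{x \<in> res. P x} = {(w * v) mod int p}"
  proof (intro equalityI subsetI)
    fix x assume "x \<in> {x \<in> res. P x}"
    then have x: "x \<in> res" "int p dvd u * x - v" using P by auto
    have "x - w * v = w * (u * x - v) - x * (u * w - 1)" by (simp add: algebra_simps)
    then have "int p dvd x - w * v" using x(2) w by (metis dvd_diff dvd_mult)
    then have "x mod int p = (w * v) mod int p" by (simp add: mod_eq_dvd_iff)
    then show "x \<in> {(w * v) mod int p}" using x(1) by (simp add: res_def)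
  next
    fix x assume "x \<in> {(w * v) mod int p}"
    then have x: "x = (w * v) mod int p" by simp
    have xr: "x \<in> res" using p_pos by (simp add: x res_def)
    have "x mod int p = (w * v) mod int p" by (simp add: x)
    then have d: "int p dvd x - w * v" by (simp add: mod_eq_dvd_iff)
    have "u * x - v = u * (x - w * v) + v * (u * w - 1)" by (simp add: algebra_simps)
    then have "int p dvd u * x - v" using d w by (metis dvd_add dvd_mult)
    then show "x \<in> {x \<in> res. P x}" using P[OF xr] xr by simp
  qed
  then show ?thesis by simp
qed

lemma card_res_filter_all: "(\<And>x. x \<in> res \<Longrightarrow> P x) \<Longrightarrow> card {x \<in> res. P x} = p"
  by (metis (mono_tags, lifting) Collect_cong Collect_mem_eq res_simps(2))

lemma sum_res_split: "(\<Sum>x\<in>res. f x) = f 0 + (\<Sum>x\<in>res - {0}. f x :: nat)"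
  by (rule sum.remove) simp_all

lemma sum_res_nonzero: "(\<And>x. x \<in> res \<Longrightarrow> x \<noteq> 0 \<Longrightarrow> f x = k) \<Longrightarrow> (\<Sum>x\<in>res - {0}. f x) = (p - 1) * (k :: nat)"
  by (subst sum.cong[of _ "res - {0}" f "\<lambda>_. k"]) (simp_all add: card_Diff_singleton)

text \<open>(d,e,f) stands for the symmetric matrix with rows (d,e), (e,f), which occurs below as
  lower right part of a 3 by 3 matrix.\<close>

definition sym2_singular :: "(int \<times> int \<times> int) set" where
  "sym2_singular = {z \<in> res \<times> res \<times> res. case z of (d,e,f) \<Rightarrow> int p dvd d * f - e * e}"

lemma p_minus: "(p - 1) * k + k = p * k"
  using p_pos by (cases p) simp_all

text \<open>For d \<noteq> 0 the entry f is determined by d and e, giving (p - 1) p matrices; for d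
  = 0 also e = 0 and f is free, giving p.\<close>

lemma card_sym2_singular: "card sym2_singular = p ^ 2"
proof -
  let ?c = "\<lambda>d e. card {f \<in> res. int p dvd d * f - e * e}"
  have 1: "(\<Sum>d\<in>res - {0}. \<Sum>e\<in>res. ?c d e) = (p - 1) * p"
  proof (rule sum_res_nonzero)
    fix d assume d: "d \<in> res" "d \<noteq> 0"
    have nd: "\<not> int p dvd d" using d by (simp add: dvd_res)
    have "?c d e = 1" for e
      by (rule card_linear_congruence[OF nd, of _ "e * e"]) simp
    then show "(\<Sum>e\<in>res. ?c d e) = p" by simp
  qed
  have 2: "(\<Sum>e\<in>res - {0}. ?c 0 e) = (p - 1) * 0"
  proof (rule sum_res_nonzero)
    fix e assume e: "e \<in> res" "e \<noteq> 0"
    have "{f \<in> res. int p dvd 0 * f - e * e} = {}" using e dvd_res[OF e(1)] by (simp add: dvd_mult_p)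
    then show "?c 0 e = 0" by simp
  qed
  have 3: "?c 0 0 = p" by (rule card_res_filter_all) simp
  have "card sym2_singular = (\<Sum>d\<in>res. \<Sum>e\<in>res. card {f \<in> res. int p dvd d * f - e * e})"
    by (simp add: sym2_singular_def card_Times_filter split_def)
  also have "(\<Sum>d\<in>res. \<Sum>e\<in>res. ?c d e) = p + (p - 1) * p"
    unfolding sum_res_split[of "\<lambda>d. \<Sum>e\<in>res. ?c d e"] sum_res_split[of "?c 0"] 1 2 3 by simp
  finally show ?thesis using p_minus[of p] by (simp add: power2_eq_square)
qed

text \<open>The sextuple is the symmetric matrix with rows (a,b,c), (b,d,e), (c,e,f). By symmetry
  its nine 2 by 2 minors reduce to these six, so the condition is rank at most 1 modulo p.\<close>

definition sym3_minors :: "int \<times> int \<times> int \<times> int \<times> int \<times> int \<Rightarrow> bool" where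
  "sym3_minors = (\<lambda>(a,b,c,d,e,f). int p dvd a * d - b * b \<and> int p dvd a * e - b * c \<and> int p dvd a * f - c * c \<and>
     int p dvd b * e - c * d \<and> int p dvd b * f - c * e \<and> int p dvd d * f - e * e)"

definition sym3_det :: "int \<times> int \<times> int \<times> int \<times> int \<times> int \<Rightarrow> int" where
  "sym3_det = (\<lambda>(a,b,c,d,e,f). a * (d * f - e * e) - b * (b * f - c * e) + c * (b * e - c * d))"

abbreviation sym3 :: "(int \<times> int \<times> int \<times> int \<times> int \<times> int) set" where
  "sym3 \<equiv> res \<times> res \<times> res \<times> res \<times> res \<times> res"

lemma dvd_combination:
  "(m::int) dvd x \<Longrightarrow> m dvd y \<Longrightarrow> z = s * x + t * y \<Longrightarrow> m dvd z"
  by simp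

text \<open>A unit a leaves b and c free and determines d, e, f, giving (p - 1) p^2; the remaining
  minors follow after multiplication by a. For a = 0 also b = c = 0, and a singular 2 by 2 matrix is
  left.\<close>

lemma card_sym3_minors: "card {t \<in> sym3. sym3_minors t} = p ^ 3"
proof -
  have "card {t \<in> sym3. sym3_minors t} = (\<Sum>a\<in>res. card {u \<in> res \<times> res \<times> res \<times> res \<times> res. sym3_minors (a,u)})"
    by (rule card_Times_filter) simp_all
  also have "\<dots> = card {u \<in> res \<times> res \<times> res \<times> res \<times> res. sym3_minors (0,u)} + (p - 1) * p ^ 2"
    unfolding sum_res_split
  proof (rule arg_cong2[where f = "(+)", OF refl sum_res_nonzero])
    fix a assume a: "a \<in> res" "a \<noteq> 0"
    then have na: "\<not> int p dvd a" by (simp add: dvd_res)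
    have step: "sym3_minors (a,b,c,d,e,f) \<longleftrightarrow> int p dvd a * d - b * b \<and> int p dvd a * e - b * c \<and> int p dvd a * f - c * c" for b c d e f
    proof -
      have "int p dvd b * e - c * d" if h: "int p dvd a * d - b * b" "int p dvd a * e - b * c"
      proof -
        have "int p dvd a * (b * e - c * d)"
          by (rule dvd_combination[OF h, of _ "-c" b]) (simp add: algebra_simps)
        then show ?thesis using na by (simp add: dvd_mult_p)
      qed
      moreover have "int p dvd b * f - c * e" if h: "int p dvd a * f - c * c" "int p dvd a * e - b * c"
      proof -
        have "int p dvd a * (b * f - c * e)"
          by (rule dvd_combination[OF h, of _ b "-c"]) (simp add: algebra_simps)
        then show ?thesis using na by (simp add: dvd_mult_p)
      qed
      moreover have "int p dvd d * f - e * e" if h: "int p dvd a * d - b * b" "int p dvd a * e - b * c" "int p dvd a * f - c * c"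
      proof -
        have 1: "int p dvd a * d * f - b * b * f" using dvd_mult2[OF h(1), of f] by (simp add: algebra_simps)
        have 2: "int p dvd (a * e - b * c) * e" using h(2) by simp
        have "int p dvd a * (b * f - c * e)"
          by (rule dvd_combination[OF h(3,2), of _ b "-c"]) (simp add: algebra_simps)
        then have 3: "int p dvd b * f - c * e" using na by (simp add: dvd_mult_p)
        have "a * (d * f - e * e) = (a * d * f - b * b * f) - (a * e - b * c) * e + b * (b * f - c * e)" by (simp add: algebra_simps)
        then have "int p dvd a * (d * f - e * e)" using 1 2 3 by simp
        then show ?thesis using na by (simp add: dvd_mult_p)
      qed
      ultimately show ?thesis unfolding sym3_minors_def by auto
    qed
    have one: "card {x \<in> res. int p dvd a * x - v} = 1" for v
      by (rule card_linear_congruence[OF na]) simp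
    have "card {u \<in> res \<times> res \<times> res \<times> res \<times> res. sym3_minors (a,u)} =
       (\<Sum>b\<in>res. \<Sum>c\<in>res. card {z \<in> res \<times> res \<times> res. sym3_minors (a,b,c,z)})"
      by (simp add: card_Times_filter)
    also have "\<dots> = (\<Sum>b\<in>res. \<Sum>c\<in>res. 1)"
    proof (intro sum.cong refl)
      fix b c
      have "{z \<in> res \<times> res \<times> res. sym3_minors (a,b,c,z)} =
        {d \<in> res. int p dvd a * d - b * b} \<times> {e \<in> res. int p dvd a * e - b * c} \<times> {f \<in> res. int p dvd a * f - c * c}"
        using step by auto
      then show "card {z \<in> res \<times> res \<times> res. sym3_minors (a,b,c,z)} = 1" by (simp add: one card_cartesian_product)
    qed
    finally show "card {u \<in> res \<times> res \<times> res \<times> res \<times> res. sym3_minors (a,u)} = p ^ 2" by (simp add: power2_eq_square)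
  qed
  also have "card {u \<in> res \<times> res \<times> res \<times> res \<times> res. sym3_minors (0,u)} = p ^ 2"
  proof -
    have "{u \<in> res \<times> res \<times> res \<times> res \<times> res. sym3_minors (0,u)} = {0} \<times> {0} \<times> sym2_singular"
      by (auto simp: sym3_minors_def sym2_singular_def dvd_mult_p dvd_res)
    then show ?thesis
      by (simp add: card_cartesian_product card_sym2_singular)
  qed
  finally show ?thesis using p_minus[of "p ^ 2"] by (simp add: power3_eq_cube power2_eq_square)
qed

text \<open>Sorted by the lower right block (d,e,f): if it is nonsingular, a is determined by b and
  c. If it is zero, the determinant vanishes identically. If it has rank 1, the determinant reduces
  to a quadratic form in (b,c) that is a multiple of the square of a linear form, so p pairs (b,c)
  and p values of a remain.\<close>

lemma card_sym3_singular: "card {t \<in> sym3. int p dvd sym3_det t} = p ^ 5 + p ^ 3 - p ^ 2"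
proof -
  define N where "N = (\<lambda>(d,e,f). card {u \<in> res \<times> res \<times> res. int p dvd sym3_det (snd (snd u), fst u, fst (snd u), d, e, f)})"
  let ?R3 = "res \<times> res \<times> res"
  \<comment> \<open>Reordered so that the block (d,e,f) comes first and a is counted last.\<close>
  have "bij_betw (\<lambda>((d,e,f),(b,c,a)). (a,b,c,d,e,f)) {t \<in> ?R3 \<times> ?R3. int p dvd sym3_det (case t of ((d,e,f),(b,c,a)) \<Rightarrow> (a,b,c,d,e,f))}
     {t \<in> sym3. int p dvd sym3_det t}"
    by (rule bij_betw_byWitness[where f' = "\<lambda>(a,b,c,d,e,f). ((d,e,f),(b,c,a))"]) auto
  from bij_betw_same_card[OF this, symmetric]
  have "card {t \<in> sym3. int p dvd sym3_det t} = (\<Sum>z\<in>?R3. N z)"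
    by (simp add: card_Times_filter N_def split_def)
  also have "\<dots> = (\<Sum>z\<in>?R3 - sym2_singular. N z) + (\<Sum>z\<in>sym2_singular. N z)"
    by (rule sum.subset_diff) (auto simp: sym2_singular_def)
  also have "(\<Sum>z\<in>?R3 - sym2_singular. N z) = (\<Sum>z\<in>?R3 - sym2_singular. p ^ 2)"
  proof (rule sum.cong[OF refl])
    fix z assume z: "z \<in> ?R3 - sym2_singular"
    obtain d e f where def: "z = (d,e,f)" by (cases z)
    have nd: "\<not> int p dvd d * f - e * e" using z by (auto simp: def sym2_singular_def)
    have one: "card {a \<in> res. int p dvd sym3_det (a,b,c,d,e,f)} = 1" for b c
      by (rule card_linear_congruence[OF nd, of _ "b * (b * f - c * e) - c * (b * e - c * d)"])
        (simp add: sym3_det_def algebra_simps)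
    have "N z = (\<Sum>b\<in>res. \<Sum>c\<in>res. card {a \<in> res. int p dvd sym3_det (a,b,c,d,e,f)})"
      by (simp add: N_def def card_Times_filter)
    also have "\<dots> = (\<Sum>b\<in>res. \<Sum>c\<in>res. 1)"
      unfolding one ..
    finally show "N z = p ^ 2" by (simp add: power2_eq_square)
  qed
  also have "(\<Sum>z\<in>sym2_singular. N z) = N (0,0,0) + (\<Sum>z\<in>sym2_singular - {(0,0,0)}. N z)"
    by (rule sum.remove) (auto simp: sym2_singular_def)
  also have "N (0,0,0) = p ^ 3"
  proof -
    have "N (0,0,0) = card ?R3" by (simp add: N_def sym3_det_def)
    then show ?thesis by (simp add: card_cartesian_product power3_eq_cube)
  qed
  also have "(\<Sum>z\<in>sym2_singular - {(0,0,0)}. N z) = (\<Sum>z\<in>sym2_singular - {(0,0,0)}. p ^ 2)"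
  proof (rule sum.cong[OF refl])
    fix z assume z: "z \<in> sym2_singular - {(0,0,0)}"
    obtain d e f where def: "z = (d,e,f)" by (cases z)
    have r: "d \<in> res" "e \<in> res" "f \<in> res" and df: "int p dvd d * f - e * e" and nz: "(d,e,f) \<noteq> (0,0,0)"
      using z by (auto simp: def sym2_singular_def)
    have q: "int p dvd sym3_det (a,b,c,d,e,f) \<longleftrightarrow> int p dvd b * b * f - 2 * b * c * e + c * c * d" for a b c
    proof -
      have "sym3_det (a,b,c,d,e,f) = a * (d * f - e * e) - (b * b * f - 2 * b * c * e + c * c * d)"
        by (simp add: sym3_det_def algebra_simps)
      then show ?thesis using df by (simp add: dvd_diff_right_iff)
    qed
    have N: "N z = (\<Sum>b\<in>res. \<Sum>c\<in>res. card {a \<in> res. int p dvd b * b * f - 2 * b * c * e + c * c * d})"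
      by (simp add: N_def def card_Times_filter q)
    have count: "N z = p ^ 2" if "(\<Sum>b\<in>res. card {c \<in> res. int p dvd b * b * f - 2 * b * c * e + c * c * d}) = p"
    proof -
      have "card {a \<in> res. Q} = (if Q then p else 0)" for Q by simp
      then have "N z = (\<Sum>b\<in>res. \<Sum>c\<in>res. if int p dvd b * b * f - 2 * b * c * e + c * c * d then p else 0)" unfolding N by simp
      also have "\<dots> = (\<Sum>b\<in>res. p * card {c \<in> res. int p dvd b * b * f - 2 * b * c * e + c * c * d})"
        by (simp add: sum.If_cases Int_def mult.commute)
      also have "\<dots> = p * p" unfolding sum_distrib_left[symmetric] that ..
      finally show ?thesis by (simp add: power2_eq_square)
    qed
    show "N z = p ^ 2"
    proof (rule count, cases "d = 0")
      case False
      then have nd: "\<not> int p dvd d" using dvd_res r by simp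
      have "card {c \<in> res. int p dvd b * b * f - 2 * b * c * e + c * c * d} = 1" for b
      proof (rule card_linear_congruence[OF nd, of _ "b * e"])
        fix c
        \<comment> \<open>Modulo p and up to the unit d, the form is the square of d c - b
          e.\<close>
        have "d * (b * b * f - 2 * b * c * e + c * c * d) = b * b * (d * f - e * e) + (d * c - b * e) * (d * c - b * e)"
          by (simp add: algebra_simps)
        then have "int p dvd d * (b * b * f - 2 * b * c * e + c * c * d) \<longleftrightarrow> int p dvd (d * c - b * e) * (d * c - b * e)"
          using df by (simp add: dvd_add_right_iff)
        then show "int p dvd b * b * f - 2 * b * c * e + c * c * d \<longleftrightarrow> int p dvd d * c - b * e"
          using nd by (simp add: dvd_mult_p)
      qed
      then show "(\<Sum>b\<in>res. card {c \<in> res. int p dvd b * b * f - 2 * b * c * e + c * c * d}) = p" by simp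
    next
      case True
      then have e0: "e = 0" using df dvd_res[OF r(2)] by (simp add: dvd_mult_p)
      then have nf: "\<not> int p dvd f" using True nz dvd_res[OF r(3)] by simp
      have "card {c \<in> res. int p dvd b * b * f - 2 * b * c * e + c * c * d} = (if b = 0 then p else 0)" if "b \<in> res" for b
        using that nf dvd_res[OF that] by (simp add: e0 True dvd_mult_p)
      then show "(\<Sum>b\<in>res. card {c \<in> res. int p dvd b * b * f - 2 * b * c * e + c * c * d}) = p" by simp
    qed
  qed
  also have "(\<Sum>z\<in>?R3 - sym2_singular. p ^ 2) = (p ^ 3 - p ^ 2) * p ^ 2"
  proof -
    have "card (?R3 - sym2_singular) = card ?R3 - card sym2_singular"
      by (rule card_Diff_subset) (auto simp: sym2_singular_def intro: finite_subset[of _ ?R3])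
    then show ?thesis by (simp add: card_sym2_singular card_cartesian_product power3_eq_cube)
  qed
  also have "(\<Sum>z\<in>sym2_singular - {(0,0,0)}. p ^ 2) = (p ^ 2 - 1) * p ^ 2"
  proof -
    have "(0,0,0) \<in> sym2_singular" by (simp add: sym2_singular_def)
    then have "card (sym2_singular - {(0,0,0)}) = p ^ 2 - 1" by (simp add: card_Diff_singleton card_sym2_singular)
    then show ?thesis by (simp only: sum_constant of_nat_id)
  qed
  finally have c: "card {t \<in> sym3. int p dvd sym3_det t} = (p ^ 3 - p ^ 2) * p ^ 2 + (p ^ 3 + (p ^ 2 - 1) * p ^ 2)" .
  \<comment> \<open>Additive witnesses for the differences avoid truncated subtraction in the final
    arithmetic.\<close>
  obtain a where a: "p ^ 3 = p ^ 2 + a"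
    using le_iff_add[of "p ^ 2" "p ^ 3"] power_increasing[of 2 3 p] p_pos(1) by auto
  obtain b where b: "p ^ 2 = 1 + b"
    using le_iff_add[of 1 "p ^ 2"] one_le_power[of p 2] p_pos(1) by auto
  have "p ^ 3 - p ^ 2 = a" "p ^ 2 - 1 = b" using a b by simp_all
  then have "card {t \<in> sym3. int p dvd sym3_det t} + p ^ 2 = p ^ 2 * (a + (1 + b)) + p ^ 3"
    unfolding c by (simp add: algebra_simps)
  also have "a + (1 + b) = p ^ 3" using a b by simp
  also have "p ^ 2 * p ^ 3 = p ^ 5" by (simp flip: power_add)
  finally show ?thesis by simp
qed

lemma sym3_det_minors: "sym3_minors t \<Longrightarrow> int p dvd sym3_det t"
  by (auto simp: sym3_minors_def sym3_det_def split: prod.splits)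

lemma card_sym3_rank:
  "card {t \<in> sym3. sym3_minors t \<and> t \<noteq> (0,0,0,0,0,0)} = p ^ 3 - 1"
  "card {t \<in> sym3. int p dvd sym3_det t \<and> \<not> sym3_minors t} = p ^ 5 - p ^ 2"
proof -
  let ?A = "{t \<in> sym3. sym3_minors t}" and ?D = "{t \<in> sym3. int p dvd sym3_det t}"
  have fin: "finite sym3" by simp
  have "(0,0,0,0,0,0) \<in> ?A" by (simp add: sym3_minors_def)
  then have "card (?A - {(0,0,0,0,0,0)}) = p ^ 3 - 1" by (simp add: card_Diff_singleton card_sym3_minors)
  moreover have "?A - {(0,0,0,0,0,0)} = {t \<in> sym3. sym3_minors t \<and> t \<noteq> (0,0,0,0,0,0)}" by blast
  ultimately show "card {t \<in> sym3. sym3_minors t \<and> t \<noteq> (0,0,0,0,0,0)} = p ^ 3 - 1" by simp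
  have "card (?D - ?A) = card ?D - card ?A"
    by (rule card_Diff_subset) (use sym3_det_minors fin in auto)
  moreover have "?D - ?A = {t \<in> sym3. int p dvd sym3_det t \<and> \<not> sym3_minors t}" by blast
  ultimately show "card {t \<in> sym3. int p dvd sym3_det t \<and> \<not> sym3_minors t} = p ^ 5 - p ^ 2"
    by (simp add: card_sym3_minors card_sym3_singular)
qed

lemma card_sym2_rank_1: "card (sym2_singular - {(0,0,0)}) = p ^ 2 - 1"
proof -
  have "(0,0,0) \<in> sym2_singular" by (simp add: sym2_singular_def)
  then show ?thesis by (simp add: card_Diff_singleton card_sym2_singular)
qed

section \<open>Removing the off-diagonal entries of D\<close>

lemma card_UN_residues:
  assumes "\<And>x. x < p \<Longrightarrow> finite (A x)" "\<And>x y. x < p \<Longrightarrow> y < p \<Longrightarrow> x \<noteq> y \<Longrightarrow> A x \<inter> A y = {}"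
    and "\<And>x. x < p \<Longrightarrow> x \<noteq> 0 \<Longrightarrow> card (A x) = k"
  shows "card (\<Union>x\<in>{..<p}. A x) = card (A 0) + (p - 1) * k"
proof -
  have "card (\<Union>x\<in>{..<p}. A x) = (\<Sum>x<p. card (A x))"
    by (rule card_UN_disjoint) (use assms in auto)
  also have "\<dots> = card (A 0) + (\<Sum>x\<in>{..<p} - {0}. card (A x))"
    by (rule sum.remove) (use p_pos in simp_all)
  also have "(\<Sum>x\<in>{..<p} - {0}. card (A x)) = (\<Sum>x\<in>{..<p} - {0}. k)"
    by (rule sum.cong) (use assms(3) in auto)
  finally show ?thesis using p_pos by simp
qed

text \<open>The root of \<open>root3\<close> is not simple: it would carry the entries (3,4) and
  (4,5) below the diagonal. Where these vanish, the argument for simple roots goes through and they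
  remain 0.\<close>

lemma tri_root3_move:
  assumes M: "tri p \<delta> (dvec a b c) M" and M0: "M $$ (3,4) = 0" "M $$ (4,5) = 0" "M $$ (3,5) = x"
    and eq: "sl2_equiv_by (\<alpha>,\<beta>,\<gamma>,\<epsilon>) (\<alpha>',\<beta>',\<gamma>',\<epsilon>') (of_nat p ^ a, x, of_nat p ^ c) (of_nat p ^ a', x', of_nat p ^ c')"
    and N: "N = root3 \<alpha> \<beta> \<gamma> \<epsilon> * M * root3 \<epsilon>' (-\<beta>') (-\<gamma>') \<alpha>'"
  shows "root3 \<alpha> \<beta> \<gamma> \<epsilon> \<in> Sp_int 3" "root3 \<epsilon>' (-\<beta>') (-\<gamma>') \<alpha>' \<in> Sp_int 3"
    "tri p \<delta> (dvec a' b c') N" "N $$ (3,4) = 0" "N $$ (4,5) = 0" "N $$ (3,5) = x'"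
proof -
  have I: "\<alpha> \<in> \<int>" "\<beta> \<in> \<int>" "\<gamma> \<in> \<int>" "\<epsilon> \<in> \<int>" "\<alpha>' \<in> \<int>" "\<beta>' \<in> \<int>" "\<gamma>' \<in> \<int>" "\<epsilon>' \<in> \<int>"
    and d: "\<alpha> * \<epsilon> - \<beta> * \<gamma> = 1" "\<epsilon>' * \<alpha>' - (-\<beta>') * (-\<gamma>') = 1"
    using eq by (simp_all add: sl2_equiv_by_def algebra_simps)
  note r = sl2_equiv_by_conj[OF eq]
  show g: "root3 \<alpha> \<beta> \<gamma> \<epsilon> \<in> Sp_int 3" by (rule Sp_int_generators(4)[OF I(1-4) d(1)])
  show h: "root3 \<epsilon>' (-\<beta>') (-\<gamma>') \<alpha>' \<in> Sp_int 3"
    by (rule Sp_int_generators(4)[OF I(8) _ _ I(5) d(2)]) (use I in simp_all)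
  have NI: "N \<in> int_sim p \<delta>" unfolding N by (rule int_sim_mult_right[OF int_sim_mult_left[OF g triD(1)[OF M]] h])
  note t = triD[OF M] and td = tri_diag[OF M]
  note m = mult6[OF root3_index(1) tri_carrier[OF M]] mult6[OF mult_carrier_mat[OF root3_index(1) tri_carrier[OF M]] root3_index(1)]
  note ts = t(2-13,17-) td(1-3)[simplified]
  have dd: "M $$ (3,3) = of_nat p ^ a" "M $$ (4,4) = of_nat p ^ b" "M $$ (5,5) = of_nat p ^ c"
    using t(14-16) by simp_all
  have n: "N $$ (3,3) = \<alpha> * of_nat p ^ a * \<epsilon>' - (\<alpha> * x + \<beta> * of_nat p ^ c) * \<gamma>'"
    "N $$ (3,5) = (\<alpha> * x + \<beta> * of_nat p ^ c) * \<alpha>' - \<alpha> * of_nat p ^ a * \<beta>'"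
    "N $$ (5,3) = \<gamma> * of_nat p ^ a * \<epsilon>' - (\<gamma> * x + \<epsilon> * of_nat p ^ c) * \<gamma>'"
    "N $$ (5,5) = (\<gamma> * x + \<epsilon> * of_nat p ^ c) * \<alpha>' - \<gamma> * of_nat p ^ a * \<beta>'"
    unfolding N by (simp_all add: m ts dd M0 algebra_simps del: index_mult_mat)
  have z: "N $$ (3,0) = 0" "N $$ (3,1) = 0" "N $$ (3,2) = 0" "N $$ (4,0) = 0" "N $$ (4,1) = 0" "N $$ (4,2) = 0"
      "N $$ (4,3) = 0" "N $$ (5,0) = 0" "N $$ (5,1) = 0" "N $$ (5,2) = 0" "N $$ (5,4) = 0"
    and z': "N $$ (4,4) = of_nat p ^ b" "N $$ (3,4) = 0" "N $$ (4,5) = 0"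
    unfolding N by (simp_all add: m ts dd M0 del: index_mult_mat)
  show "N $$ (3,4) = 0" "N $$ (4,5) = 0" by (fact z')+
  show "N $$ (3,5) = x'" unfolding n(2) by (rule r(2))
  show "tri p \<delta> (dvec a' b c') N"
    unfolding tri_def using NI n[unfolded r] z z' by simp
qed

lemma tri_left_unipotent:
  assumes M: "tri p \<delta> d M" and t: "t \<in> \<int>"
  shows "\<exists>N. tri p \<delta> d N \<and> cs N = cs M \<and> N $$ (3,4) = M $$ (3,4) + t * M $$ (4,4) \<and>
      N $$ (3,5) = M $$ (3,5) + t * M $$ (4,5) \<and> N $$ (4,5) = M $$ (4,5)"
    "\<exists>N. tri p \<delta> d N \<and> cs N = cs M \<and> N $$ (3,4) = M $$ (3,4) \<and>
      N $$ (3,5) = M $$ (3,5) \<and> N $$ (4,5) = M $$ (4,5) + t * M $$ (5,5)"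
    "\<exists>N. tri p \<delta> d N \<and> cs N = cs M \<and> N $$ (3,4) = M $$ (3,4) \<and>
      N $$ (3,5) = M $$ (3,5) + t * M $$ (5,5) \<and> N $$ (4,5) = M $$ (4,5)"
proof -
  note ts = triD[OF M]
  have g: "root1 1 t 0 1 \<in> Sp_int 3" "root2 1 t 0 1 \<in> Sp_int 3" "root3 1 t 0 1 \<in> Sp_int 3"
    using Sp_int_generators[of 1 t 0 1] t by simp_all
  note cs = cs_mult_left[OF ts(1) g(1)] cs_mult_left[OF ts(1) g(2)] cs_mult_left[OF ts(1) g(3)]
  note NI = int_sim_mult_left[OF g(1) ts(1)] int_sim_mult_left[OF g(2) ts(1)] int_sim_mult_left[OF g(3) ts(1)]
  note m = mult6[OF root1_index(1) tri_carrier[OF M]] mult6[OF root2_index(1) tri_carrier[OF M]] mult6[OF root3_index(1) tri_carrier[OF M]]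
  have 1: "tri p \<delta> d (root1 1 t 0 1 * M)" "tri p \<delta> d (root2 1 t 0 1 * M)" "tri p \<delta> d (root3 1 t 0 1 * M)"
    unfolding tri_def using NI by (simp_all add: m ts(2-) del: index_mult_mat)
  show "\<exists>N. tri p \<delta> d N \<and> cs N = cs M \<and> N $$ (3,4) = M $$ (3,4) + t * M $$ (4,4) \<and>
      N $$ (3,5) = M $$ (3,5) + t * M $$ (4,5) \<and> N $$ (4,5) = M $$ (4,5)"
    by (intro exI[of _ "root1 1 t 0 1 * M"] conjI 1(1) cs(1)) (simp_all add: m ts(2-) del: index_mult_mat)
  show "\<exists>N. tri p \<delta> d N \<and> cs N = cs M \<and> N $$ (3,4) = M $$ (3,4) \<and>
      N $$ (3,5) = M $$ (3,5) \<and> N $$ (4,5) = M $$ (4,5) + t * M $$ (5,5)"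
    by (intro exI[of _ "root2 1 t 0 1 * M"] conjI 1(2) cs(2)) (simp_all add: m ts(2-) del: index_mult_mat)
  show "\<exists>N. tri p \<delta> d N \<and> cs N = cs M \<and> N $$ (3,4) = M $$ (3,4) \<and>
      N $$ (3,5) = M $$ (3,5) + t * M $$ (5,5) \<and> N $$ (4,5) = M $$ (4,5)"
    by (intro exI[of _ "root3 1 t 0 1 * M"] conjI 1(3) cs(3)) (simp_all add: m ts(2-) del: index_mult_mat)
qed

text \<open>Above the diagonal of D only the corner (3,5) may differ from 0, the situation in which
  \<open>root3\<close> can be used.\<close>

definition clean_cosets :: "rat mat set set \<Rightarrow> nat \<Rightarrow> nat \<Rightarrow> nat \<Rightarrow> rat \<Rightarrow> rat mat set set" where
  "clean_cosets S a b c x = {C \<in> S. \<exists>M. tri p 2 (dvec a b c) M \<and> M $$ (3,4) = 0 \<and> M $$ (4,5) = 0 \<and> M $$ (3,5) = x \<and> C = cs M}"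

lemma card_clean_cosets_le:
  assumes S: "translation_closed 2 S"
    and eq: "sl2_equiv (of_nat p ^ a, x, of_nat p ^ c) (of_nat p ^ a', x', of_nat p ^ c')"
  shows "card (clean_cosets S a b c x) \<le> card (clean_cosets S a' b c' x')"
proof -
  obtain \<alpha> \<beta> \<gamma> \<epsilon> \<alpha>' \<beta>' \<gamma>' \<epsilon>' where
    eq: "sl2_equiv_by (\<alpha>,\<beta>,\<gamma>,\<epsilon>) (\<alpha>',\<beta>',\<gamma>',\<epsilon>') (of_nat p ^ a, x, of_nat p ^ c) (of_nat p ^ a', x', of_nat p ^ c')"
    using eq by (rule sl2_equivE)
  define h where "h = root3 \<epsilon>' (-\<beta>') (-\<gamma>') \<alpha>'"
  define g where "g = root3 \<alpha> \<beta> \<gamma> \<epsilon>"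
  have h: "h \<in> Sp_int 3" unfolding h_def using eq by (intro Sp_int_generators(4)) (auto simp: sl2_equiv_by_def algebra_simps)
  show ?thesis
  proof (rule card_translate_le[OF _ h])
    show "finite (clean_cosets S a' b c' x')"
      using S by (simp add: translation_closed_def clean_cosets_def)
    fix C assume "C \<in> clean_cosets S a b c x"
    then obtain M where M: "C \<in> S" "tri p 2 (dvec a b c) M" "M $$ (3,4) = 0" "M $$ (4,5) = 0" "M $$ (3,5) = x" "C = cs M"
      by (auto simp: clean_cosets_def)
    note MI = triD(1)[OF M(2)]
    note N = tri_root3_move[OF M(2-5) eq refl, folded g_def h_def]
    have as: "g * M * h = g * (M * h)"
      by (rule mult6_assoc[OF Sp_int_carrier[OF N(1)] int_sim_carrier[OF MI] Sp_int_carrier[OF h]])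
    have e: "cs (g * M * h) = cs (M * h)" unfolding as by (rule cs_mult_left[OF int_sim_mult_right[OF MI h] N(1)])
    have "cs (M * h) \<in> S"
      by (rule translation_closedD[OF S MI h M(1)[unfolded M(6)]])
    then have "cs (M * h) \<in> clean_cosets S a' b c' x'"
      unfolding clean_cosets_def by (intro CollectI conjI exI[of _ "g * M * h"] N(3-6) e[symmetric])
    then show "\<exists>M \<in> int_sim p 2. C = cs M \<and> cs (M * h) \<in> clean_cosets S a' b c' x'"
      using MI M(6) by (intro bexI[of _ M] conjI)
  qed
qed

lemma card_clean_cosets_eq:
  assumes "translation_closed 2 S" "sl2_equiv (of_nat p ^ a, x, of_nat p ^ c) (of_nat p ^ a', x', of_nat p ^ c')"
  shows "card (clean_cosets S a b c x) = card (clean_cosets S a' b c' x')"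
  using card_clean_cosets_le[OF assms] card_clean_cosets_le[OF assms(1) sl2_equiv_sym[OF assms(2)]] by (rule le_antisym)

text \<open>For the exponents (2,1,0) the entry (0,0) is 1, so the relation between A and D makes
  (3,4) divisible by its pivot p, while column 5 has pivot 1. Left unipotent factors clear D off the
  diagonal.\<close>

lemma clean_cosets_210: "clean_cosets S 2 1 0 0 = tri_cosets 2 S (dvec 2 1 0)"
proof
  show "clean_cosets S 2 1 0 0 \<subseteq> tri_cosets 2 S (dvec 2 1 0)"
    unfolding clean_cosets_def tri_cosets_def by blast
  show "tri_cosets 2 S (dvec 2 1 0) \<subseteq> clean_cosets S 2 1 0 0"
  proof
    fix C assume "C \<in> tri_cosets 2 S (dvec 2 1 0)"
    then obtain M where M: "C \<in> S" "tri p 2 (dvec 2 1 0) M" "C = cs M" by (auto simp: tri_cosets_def)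
    let ?p = "of_nat p :: rat"
    have I: "M $$ (i,j) \<in> \<int>" if "i < 6" "j < 6" for i j using int_sim_Ints[OF triD(1)[OF M(2)] that] .
    have d: "M $$ (0,0) = 1" "M $$ (4,4) = ?p" using triD(15)[OF M(2)] tri_diag(7)[OF M(2)] by simp_all
    have 34: "M $$ (3,4) + M $$ (1,0) * ?p = 0" using tri_relations(1)[OF M(2)] d by simp
    obtain N1 where N1: "tri p 2 (dvec 2 1 0) N1" "cs N1 = cs M" "N1 $$ (3,4) = 0"
      using tri_left_unipotent(1)[OF M(2), of "M $$ (1,0)"] I[of 1 0] 34 d by auto
    have I1: "N1 $$ (i,j) \<in> \<int>" if "i < 6" "j < 6" for i j using int_sim_Ints[OF triD(1)[OF N1(1)] that] .
    have d1: "N1 $$ (5,5) = 1" using triD(16)[OF N1(1)] by simp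
    obtain N2 where N2: "tri p 2 (dvec 2 1 0) N2" "cs N2 = cs M" "N2 $$ (3,4) = 0" "N2 $$ (4,5) = 0"
      using tri_left_unipotent(2)[OF N1(1), of "- N1 $$ (4,5)"] I1[of 4 5] d1 N1(2,3) by auto
    have I2: "N2 $$ (i,j) \<in> \<int>" if "i < 6" "j < 6" for i j using int_sim_Ints[OF triD(1)[OF N2(1)] that] .
    have d2: "N2 $$ (5,5) = 1" using triD(16)[OF N2(1)] by simp
    obtain N3 where N3: "tri p 2 (dvec 2 1 0) N3" "cs N3 = cs M" "N3 $$ (3,4) = 0" "N3 $$ (4,5) = 0" "N3 $$ (3,5) = 0"
      using tri_left_unipotent(3)[OF N2(1), of "- N2 $$ (3,5)"] I2[of 3 5] d2 N2(2-4) by auto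
    show "C \<in> clean_cosets S 2 1 0 0"
      unfolding clean_cosets_def by (intro CollectI conjI exI[of _ N3] M(1) N3) (simp add: M(3) N3(2))
  qed
qed

lemma residue_of_Ints:
  assumes "x \<in> \<int>"
  obtains t :: rat and r :: nat where "t \<in> \<int>" "r < p" "x + t * of_nat p = of_nat r"
proof -
  obtain z where z: "x = of_int z" using assms by (auto elim: Ints_cases)
  have pos: "int p > 0" using p_pos(1) by simp
  have "(of_int z :: rat) + of_int (- (z div int p)) * of_nat p = of_int (z - z div int p * int p)" by simp
  also have "z - z div int p * int p = int (nat (z mod int p))" using pos by (simp add: minus_div_mult_eq_mod)
  finally have "x + of_int (- (z div int p)) * of_nat p = of_nat (nat (z mod int p))" by (simp add: z)
  moreover have "nat (z mod int p) < p" using pos_mod_bound[OF pos, of z] pos by (simp add: nat_less_iff)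
  ultimately show thesis using that[of "of_int (- (z div int p))"] by simp
qed

lemma residue_unique:
  assumes "x < p" "y < p" "t \<in> \<int>" "(of_nat y :: rat) = of_nat x + t * of_nat p"
  shows "x = y"
proof -
  obtain l where l: "t = of_int l" using assms(3) by (auto elim: Ints_cases)
  then have "rat_of_int (int y) = of_int (int x + l * int p)" using assms(4) by simp
  then have "int y = int x + l * int p" by (simp only: of_int_eq_iff)
  then have "int y mod int p = int x mod int p" by simp
  then show ?thesis using assms by simp
qed

lemma clean_cosets_disjoint:
  assumes xy: "x < p" "y < p" "x \<noteq> y"
  shows "clean_cosets S 1 1 1 (of_nat x) \<inter> clean_cosets S 1 1 1 (of_nat y) = {}"
proof (rule ccontr)
  assume "\<not> ?thesis"
  then obtain C where C: "C \<in> clean_cosets S 1 1 1 (of_nat x)" "C \<in> clean_cosets S 1 1 1 (of_nat y)" by blast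
  obtain M where M: "tri p 2 (dvec 1 1 1) M" "M $$ (3,4) = 0" "M $$ (4,5) = 0" "M $$ (3,5) = of_nat x" "C = cs M"
    using C(1) by (auto simp: clean_cosets_def)
  obtain N where N: "tri p 2 (dvec 1 1 1) N" "N $$ (3,5) = of_nat y" "C = cs N"
    using C(2) by (auto simp: clean_cosets_def)
  obtain g where g: "g \<in> Sp_int 3" "N = g * M"
    using cs_lrel_iff[OF triD(1)[OF M(1)] triD(1)[OF N(1)]] M(5) N(3) by (auto simp: lrel_def)
  note u = tri_lrel_unipotent[OF M(1) N(1)[unfolded g(2)] g(1)]
  have "N $$ (3,5) = M $$ (3,5) + g $$ (3,5) * of_nat p"
    unfolding g(2) using mult6[OF Sp_int_carrier[OF g(1)] tri_carrier[OF M(1)], of 3 5] u(5-7,12) M(3) triD(16)[OF M(1)] by simp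
  then have "(of_nat y :: rat) = of_nat x + g $$ (3,5) * of_nat p" unfolding M(4) N(2) .
  moreover have "g $$ (3,5) \<in> \<int>" using Sp_int_Ints[OF g(1)] by simp
  ultimately show False using residue_unique[OF xy(1,2)] xy(3) by blast
qed

lemma set_exps_111: "set_exps k (dvec 1 1 1) 1 1 = dvec 1 1 1"
  by (auto simp: set_exps_def dvec_def fun_eq_iff)

lemma pmult_of_nat: "pmult 1 (of_nat n) \<longleftrightarrow> p dvd n"
proof
  assume "pmult 1 (of_nat n)"
  then obtain k where k: "k \<in> \<int>" "(of_nat n :: rat) = of_nat p * k" by (auto simp: pmult_def)
  then obtain l where "k = of_int l" by (auto elim: Ints_cases)
  then have "rat_of_int (int n) = of_int (int p * l)" using k(2) by simp
  then have "int n = int p * l" by (simp only: of_int_eq_iff)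
  then have "int p dvd int n" by simp
  then show "p dvd n" by simp
next
  assume "p dvd n"
  then obtain k where "n = p * k" by (elim dvdE)
  then show "pmult 1 (of_nat n)" by (intro pmult1I[of "of_nat k"]) simp_all
qed

text \<open>Integrality of A = p^2 D^-T: its entry (2,0) is, up to an integer, the product of these
  two entries divided by p.\<close>

lemma tri_111_relation:
  assumes M: "tri p 2 (dvec 1 1 1) M"
  shows "pmult 1 (M $$ (3,4) * M $$ (4,5))"
proof -
  let ?p = "of_nat p :: rat"
  have d: "M $$ (0,0) = ?p" "M $$ (4,4) = ?p" "M $$ (5,5) = ?p"
    using triD(15,16)[OF M] tri_diag(7)[OF M] by simp_all
  have "?p * (M $$ (1,0) + M $$ (3,4)) = 0" using tri_relations(1)[OF M] d by (simp add: algebra_simps)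
  then have "M $$ (1,0) + M $$ (3,4) = 0" by simp
  then have "M $$ (1,0) = - M $$ (3,4)" by (rule eq_neg_iff_add_eq_0[THEN iffD2])
  then have "M $$ (3,4) * M $$ (4,5) = ?p * (M $$ (3,5) + M $$ (2,0))"
    using tri_relations(2)[OF M] d by (simp add: algebra_simps)
  then show ?thesis
    by (rule pmult1I[rotated]) (use int_sim_Ints[OF triD(1)[OF M]] in simp)
qed

text \<open>D has diagonal (p,p,p). Its entries above the diagonal are examined modulo p in the
  order (3,4), (4,5), (3,5). The position of the first nonzero one decides which block becomes
  diag(p^2, 1), and this gives the three counts on the right, each p - 1 times; the clean cosets are
  those with all three zero.\<close>

lemma card_tri_cosets_111:
  assumes S: "translation_closed 2 S"
  shows "tcount 2 S 1 1 1 = (p - 1) * (tcount 2 S 2 0 1 + tcount 2 S 1 2 0 + tcount 2 S 2 1 0) + card (clean_cosets S 1 1 1 0)"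
proof -
  let ?X = "tri_cosets 2 S (dvec 1 1 1)"
  define B where "B = (\<lambda>k x. block_cosets 2 S k (dvec 1 1 1) (of_nat x))"
  have fS: "finite S" using S by (simp add: translation_closed_def)
  have finB: "finite (B k x)" for k x using fS by (simp add: B_def block_cosets_def)
  have BX: "?X = (\<Union>x\<in>{..<p}. B k x)" if "k < 3" for k
    using tri_cosets_eq_blocks[OF that, of 1 1 2 S "dvec 1 1 1"] by (simp add: set_exps_111[simplified] B_def)
  have Bdisj: "B k x \<inter> B k y = {}" if "k < 3" "x < p" "y < p" "x \<noteq> y" for k x y
    using block_cosets_disjoint[OF that(1), of 1 1 2 x y S "dvec 1 1 1"] that(2-4) by (simp add: set_exps_111[simplified] B_def)
  have overlap: "\<exists>t \<in> \<int>. y = x + t * of_nat p" if "k < 3" "C \<in> block_cosets 2 S k (dvec 1 1 1) x" "C \<in> block_cosets 2 S k (dvec 1 1 1) y" for k C x y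
    using block_cosets_overlap[OF that(1), of 1 1 2 C S "dvec 1 1 1" x y] that(2,3) by (simp add: set_exps_111[simplified])
  have "tcount 2 S 1 1 1 = card (B 1 0) + (p - 1) * tcount 2 S 2 0 1"
    using card_tri_cosets_split[OF S, of 1 "dvec 1 1 1"]
    unfolding set_exps_111 tri_cosets_set_exps by (simp add: tcount_def B_def)
  moreover have "card (B 1 0) = card (B 1 0 \<inter> B 2 0) + (p - 1) * tcount 2 S 1 2 0"
  proof -
    have un: "B 1 0 = (\<Union>y\<in>{..<p}. B 1 0 \<inter> B 2 y)"
    proof -
      have "B 1 0 \<subseteq> ?X" using BX[of 1] p_pos(1) by auto
      then show ?thesis using BX[of 2] by auto
    qed
    \<comment> \<open>A nonzero entry (4,5) forces (3,4) to vanish modulo p by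
      \<open>tri_111_relation\<close>, so the full block count for (4,5) applies inside
      \<open>B 1 0\<close>.\<close>
    have sub: "B 2 y \<subseteq> B 1 0" if y: "y < p" "y \<noteq> 0" for y
    proof
      fix C assume C: "C \<in> B 2 y"
      then have "C \<in> ?X" using BX[of 2] y by auto
      then obtain x where x: "x < p" "C \<in> B 1 x" using BX[of 1] by auto
      then obtain N where N: "tri p 2 (dvec 1 1 1) N" "N $$ (3,4) = of_nat x" "C = cs N" "C \<in> S"
        by (auto simp: B_def block_cosets_def root_pos_def)
      have "C \<in> block_cosets 2 S 2 (dvec 1 1 1) (N $$ (4,5))"
        using N by (auto simp: block_cosets_def root_pos_def)
      with C obtain t where t: "t \<in> \<int>" "N $$ (4,5) = of_nat y + t * of_nat p"
        using overlap[of 2 C "of_nat y" "N $$ (4,5)"] by (auto simp: B_def)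
      have e: "N $$ (3,4) * N $$ (4,5) = of_nat p * (of_nat x * t) + of_nat (x * y)" unfolding t(2) N(2) by (simp add: algebra_simps)
      have "pmult 1 (of_nat p * (of_nat x * t))" using t(1) by (intro pmult1I[of "of_nat x * t"]) simp_all
      from pmult_diff_cancel[OF tri_111_relation[OF N(1), unfolded e] this]
      have "pmult 1 (of_nat (x * y))" .
      then have "p dvd x * y" by (simp only: pmult_of_nat)
      then have "p dvd x \<or> p dvd y" using prime_dvd_multD[OF prime_p] by blast
      then have "x = 0" using x(1) y by (auto dest: nat_dvd_not_less)
      then show "C \<in> B 1 0" using x(2) by simp
    qed
    have "card (\<Union>y\<in>{..<p}. B 1 0 \<inter> B 2 y) = card (B 1 0 \<inter> B 2 0) + (p - 1) * tcount 2 S 1 2 0"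
    proof (rule card_UN_residues)
      show "finite (B 1 0 \<inter> B 2 y)" for y using finB by simp
      show "(B 1 0 \<inter> B 2 x) \<inter> (B 1 0 \<inter> B 2 y) = {}" if "x < p" "y < p" "x \<noteq> y" for x y
        using Bdisj[OF _ that, of 2] by auto
      fix y assume y: "y < p" "y \<noteq> 0"
      have "B 1 0 \<inter> B 2 y = B 2 y" using sub[OF y] by blast
      moreover have "\<not> int p dvd int y" using y by (auto dest: nat_dvd_not_less)
      ultimately show "card (B 1 0 \<inter> B 2 y) = tcount 2 S 1 2 0"
        using card_block_cosets_unit[OF S, of 2 "int y" "dvec 1 1 1"]
        unfolding set_exps_111 tri_cosets_set_exps by (simp add: tcount_def B_def)
    qed
    then show ?thesis using un by simp
  qed
  moreover have "card (B 1 0 \<inter> B 2 0) = card (clean_cosets S 1 1 1 0) + (p - 1) * tcount 2 S 2 1 0"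
  proof -
    have "B 1 0 \<inter> B 2 0 = (\<Union>z\<in>{..<p}. clean_cosets S 1 1 1 (of_nat z))"
    proof
      show "(\<Union>z\<in>{..<p}. clean_cosets S 1 1 1 (of_nat z)) \<subseteq> B 1 0 \<inter> B 2 0"
        by (auto simp: clean_cosets_def B_def block_cosets_def root_pos_def)
      show "B 1 0 \<inter> B 2 0 \<subseteq> (\<Union>z\<in>{..<p}. clean_cosets S 1 1 1 (of_nat z))"
      proof
        fix C assume C: "C \<in> B 1 0 \<inter> B 2 0"
        then obtain M where M: "tri p 2 (dvec 1 1 1) M" "M $$ (3,4) = 0" "C = cs M" "C \<in> S"
          by (auto simp: B_def block_cosets_def root_pos_def)
        have "C \<in> block_cosets 2 S 2 (dvec 1 1 1) (M $$ (4,5))"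
          using M by (auto simp: block_cosets_def root_pos_def)
        with C obtain t where t: "t \<in> \<int>" "0 = M $$ (4,5) + t * of_nat p"
          using overlap[of 2 C "M $$ (4,5)" 0] by (auto simp: B_def)
        have d: "M $$ (5,5) = of_nat p" using triD(16)[OF M(1)] by simp
        obtain N where N: "tri p 2 (dvec 1 1 1) N" "cs N = cs M" "N $$ (3,4) = 0" "N $$ (4,5) = 0"
          using tri_left_unipotent(2)[OF M(1) t(1)] t(2) d M(2) by auto
        have dN: "N $$ (5,5) = of_nat p" using triD(16)[OF N(1)] by simp
        have "N $$ (3,5) \<in> \<int>" using int_sim_Ints[OF triD(1)[OF N(1)]] by simp
        then obtain s r where r: "s \<in> \<int>" "r < p" "N $$ (3,5) + s * of_nat p = of_nat r" by (rule residue_of_Ints)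
        obtain N' where N': "tri p 2 (dvec 1 1 1) N'" "cs N' = cs M" "N' $$ (3,4) = 0" "N' $$ (4,5) = 0" "N' $$ (3,5) = of_nat r"
          using tri_left_unipotent(3)[OF N(1) r(1)] r(3) dN N(2-4) by auto
        have "C \<in> clean_cosets S 1 1 1 (of_nat r)"
          unfolding clean_cosets_def by (intro CollectI conjI exI[of _ N'] M(4) N') (simp add: M(3) N'(2))
        then show "C \<in> (\<Union>z\<in>{..<p}. clean_cosets S 1 1 1 (of_nat z))" using r(2) by blast
      qed
    qed
    moreover have "card (\<Union>z\<in>{..<p}. clean_cosets S 1 1 1 (of_nat z)) = card (clean_cosets S 1 1 1 (of_nat 0)) + (p - 1) * tcount 2 S 2 1 0"
    proof (rule card_UN_residues)
      show "finite (clean_cosets S 1 1 1 (of_nat x))" for x using fS by (simp add: clean_cosets_def)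
      show "clean_cosets S 1 1 1 (of_nat x) \<inter> clean_cosets S 1 1 1 (of_nat y) = {}" if "x < p" "y < p" "x \<noteq> y" for x y
        using that by (rule clean_cosets_disjoint)
      fix z assume "z < p" "z \<noteq> 0"
      then have "\<not> int p dvd int z" by (auto dest: nat_dvd_not_less)
      from card_clean_cosets_eq[OF S sl2_equiv_unit[OF this], of 1]
      show "card (clean_cosets S 1 1 1 (of_nat z)) = tcount 2 S 2 1 0"
        unfolding clean_cosets_210 by (simp add: tcount_def)
    qed
    ultimately show ?thesis by simp
  qed
  ultimately show ?thesis by (simp add: algebra_simps)
qed

end

section \<open>Cosets of symmetric blocks\<close>

context fixed_prime
begin

text \<open>A and D are diagonal, B is symmetric. With r = s = p it represents the clean cosets with
  exponents (1,1,1) and corner 0; with r = p^2, s = 1 and B supported on a, b, d, the cosets with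
  exponents (1,1,0) and vanishing (3,4).\<close>

definition sblock :: "rat \<Rightarrow> rat \<Rightarrow> rat \<Rightarrow> rat \<Rightarrow> rat \<Rightarrow> rat \<Rightarrow> rat \<Rightarrow> rat \<Rightarrow> rat mat" where
  "sblock r s a b c d e f = mat6 [[of_nat p,0,0,a,b,c],[0,of_nat p,0,b,d,e],[0,0,r,c,e,f],
     [0,0,0,of_nat p,0,0],[0,0,0,0,of_nat p,0],[0,0,0,0,0,s]]"

lemma sblock_index [simp]: "sblock r s a b c d e f \<in> carrier_mat 6 6"
  "dim_row (sblock r s a b c d e f) = 6" "dim_col (sblock r s a b c d e f) = 6"
  "i < 6 \<Longrightarrow> j < 6 \<Longrightarrow> sblock r s a b c d e f $$ (i,j) = [[of_nat p,0,0,a,b,c],[0,of_nat p,0,b,d,e],[0,0,r,c,e,f],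
     [0,0,0,of_nat p,0,0],[0,0,0,0,of_nat p,0],[0,0,0,0,0,s]] ! i ! j"
  using carrier_matD[OF mat6_carrier] by (simp_all add: sblock_def)

lemma sblock_tri:
  assumes k: "k \<le> 2" and I: "a \<in> \<int>" "b \<in> \<int>" "c \<in> \<int>" "d \<in> \<int>" "e \<in> \<int>" "f \<in> \<int>"
    and ce: "k = 1 \<or> c = 0 \<and> e = 0"
  shows "tri p 2 (dvec 1 1 k) (sblock (of_nat p ^ (2 - k)) (of_nat p ^ k) a b c d e f)"
proof -
  let ?M = "sblock (of_nat p ^ (2 - k)) (of_nat p ^ k) a b c d e f"
  have rs: "of_nat p ^ (2 - k) * of_nat p ^ k = (of_nat p * of_nat p :: rat)"
    using k by (simp flip: power_add power2_eq_square)
  have "similitude 3 (of_nat p * of_nat p) ?M"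
    using ce by (elim disjE conjE; intro similitude3I) (simp_all add: cpair_def rs)
  then have "similitude 3 (of_nat p ^ 2) ?M" by (simp add: power2_eq_square)
  moreover have "integral_mat ?M"
  proof (rule integral_matI)
    fix i j assume "i < dim_row ?M" "j < dim_col ?M"
    then have "i < 6" "j < 6" by auto
    then show "?M $$ (i,j) \<in> \<int>" by (elim less6_cases) (simp_all add: I)
  qed
  ultimately show ?thesis unfolding tri_def by (simp add: int_sim_def)
qed

text \<open>Left multiplication by a unipotent matrix with symmetric block S adds S D to B. The
  entries of B on and above the diagonal determine the others by symmetry of B^T D, so M is such a
  multiple.\<close>

lemma cs_eq_sblock:
  assumes M: "tri p 2 (dvec 1 1 k) M" and k: "k \<le> 2"
    and I: "a \<in> \<int>" "b \<in> \<int>" "c \<in> \<int>" "d \<in> \<int>" "e \<in> \<int>" "f \<in> \<int>"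
    and ce: "k = 1 \<or> c = 0 \<and> e = 0"
    and M0: "M $$ (3,4) = 0" "M $$ (3,5) = 0" "M $$ (4,5) = 0"
    and S: "s00 \<in> \<int>" "s01 \<in> \<int>" "s02 \<in> \<int>" "s11 \<in> \<int>" "s12 \<in> \<int>" "s22 \<in> \<int>"
    and M1: "M $$ (0,3) = a + s00 * of_nat p" "M $$ (0,4) = b + s01 * of_nat p" "M $$ (0,5) = c + s02 * of_nat p ^ k"
      "M $$ (1,4) = d + s11 * of_nat p" "M $$ (1,5) = e + s12 * of_nat p ^ k" "M $$ (2,5) = f + s22 * of_nat p ^ k"
  shows "cs M = cs (sblock (of_nat p ^ (2 - k)) (of_nat p ^ k) a b c d e f)"
proof -
  let ?p = "of_nat p :: rat" and ?s = "of_nat p ^ k :: rat" and ?r = "of_nat p ^ (2 - k) :: rat"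
  let ?F = "sblock ?r ?s a b c d e f" and ?g = "upper_unip s00 s01 s02 s11 s12 s22"
  note F = sblock_tri[OF k I ce]
  have c: "c * of_nat p ^ k = of_nat p * c" and e: "e * of_nat p ^ k = of_nat p * e" using ce by auto
  note t = triD[OF M] and td = tri_diag[OF M] and rel = tri_relations[OF M]
  have g: "?g \<in> Sp_int 3" by (rule upper_unip_Sp_int) fact+
  have dg: "M $$ (0,0) = ?p" "M $$ (1,1) = ?p" "M $$ (2,2) = ?r" "M $$ (3,3) = ?p" "M $$ (4,4) = ?p" "M $$ (5,5) = ?s"
    using t(14-16) td(7-9) by simp_all
  have s: "?s \<noteq> 0" by simp
  have z: "M $$ (1,0) = 0" "M $$ (2,0) = 0" "M $$ (2,1) = 0"
    using rel(1-3) M0 dg s by simp_all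
  have "?p * M $$ (1,3) = ?p * M $$ (0,4)" using rel(4) M0 dg by (simp add: algebra_simps)
  then have m13: "M $$ (1,3) = b + s01 * ?p" unfolding M1(2) by simp
  have "M $$ (2,3) * ?s = ?p * M $$ (0,5)" using rel(5) M0 dg by (simp add: algebra_simps)
  also have "\<dots> = ?p * c + s02 * ?p * ?s" unfolding M1(3) by (simp add: algebra_simps)
  also have "\<dots> = (c + s02 * ?p) * ?s" unfolding c[symmetric] by (simp add: algebra_simps)
  finally have m23: "M $$ (2,3) = c + s02 * ?p" using s by simp
  have "M $$ (2,4) * ?s = ?p * M $$ (1,5)" using rel(6) M0 dg by (simp add: algebra_simps)
  also have "\<dots> = ?p * e + s12 * ?p * ?s" unfolding M1(5) by (simp add: algebra_simps)
  also have "\<dots> = (e + s12 * ?p) * ?s" unfolding e[symmetric] by (simp add: algebra_simps)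
  finally have m24: "M $$ (2,4) = e + s12 * ?p" using s by simp
  note m = mult6[OF upper_unip_index(1) sblock_index(1)]
  have "M = ?g * ?F"
  proof (rule eq_matI)
    fix i j assume "i < dim_row (?g * ?F)" "j < dim_col (?g * ?F)"
    then have i: "i < 6" and j: "j < 6" by auto
    have row: "M $$ (0,j) = (?g * ?F) $$ (0,j)" "M $$ (1,j) = (?g * ?F) $$ (1,j)" "M $$ (2,j) = (?g * ?F) $$ (2,j)"
      "M $$ (3,j) = (?g * ?F) $$ (3,j)" "M $$ (4,j) = (?g * ?F) $$ (4,j)" "M $$ (5,j) = (?g * ?F) $$ (5,j)"
      using j by (elim less6_cases; hypsubst; simp add: m t(2-13,17-) td(1-3)[simplified] dg[simplified] z[simplified] M0 M1[simplified] m13[simplified] m23 m24 del: index_mult_mat)+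
    show "M $$ (i,j) = (?g * ?F) $$ (i,j)"
      using i by (elim less6_cases) (use row in simp_all)
  qed (use tri_carrier[OF M] in auto)
  then have "cs M = cs (?g * ?F)" by simp
  also have "\<dots> = cs ?F" by (rule cs_mult_left[OF triD(1)[OF F] g])
  finally show ?thesis .
qed

lemma residue_Ints:
  fixes x :: rat
  assumes "x \<in> \<int>"
  shows "\<exists>r \<in> res. \<exists>t \<in> \<int>. x = of_int r + t * of_nat p"
proof -
  obtain t r where "t \<in> \<int>" "r < p" "x + t * of_nat p = of_nat r" using assms by (rule residue_of_Ints)
  then show ?thesis
    by (intro bexI[of _ "int r"] bexI[of _ "- t"]) (auto simp: res_def algebra_simps)
qed

lemma res_eqI:
  assumes "x \<in> res" "y \<in> res" "t \<in> \<int>" "(of_int y :: rat) = of_int x + t * of_nat p"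
  shows "x = y"
proof -
  have "nat x = nat y" by (rule residue_unique[OF _ _ assms(3)]) (use assms in \<open>auto simp: res_def\<close>)
  then show ?thesis using assms(1,2) by (auto simp: res_def)
qed

lemma pmult_of_int: "pmult 1 (of_int z) \<longleftrightarrow> int p dvd z"
proof
  assume "pmult 1 (of_int z)"
  then obtain k where k: "k \<in> \<int>" "(of_int z :: rat) = of_nat p * k" by (auto simp: pmult_def)
  then obtain l where "k = of_int l" by (auto elim: Ints_cases)
  then have "rat_of_int z = of_int (int p * l)" using k(2) by simp
  then have "z = int p * l" by (simp only: of_int_eq_iff)
  then show "int p dvd z" by simp
next
  assume "int p dvd z"
  then obtain k where "z = int p * k" by (elim dvdE)
  then show "pmult 1 (of_int z)" by (intro pmult1I[of "of_int k"]) simp_all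
qed

text \<open>Both A blocks are diagonal, so the matrix g between the two has upper left block 1; as D
  is diagonal too, a column of B changes only by integral multiples of the diagonal entry of D in
  that column.\<close>

lemma tri_lrel_diagonal:
  assumes M: "tri p \<delta> (dvec a b c) M" and N: "tri p \<delta> (dvec a b c) N" and eq: "cs M = cs N"
    and M0: "M $$ (1,0) = 0" "M $$ (2,0) = 0" "M $$ (2,1) = 0" "M $$ (3,4) = 0" "M $$ (3,5) = 0" "M $$ (4,5) = 0"
      "N $$ (1,0) = 0" "N $$ (2,0) = 0" "N $$ (2,1) = 0"
  shows "i < 3 \<Longrightarrow> \<exists>t \<in> \<int>. N $$ (i,3) = M $$ (i,3) + t * of_nat p ^ a"
    "i < 3 \<Longrightarrow> \<exists>t \<in> \<int>. N $$ (i,4) = M $$ (i,4) + t * of_nat p ^ b"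
    "i < 3 \<Longrightarrow> \<exists>t \<in> \<int>. N $$ (i,5) = M $$ (i,5) + t * of_nat p ^ c"
proof -
  obtain g where g: "g \<in> Sp_int 3" "N = g * M"
    using cs_lrel_iff[OF triD(1)[OF M] triD(1)[OF N]] eq by (auto simp: lrel_def)
  note u = tri_lrel_unipotent[OF M N[unfolded g(2)] g(1)]
  note m = mult6[OF Sp_int_carrier[OF g(1)] tri_carrier[OF M], folded g(2)]
  note t = triD[OF M] and td = tri_diag[OF M]
  have nz: "M $$ (0,0) \<noteq> 0" "M $$ (1,1) \<noteq> 0" unfolding td by simp_all
  note zM = M0(1-6)[simplified] t(2-13,17-) td(1-3)[simplified]
  have "N $$ (2,1) = g $$ (2,1) * M $$ (1,1)" "N $$ (1,0) = g $$ (1,0) * M $$ (0,0)" "N $$ (2,0) = g $$ (2,0) * M $$ (0,0)"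
    by (subst m; simp add: zM del: index_mult_mat)+
  then have gz: "g $$ (2,1) = 0" "g $$ (1,0) = 0" "g $$ (2,0) = 0"
    unfolding M0(7-9) using nz by auto
  have gI: "g $$ (i,j) \<in> \<int>" if "i < 6" "j < 6" for i j using Sp_int_Ints[OF g(1) that] .
  assume i3: "i < 3"
  then have *: "N $$ (i,j) = M $$ (i,j) + g $$ (i,3) * M $$ (3,j) + g $$ (i,4) * M $$ (4,j) + g $$ (i,5) * M $$ (5,j)" if "j < 6" for j
  proof -
    have "g $$ (i,0) * M $$ (0,j) + g $$ (i,1) * M $$ (1,j) + g $$ (i,2) * M $$ (2,j) = M $$ (i,j)"
    proof -
      consider "i = 0" | "i = 1" | "i = 2" using i3 by linarith
      then show ?thesis by cases (simp_all only: u gz mult_1 mult_zero_left add_0 add_0_right)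
    qed
    then show ?thesis using m[of i j] that i3 by simp
  qed
  show "\<exists>t \<in> \<int>. N $$ (i,3) = M $$ (i,3) + t * of_nat p ^ a"
    using *[of 3] gI[of i 3] i3 by (intro bexI[of _ "g $$ (i,3)"]) (simp_all add: t(8,12,14))
  show "\<exists>t \<in> \<int>. N $$ (i,4) = M $$ (i,4) + t * of_nat p ^ b"
    using *[of 4] gI[of i 4] i3 by (intro bexI[of _ "g $$ (i,4)"]) (simp_all add: t(13,15) M0(4))
  show "\<exists>t \<in> \<int>. N $$ (i,5) = M $$ (i,5) + t * of_nat p ^ c"
    using *[of 5] gI[of i 5] i3 by (intro bexI[of _ "g $$ (i,5)"]) (simp_all add: t(16) M0(5,6))
qed

definition smat3 :: "int \<times> int \<times> int \<times> int \<times> int \<times> int \<Rightarrow> rat mat" where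
  "smat3 = (\<lambda>(a,b,c,d,e,f). sblock (of_nat p) (of_nat p) (of_int a) (of_int b) (of_int c) (of_int d) (of_int e) (of_int f))"

definition smat2 :: "int \<times> int \<times> int \<Rightarrow> rat mat" where
  "smat2 = (\<lambda>(a,b,d). sblock (of_nat p ^ 2) 1 (of_int a) (of_int b) 0 (of_int d) 0 0)"

lemma smat3_tri: "tri p 2 (dvec 1 1 1) (smat3 t)"
proof -
  obtain a b c d e f where t: "t = (a,b,c,d,e,f)" by (cases t)
  show ?thesis using sblock_tri[of 1 "of_int a" "of_int b" "of_int c" "of_int d" "of_int e" "of_int f"]
    by (simp add: smat3_def t)
qed

lemma smat2_tri: "tri p 2 (dvec 1 1 0) (smat2 t)"
proof -
  obtain a b d where t: "t = (a,b,d)" by (cases t)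
  show ?thesis using sblock_tri[of 0 "of_int a" "of_int b" 0 "of_int d" 0 0]
    by (simp add: smat2_def t)
qed

text \<open>\<open>cs_eq_sblock\<close> reduces the entries of B modulo p, and
  \<open>tri_lrel_diagonal\<close> will make the reduced matrix unique; clean cosets thus correspond
  to symmetric matrices over the residue field.\<close>

lemma clean_cosets_111: "clean_cosets S 1 1 1 0 = (\<lambda>t. cs (smat3 t)) ` {t \<in> sym3. cs (smat3 t) \<in> S}"
proof (intro equalityI subsetI)
  fix C assume "C \<in> clean_cosets S 1 1 1 0"
  then obtain M where M: "C \<in> S" "tri p 2 (dvec 1 1 1) M" "M $$ (3,4) = 0" "M $$ (4,5) = 0" "M $$ (3,5) = 0" "C = cs M"
    by (auto simp: clean_cosets_def)
  have I: "M $$ (i,j) \<in> \<int>" if "i < 6" "j < 6" for i j using int_sim_Ints[OF triD(1)[OF M(2)] that] .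
  have R: "\<exists>r \<in> res. \<exists>t \<in> \<int>. M $$ (i,j) = of_int r + t * of_nat p" if "i < 6" "j < 6" for i j
    by (rule residue_Ints[OF I[OF that]])
  obtain a s00 where a: "a \<in> res" "s00 \<in> \<int>" "M $$ (0,3) = of_int a + s00 * of_nat p" using R[of 0 3] by auto
  obtain b s01 where b: "b \<in> res" "s01 \<in> \<int>" "M $$ (0,4) = of_int b + s01 * of_nat p" using R[of 0 4] by auto
  obtain c s02 where c: "c \<in> res" "s02 \<in> \<int>" "M $$ (0,5) = of_int c + s02 * of_nat p" using R[of 0 5] by auto
  obtain d s11 where d: "d \<in> res" "s11 \<in> \<int>" "M $$ (1,4) = of_int d + s11 * of_nat p" using R[of 1 4] by auto
  obtain e s12 where e: "e \<in> res" "s12 \<in> \<int>" "M $$ (1,5) = of_int e + s12 * of_nat p" using R[of 1 5] by auto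
  obtain f s22 where f: "f \<in> res" "s22 \<in> \<int>" "M $$ (2,5) = of_int f + s22 * of_nat p" using R[of 2 5] by auto
  have "cs M = cs (sblock (of_nat p ^ (2 - 1)) (of_nat p ^ 1) (of_int a) (of_int b) (of_int c) (of_int d) (of_int e) (of_int f))"
    by (rule cs_eq_sblock[OF M(2) _ _ _ _ _ _ _ _ M(3,5,4) a(2) b(2) c(2) d(2) e(2) f(2) a(3) b(3) _ d(3)])
      (use c(3) e(3) f(3) in simp_all)
  then have "cs M = cs (smat3 (a,b,c,d,e,f))" by (simp add: smat3_def)
  then show "C \<in> (\<lambda>t. cs (smat3 t)) ` {t \<in> sym3. cs (smat3 t) \<in> S}"
    using M(1,6) a(1) b(1) c(1) d(1) e(1) f(1) by (intro image_eqI[of _ _ "(a,b,c,d,e,f)"]) simp_all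
next
  fix C assume "C \<in> (\<lambda>t. cs (smat3 t)) ` {t \<in> sym3. cs (smat3 t) \<in> S}"
  then obtain t where t: "C = cs (smat3 t)" "cs (smat3 t) \<in> S" by blast
  obtain a b c d e f where e: "t = (a,b,c,d,e,f)" by (cases t)
  have "smat3 t $$ (3,4) = 0" "smat3 t $$ (4,5) = 0" "smat3 t $$ (3,5) = 0" by (simp_all add: e smat3_def)
  then show "C \<in> clean_cosets S 1 1 1 0"
    unfolding clean_cosets_def using smat3_tri[of t] t by blast
qed

lemma inj_on_smat3: "inj_on (\<lambda>t. cs (smat3 t)) sym3"
proof (rule inj_onI)
  fix t u assume tu: "t \<in> sym3" "u \<in> sym3" "cs (smat3 t) = cs (smat3 u)"
  obtain a b c d e f where t: "t = (a,b,c,d,e,f)" by (cases t)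
  obtain a' b' c' d' e' f' where u: "u = (a',b',c',d',e',f')" by (cases u)
  note L = tri_lrel_diagonal[OF smat3_tri smat3_tri tu(3)]
  have 1: "\<exists>x \<in> \<int>. smat3 u $$ (i,j) = smat3 t $$ (i,j) + x * of_nat p" if "i < 3" "j = 3 \<or> j = 4 \<or> j = 5" for i j
    using that(2) by (elim disjE; hypsubst; intro L[where i = i, unfolded power_one_right]; simp add: t u smat3_def that(1))
  have r: "a \<in> res" "b \<in> res" "c \<in> res" "d \<in> res" "e \<in> res" "f \<in> res"
    "a' \<in> res" "b' \<in> res" "c' \<in> res" "d' \<in> res" "e' \<in> res" "f' \<in> res"
    using tu(1,2) by (simp_all add: t u)
  have "a = a'" using 1[of 0 3] res_eqI[OF r(1,7)] by (auto simp: t u smat3_def)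
  moreover have "b = b'" using 1[of 0 4] res_eqI[OF r(2,8)] by (auto simp: t u smat3_def)
  moreover have "c = c'" using 1[of 0 5] res_eqI[OF r(3,9)] by (auto simp: t u smat3_def)
  moreover have "d = d'" using 1[of 1 4] res_eqI[OF r(4,10)] by (auto simp: t u smat3_def)
  moreover have "e = e'" using 1[of 1 5] res_eqI[OF r(5,11)] by (auto simp: t u smat3_def)
  moreover have "f = f'" using 1[of 2 5] res_eqI[OF r(6,12)] by (auto simp: t u smat3_def)
  ultimately show "t = u" by (simp add: t u)
qed

lemma card_clean_cosets_111: "card (clean_cosets S 1 1 1 0) = card {t \<in> sym3. cs (smat3 t) \<in> S}"
  unfolding clean_cosets_111 by (rule card_image) (rule inj_on_subset[OF inj_on_smat3], blast)

text \<open>D has diagonal (p,p,1): column 5 can be cleared with the pivot 1, and a symmetric 2 by 2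
  matrix modulo p remains.\<close>

lemma block_cosets_110:
  "block_cosets 2 S 1 (dvec 1 1 0) 0 = (\<lambda>t. cs (smat2 t)) ` {t \<in> res \<times> res \<times> res. cs (smat2 t) \<in> S}"
proof (intro equalityI subsetI)
  fix C assume "C \<in> block_cosets 2 S 1 (dvec 1 1 0) 0"
  then obtain M where M: "C \<in> S" "tri p 2 (dvec 1 1 0) M" "M $$ (3,4) = 0" "C = cs M"
    by (auto simp: block_cosets_def root_pos_def)
  have I1: "M $$ (4,5) \<in> \<int>" using int_sim_Ints[OF triD(1)[OF M(2)]] by simp
  have d1: "M $$ (5,5) = 1" using triD(16)[OF M(2)] by simp
  obtain N1 where N1: "tri p 2 (dvec 1 1 0) N1" "cs N1 = cs M" "N1 $$ (3,4) = 0" "N1 $$ (4,5) = 0"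
    using tri_left_unipotent(2)[OF M(2), of "- M $$ (4,5)"] I1 d1 M(3) by auto
  have I2: "N1 $$ (3,5) \<in> \<int>" using int_sim_Ints[OF triD(1)[OF N1(1)]] by simp
  have d2: "N1 $$ (5,5) = 1" using triD(16)[OF N1(1)] by simp
  obtain N where N: "tri p 2 (dvec 1 1 0) N" "cs N = cs M" "N $$ (3,4) = 0" "N $$ (4,5) = 0" "N $$ (3,5) = 0"
    using tri_left_unipotent(3)[OF N1(1), of "- N1 $$ (3,5)"] I2 d2 N1(2-4) by auto
  have I: "N $$ (i,j) \<in> \<int>" if "i < 6" "j < 6" for i j using int_sim_Ints[OF triD(1)[OF N(1)] that] .
  have R: "\<exists>r \<in> res. \<exists>t \<in> \<int>. N $$ (i,j) = of_int r + t * of_nat p" if "i < 6" "j < 6" for i j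
    by (rule residue_Ints[OF I[OF that]])
  obtain a s00 where a: "a \<in> res" "s00 \<in> \<int>" "N $$ (0,3) = of_int a + s00 * of_nat p" using R[of 0 3] by auto
  obtain b s01 where b: "b \<in> res" "s01 \<in> \<int>" "N $$ (0,4) = of_int b + s01 * of_nat p" using R[of 0 4] by auto
  obtain d s11 where d: "d \<in> res" "s11 \<in> \<int>" "N $$ (1,4) = of_int d + s11 * of_nat p" using R[of 1 4] by auto
  have "cs N = cs (sblock (of_nat p ^ (2 - 0)) (of_nat p ^ 0) (of_int a) (of_int b) 0 (of_int d) 0 0)"
    by (rule cs_eq_sblock[OF N(1) _ _ _ _ _ _ _ _ N(3,5,4) a(2) b(2) I[of 0 5] d(2) I[of 1 5] I[of 2 5] a(3) b(3) _ d(3)])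
      simp_all
  then have "cs M = cs (smat2 (a,b,d))" using N(2) by (simp add: smat2_def)
  then show "C \<in> (\<lambda>t. cs (smat2 t)) ` {t \<in> res \<times> res \<times> res. cs (smat2 t) \<in> S}"
    using M(1,4) a(1) b(1) d(1) by (intro image_eqI[of _ _ "(a,b,d)"]) simp_all
next
  fix C assume "C \<in> (\<lambda>t. cs (smat2 t)) ` {t \<in> res \<times> res \<times> res. cs (smat2 t) \<in> S}"
  then obtain t where t: "C = cs (smat2 t)" "cs (smat2 t) \<in> S" by blast
  obtain a b d where e: "t = (a,b,d)" by (cases t)
  have "smat2 t $$ (3,4) = 0" by (simp add: e smat2_def)
  then show "C \<in> block_cosets 2 S 1 (dvec 1 1 0) 0"
    unfolding block_cosets_def root_pos_def using smat2_tri[of t] t by auto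
qed

lemma inj_on_smat2: "inj_on (\<lambda>t. cs (smat2 t)) (res \<times> res \<times> res)"
proof (rule inj_onI)
  fix t u assume tu: "t \<in> res \<times> res \<times> res" "u \<in> res \<times> res \<times> res" "cs (smat2 t) = cs (smat2 u)"
  obtain a b d where t: "t = (a,b,d)" by (cases t)
  obtain a' b' d' where u: "u = (a',b',d')" by (cases u)
  note L = tri_lrel_diagonal[OF smat2_tri smat2_tri tu(3)]
  have 1: "\<exists>x \<in> \<int>. smat2 u $$ (i,j) = smat2 t $$ (i,j) + x * of_nat p" if "i < 3" "j = 3 \<or> j = 4" for i j
    using that(2) by (elim disjE; hypsubst; intro L(1,2)[where i = i, unfolded power_one_right]; simp add: t u smat2_def that(1))
  have r: "a \<in> res" "b \<in> res" "d \<in> res" "a' \<in> res" "b' \<in> res" "d' \<in> res"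
    using tu(1,2) by (simp_all add: t u)
  have "a = a'" using 1[of 0 3] res_eqI[OF r(1,4)] by (auto simp: t u smat2_def)
  moreover have "b = b'" using 1[of 0 4] res_eqI[OF r(2,5)] by (auto simp: t u smat2_def)
  moreover have "d = d'" using 1[of 1 4] res_eqI[OF r(3,6)] by (auto simp: t u smat2_def)
  ultimately show "t = u" by (simp add: t u)
qed

lemma card_block_cosets_110: "card (block_cosets 2 S 1 (dvec 1 1 0) 0) = card {t \<in> res \<times> res \<times> res. cs (smat2 t) \<in> S}"
  unfolding block_cosets_110 by (rule card_image) (rule inj_on_subset[OF inj_on_smat2], blast)

section \<open>Rank modulo p in terms of the symmetric block\<close>

definition sym_entry :: "int \<times> int \<times> int \<times> int \<times> int \<times> int \<Rightarrow> nat \<Rightarrow> nat \<Rightarrow> int" where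
  "sym_entry = (\<lambda>(a,b,c,d,e,f) i j. [[a,b,c],[b,d,e],[c,e,f]] ! i ! j)"

lemma smat3_index:
  "i < 3 \<Longrightarrow> j < 3 \<Longrightarrow> smat3 t $$ (i, j + 3) = of_int (sym_entry t i j)"
  "i < 6 \<Longrightarrow> j < 6 \<Longrightarrow> \<not> (i < 3 \<and> 3 \<le> j) \<Longrightarrow> pmult 1 (smat3 t $$ (i, j))"
proof -
  obtain a b c d e f where t: "t = (a,b,c,d,e,f)" by (cases t)
  show "i < 3 \<Longrightarrow> j < 3 \<Longrightarrow> smat3 t $$ (i, j + 3) = of_int (sym_entry t i j)"
    by (elim less3_cases) (simp_all add: smat3_def sym_entry_def t)
  show "i < 6 \<Longrightarrow> j < 6 \<Longrightarrow> \<not> (i < 3 \<and> 3 \<le> j) \<Longrightarrow> pmult 1 (smat3 t $$ (i, j))"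
    by (elim less6_cases) (simp_all add: smat3_def t pmult_1_p')
qed

lemma rank_le_smat3:
  assumes "\<And>i j. i < 3 \<Longrightarrow> j < 3 \<Longrightarrow> int p dvd sym_entry t i j - (\<Sum>k<r. x k i * y k j)"
  shows "rank_le r (smat3 t)"
proof -
  let ?x = "\<lambda>k i. if i < 3 then rat_of_int (x k i) else 0" and ?y = "\<lambda>k j. if 3 \<le> j then rat_of_int (y k (j - 3)) else 0"
  have "pmult 1 (smat3 t $$ (i,j) - (\<Sum>k<r. ?x k i * ?y k j))" if ij: "i < 6" "j < 6" for i j
  proof (cases "i < 3 \<and> 3 \<le> j")
    case True
    then obtain l where l: "j = l + 3" by (metis add.commute le_iff_add)
    have "smat3 t $$ (i,j) - (\<Sum>k<r. ?x k i * ?y k j) = of_int (sym_entry t i l - (\<Sum>k<r. x k i * y k l))"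
      using True ij by (simp add: l smat3_index)
    then show ?thesis using assms[of i l] True ij by (simp only: pmult_of_int) (simp add: l)
  next
    case False
    then have "(\<Sum>k<r. ?x k i * ?y k j) = 0" by (intro sum.neutral) auto
    then show ?thesis using smat3_index(2)[OF ij False] by simp
  qed
  then show ?thesis unfolding rank_le_def by (intro exI[of _ ?x] exI[of _ ?y]) auto
qed

lemma rank_le_0_smat3:
  assumes "t \<in> sym3"
  shows "rank_le 0 (smat3 t) \<longleftrightarrow> t = (0,0,0,0,0,0)"
proof
  obtain a b c d e f where t: "t = (a,b,c,d,e,f)" by (cases t)
  assume r: "rank_le 0 (smat3 t)"
  have z: "sym_entry t i j = 0" if "i < 3" "j < 3" "sym_entry t i j \<in> res" for i j
    using rank_le_0D[OF r, of i "j + 3"] that dvd_res[OF that(3)] smat3_index(1)[OF that(1,2), of t] pmult_of_int by simp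
  show "t = (0,0,0,0,0,0)"
    using z[of 0 0] z[of 0 1] z[of 0 2] z[of 1 1] z[of 1 2] z[of 2 2] assms by (simp add: t sym_entry_def)
next
  assume "t = (0,0,0,0,0,0)"
  then show "rank_le 0 (smat3 t)"
    by (intro rank_le_smat3) (auto simp: sym_entry_def elim!: less3_cases)
qed

text \<open>If a diagonal entry is a unit, the minors containing it express the matrix as a multiple
  of the outer product of that row with itself. If all diagonal entries vanish, the principal minors
  are -b^2, -c^2, -e^2 and the matrix is zero.\<close>

lemma rank_le_1_smat3:
  assumes "t \<in> sym3"
  shows "rank_le 1 (smat3 t) \<longleftrightarrow> sym3_minors t"
proof
  obtain a b c d e f where t: "t = (a,b,c,d,e,f)" by (cases t)
  assume r: "rank_le 1 (smat3 t)"
  note tr = smat3_tri[of t]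
  have m: "int p dvd sym_entry t i j * sym_entry t k l - sym_entry t i l * sym_entry t k j" if "i < 3" "j < 3" "k < 3" "l < 3" for i j k l
  proof -
    have "pmult 1 (minor2 (smat3 t) i k (j + 3) (l + 3))"
      by (rule rank_le_1D[OF r]) (use int_sim_integral[OF triD(1)[OF tr]] tri_carrier[OF tr] that in simp_all)
    moreover have "minor2 (smat3 t) i k (j + 3) (l + 3) = of_int (sym_entry t i j * sym_entry t k l - sym_entry t i l * sym_entry t k j)"
      using that by (simp add: minor2_def smat3_index)
    ultimately show ?thesis by (simp only: pmult_of_int)
  qed
  show "sym3_minors t"
    using m[of 0 0 1 1] m[of 0 0 1 2] m[of 0 0 2 2] m[of 0 1 1 2] m[of 0 1 2 2] m[of 1 1 2 2]
    by (simp add: t sym_entry_def sym3_minors_def mult.commute)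
next
  obtain a b c d e f where t: "t = (a,b,c,d,e,f)" by (cases t)
  assume "sym3_minors t"
  then have m: "int p dvd a * d - b * b" "int p dvd a * e - b * c" "int p dvd a * f - c * c"
    "int p dvd b * e - c * d" "int p dvd b * f - c * e" "int p dvd d * f - e * e"
    by (simp_all add: t sym3_minors_def)
  have m': "int p dvd d * a - b * b" "int p dvd d * c - b * e" "int p dvd d * c - e * b" "int p dvd a * e - c * b"
    "int p dvd f * a - c * c" "int p dvd f * b - c * e" "int p dvd f * b - e * c" "int p dvd f * d - e * e"
    using m dvd_minus_iff[of "int p" "b * e - c * d"] by (simp_all add: mult.commute)
  have pivot: "rank_le 1 (smat3 t)"
    if q: "q < 3" "\<not> int p dvd sym_entry t q q"
      and h: "\<And>i j. i < 3 \<Longrightarrow> j < 3 \<Longrightarrow> int p dvd sym_entry t q q * sym_entry t i j - sym_entry t q i * sym_entry t q j" for q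
  proof -
    obtain v where v: "int p dvd sym_entry t q q * v - 1" by (rule unit_mod_p[OF q(2)])
    show ?thesis
    proof (rule rank_le_smat3[where x = "\<lambda>_ i. v * sym_entry t q i" and y = "\<lambda>_. sym_entry t q"])
      fix i j :: nat assume "i < 3" "j < 3"
      note hij = h[OF this]
      have "int p dvd sym_entry t i j - v * sym_entry t q i * sym_entry t q j"
        by (rule dvd_combination[OF hij v, of _ v "- sym_entry t i j"]) (simp add: algebra_simps)
      then show "int p dvd sym_entry t i j - (\<Sum>k<(1::nat). v * sym_entry t q i * sym_entry t q j)" by simp
    qed
  qed
  show "rank_le 1 (smat3 t)"
  proof (cases "int p dvd a \<and> int p dvd d \<and> int p dvd f")
    case False
    then consider "\<not> int p dvd a" | "\<not> int p dvd d" | "\<not> int p dvd f" by blast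
    then show ?thesis
    proof cases
      case 1
      show ?thesis
        by (rule pivot[of 0]; (elim less3_cases)?) (use 1 m m' in \<open>simp_all add: t sym_entry_def\<close>)
    next
      case 2
      show ?thesis
        by (rule pivot[of 1]; (elim less3_cases)?) (use 2 m m' in \<open>simp_all add: t sym_entry_def\<close>)
    next
      case 3
      show ?thesis
        by (rule pivot[of 2]; (elim less3_cases)?) (use 3 m m' in \<open>simp_all add: t sym_entry_def\<close>)
    qed
  next
    case True
    have "a = 0" "d = 0" "f = 0" using True assms dvd_res by (auto simp: t)
    then have "int p dvd b" "int p dvd c" "int p dvd e" using m(1,3,6) by (simp_all add: dvd_mult_p)
    then have "t = (0,0,0,0,0,0)" using \<open>a = 0\<close> \<open>d = 0\<close> \<open>f = 0\<close> assms dvd_res by (auto simp: t)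
    then show ?thesis using rank_le_0_smat3[OF assms] rank_le_mono_0 by blast
  qed
qed

text \<open>If the determinant vanishes, every row of the adjugate is a linear relation between the
  rows, and one with a unit coefficient expresses a row by the other two. If the adjugate vanishes
  as well, the rank is at most 1.\<close>

lemma rank_le_2_smat3:
  assumes "t \<in> sym3"
  shows "rank_le 2 (smat3 t) \<longleftrightarrow> int p dvd sym3_det t"
proof
  obtain a b c d e f where t: "t = (a,b,c,d,e,f)" by (cases t)
  note tr = smat3_tri[of t]
  assume r: "rank_le 2 (smat3 t)"
  have "pmult 1 (minor3 (smat3 t) 0 1 2 3 4 5)"
    by (rule rank_le_2D[OF r]) (use int_sim_integral[OF triD(1)[OF tr]] tri_carrier[OF tr] in simp_all)
  moreover have "minor3 (smat3 t) 0 1 2 3 4 5 = of_int (sym3_det t)"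
    by (simp add: minor3_def smat3_def t sym3_det_def algebra_simps)
  ultimately show "int p dvd sym3_det t" by (simp only: pmult_of_int)
next
  obtain a b c d e f where t: "t = (a,b,c,d,e,f)" by (cases t)
  assume det: "int p dvd sym3_det t"
  let ?B = "sym_entry t"
  have kernel: "rank_le 2 (smat3 t)"
    if w: "\<And>j. j < 3 \<Longrightarrow> int p dvd w 0 * ?B 0 j + w 1 * ?B 1 j + w 2 * ?B 2 j"
      and q: "q < 3" "\<not> int p dvd w q" for w :: "nat \<Rightarrow> int" and q
  proof -
    obtain v where v: "int p dvd w q * v - 1" by (rule unit_mod_p[OF q(2)])
    have red: "int p dvd ?B q j - (\<Sum>k\<in>{..<3} - {q}. (- v * w k) * ?B k j)" if "j < 3" for j
    proof -
      have s: "(\<Sum>k<3. w k * ?B k j) = w 0 * ?B 0 j + w 1 * ?B 1 j + w 2 * ?B 2 j"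
        by (rule sum_lt3)
      have "(\<Sum>k<3. w k * ?B k j) = w q * ?B q j + (\<Sum>k\<in>{..<3} - {q}. w k * ?B k j)"
        by (rule sum.remove) (use q in auto)
      then have s1: "int p dvd w q * ?B q j + (\<Sum>k\<in>{..<3} - {q}. w k * ?B k j)" using w[OF that] s by simp
      have "(\<Sum>k\<in>{..<3} - {q}. (- v * w k) * ?B k j) = - v * (\<Sum>k\<in>{..<3} - {q}. w k * ?B k j)"
        by (simp add: sum_distrib_left mult.assoc)
      then show ?thesis
        by (intro dvd_combination[OF s1 v, of _ v "- ?B q j"]) (simp add: algebra_simps)
    qed
    have "\<exists>k l. {..<3} - {q} = {k, l} \<and> k \<noteq> l \<and> k \<noteq> q \<and> l \<noteq> q"
      using q(1)
    proof (rule less3_cases)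
      assume "q = 0" then show ?thesis by (intro exI[of _ 1] exI[of _ 2] conjI) auto
    next
      assume "q = Suc 0" then show ?thesis by (intro exI[of _ 0] exI[of _ 2] conjI) auto
    next
      assume "q = 2" then show ?thesis by (intro exI[of _ 0] exI[of _ 1] conjI) auto
    qed
    then obtain k l where kl: "{..<3} - {q} = {k, l}" "k \<noteq> l" "k \<noteq> q" "l \<noteq> q" by (elim exE conjE)
    \<comment> \<open>The outer products are formed with the rows k and l; row q enters through its
      expression by these two.\<close>
    let ?x = "\<lambda>n i. if i = q then - v * w (if n = 0 then k else l) else if i = (if n = 0 then k else l) then 1 else 0"
    let ?y = "\<lambda>n. ?B (if n = 0 then k else l)"
    show ?thesis
    proof (rule rank_le_smat3[where x = ?x and y = ?y])
      fix i j :: nat assume ij: "i < 3" "j < 3"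
      have s2: "(\<Sum>n<2::nat. ?x n i * ?y n j) = (if i = q then - v * w k else if i = k then 1 else 0) * ?B k j +
          (if i = q then - v * w l else if i = l then 1 else 0) * ?B l j"
        by (simp add: numeral_2_eq_2)
      have r: "int p dvd ?B q j - ((- v * w k) * ?B k j + (- v * w l) * ?B l j)"
        using red[OF ij(2)] unfolding kl(1) by (simp add: kl(2))
      have "i \<in> insert q {k, l}" unfolding kl(1)[symmetric] using ij(1) by auto
      then consider "i = q" | "i = k" | "i = l" by auto
      then show "int p dvd ?B i j - (\<Sum>n<2::nat. ?x n i * ?y n j)"
        unfolding s2 by cases (use r kl(2-4) in simp_all)
    qed
  qed
  \<comment> \<open>The rows of the adjugate. It is symmetric, so six of its entries are enough in
    the final case distinction.\<close>
  define w0 where "w0 = (\<lambda>i::nat. [d * f - e * e, - (b * f - c * e), b * e - c * d] ! i)"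
  define w1 where "w1 = (\<lambda>i::nat. [- (b * f - c * e), a * f - c * c, - (a * e - b * c)] ! i)"
  define w2 where "w2 = (\<lambda>i::nat. [b * e - c * d, - (a * e - b * c), a * d - b * b] ! i)"
  have D: "sym3_det t = a * (d * f - e * e) - b * (b * f - c * e) + c * (b * e - c * d)" by (simp add: t sym3_det_def)
  have k0: "int p dvd w0 0 * ?B 0 j + w0 1 * ?B 1 j + w0 2 * ?B 2 j" if "j < 3" for j
  proof -
    have "w0 0 * ?B 0 j + w0 1 * ?B 1 j + w0 2 * ?B 2 j = (if j = 0 then sym3_det t else 0)"
      using that by (elim less3_cases) (simp_all add: w0_def t sym_entry_def sym3_det_def algebra_simps)
    then show ?thesis using det by simp
  qed
  have k1: "int p dvd w1 0 * ?B 0 j + w1 1 * ?B 1 j + w1 2 * ?B 2 j" if "j < 3" for j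
  proof -
    have "w1 0 * ?B 0 j + w1 1 * ?B 1 j + w1 2 * ?B 2 j = (if j = 1 then sym3_det t else 0)"
      using that by (elim less3_cases) (simp_all add: w1_def t sym_entry_def sym3_det_def algebra_simps)
    then show ?thesis using det by simp
  qed
  have k2: "int p dvd w2 0 * ?B 0 j + w2 1 * ?B 1 j + w2 2 * ?B 2 j" if "j < 3" for j
  proof -
    have "w2 0 * ?B 0 j + w2 1 * ?B 1 j + w2 2 * ?B 2 j = (if j = 2 then sym3_det t else 0)"
      using that by (elim less3_cases) (simp_all add: w2_def t sym_entry_def sym3_det_def algebra_simps)
    then show ?thesis using det by simp
  qed
  show "rank_le 2 (smat3 t)"
  proof (cases "sym3_minors t")
    case True
    then show ?thesis using rank_le_1_smat3[OF assms] rank_le_1_2 by blast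
  next
    case False
    then consider "\<not> int p dvd w0 0" | "\<not> int p dvd w0 1" | "\<not> int p dvd w0 2" | "\<not> int p dvd w1 1" | "\<not> int p dvd w1 2" | "\<not> int p dvd w2 2"
      by (auto simp: sym3_minors_def t w0_def w1_def w2_def dvd_diff_commute)
    then show ?thesis
    proof cases
      case 1
      show ?thesis by (rule kernel[of w0, OF k0 _ 1]) simp_all
    next
      case 2
      show ?thesis by (rule kernel[of w0, OF k0 _ 2]) simp_all
    next
      case 3
      show ?thesis by (rule kernel[of w0, OF k0 _ 3]) simp_all
    next
      case 4
      show ?thesis by (rule kernel[of w1, OF k1 _ 4]) simp_all
    next
      case 5
      show ?thesis by (rule kernel[of w1, OF k1 _ 5]) simp_all
    next
      case 6
      show ?thesis by (rule kernel[of w2, OF k2 _ 6]) simp_all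
    qed
  qed
qed

text \<open>Modulo p the matrix is the 2 by 2 block plus an independent 1 at (5,5), so rank exactly
  2 means that the block has rank exactly 1.\<close>

lemma rank_smat2:
  assumes "t \<in> res \<times> res \<times> res"
  shows "rank_le 2 (smat2 t) \<and> \<not> rank_le 1 (smat2 t) \<longleftrightarrow> t \<in> sym2_singular - {(0,0,0)}"
proof -
  obtain a b d where t: "t = (a,b,d)" by (cases t)
  note tr = smat2_tri[of t]
  have r: "a \<in> res" "b \<in> res" "d \<in> res" using assms by (simp_all add: t)
  have 2: "int p dvd a * d - b * b" if "rank_le 2 (smat2 t)"
  proof -
    have "pmult 1 (minor3 (smat2 t) 0 1 5 3 4 5)"
      by (rule rank_le_2D[OF that]) (use int_sim_integral[OF triD(1)[OF tr]] tri_carrier[OF tr] in simp_all)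
    moreover have "minor3 (smat2 t) 0 1 5 3 4 5 = of_int (a * d - b * b)"
      by (simp add: minor3_def smat2_def t)
    ultimately show ?thesis by (simp only: pmult_of_int)
  qed
  have I2: "rank_le 2 (smat2 t)" if ad: "int p dvd a - x0 * y0" "int p dvd b - x0 * y1" "int p dvd b - x1 * y0" "int p dvd d - x1 * y1" for x0 x1 y0 y1
  proof -
    let ?x = "\<lambda>i::nat. if i = 0 then rat_of_int x0 else if i = 1 then of_int x1 else 0"
    let ?y = "\<lambda>i::nat. if i = 3 then rat_of_int y0 else if i = 4 then of_int y1 else 0"
    have q: "pmult 1 (of_int a - of_int x0 * of_int y0)" "pmult 1 (of_int b - of_int x0 * of_int y1)"
      "pmult 1 (of_int b - of_int x1 * of_int y0)" "pmult 1 (of_int d - of_int x1 * of_int y1)"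
      using ad by (simp_all flip: of_int_mult of_int_diff add: pmult_of_int[simplified])
    have pp: "pmult (Suc 0) ((of_nat p)\<^sup>2)" using pmult1I[of "of_nat p" "(of_nat p)\<^sup>2"] by (simp add: power2_eq_square)
    show ?thesis
    proof (rule rank_le_I2[of ?x ?y "unit_vec 5" "unit_vec 5"])
      fix i j :: nat assume "i < 6" "j < 6"
      then show "pmult 1 (smat2 t $$ (i,j) - (?x i * ?y j + unit_vec 5 i * unit_vec 5 j))"
        by (elim less6_cases) (use q pp in \<open>simp_all add: smat2_def t unit_vec_def pmult_1_p'\<close>)
    qed (auto simp: unit_vec_def)
  qed
  have 1: "rank_le 1 (smat2 t) \<longleftrightarrow> t = (0,0,0)"
  proof
    assume r1: "rank_le 1 (smat2 t)"
    have *: "pmult 1 (minor2 (smat2 t) i 5 j 5)" if "i < 6" "j < 6" for i j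
      by (rule rank_le_1D[OF r1]) (use that int_sim_integral[OF triD(1)[OF tr]] tri_carrier[OF tr] in simp_all)
    have m: "minor2 (smat2 t) 0 5 3 5 = of_int a" "minor2 (smat2 t) 0 5 4 5 = of_int b" "minor2 (smat2 t) 1 5 4 5 = of_int d"
      by (simp_all add: minor2_def smat2_def t)
    show "t = (0,0,0)"
      using *[of 0 3] *[of 0 4] *[of 1 4] unfolding m pmult_of_int using r dvd_res by (simp add: t)
  next
    assume t0: "t = (0,0,0)"
    have pp: "pmult (Suc 0) ((of_nat p)\<^sup>2)" using pmult1I[of "of_nat p" "(of_nat p)\<^sup>2"] by (simp add: power2_eq_square)
    show "rank_le 1 (smat2 t)"
    proof (rule rank_le_I1[of "unit_vec 5" "unit_vec 5"])
      fix i j :: nat assume "i < 6" "j < 6"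
      then show "pmult 1 (smat2 t $$ (i,j) - unit_vec 5 i * unit_vec 5 j)"
        by (elim less6_cases) (use pp in \<open>simp_all add: smat2_def t0 unit_vec_def pmult_1_p'\<close>)
    qed (auto simp: unit_vec_def)
  qed
  have "rank_le 2 (smat2 t)" if h: "int p dvd a * d - b * b"
  proof (cases "a = 0")
    case True
    then have "b = 0" using h dvd_res[OF r(2)] by (simp add: dvd_mult_p)
    then show ?thesis using True by (intro I2[of 0 0 d 1]) simp_all
  next
    case False
    then obtain v where v: "int p dvd a * v - 1" using unit_mod_p dvd_res[OF r(1)] by blast
    show ?thesis
    proof (rule I2[of 1 a b "b * v"])
      show "int p dvd b - b * v * a"
        by (rule dvd_combination[OF v v, of _ "- b" 0]) (simp add: algebra_simps)
      show "int p dvd d - b * v * b"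
        by (rule dvd_combination[OF h v, of _ v "- d"]) (simp add: algebra_simps)
    qed simp_all
  qed
  then show ?thesis using 1 2 r by (auto simp: t sym2_singular_def)
qed

text \<open>A corner prime to p would lead to the exponents (2,0,0), in the orbit of (0,0,0), where
  this generator has no coset. The singular nonzero symmetric 2 by 2 blocks are left.\<close>

lemma tcoef_T1_110: "tcoef 2 (dc (T2_rep 1)) 1 1 0 = (of_nat p ^ 2 - 1) / of_nat p ^ 3"
proof -
  let ?S = "dc (T2_rep 1)"
  have S: "translation_closed 2 ?S" by (rule translation_closed_dc[OF T2_rep_int_sim])
  have "tcoef 2 ?S 2 0 0 = 0" using tcoef_2(1)[OF S] tcoef_zero(1) by simp
  then have z: "tcount 2 ?S 2 0 0 = 0" by (simp add: tcoef_def)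
  have e: "set_exps 1 (dvec 1 1 0) 1 1 = dvec 1 1 0" by (auto simp: set_exps_def dvec_def fun_eq_iff)
  have "tcount 2 ?S 1 1 0 = card (block_cosets 2 ?S 1 (dvec 1 1 0) 0)"
    using card_tri_cosets_split[OF S, of 1 "dvec 1 1 0"] z unfolding e tri_cosets_set_exps by (simp add: tcount_def)
  also have "\<dots> = card {t \<in> res \<times> res \<times> res. cs (smat2 t) \<in> ?S}" by (rule card_block_cosets_110)
  also have "{t \<in> res \<times> res \<times> res. cs (smat2 t) \<in> ?S} = sym2_singular - {(0,0,0)}"
  proof -
    have "cs (smat2 t) \<in> ?S \<longleftrightarrow> t \<in> sym2_singular - {(0,0,0)}" if "t \<in> res \<times> res \<times> res" for t
      unfolding mem_dc_T2_rep_iff(2)[OF triD(1)[OF smat2_tri]] by (rule rank_smat2[OF that])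
    moreover have "sym2_singular \<subseteq> res \<times> res \<times> res" unfolding sym2_singular_def by blast
    ultimately show ?thesis by blast
  qed
  also have "card \<dots> = p ^ 2 - 1" by (rule card_sym2_rank_1)
  finally have c: "tcount 2 ?S 1 1 0 = p ^ 2 - 1" .
  have "1 \<le> p ^ 2" by (rule one_le_power) (use p_pos(1) in linarith)
  then have "(of_nat (p ^ 2 - 1) :: rat) = of_nat p ^ 2 - 1" by (simp add: of_nat_diff)
  then show ?thesis unfolding tcoef_def c by (simp add: power3_eq_cube)
qed

text \<open>The three auxiliary exponents lie in the orbit of (1,0,0), where this generator has no
  coset; what remains are the symmetric matrices of rank exactly 1.\<close>

lemma tcoef_T2_111: "tcoef 2 (dc (T2_rep 2)) 1 1 1 = (of_nat p ^ 3 - 1) / of_nat p ^ 6"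
proof -
  let ?S = "dc (T2_rep 2)"
  have S: "translation_closed 2 ?S" by (rule translation_closed_dc[OF T2_rep_int_sim])
  note w = tcoef_2[OF S]
  have "tcoef 2 ?S 2 0 1 = 0" "tcoef 2 ?S 1 2 0 = 0" "tcoef 2 ?S 2 1 0 = 0"
    using w(1)[of 0 1] w(2)[of 1 0] w(1)[of 1 0] w(4,5) tcoef_zero(3) by simp_all
  then have z: "tcount 2 ?S 2 0 1 = 0" "tcount 2 ?S 1 2 0 = 0" "tcount 2 ?S 2 1 0 = 0" by (simp_all add: tcoef_def)
  have "tcount 2 ?S 1 1 1 = card (clean_cosets ?S 1 1 1 0)"
    using card_tri_cosets_111[OF S] unfolding z by simp
  also have "\<dots> = card {t \<in> sym3. cs (smat3 t) \<in> ?S}" by (rule card_clean_cosets_111)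
  also have "{t \<in> sym3. cs (smat3 t) \<in> ?S} = {t \<in> sym3. sym3_minors t \<and> t \<noteq> (0,0,0,0,0,0)}"
  proof -
    have *: "cs (smat3 t) \<in> ?S \<longleftrightarrow> sym3_minors t \<and> t \<noteq> (0,0,0,0,0,0)" if "t \<in> sym3" for t
      unfolding mem_dc_T2_rep_iff(1)[OF triD(1)[OF smat3_tri]] rank_le_1_smat3[OF that] rank_le_0_smat3[OF that] ..
    show ?thesis by (intro Collect_cong conj_cong refl *)
  qed
  also have "card \<dots> = p ^ 3 - 1" by (rule card_sym3_rank)
  finally have c: "tcount 2 ?S 1 1 1 = p ^ 3 - 1" .
  have "1 \<le> p ^ 3" by (rule one_le_power) (use p_pos(1) in linarith)
  then have "(of_nat (p ^ 3 - 1) :: rat) = of_nat p ^ 3 - 1" by (simp add: of_nat_diff)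
  then show ?thesis unfolding tcoef_def c by simp
qed

text \<open>Here the auxiliary exponents do contribute: their orbit has coefficient 1 / p, and
  undoing the weights with exponents 5, 5, 4 gives p^4, p^4, p^3. The clean cosets add the p^5 - p^2
  symmetric matrices of rank exactly 2.\<close>

lemma tcoef_T1_111:
  "tcoef 2 (dc (T2_rep 1)) 1 1 1 = (3 * of_nat p ^ 5 - of_nat p ^ 4 - of_nat p ^ 3 - of_nat p ^ 2) / of_nat p ^ 6"
proof -
  let ?S = "dc (T2_rep 1)" and ?p = "of_nat p :: rat"
  have S: "translation_closed 2 ?S" by (rule translation_closed_dc[OF T2_rep_int_sim])
  note w = tcoef_2[OF S]
  have "tcoef 2 ?S 2 0 1 = 1 / ?p" "tcoef 2 ?S 1 2 0 = 1 / ?p" "tcoef 2 ?S 2 1 0 = 1 / ?p"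
    using w(1)[of 0 1] w(2)[of 1 0] w(1)[of 1 0] w(4,5) tcoef_T1_100 by simp_all
  then have z: "of_nat (tcount 2 ?S 2 0 1) = ?p ^ 4" "of_nat (tcount 2 ?S 1 2 0) = ?p ^ 4" "of_nat (tcount 2 ?S 2 1 0) = ?p ^ 3"
    unfolding tcount_eq_tcoef by (simp_all add: eval_nat_numeral)
  have "card (clean_cosets ?S 1 1 1 0) = card {t \<in> sym3. cs (smat3 t) \<in> ?S}" by (rule card_clean_cosets_111)
  also have "{t \<in> sym3. cs (smat3 t) \<in> ?S} = {t \<in> sym3. int p dvd sym3_det t \<and> \<not> sym3_minors t}"
  proof -
    have *: "cs (smat3 t) \<in> ?S \<longleftrightarrow> int p dvd sym3_det t \<and> \<not> sym3_minors t" if "t \<in> sym3" for t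
      unfolding mem_dc_T2_rep_iff(2)[OF triD(1)[OF smat3_tri]] rank_le_1_smat3[OF that] rank_le_2_smat3[OF that] ..
    show ?thesis by (intro Collect_cong conj_cong refl *)
  qed
  also have "card \<dots> = p ^ 5 - p ^ 2" by (rule card_sym3_rank)
  finally have c: "card (clean_cosets ?S 1 1 1 0) = p ^ 5 - p ^ 2" .
  have "p ^ 2 \<le> p ^ 5" by (rule power_increasing) (use p_pos(1) in linarith)+
  then have c': "(of_nat (card (clean_cosets ?S 1 1 1 0)) :: rat) = ?p ^ 5 - ?p ^ 2" unfolding c by (simp add: of_nat_diff)
  have "1 \<le> p" using p_pos(1) by linarith
  from of_nat_diff[OF this] have p1: "(of_nat (p - 1) :: rat) = ?p - 1" by simp
  have "of_nat (tcount 2 ?S 1 1 1) = (?p - 1) * (?p ^ 4 + ?p ^ 4 + ?p ^ 3) + (?p ^ 5 - ?p ^ 2)"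
    unfolding card_tri_cosets_111[OF S] of_nat_add of_nat_mult p1 z c' ..
  also have "\<dots> = 3 * ?p ^ 5 - ?p ^ 4 - ?p ^ 3 - ?p ^ 2" by (simp add: algebra_simps eval_nat_numeral)
  finally show ?thesis unfolding tcoef_def by simp
qed

end

section \<open>The spinor polynomial\<close>

lemma sum_le1: "(\<Sum>a\<le>1. f a) = f 0 + (f (1::nat) :: 'a::comm_monoid_add)"
  by simp

lemma sum_monom_8:
  "(\<Sum>j\<le>8. Polynomial.monom (g j) j) = [:g 0, g 1, g 2, g 3, g 4, g 5, g 6, g 7, g (8::nat):]"
  by (simp add: eval_nat_numeral monom_Suc monom_0)

lemma mconst_simps:
  "mconst (a + b) = mconst a + mconst b" "mconst (a - b) = mconst a - mconst b" "mconst (a * b) = mconst a * mconst b"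
  "mconst 1 = 1" "mconst 0 = 0" "mconst (a ^ n) = mconst a ^ n"
proof -
  show m: "mconst (a * b) = mconst a * mconst b" for a b by (simp add: mconst_def mult_single)
  show one: "mconst 1 = 1" by (simp add: mconst_def)
  show "mconst (a ^ n) = mconst a ^ n" by (induction n) (simp_all add: m one)
qed (simp_all add: mconst_def single_add single_diff)

lemma mconst_of_nat: "mconst (of_nat n) = of_nat n"
  by (induction n) (simp_all add: mconst_simps)

text \<open>Products are expanded with generic coefficients, so that the eight linear factors are
  multiplied before the large expressions are inserted.\<close>

lemma quadratic_mult:
  fixes s p s' p' :: "'a :: comm_ring_1"
  shows "[:1, s, p:] * [:1, s', p':] = [:1, s + s', p + p' + s * s', s * p' + s' * p, p * p':]"
  by (simp add: add_ac mult_ac)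

lemma quartic_mult:
  fixes a b c d a' b' c' d' :: "'a :: comm_ring_1"
  shows "[:1, a, b, c, d:] * [:1, a', b', c', d':] = [:1, a + a', b + b' + a * a', c + c' + a * b' + a' * b,
     d + d' + a * c' + a' * c + b * b', a * d' + a' * d + b * c' + b' * c, b * d' + b' * d + c * c', c * d' + c' * d, d * d':]"
  unfolding mult_pCons_left mult_pCons_right smult_pCons add_pCons mult_zero_left mult_zero_right smult_0_right
    pCons_eq_iff
  by (simp only: add_pCons add_0 add_0_right mult_1 pCons_eq_iff, intro conjI refl; (simp only: mult_1 ac_simps)?)

lemma linear_mult: "[:1, a:] * [:1, b:] = [:1, a + b, a * b :: 'a :: comm_ring_1:]"
  by (simp add: add.commute)

text \<open>q plays the part of 1 / p; working with the relation P q = 1 keeps everything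
  polynomial.\<close>

lemma spinor_product:
  fixes P q y x1 x2 x3 :: "'a :: comm_ring_1"
  assumes Pq: "P * q = 1"
    and T: "T = y * (1 + x1) * (1 + x2) * (1 + x3)"
    and T1: "T1 = y ^ 2 * (q * (x1 * (1 + x2 ^ 2) * (1 + x3 ^ 2) + x2 * (1 + x1 ^ 2) * (1 + x3 ^ 2) + x3 * (1 + x1 ^ 2) * (1 + x2 ^ 2))
        + (q - q ^ 3) * (x1 * x2 * (1 + x3 ^ 2) + x1 * x3 * (1 + x2 ^ 2) + x2 * x3 * (1 + x1 ^ 2))
        + (3 * q - q ^ 2 - q ^ 3 - q ^ 4) * (x1 * x2 * x3))"
    and T2: "T2 = y ^ 2 * (q ^ 3 * (x1 * x2 * (1 + x3 ^ 2) + x1 * x3 * (1 + x2 ^ 2) + x2 * x3 * (1 + x1 ^ 2))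
        + (q ^ 3 - q ^ 6) * (x1 * x2 * x3))"
    and T3: "T3 = y ^ 2 * (q ^ 6 * (x1 * x2 * x3))"
  shows "[:1, - y:] * [:1, - (y * x1):] * [:1, - (y * x2):] * [:1, - (y * x3):] *
      [:1, - (y * x1 * x2):] * [:1, - (y * x1 * x3):] * [:1, - (y * x2 * x3):] * [:1, - (y * x1 * x2 * x3):] =
    [:1, - T, P * (T1 + (P ^ 2 + 1) * T2 + (1 + P ^ 2) ^ 2 * T3), - (P ^ 3 * (T * (T2 + T3))),
      P ^ 6 * (- 2 * P * (T1 * T3) + T2 ^ 2 - 2 * (P - 1) * (T2 * T3)
        - (P ^ 2 + 2 * P - 1) * (P ^ 2 - P + 1) * (P ^ 2 + P + 1) * T3 ^ 2 + T3 * T ^ 2),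
      - (P ^ 9 * (T3 * T * (T2 + T3))), P ^ 13 * (T3 ^ 2 * (T1 + (P ^ 2 + 1) * T2 + (P ^ 2 + 1) ^ 2 * T3)),
      - (P ^ 18 * (T3 ^ 3 * T)), P ^ 24 * T3 ^ 4:]"
proof -
  define X where "X = x1 * x2 * x3"
  define E1 where "E1 = x1 * (1 + x2 ^ 2) * (1 + x3 ^ 2) + x2 * (1 + x1 ^ 2) * (1 + x3 ^ 2) + x3 * (1 + x1 ^ 2) * (1 + x2 ^ 2)"
  define E2 where "E2 = x1 * x2 * (1 + x3 ^ 2) + x1 * x3 * (1 + x2 ^ 2) + x2 * x3 * (1 + x1 ^ 2)"
  \<comment> \<open>\<open>W1\<close>, \<open>W2\<close>, \<open>W3\<close> strip the powers q, q^3,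
    q^6 off the generators. In every coefficient P then occurs only in powers of P q, which leaves
    polynomials in q.\<close>
  define W1 where "W1 = y ^ 2 * (E1 + (1 - q ^ 2) * E2 + (3 - q - q ^ 2 - q ^ 3) * X)"
  define W2 where "W2 = y ^ 2 * (E2 + (1 - q ^ 3) * X)"
  define W3 where "W3 = y ^ 2 * X"
  have W: "T1 = q * W1" "T2 = q ^ 3 * W2" "T3 = q ^ 6 * W3"
    unfolding T1 T2 T3 E1_def[symmetric] E2_def[symmetric] X_def[symmetric] W1_def W2_def W3_def by (simp add: algebra_simps eval_nat_numeral)+
  have c2: "P * (T1 + (P ^ 2 + 1) * T2 + (1 + P ^ 2) ^ 2 * T3) = W1 + (1 + q ^ 2) * W2 + (q ^ 5 + 2 * q ^ 3 + q) * W3"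
  proof -
    have "P * (T1 + (P ^ 2 + 1) * T2 + (1 + P ^ 2) ^ 2 * T3) = (P * q) * W1 + ((P * q) ^ 3 + (P * q) * q ^ 2) * W2
       + ((P * q) * q ^ 5 + 2 * (P * q) ^ 3 * q ^ 3 + (P * q) ^ 5 * q) * W3"
      unfolding W by (simp add: algebra_simps eval_nat_numeral)
    then show ?thesis by (simp only: Pq power_one mult_1 mult_1_right)
  qed
  have c3: "P ^ 3 * (T * (T2 + T3)) = T * (W2 + q ^ 3 * W3)"
  proof -
    have "P ^ 3 * (T * (T2 + T3)) = (P * q) ^ 3 * (T * (W2 + q ^ 3 * W3))" unfolding W by (simp add: algebra_simps eval_nat_numeral)
    then show ?thesis by (simp only: Pq power_one mult_1 mult_1_right)
  qed
  \<comment> \<open>The three quadratic factors multiply to P^6 + 2 P^5 + 2 P^3 + 2 P - 1; with P^6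
    in front and q^12 from the square of \<open>T3\<close> this becomes the bracket on the
    right.\<close>
  have c4: "P ^ 6 * (- 2 * P * (T1 * T3) + T2 ^ 2 - 2 * (P - 1) * (T2 * T3)
        - (P ^ 2 + 2 * P - 1) * (P ^ 2 - P + 1) * (P ^ 2 + P + 1) * T3 ^ 2 + T3 * T ^ 2)
     = - 2 * W1 * W3 + W2 ^ 2 - 2 * (q ^ 2 - q ^ 3) * W2 * W3 - (1 + 2 * q + 2 * q ^ 3 + 2 * q ^ 5 - q ^ 6) * W3 ^ 2 + W3 * T ^ 2"
  proof -
    have "P ^ 6 * (- 2 * P * (T1 * T3) + T2 ^ 2 - 2 * (P - 1) * (T2 * T3)
        - (P ^ 2 + 2 * P - 1) * (P ^ 2 - P + 1) * (P ^ 2 + P + 1) * T3 ^ 2 + T3 * T ^ 2)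
      = - 2 * (P * q) ^ 7 * W1 * W3 + (P * q) ^ 6 * W2 ^ 2 - 2 * ((P * q) ^ 7 * q ^ 2 - (P * q) ^ 6 * q ^ 3) * W2 * W3
        - ((P * q) ^ 12 + 2 * (P * q) ^ 11 * q + 2 * (P * q) ^ 9 * q ^ 3 + 2 * (P * q) ^ 7 * q ^ 5 - (P * q) ^ 6 * q ^ 6) * W3 ^ 2
        + (P * q) ^ 6 * W3 * T ^ 2"
      unfolding W by (simp add: algebra_simps eval_nat_numeral)
    then show ?thesis by (simp only: Pq power_one mult_1 mult_1_right)
  qed
  have c5: "P ^ 9 * (T3 * T * (T2 + T3)) = W3 * T * (W2 + q ^ 3 * W3)"
  proof -
    have "P ^ 9 * (T3 * T * (T2 + T3)) = (P * q) ^ 9 * (W3 * T * (W2 + q ^ 3 * W3))" unfolding W by (simp add: algebra_simps eval_nat_numeral)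
    then show ?thesis by (simp only: Pq power_one mult_1 mult_1_right)
  qed
  have c6: "P ^ 13 * (T3 ^ 2 * (T1 + (P ^ 2 + 1) * T2 + (P ^ 2 + 1) ^ 2 * T3)) = W3 ^ 2 * (W1 + (1 + q ^ 2) * W2 + (q ^ 5 + 2 * q ^ 3 + q) * W3)"
  proof -
    have "P ^ 13 * (T3 ^ 2 * (T1 + (P ^ 2 + 1) * T2 + (P ^ 2 + 1) ^ 2 * T3)) =
        (P * q) ^ 12 * W3 ^ 2 * (P * (T1 + (P ^ 2 + 1) * T2 + (1 + P ^ 2) ^ 2 * T3))" unfolding W(3) by (simp add: algebra_simps eval_nat_numeral)
    then show ?thesis by (simp only: Pq c2 power_one mult_1 mult_1_right)
  qed
  have c7: "P ^ 18 * (T3 ^ 3 * T) = W3 ^ 3 * T"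
  proof -
    have "P ^ 18 * (T3 ^ 3 * T) = (P * q) ^ 18 * (W3 ^ 3 * T)" unfolding W by (simp add: algebra_simps eval_nat_numeral)
    then show ?thesis by (simp only: Pq power_one mult_1 mult_1_right)
  qed
  have c8: "P ^ 24 * T3 ^ 4 = W3 ^ 4"
  proof -
    have "P ^ 24 * T3 ^ 4 = (P * q) ^ 24 * W3 ^ 4" unfolding W by (simp add: algebra_simps eval_nat_numeral)
    then show ?thesis by (simp only: Pq power_one mult_1 mult_1_right)
  qed
  \<comment> \<open>Each factor is paired with the one for the complementary set of variables; in
    all four pairs the leading coefficient of the product is W3.\<close>
  have "[:1, - y:] * [:1, - (y * x1):] * [:1, - (y * x2):] * [:1, - (y * x3):] *
      [:1, - (y * x1 * x2):] * [:1, - (y * x1 * x3):] * [:1, - (y * x2 * x3):] * [:1, - (y * x1 * x2 * x3):] =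
    (([:1, - y:] * [:1, - (y * x1 * x2 * x3):]) * ([:1, - (y * x1):] * [:1, - (y * x2 * x3):])) *
    (([:1, - (y * x2):] * [:1, - (y * x1 * x3):]) * ([:1, - (y * x3):] * [:1, - (y * x1 * x2):]))"
    by (simp only: mult_ac)
  also have "\<dots> = [:1, - T, P * (T1 + (P ^ 2 + 1) * T2 + (1 + P ^ 2) ^ 2 * T3), - (P ^ 3 * (T * (T2 + T3))),
      P ^ 6 * (- 2 * P * (T1 * T3) + T2 ^ 2 - 2 * (P - 1) * (T2 * T3)
        - (P ^ 2 + 2 * P - 1) * (P ^ 2 - P + 1) * (P ^ 2 + P + 1) * T3 ^ 2 + T3 * T ^ 2),
      - (P ^ 9 * (T3 * T * (T2 + T3))), P ^ 13 * (T3 ^ 2 * (T1 + (P ^ 2 + 1) * T2 + (P ^ 2 + 1) ^ 2 * T3)),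
      - (P ^ 18 * (T3 ^ 3 * T)), P ^ 24 * T3 ^ 4:]"
    unfolding linear_mult quadratic_mult quartic_mult c2 c3 c4 c5 c6 c7 c8 pCons_eq_iff
    unfolding T W1_def W2_def W3_def E1_def E2_def X_def
    by (intro conjI refl; (simp add: algebra_simps eval_nat_numeral)?)
  finally show ?thesis .
qed

context fixed_prime
begin

section \<open>Satake images of the generators\<close>

definition p_inv :: rat_mpoly where "p_inv = mconst (1 / of_nat p)"

lemma p_inv: "of_nat p * p_inv = 1"
  unfolding p_inv_def mconst_of_nat[symmetric] mconst_simps(3)[symmetric] by (simp add: mconst_simps)

lemma mconst_p_inv: "mconst (1 / of_nat p ^ n) = p_inv ^ n"
  by (simp add: p_inv_def mconst_simps(6)[symmetric] power_one_over)

lemma satake_T: "satake 3 p (hecke_T 3 p) = mvar 0 * (1 + mvar 1) * (1 + mvar 2) * (1 + mvar 3)"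
proof -
  let ?c = "tcoef 1 (dc T_rep)"
  note w = tcoef_weyl[OF translation_closed_dc[OF T_rep_int_sim]]
  have 1: "?c 1 b c = ?c 0 b c" for b c by (rule w(3)) simp
  have 2: "?c 0 1 c = ?c 0 0 c" for c using w(1)[of 0 1 c] 1[of 0 c] by simp
  have 3: "?c 0 0 1 = ?c 0 0 0" using w(2)[of 0 0 1] 2[of 0] by simp
  show ?thesis
    unfolding hecke_T_eq satake_double_coset_tcoef[OF T_rep_int_sim] sum_le1 1 2 3 tcoef_T mconst_simps(4) power_0 power_one_right
    by (simp add: algebra_simps)
qed

lemma satake_T1:
  "satake 3 p (hecke_T2 3 p 1) = mvar 0 ^ 2 * (p_inv * (mvar 1 * (1 + mvar 2 ^ 2) * (1 + mvar 3 ^ 2)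
        + mvar 2 * (1 + mvar 1 ^ 2) * (1 + mvar 3 ^ 2) + mvar 3 * (1 + mvar 1 ^ 2) * (1 + mvar 2 ^ 2))
      + (p_inv - p_inv ^ 3) * (mvar 1 * mvar 2 * (1 + mvar 3 ^ 2) + mvar 1 * mvar 3 * (1 + mvar 2 ^ 2) + mvar 2 * mvar 3 * (1 + mvar 1 ^ 2))
      + (3 * p_inv - p_inv ^ 2 - p_inv ^ 3 - p_inv ^ 4) * (mvar 1 * mvar 2 * mvar 3))"
proof -
  let ?p = "of_nat p :: rat"
  have "(?p ^ 2 - 1) / ?p ^ 3 = 1 / ?p - (1 / ?p) ^ 3"
    by (simp add: field_simps eval_nat_numeral)
  then have 1: "mconst ((?p ^ 2 - 1) / ?p ^ 3) = p_inv - p_inv ^ 3"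
    by (simp only: mconst_simps(2,6) p_inv_def)
  have mconst_3: "mconst 3 = 3" using mconst_of_nat[of 3] by simp
  have "(3 * ?p ^ 5 - ?p ^ 4 - ?p ^ 3 - ?p ^ 2) / ?p ^ 6 = of_nat 3 * (1 / ?p) - (1 / ?p) ^ 2 - (1 / ?p) ^ 3 - (1 / ?p) ^ 4"
    by (simp add: field_simps eval_nat_numeral)
  then have 2: "mconst ((3 * ?p ^ 5 - ?p ^ 4 - ?p ^ 3 - ?p ^ 2) / ?p ^ 6) = 3 * p_inv - p_inv ^ 2 - p_inv ^ 3 - p_inv ^ 4"
    by (simp only: mconst_simps(2,3,6) mconst_3 p_inv_def of_nat_numeral)
  have i: "(1::nat) \<in> {1,2,3}" by simp
  show ?thesis
    unfolding hecke_T2_eq[OF i] satake_double_coset_2[OF T2_rep_int_sim] tcoef_zero tcoef_T1_100 tcoef_T1_110 tcoef_T1_111 1 2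
      p_inv_def[symmetric] mconst_simps(5) mult_zero_left add_0 ..
qed

lemma satake_T2:
  "satake 3 p (hecke_T2 3 p 2) = mvar 0 ^ 2 * (p_inv ^ 3 * (mvar 1 * mvar 2 * (1 + mvar 3 ^ 2)
        + mvar 1 * mvar 3 * (1 + mvar 2 ^ 2) + mvar 2 * mvar 3 * (1 + mvar 1 ^ 2))
      + (p_inv ^ 3 - p_inv ^ 6) * (mvar 1 * mvar 2 * mvar 3))"
proof -
  let ?p = "of_nat p :: rat"
  have "(?p ^ 3 - 1) / ?p ^ 6 = 1 / ?p ^ 3 - 1 / ?p ^ 6"
    by (simp add: field_simps eval_nat_numeral)
  then have 1: "mconst ((?p ^ 3 - 1) / ?p ^ 6) = p_inv ^ 3 - p_inv ^ 6"
    by (simp only: mconst_simps(2) mconst_p_inv)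
  have i: "(2::nat) \<in> {1,2,3}" by simp
  show ?thesis
    unfolding hecke_T2_eq[OF i] satake_double_coset_2[OF T2_rep_int_sim] tcoef_zero tcoef_T2_110 tcoef_T2_111 1
      mconst_p_inv mconst_simps(5) mult_zero_left add_0 ..
qed

text \<open>a h = h a lies in the coset of a, so the double coset consists of this one
  coset.\<close>

lemma satake_double_coset_central:
  assumes a: "tri p \<delta> d a" and central: "\<And>h. h \<in> Sp_int 3 \<Longrightarrow> a * h = h * a"
  shows "satake 3 p (double_coset (GSp_plus 3) (Sp_int 3) a) = wmono \<delta> d"
proof -
  have "cs (a * h) = cs a" if "h \<in> Sp_int 3" for h
    unfolding central[OF that] by (rule cs_mult_left[OF triD(1)[OF a] that])
  then have "dc a = {cs a}" using Sp_int_one unfolding dc_eq by blast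
  then show ?thesis unfolding satake_double_coset[OF triD(1)[OF a]] by (simp add: satake_coset_tri[OF a])
qed

lemma satake_p: "satake 3 p (hecke_p 3 p) = mvar 0 ^ 2 * (p_inv ^ 6 * (mvar 1 * mvar 2 * mvar 3))"
proof -
  have t: "tri p 2 (dvec 1 1 1) (T2_rep 3)"
    unfolding tri_def using T2_rep_int_sim[of 3] by (simp add: T2_rep_def)
  have e: "T2_rep 3 = of_nat p \<cdot>\<^sub>m 1\<^sub>m 6"
  proof (rule eq_matI)
    fix i j assume "i < dim_row (of_nat p \<cdot>\<^sub>m 1\<^sub>m 6 :: rat mat)" "j < dim_col (of_nat p \<cdot>\<^sub>m 1\<^sub>m 6 :: rat mat)"
    then have "i < 6" "j < 6" by auto
    then show "T2_rep 3 $$ (i,j) = (of_nat p \<cdot>\<^sub>m 1\<^sub>m 6) $$ (i,j)"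
      by (elim less6_cases) (simp_all add: T2_rep_def)
  qed (simp_all add: T2_rep_def)
  have c: "T2_rep 3 * h = h * T2_rep 3" if "h \<in> Sp_int 3" for h
  proof -
    note c = Sp_int_carrier[OF that]
    show ?thesis
      unfolding e mult_smult_assoc_mat[OF one_carrier_mat c] mult_smult_distrib[OF c one_carrier_mat]
        left_mult_one_mat[OF c] right_mult_one_mat[OF c] ..
  qed
  have "satake 3 p (hecke_p 3 p) = wmono 2 (dvec 1 1 1)"
    unfolding hecke_p_eq by (rule satake_double_coset_central[OF t c])
  also have "\<dots> = of_nat 1 * wmono 2 (dvec 1 1 1)" by simp
  also have "\<dots> = mconst (1 / of_nat p ^ 6) * (mvar 0 ^ 2 * (mvar 1 * (mvar 2 * mvar 3)))"
    unfolding of_nat_mult_wmono by simp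
  finally show ?thesis unfolding mconst_p_inv by (simp add: mult_ac)
qed

lemma satake_one: "satake 3 p (double_coset (GSp_plus 3) (Sp_int 3) (1\<^sub>m 6)) = 1"
proof -
  have "tri p 0 (dvec 0 0 0) (1\<^sub>m 6)" unfolding tri_def using Sp_int_one by (simp add: int_sim_0)
  then have "satake 3 p (double_coset (GSp_plus 3) (Sp_int 3) (1\<^sub>m 6)) = wmono 0 (dvec 0 0 0)"
  proof (rule satake_double_coset_central)
    fix h assume "h \<in> Sp_int 3"
    then have "h \<in> carrier_mat 6 6" by (rule Sp_int_carrier)
    then show "1\<^sub>m 6 * h = h * 1\<^sub>m 6" by (simp only: left_mult_one_mat right_mult_one_mat)
  qed
  also have "\<dots> = of_nat 1 * wmono 0 (dvec 0 0 0)" by simp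
  also have "\<dots> = 1" unfolding of_nat_mult_wmono by (simp add: mconst_simps)
  finally show ?thesis .
qed

section \<open>Transport of the ring laws along the Satake map\<close>

lemma hecke_LZ_simps [simp]:
  "monoid.mult (hecke_LZ 3 p) = hecke_mult (GSp_plus 3) (Sp_int 3)"
  "monoid.one (hecke_LZ 3 p) = double_coset (GSp_plus 3) (Sp_int 3) (1\<^sub>m 6)"
  "ring.zero (hecke_LZ 3 p) = 0" "ring.add (hecke_LZ 3 p) = (+)"
  by (simp_all add: hecke_LZ_def hecke_ring_def GSp_plus_def Let_def)

lemma carrier_hecke_LZ:
  "carrier (hecke_LZ 3 p) = generate_ring (hecke_ring (GSp_plus 3) (Sp_int 3)) (insert (hecke_T 3 p) (hecke_T2 3 p ` {1..3}))"
  by (simp add: hecke_LZ_def Let_def)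

text \<open>\<open>generate_ring\<close> closes under the additive inverse of
  \<open>hecke_ring\<close>, a definite description. As the ring laws of \<open>hecke_ring\<close>
  are not at hand, it is evaluated directly; right invariance of the negative puts the witness into
  the carrier.\<close>

lemma a_inv_hecke_ring:
  assumes "f \<in> hecke_carrier (GSp_plus 3) (Sp_int 3)"
  shows "\<ominus>\<^bsub>hecke_ring (GSp_plus 3) (Sp_int 3)\<^esub> f = - f"
  unfolding a_inv_def m_inv_def
  by (rule the_equality) (use assms Sp.hecke_uminus_closed[of f 3] in \<open>auto simp: hecke_ring_def eq_neg_iff_add_eq_0 add.commute\<close>)

lemma hecke_LZ_subset: "carrier (hecke_LZ 3 p) \<subseteq> hecke_int"
proof
  fix f assume "f \<in> carrier (hecke_LZ 3 p)"
  then have "f \<in> generate_ring (hecke_ring (GSp_plus 3) (Sp_int 3)) (insert (hecke_T 3 p) (hecke_T2 3 p ` {1..3}))"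
    by (simp add: carrier_hecke_LZ)
  then show "f \<in> hecke_int"
  proof induction
    case one
    have "(1\<^sub>m 6 :: rat mat) \<in> int_sim p 0" using Sp_int_one by (simp add: int_sim_0)
    from double_coset_hecke_int[OF this] show ?case by (simp add: hecke_ring_def GSp_plus_def)
  next
    case (incl h)
    have "{1..3} = {1,2,3::nat}" by auto
    then consider "h = hecke_T 3 p" | i where "i \<in> {1,2,3}" "h = hecke_T2 3 p i" using incl by blast
    then show ?case
      by cases (simp_all only: hecke_T_eq hecke_T2_eq double_coset_hecke_int[OF T_rep_int_sim] double_coset_hecke_int[OF T2_rep_int_sim])
  next
    case (a_inv h)
    then show ?case using hecke_int_uminus by (simp add: a_inv_hecke_ring[OF hecke_intD])
  next
    case (eng_add h1 h2)
    then show ?case using hecke_int_add by (simp add: hecke_ring_def)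
  next
    case (eng_mult h1 h2)
    then show ?case using hecke_int_mult by (simp add: hecke_ring_def)
  qed
qed

lemma hecke_LZ_closed:
  "double_coset (GSp_plus 3) (Sp_int 3) (1\<^sub>m 6) \<in> carrier (hecke_LZ 3 p)"
  "f \<in> carrier (hecke_LZ 3 p) \<Longrightarrow> g \<in> carrier (hecke_LZ 3 p) \<Longrightarrow> f + g \<in> carrier (hecke_LZ 3 p)"
  "f \<in> carrier (hecke_LZ 3 p) \<Longrightarrow> - f \<in> carrier (hecke_LZ 3 p)"
  "f \<in> carrier (hecke_LZ 3 p) \<Longrightarrow> g \<in> carrier (hecke_LZ 3 p) \<Longrightarrow> hecke_mult (GSp_plus 3) (Sp_int 3) f g \<in> carrier (hecke_LZ 3 p)"
proof -
  let ?R = "hecke_ring (GSp_plus 3) (Sp_int 3)" and ?H = "insert (hecke_T 3 p) (hecke_T2 3 p ` {1..3})"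
  show "double_coset (GSp_plus 3) (Sp_int 3) (1\<^sub>m 6) \<in> carrier (hecke_LZ 3 p)"
    using generate_ring.one[of ?R ?H] unfolding carrier_hecke_LZ by (simp add: hecke_ring_def GSp_plus_def)
  show "f + g \<in> carrier (hecke_LZ 3 p)" if "f \<in> carrier (hecke_LZ 3 p)" "g \<in> carrier (hecke_LZ 3 p)"
    using generate_ring.eng_add[of f ?R ?H g] that unfolding carrier_hecke_LZ by (simp add: hecke_ring_def)
  show "hecke_mult (GSp_plus 3) (Sp_int 3) f g \<in> carrier (hecke_LZ 3 p)"
    if "f \<in> carrier (hecke_LZ 3 p)" "g \<in> carrier (hecke_LZ 3 p)"
    using generate_ring.eng_mult[of f ?R ?H g] that unfolding carrier_hecke_LZ by (simp add: hecke_ring_def)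
  show "- f \<in> carrier (hecke_LZ 3 p)" if f: "f \<in> carrier (hecke_LZ 3 p)"
    using generate_ring.a_inv[OF f[unfolded carrier_hecke_LZ]] a_inv_hecke_ring[OF hecke_intD] hecke_LZ_subset f
    unfolding carrier_hecke_LZ by auto
qed

text \<open>Both sides of each law for the product lie in \<open>hecke_int\<close> and have the same
  image in a commutative ring, and the Satake map is injective there. The unit has image 1.\<close>

lemma cring_hecke_LZ: "cring (hecke_LZ 3 p)"
proof (rule cringI)
  note int = hecke_LZ_subset[THEN subsetD]
  have "0 \<in> carrier (hecke_LZ 3 p)"
    using hecke_LZ_closed(2)[OF hecke_LZ_closed(1) hecke_LZ_closed(3)[OF hecke_LZ_closed(1)]] by simp
  then show "abelian_group (hecke_LZ 3 p)"
    by (intro abelian_groupI) (auto intro: hecke_LZ_closed(2) bexI[OF _ hecke_LZ_closed(3)] simp: add_ac)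
  have one: "double_coset (GSp_plus 3) (Sp_int 3) (1\<^sub>m 6) \<in> hecke_int" using int hecke_LZ_closed(1) by blast
  show "comm_monoid (hecke_LZ 3 p)"
  proof (intro comm_monoidI; unfold hecke_LZ_simps)
    fix x y z assume "x \<in> carrier (hecke_LZ 3 p)" "y \<in> carrier (hecke_LZ 3 p)" "z \<in> carrier (hecke_LZ 3 p)"
    then have x: "x \<in> hecke_int" "y \<in> hecke_int" "z \<in> hecke_int" using int by blast+
    show "hecke_mult (GSp_plus 3) (Sp_int 3) (hecke_mult (GSp_plus 3) (Sp_int 3) x y) z =
        hecke_mult (GSp_plus 3) (Sp_int 3) x (hecke_mult (GSp_plus 3) (Sp_int 3) y z)"
      by (rule satake_inj) (simp_all add: x satake_mult hecke_int_mult mult.assoc)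
  next
    fix x y assume "x \<in> carrier (hecke_LZ 3 p)" "y \<in> carrier (hecke_LZ 3 p)"
    then have x: "x \<in> hecke_int" "y \<in> hecke_int" using int by blast+
    show "hecke_mult (GSp_plus 3) (Sp_int 3) x y = hecke_mult (GSp_plus 3) (Sp_int 3) y x"
      by (rule satake_inj) (simp_all add: x satake_mult hecke_int_mult mult.commute)
  next
    fix x assume "x \<in> carrier (hecke_LZ 3 p)"
    then have x: "x \<in> hecke_int" using int by blast
    show "hecke_mult (GSp_plus 3) (Sp_int 3) (double_coset (GSp_plus 3) (Sp_int 3) (1\<^sub>m 6)) x = x"
      by (rule satake_inj) (simp_all add: x one satake_mult hecke_int_mult satake_one)
  qed (auto intro: hecke_LZ_closed)
  fix x y z assume "x \<in> carrier (hecke_LZ 3 p)" "y \<in> carrier (hecke_LZ 3 p)" "z \<in> carrier (hecke_LZ 3 p)"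
  then have x: "x \<in> hecke_int" "y \<in> hecke_int" "z \<in> hecke_int" using int by blast+
  show "(x \<oplus>\<^bsub>hecke_LZ 3 p\<^esub> y) \<otimes>\<^bsub>hecke_LZ 3 p\<^esub> z = x \<otimes>\<^bsub>hecke_LZ 3 p\<^esub> z \<oplus>\<^bsub>hecke_LZ 3 p\<^esub> y \<otimes>\<^bsub>hecke_LZ 3 p\<^esub> z"
    unfolding hecke_LZ_simps
    by (rule satake_inj) (simp_all add: x satake_mult satake_add hecke_int_mult hecke_int_add distrib_right)
qed

lemma satake_hom:
  assumes x: "x \<in> carrier (hecke_LZ 3 p)"
  shows "y \<in> carrier (hecke_LZ 3 p) \<Longrightarrow> satake 3 p (x \<otimes>\<^bsub>hecke_LZ 3 p\<^esub> y) = satake 3 p x * satake 3 p y"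
    "satake 3 p (x \<oplus>\<^bsub>hecke_LZ 3 p\<^esub> y) = satake 3 p x + satake 3 p y"
    "satake 3 p (\<ominus>\<^bsub>hecke_LZ 3 p\<^esub> x) = - satake 3 p x"
    "y \<in> carrier (hecke_LZ 3 p) \<Longrightarrow> satake 3 p (x \<ominus>\<^bsub>hecke_LZ 3 p\<^esub> y) = satake 3 p x - satake 3 p y"
    "satake 3 p (x [^]\<^bsub>hecke_LZ 3 p\<^esub> (n::nat)) = satake 3 p x ^ n"
    "satake 3 p ([k] \<cdot>\<^bsub>hecke_LZ 3 p\<^esub> x) = of_int k * satake 3 p x"
proof -
  interpret cring "hecke_LZ 3 p" by (rule cring_hecke_LZ)
  have mult: "satake 3 p (x \<otimes>\<^bsub>hecke_LZ 3 p\<^esub> y) = satake 3 p x * satake 3 p y"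
    if "x \<in> carrier (hecke_LZ 3 p)" "y \<in> carrier (hecke_LZ 3 p)" for x y
    using that hecke_LZ_subset by (auto intro: satake_mult)
  show "y \<in> carrier (hecke_LZ 3 p) \<Longrightarrow> satake 3 p (x \<otimes>\<^bsub>hecke_LZ 3 p\<^esub> y) = satake 3 p x * satake 3 p y"
    using mult x by blast
  show add: "satake 3 p (x \<oplus>\<^bsub>hecke_LZ 3 p\<^esub> y) = satake 3 p x + satake 3 p y" for x y
    by (simp add: satake_add)
  have neg: "satake 3 p (\<ominus>\<^bsub>hecke_LZ 3 p\<^esub> x) = - satake 3 p x" if x: "x \<in> carrier (hecke_LZ 3 p)" for x
  proof -
    have "\<ominus>\<^bsub>hecke_LZ 3 p\<^esub> x = - x"
      by (rule minus_equality) (use x hecke_LZ_closed(3)[OF x] in simp_all)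
    then show ?thesis by (simp add: satake_uminus)
  qed
  show "satake 3 p (\<ominus>\<^bsub>hecke_LZ 3 p\<^esub> x) = - satake 3 p x" by (rule neg[OF x])
  show "satake 3 p (x \<ominus>\<^bsub>hecke_LZ 3 p\<^esub> y) = satake 3 p x - satake 3 p y" if "y \<in> carrier (hecke_LZ 3 p)"
    unfolding minus_eq add neg[OF that] by simp
  have one: "satake 3 p \<one>\<^bsub>hecke_LZ 3 p\<^esub> = 1" by (simp add: satake_one)
  show "satake 3 p (x [^]\<^bsub>hecke_LZ 3 p\<^esub> (n::nat)) = satake 3 p x ^ n"
    by (induction n) (simp_all only: nat_pow_0 nat_pow_Suc one mult[OF nat_pow_closed[OF x] x] power_0 power_Suc2)
  have zero: "satake 3 p \<zero>\<^bsub>hecke_LZ 3 p\<^esub> = 0" by (simp add: satake_def)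
  have nat: "satake 3 p ([m] \<cdot>\<^bsub>hecke_LZ 3 p\<^esub> x) = of_nat m * satake 3 p x" for m :: nat
    by (induction m) (simp_all only: add.nat_pow_0 add.nat_pow_Suc zero add of_nat_0 of_nat_Suc mult_zero_left distrib_right mult_1 add_ac)
  have mcl: "[m] \<cdot>\<^bsub>hecke_LZ 3 p\<^esub> x \<in> carrier (hecke_LZ 3 p)" for m :: nat by (rule add.nat_pow_closed[OF x])
  show "satake 3 p ([k] \<cdot>\<^bsub>hecke_LZ 3 p\<^esub> x) = of_int k * satake 3 p x"
  proof (cases "0 \<le> k")
    case True
    then show ?thesis unfolding add_pow_int_ge[OF True] nat by simp
  next
    case False
    then have k: "k < 0" by simp
    have "(of_nat (nat (- k)) :: rat_mpoly) = of_int (int (nat (- k)))" by simp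
    also have "int (nat (- k)) = - k" using k by simp
    finally show ?thesis unfolding add_pow_int_lt[OF k] neg[OF mcl] nat by simp
  qed
qed

end

text \<open>The equivalence contains two facts: from right to left, coefficients with the prescribed
  images exist in the ring; from left to right, they are unique, by injectivity.\<close>

theorem theorem2p1:
  fixes p :: nat
    and L :: "(rat mat set \<Rightarrow>\<^sub>0 int) ring" (structure)
    and P :: "(rat mat set \<Rightarrow>\<^sub>0 int, nat \<Rightarrow> (rat mat set \<Rightarrow>\<^sub>0 int)) up_ring"
    and Q :: "nat \<Rightarrow> (rat mat set \<Rightarrow>\<^sub>0 int)"
    and T T1 T2 pp :: "rat mat set \<Rightarrow>\<^sub>0 int"
  assumes "prime p"
    and "L = hecke_LZ 3 p" and "P = UP L"
    and "T = hecke_T 3 p" and "T1 = hecke_T2 3 p 1" and "T2 = hecke_T2 3 p 2"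
    and "pp = hecke_p 3 p"
  shows
    "(\<exists>t \<in> {..8} \<rightarrow> carrier L.
        Q = (\<Oplus>\<^bsub>P\<^esub>j \<in> {..8}. up_ring.monom P (t j) j) \<and>
        (\<Sum>j\<le>8. Polynomial.monom (satake 3 p (t j)) j) =
          [:1, - mvar 0:] * [:1, - (mvar 0 * mvar 1):] * [:1, - (mvar 0 * mvar 2):] * [:1, - (mvar 0 * mvar 3):] *
          [:1, - (mvar 0 * mvar 1 * mvar 2):] * [:1, - (mvar 0 * mvar 1 * mvar 3):] * [:1, - (mvar 0 * mvar 2 * mvar 3):] *
          [:1, - (mvar 0 * mvar 1 * mvar 2 * mvar 3):])
     \<longleftrightarrow>
     Q = \<one>\<^bsub>P\<^esub>
       \<ominus>\<^bsub>P\<^esub> up_ring.monom P T 1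
       \<oplus>\<^bsub>P\<^esub> up_ring.monom P
             ([(int p)] \<cdot> (T1 \<oplus> [((int p)^2 + 1)] \<cdot> T2 \<oplus> [((1 + (int p)^2)^2)] \<cdot> pp)) 2
       \<ominus>\<^bsub>P\<^esub> up_ring.monom P ([((int p)^3)] \<cdot> (T \<otimes> (T2 \<oplus> pp))) 3
       \<oplus>\<^bsub>P\<^esub> up_ring.monom P
             ([((int p)^6)] \<cdot>
               ([(- 2 * int p)] \<cdot> (T1 \<otimes> pp) \<oplus> T2 [^] (2::nat)
                \<ominus> [(2 * (int p - 1))] \<cdot> (T2 \<otimes> pp)
                \<ominus> [(((int p)^2 + 2 * int p - 1) * ((int p)^2 - int p + 1) * ((int p)^2 + int p + 1))]
                    \<cdot> (pp [^] (2::nat))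
                \<oplus> pp \<otimes> T [^] (2::nat))) 4
       \<ominus>\<^bsub>P\<^esub> up_ring.monom P ([((int p)^9)] \<cdot> (pp \<otimes> T \<otimes> (T2 \<oplus> pp))) 5
       \<oplus>\<^bsub>P\<^esub> up_ring.monom P
             ([((int p)^13)] \<cdot>
               (pp [^] (2::nat) \<otimes> (T1 \<oplus> [((int p)^2 + 1)] \<cdot> T2 \<oplus> [(((int p)^2 + 1)^2)] \<cdot> pp))) 6
       \<ominus>\<^bsub>P\<^esub> up_ring.monom P ([((int p)^18)] \<cdot> (pp [^] (3::nat) \<otimes> T)) 7
       \<oplus>\<^bsub>P\<^esub> up_ring.monom P ([((int p)^24)] \<cdot> (pp [^] (4::nat))) 8"
proof -
  interpret fixed_prime p by unfold_locales fact
  interpret L: cring L unfolding assms(2) by (rule cring_hecke_LZ)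
  have L: "carrier L = carrier (hecke_LZ 3 p)" by (simp add: assms(2))
  note hom = satake_hom[folded assms(2)]
  interpret U: UP_cring L P
    unfolding assms(3) by (intro UP_cring.intro L.cring_axioms)
  have T: "T \<in> carrier L" "T1 \<in> carrier L" "T2 \<in> carrier L" "pp \<in> carrier L"
  proof -
    \<comment> \<open>\<open>pp\<close> is itself the last generator T_3(p^2), so it lies in the
      ring.\<close>
    have "hecke_p 3 p = hecke_T2 3 p 3" using hecke_T2_eq[of 3] by (simp add: hecke_p_eq)
    then show "T \<in> carrier L" "T1 \<in> carrier L" "T2 \<in> carrier L" "pp \<in> carrier L"
      unfolding assms(4-7) L carrier_hecke_LZ by (auto intro!: generate_ring.incl)
  qed
  have pow: "x [^]\<^bsub>L\<^esub> (n::nat) \<in> carrier L" "[k] \<cdot>\<^bsub>L\<^esub> x \<in> carrier L" if "x \<in> carrier L" for x n and k :: int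
    using that by (auto intro: L.nat_pow_closed L.add.int_pow_closed)
  note closed = T pow L.a_closed L.m_closed L.minus_closed L.a_inv_closed L.one_closed
  define c2 where "c2 = [(int p)] \<cdot> (T1 \<oplus> [((int p)^2 + 1)] \<cdot> T2 \<oplus> [((1 + (int p)^2)^2)] \<cdot> pp)"
  define c3 where "c3 = [((int p)^3)] \<cdot> (T \<otimes> (T2 \<oplus> pp))"
  define c4 where "c4 = [((int p)^6)] \<cdot>
               ([(- 2 * int p)] \<cdot> (T1 \<otimes> pp) \<oplus> T2 [^] (2::nat)
                \<ominus> [(2 * (int p - 1))] \<cdot> (T2 \<otimes> pp)
                \<ominus> [(((int p)^2 + 2 * int p - 1) * ((int p)^2 - int p + 1) * ((int p)^2 + int p + 1))]
                    \<cdot> (pp [^] (2::nat))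
                \<oplus> pp \<otimes> T [^] (2::nat))"
  define c5 where "c5 = [((int p)^9)] \<cdot> (pp \<otimes> T \<otimes> (T2 \<oplus> pp))"
  define c6 where "c6 = [((int p)^13)] \<cdot>
               (pp [^] (2::nat) \<otimes> (T1 \<oplus> [((int p)^2 + 1)] \<cdot> T2 \<oplus> [(((int p)^2 + 1)^2)] \<cdot> pp))"
  define c7 where "c7 = [((int p)^18)] \<cdot> (pp [^] (3::nat) \<otimes> T)"
  define c8 where "c8 = [((int p)^24)] \<cdot> (pp [^] (4::nat))"
  have c: "c2 \<in> carrier L" "c3 \<in> carrier L" "c4 \<in> carrier L" "c5 \<in> carrier L" "c6 \<in> carrier L" "c7 \<in> carrier L" "c8 \<in> carrier L"
    unfolding c2_def c3_def c4_def c5_def c6_def c7_def c8_def by (intro closed)+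
  \<comment> \<open>The signs are moved into the coefficients, so that the right hand side becomes a
    sum of monomials with these coefficients.\<close>
  define t0 where "t0 = (\<lambda>j::nat. [\<one>, \<ominus> T, c2, \<ominus> c3, c4, \<ominus> c5, c6, \<ominus> c7, c8] ! j)"
  have t0_eq: "t0 0 = \<one>" "t0 1 = \<ominus> T" "t0 2 = c2" "t0 3 = \<ominus> c3" "t0 4 = c4" "t0 5 = \<ominus> c5" "t0 6 = c6" "t0 7 = \<ominus> c7" "t0 8 = c8"
    by (simp_all add: t0_def)
  have le8: "j = 0 \<or> j = 1 \<or> j = 2 \<or> j = 3 \<or> j = 4 \<or> j = 5 \<or> j = 6 \<or> j = 7 \<or> j = 8" if "j \<le> 8" for j :: nat
    using that by linarith
  have t0: "t0 j \<in> carrier L" if "j \<le> 8" for j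
    using le8[OF that] by (elim disjE; hypsubst; unfold t0_eq; intro c T L.a_inv_closed L.one_closed)
  let ?\<Omega> = "satake 3 p"
  note vals = satake_T[folded assms(4)] satake_T1[folded assms(5)] satake_T2[folded assms(6)] satake_p[folded assms(7)]
  have one: "?\<Omega> \<one> = 1" by (simp add: assms(2) satake_one)
  have \<Omega>: "?\<Omega> (t0 0) = 1" "?\<Omega> (t0 1) = - ?\<Omega> T"
    "?\<Omega> (t0 2) = of_nat p * (?\<Omega> T1 + (of_nat p ^ 2 + 1) * ?\<Omega> T2 + (1 + of_nat p ^ 2) ^ 2 * ?\<Omega> pp)"
    "?\<Omega> (t0 3) = - (of_nat p ^ 3 * (?\<Omega> T * (?\<Omega> T2 + ?\<Omega> pp)))"
    "?\<Omega> (t0 4) = of_nat p ^ 6 * (- 2 * of_nat p * (?\<Omega> T1 * ?\<Omega> pp) + ?\<Omega> T2 ^ 2 - 2 * (of_nat p - 1) * (?\<Omega> T2 * ?\<Omega> pp)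
        - (of_nat p ^ 2 + 2 * of_nat p - 1) * (of_nat p ^ 2 - of_nat p + 1) * (of_nat p ^ 2 + of_nat p + 1) * ?\<Omega> pp ^ 2 + ?\<Omega> pp * ?\<Omega> T ^ 2)"
    "?\<Omega> (t0 5) = - (of_nat p ^ 9 * (?\<Omega> pp * ?\<Omega> T * (?\<Omega> T2 + ?\<Omega> pp)))"
    "?\<Omega> (t0 6) = of_nat p ^ 13 * (?\<Omega> pp ^ 2 * (?\<Omega> T1 + (of_nat p ^ 2 + 1) * ?\<Omega> T2 + (of_nat p ^ 2 + 1) ^ 2 * ?\<Omega> pp))"
    "?\<Omega> (t0 7) = - (of_nat p ^ 18 * (?\<Omega> pp ^ 3 * ?\<Omega> T))"
    "?\<Omega> (t0 8) = of_nat p ^ 24 * ?\<Omega> pp ^ 4"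
    unfolding t0_eq
    by (simp_all add: c2_def c3_def c4_def c5_def c6_def c7_def c8_def hom closed one)
  have factor: "(\<Sum>j\<le>8. Polynomial.monom (?\<Omega> (t0 j)) j) =
          [:1, - mvar 0:] * [:1, - (mvar 0 * mvar 1):] * [:1, - (mvar 0 * mvar 2):] * [:1, - (mvar 0 * mvar 3):] *
          [:1, - (mvar 0 * mvar 1 * mvar 2):] * [:1, - (mvar 0 * mvar 1 * mvar 3):] * [:1, - (mvar 0 * mvar 2 * mvar 3):] *
          [:1, - (mvar 0 * mvar 1 * mvar 2 * mvar 3):]"
    unfolding sum_monom_8[where g = "\<lambda>j. ?\<Omega> (t0 j)"] \<Omega> by (rule spinor_product[OF p_inv vals, symmetric])
  have expand: "(\<Oplus>\<^bsub>P\<^esub>j \<in> {..8}. up_ring.monom P (t0 j) j) =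
      \<one>\<^bsub>P\<^esub> \<ominus>\<^bsub>P\<^esub> up_ring.monom P T 1 \<oplus>\<^bsub>P\<^esub> up_ring.monom P c2 2 \<ominus>\<^bsub>P\<^esub> up_ring.monom P c3 3 \<oplus>\<^bsub>P\<^esub> up_ring.monom P c4 4
      \<ominus>\<^bsub>P\<^esub> up_ring.monom P c5 5 \<oplus>\<^bsub>P\<^esub> up_ring.monom P c6 6 \<ominus>\<^bsub>P\<^esub> up_ring.monom P c7 7 \<oplus>\<^bsub>P\<^esub> up_ring.monom P c8 8"
  proof -
    let ?m = "\<lambda>j. up_ring.monom P (t0 j) j"
    have m: "?m j \<in> carrier P" if "j \<le> 8" for j by (rule U.monom_closed[OF t0[OF that]])
    have step: "(\<Oplus>\<^bsub>P\<^esub>j \<in> {..k}. ?m j) = (\<Oplus>\<^bsub>P\<^esub>j \<in> {..k - 1}. ?m j) \<oplus>\<^bsub>P\<^esub> ?m k" if k: "k \<noteq> 0" "k \<le> 8" for k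
    proof -
      obtain n where n: "k = Suc n" using k(1) by (cases k) auto
      have cl: "(\<Oplus>\<^bsub>P\<^esub>j \<in> {..n}. ?m j) \<in> carrier P" by (rule U.P.finsum_closed) (use m k n in auto)
      have "(\<Oplus>\<^bsub>P\<^esub>j \<in> {..Suc n}. ?m j) = ?m (Suc n) \<oplus>\<^bsub>P\<^esub> (\<Oplus>\<^bsub>P\<^esub>j \<in> {..n}. ?m j)"
        by (rule U.P.finsum_Suc) (use m k n in auto)
      also have "\<dots> = (\<Oplus>\<^bsub>P\<^esub>j \<in> {..n}. ?m j) \<oplus>\<^bsub>P\<^esub> ?m (Suc n)"
        by (rule U.P.a_comm[OF m[OF k(2)[unfolded n]] cl])
      finally show ?thesis unfolding n by simp
    qed
    have base: "(\<Oplus>\<^bsub>P\<^esub>j \<in> {..0}. ?m j) = ?m 0"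
      using U.P.finsum_0[of ?m] m[of 0] by simp
    have pred: "8 - 1 = (7::nat)" "7 - 1 = (6::nat)" "6 - 1 = (5::nat)" "5 - 1 = (4::nat)" "4 - 1 = (3::nat)"
      "3 - 1 = (2::nat)" "2 - 1 = (1::nat)" "1 - 1 = (0::nat)" by simp_all
    have "(\<Oplus>\<^bsub>P\<^esub>j \<in> {..8}. ?m j) = ?m 0 \<oplus>\<^bsub>P\<^esub> ?m 1 \<oplus>\<^bsub>P\<^esub> ?m 2 \<oplus>\<^bsub>P\<^esub> ?m 3 \<oplus>\<^bsub>P\<^esub> ?m 4 \<oplus>\<^bsub>P\<^esub> ?m 5 \<oplus>\<^bsub>P\<^esub> ?m 6 \<oplus>\<^bsub>P\<^esub> ?m 7 \<oplus>\<^bsub>P\<^esub> ?m 8"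
      using step[of 8] step[of 7] step[of 6] step[of 5] step[of 4] step[of 3] step[of 2] step[of 1] base
      unfolding pred by (simp del: One_nat_def)
    then show ?thesis unfolding t0_eq U.monom_one U.monom_a_inv[OF c(2)] U.monom_a_inv[OF c(4)] U.monom_a_inv[OF c(6)]
        U.monom_a_inv[OF T(1)] U.P.minus_eq .
  qed
  show ?thesis
    unfolding c2_def[symmetric] c3_def[symmetric] c4_def[symmetric] c5_def[symmetric] c6_def[symmetric] c7_def[symmetric] c8_def[symmetric]
      expand[symmetric] factor[symmetric]
  proof
    assume "\<exists>t \<in> {..8} \<rightarrow> carrier L. Q = (\<Oplus>\<^bsub>P\<^esub>j \<in> {..8}. up_ring.monom P (t j) j) \<and>
        (\<Sum>j\<le>8. Polynomial.monom (?\<Omega> (t j)) j) = (\<Sum>j\<le>8. Polynomial.monom (?\<Omega> (t0 j)) j)"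
    then obtain t where t: "t \<in> {..8} \<rightarrow> carrier L" "Q = (\<Oplus>\<^bsub>P\<^esub>j \<in> {..8}. up_ring.monom P (t j) j)"
      "(\<Sum>j\<le>8. Polynomial.monom (?\<Omega> (t j)) j) = (\<Sum>j\<le>8. Polynomial.monom (?\<Omega> (t0 j)) j)" by blast
    \<comment> \<open>Comparing coefficients of v^j gives equal Satake images, and injectivity
      identifies the Hecke elements.\<close>
    have "t j = t0 j" if j: "j \<le> 8" for j
    proof (rule satake_inj)
      have "Polynomial.coeff (\<Sum>j\<le>8. Polynomial.monom (?\<Omega> (t j)) j) j = Polynomial.coeff (\<Sum>j\<le>8. Polynomial.monom (?\<Omega> (t0 j)) j) j"
        unfolding t(3) ..
      then show "?\<Omega> (t j) = ?\<Omega> (t0 j)" using j by (simp add: Polynomial.coeff_sum)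
      have "t j \<in> carrier L" using t(1) j by auto
      then show "t j \<in> hecke_int" "t0 j \<in> hecke_int" using t0[OF j] hecke_LZ_subset unfolding L by blast+
    qed
    then show "Q = (\<Oplus>\<^bsub>P\<^esub>j \<in> {..8}. up_ring.monom P (t0 j) j)"
      unfolding t(2) by (intro U.P.finsum_cong' U.monom_closed) (auto simp: t0 intro: U.monom_closed)
  next
    assume "Q = (\<Oplus>\<^bsub>P\<^esub>j \<in> {..8}. up_ring.monom P (t0 j) j)"
    then show "\<exists>t \<in> {..8} \<rightarrow> carrier L. Q = (\<Oplus>\<^bsub>P\<^esub>j \<in> {..8}. up_ring.monom P (t j) j) \<and>
        (\<Sum>j\<le>8. Polynomial.monom (?\<Omega> (t j)) j) = (\<Sum>j\<le>8. Polynomial.monom (?\<Omega> (t0 j)) j)"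
      using t0 by (intro bexI[of _ t0]) auto
  qed
qed

end
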